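(* Let $b:[0,T]\times E\times\Omega\to E$ and $\sigma:[0,T]\times E\times\Omega\to E^d$ be $\mathbb F$-progressively measurable, let $x\in E$, and consider the SDE $X_t=x+\int_0^t\sigma(s,X_s,\omega)\cdot dB_s+\int_0^tb(s,X_s,\omega)\,ds$, understood pathwise as $$X_t(\omega)=x+\int_0^t\sigma(s,X_s(\omega),\omega)\cdot d(\omega,\underline\Phi(\omega))_s+\int_0^tb(s,X_s(\omega),\omega)\tfrac{I_d}{d}:d\langle\omega\rangle_s,\qquad\omega\in\Omega .$$ (i) Assume that for each $\omega\in\Omega$ there exists $\boldsymbol\alpha(\omega)=(\alpha(\omega),\beta(\omega))$ with $\alpha(\omega)\in(\frac13,\frac12)$, $\beta(\omega)\in(1-2\alpha(\omega),\alpha(\omega)]$ such that $b(\cdot,\omega)\in\mathcal C^2_{\beta(\omega)}(E,E)$ and $\sigma(\cdot,\omega)\in\mathcal C^{2,3}_{\omega,\boldsymbol\alpha(\omega)}(E,E^d)$. Then the SDE has a unique solution $X$ such that $X(\omega)\in\mathcal C^2_{\boldsymbol\omega,\boldsymbol\alpha(\omega)}(E)$ for all $\omega\in\Omega$, where $\boldsymbol\omega=(\omega,\underline\Phi(\omega))$. (ii) Assume further that $b$ and $\sigma$ are continuous in $\omega$ in the following sense: for any $\omega,\omega^n\in\Omega$ with $\lim_{n\to\infty}d_{\alpha(\omega)}(\omega^n,\omega)=0$, $$\lim_{n\to\infty}\Big[\|b(\cdot,\omega^n)-b(\cdot,\omega)\|_{1,\beta(\omega)}+d^{\omega,\omega^n}_{2,\boldsymbol\alpha(\omega)}(\sigma(\cdot,\omega^n),\sigma(\cdot,\omega))\Big]=0$$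 (where it is implicit that $\sigma(\cdot,\omega^n)\in\mathcal C^{1,2}_{\omega^n,\boldsymbol\alpha(\omega)}(E,E^d)$, so that this distance is defined). Then $X$ is continuous in $\omega$ in the sense that, for any such $\omega,\omega^n$, $$\lim_{n\to\infty}d^{\omega,\omega^n}_{\boldsymbol\alpha(\omega)}(X(\omega),X(\omega^n))=0,\quad\text{and consequently}\quad\lim_{n\to\infty}\|X(\omega)-X(\omega^n)\|_\infty=0 .$$
   Context: Brownian setting: $\Omega_0=\{\omega\in C([0,T],\mathbb R^d):\omega_0=0\}$, $B$ is the canonical process, $\mathbb F=\mathbb F^B$ its natural filtration. With $t^n_i=iT/2^n$, put (entrywise) $\Phi_t(\omega):=\limsup_n\sum_{i=0}^{2^n-1}\omega_{t^n_i}(\omega_{t^n_i\wedge t,\,t^n_{i+1}\wedge t})^*$, $\underline\Phi_{s,t}(\omega):=\Phi_t(\omega)-\Phi_s(\omega)-\omega_s\omega_{s,t}^*$, $\langle\omega\rangle_t:=\omega_t\omega_t^*-\Phi_t(\omega)-\Phi_t(\omega)^*$. For $\alpha\in(\frac13,\frac12)$ let $A_\alpha$ be the set of $\omega\in\Omega_0$ with $\sup_{s<t}|\underline\Phi_{s,t}(\omega)|/|t-s|^{2\alpha}<\infty$, $\langle\omega\rangle_t=tI_d$ for all $t$, and $\limsup_{t\downarrow s}|v\cdot\omega_{s,t}|/|t-s|^{2\alpha}=\infty$ for all $s\in\mathbb Q\cap[0,T)$, $v\in\mathbb R^d\setminus\{0\}$. The sample space is restricted to $\Omega:=\{\omega\in\Omega_0:(\omega,\underline\Phi(\omega))\in\boldsymbol\Omega_\alpha\text{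 and }\omega\in A_\alpha\text{ for all }\alpha\in(\frac13,\frac12)\}$, and $d_\alpha(\omega,\tilde\omega):=\|\omega-\tilde\omega\|_\alpha+\|\underline\Phi(\omega)-\underline\Phi(\tilde\omega)\|_{2\alpha}$. For $\omega\in\Omega$, write $\boldsymbol\omega=(\omega,\underline\Phi(\omega))$; its bracket is $\langle\boldsymbol\omega\rangle_t=\langle\omega\rangle_t=tI_d$. Notation: $\mathbb T=[0,T]$, $\mathbb T^2=\{(s,t):0\le s<t\le T\}$; $E,\tilde E$ Euclidean spaces; $\varphi_{s,t}:=\varphi_t-\varphi_s$ for a path. Let $\boldsymbol\alpha=(\alpha,\beta)$ with $\alpha\in(\frac13,\frac12)$, $\beta\in(1-2\alpha,\alpha]$. $\Omega_\gamma(E)$: continuous $\omega:\mathbb T\to E$ with $\|\omega\|_\gamma:=\sup|\omega_{s,t}|/|t-s|^\gamma<\infty$; $\underline\Omega_\gamma(E)$: continuous $\underline\omega:\mathbb T^2\to E$ with $\|\underline\omega\|_\gamma:=\sup|\underline\omega_{s,t}|/|t-s|^\gamma<\infty$. $\boldsymbol\Omega_\alpha$: pairs $\boldsymbol\omega=(\omega,\underline\omega)\in\Omega_\alpha(\mathbb R^d)\times\underline\Omega_{2\alpha}(\mathbb R^{d\times d})$ with $\underline\omega_{s,t}-\underline\omega_{s,r}-\underline\omega_{r,t}=\omega_{s,r}\omega_{r,t}^*$ for $s<r<t$ for which there is a dense $A\subset[0,T)$ with $\limsup_{t\downarrow s}|v\cdot\omega_{s,t}|/(t-s)^{2\alpha}=\infty$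 for $s\in A$, $v\ne0$; bracket $\langle\boldsymbol\omega\rangle_t:=\omega_{0,t}\omega_{0,t}^*-\underline\omega_{0,t}-\underline\omega_{0,t}^*$. $\mathcal C^1_{\omega,\boldsymbol\alpha}(E)$: $\theta\in\Omega_\beta(E)$ for which there is $\partial_\omega\theta=(\partial_{\omega^1}\theta,\dots,\partial_{\omega^d}\theta)\in\Omega_\beta(E^{1\times d})$ with $R^{\omega,\theta}_{s,t}:=\theta_{s,t}-\partial_\omega\theta_s\omega_{s,t}$ in $\underline\Omega_{\alpha+\beta}(E)$; elements are understood together with $\partial_\omega\theta$ (part of the data whenever not unique). $\|\theta\|_{\omega,\boldsymbol\alpha}:=\|\partial_\omega\theta\|_\beta+\|R^{\omega,\theta}\|_{\alpha+\beta}$, $|||\theta|||_{\omega,\boldsymbol\alpha}:=\|\theta\|_{\omega,\boldsymbol\alpha}+|\partial_\omega\theta_0|$, $d^{\omega,\tilde\omega}_{\boldsymbol\alpha}(\theta,\tilde\theta):=\|\partial_\omega\theta-\partial_{\tilde\omega}\tilde\theta\|_\beta+\|R^{\omega,\theta}-R^{\tilde\omega,\tilde\theta}\|_{\alpha+\beta}$ (the distances $d^{\omega,\omega^n}$ in the claim compare an object controlled by $\omega$ with one controlled by $\omega^n$). For $\theta\in\mathcal C^1_{\omega,\boldsymbol\alpha}(E^d)$, $\int_0^t\theta_s\cdot d\boldsymbol\omega_s$ is the limit over partitions of $[0,t]$ with mesh tending to $0$ of $\sum_k[\sum_i\theta_{i,t_k}\omega^i_{t_k,t_{k+1}}+\sum_{i,j}\partial_{\omega^j}\theta_{i,t_k}\underline\omega^{ji}_{t_k,t_{k+1}}]$.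 $\int c:d\langle\boldsymbol\omega\rangle=\sum_{p,q}\int c_{pq}d\langle\boldsymbol\omega\rangle^{pq}$. $\mathcal C^2_{\boldsymbol\omega,\boldsymbol\alpha}(E)$: $\theta\in\mathcal C^1_{\omega,\boldsymbol\alpha}(E)$ with $\partial_\omega\theta\in\mathcal C^1_{\omega,\boldsymbol\alpha}(E^{1\times d})$ and a symmetric $D^{\boldsymbol\omega}_t\theta\in\Omega_\beta(E^{d\times d})$ with $d\theta_t=\partial_\omega\theta_td\boldsymbol\omega_t+[D^{\boldsymbol\omega}_t\theta_t+\frac12\partial_\omega[(\partial_\omega\theta_t)^*]]:d\langle\boldsymbol\omega\rangle_t$. Function spaces ($g:\mathbb T\times\tilde E\to E$, $\partial_\omega g$ taken in $t$ for fixed $y$): $\mathcal C^k_{loc}$: $k$ times differentiable in $y$ with derivatives bounded on bounded sets; $\|g\|_k:=\sum_{i\le k}\sup_{t,y}|\partial_y^{(i)}g|$. $\mathcal C^k_{\beta,loc}$: $g\in\mathcal C^k_{loc}$, each $\partial_y^{(i)}g(\cdot,y)\in\Omega_\beta$, continuous in $y$ for $\|\cdot\|_\beta$, $i\le k$. $\mathcal C^k_\beta$: those with $\|g\|_{k,\beta}:=\|g\|_k+\sum_{i\le k}\sup_y\|\partial^{(i)}_yg(\cdot,y)\|_\beta<\infty$. $\mathcal C^{1,2}_{\omega,\boldsymbol\alpha,loc}$: $g\in\mathcal C^2_{loc}$, $g(\cdot,y),\partial_yg(\cdot,y)\in\mathcal C^1_{\omega,\boldsymbol\alpha}$ depending continuously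 on $y$ for $|||\cdot|||_{\omega,\boldsymbol\alpha}$, and $\partial_\omega g\in\mathcal C^1_{\beta,loc}$. $\|g\|_{2,\boldsymbol\omega,\boldsymbol\alpha}:=\|g\|_2+\|\partial_\omega g\|_1+\sup_y[\|g(\cdot,y)\|_{\omega,\boldsymbol\alpha}+\|\partial_yg(\cdot,y)\|_{\omega,\boldsymbol\alpha}]$; $\mathcal C^{1,2}_{\omega,\boldsymbol\alpha}$: this norm is finite. $\mathcal C^{2,3}_{\omega,\boldsymbol\alpha}$: $g\in\mathcal C^{1,2}_{\omega,\boldsymbol\alpha,loc}$ with $\partial_\omega g,\partial_yg\in\mathcal C^{1,2}_{\omega,\boldsymbol\alpha,loc}$, $g(\cdot,y)\in\mathcal C^2_{\boldsymbol\omega,\boldsymbol\alpha}$ with a choice $D^{\boldsymbol\omega}_tg\in\mathcal C^1_{\beta,loc}$, and $\|g\|_{2,\boldsymbol\omega,\boldsymbol\alpha}+\|\partial_\omega g\|_{2,\boldsymbol\omega,\boldsymbol\alpha}+\|\partial_yg\|_{2,\boldsymbol\omega,\boldsymbol\alpha}<\infty$. $d^{\omega,\tilde\omega}_{2,\boldsymbol\alpha}(g,\tilde g):=\|g-\tilde g\|_2+\|\partial_\omega g-\partial_{\tilde\omega}\tilde g\|_1+\sup_y[d^{\omega,\tilde\omega}_{\boldsymbol\alpha}(g(\cdot,y),\tilde g(\cdot,y))+d^{\omega,\tilde\omega}_{\boldsymbol\alpha}(\partial_yg(\cdot,y),\partial_y\tilde g(\cdot,y))]$. Solution: for each $\omega\in\Omega$,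 $X(\omega)\in\mathcal C^1_{\omega,\boldsymbol\alpha(\omega)}(E)$ with $\partial_\omega X_t=\sigma(t,X_t,\omega)^*$ satisfies the equation, the rough integrand having derivative $(\partial_\omega\sigma)(t,X_t,\omega)+\sum_k\partial_{y_k}\sigma(t,X_t,\omega)\,\partial_\omega X^k_t$. *)

theory Defs
  imports "HOL-Analysis.Analysis"
begin

text \<open>
  Paths on the time interval \<open>{0..T}\<close> are functions on \<^typ>\<open>real\<close>, two-parameter functions on
  \<open>time2 T\<close> are curried functions; values at other times are irrelevant.  \<open>\<real>\<^sup>d\<close> is
  \<^typ>\<open>real^'d\<close>, and \<open>M $ i $ j\<close> is the entry of \<open>M\<close> in row \<open>i\<close>, column \<open>j\<close>.  Both \<open>E\<^sup>d\<close> and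
  \<open>E\<^sup>1\<^sup>\<times>\<^sup>d\<close> are \<^typ>\<open>'e^'d\<close>.  A derivative \<open>\<theta>'\<close> with respect to \<open>\<omega>\<close> has its
  direction as the outermost index: \<open>\<theta>' s $ j\<close> is the derivative of \<open>\<theta>\<close> in direction \<open>\<omega>\<^sup>j\<close> at
  time \<open>s\<close>, so for vector-valued \<open>\<theta>\<close>, \<open>\<theta>' s $ j $ i\<close> is the derivative of \<open>\<theta> $ i\<close>.

  All norms and distances are suprema in \<^typ>\<open>ennreal\<close>, so that ``finite'' means \<open>< \<infinity>\<close>.
\<close>

type_synonym 'd path = "real \<Rightarrow> real^'d"

definition time2 :: "real \<Rightarrow> (real \<times> real) set" where
  "time2 T = {(s, t). 0 \<le> s \<and> s < t \<and> t \<le> T}"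

definition incr :: "(real \<Rightarrow> 'e::real_normed_vector) \<Rightarrow> real \<Rightarrow> real \<Rightarrow> 'e" where
  "incr f s t = f t - f s"

definition outer :: "real^'d \<Rightarrow> real^'d \<Rightarrow> real^'d^'d" where
  "outer u v = (\<chi> i j. u $ i * v $ j)"

subsection \<open>Hoelder spaces\<close>

definition hoelder2_norm :: "real \<Rightarrow> real \<Rightarrow> (real \<Rightarrow> real \<Rightarrow> 'e::real_normed_vector) \<Rightarrow> ennreal" where
  "hoelder2_norm T \<gamma> w = (SUP (s, t)\<in>time2 T. ennreal (norm (w s t) / (t - s) powr \<gamma>))"

abbreviation hoelder_norm :: "real \<Rightarrow> real \<Rightarrow> (real \<Rightarrow> 'e::real_normed_vector) \<Rightarrow> ennreal" where
  "hoelder_norm T \<gamma> f \<equiv> hoelder2_norm T \<gamma> (incr f)"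

definition hoelder2 :: "real \<Rightarrow> real \<Rightarrow> (real \<Rightarrow> real \<Rightarrow> 'e::real_normed_vector) \<Rightarrow> bool" where
  "hoelder2 T \<gamma> w \<longleftrightarrow> continuous_on (time2 T) (\<lambda>(s, t). w s t) \<and> hoelder2_norm T \<gamma> w < \<infinity>"

definition hoelder :: "real \<Rightarrow> real \<Rightarrow> (real \<Rightarrow> 'e::real_normed_vector) \<Rightarrow> bool" where
  "hoelder T \<gamma> f \<longleftrightarrow> continuous_on {0..T} f \<and> hoelder_norm T \<gamma> f < \<infinity>"

definition sup_norm :: "real \<Rightarrow> (real \<Rightarrow> 'e::real_normed_vector) \<Rightarrow> ennreal" where
  "sup_norm T f = (SUP t\<in>{0..T}. ennreal (norm (f t)))"

subsection \<open>Rough paths\<close>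

definition truly_rough_at :: "real \<Rightarrow> ('d::finite) path \<Rightarrow> real \<Rightarrow> bool" where
  "truly_rough_at \<alpha> \<omega> s \<longleftrightarrow> (\<forall>v. v \<noteq> 0 \<longrightarrow>
     Limsup (at_right s) (\<lambda>t. ereal (\<bar>v \<bullet> incr \<omega> s t\<bar> / (t - s) powr (2 * \<alpha>))) = \<infinity>)"

definition rough_path :: "real \<Rightarrow> real \<Rightarrow> 'd path \<Rightarrow> (real \<Rightarrow> real \<Rightarrow> real^'d^'d) \<Rightarrow> bool" where
  "rough_path T \<alpha> \<omega> W \<longleftrightarrow>
     hoelder T \<alpha> \<omega> \<and> hoelder2 T (2 * \<alpha>) W \<and>
     (\<forall>s r t. 0 \<le> s \<and> s < r \<and> r < t \<and> t \<le> T \<longrightarrow>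
        W s t - W s r - W r t = outer (incr \<omega> s r) (incr \<omega> r t)) \<and>
     (\<exists>A. A \<subseteq> {0..<T} \<and> {0..<T} \<subseteq> closure A \<and> (\<forall>s\<in>A. truly_rough_at \<alpha> \<omega> s))"

text \<open>\<open>W\<close> is only defined for \<open>s < t\<close>; the bracket starts at \<open>0\<close>.\<close>

definition bracket :: "'d path \<Rightarrow> (real \<Rightarrow> real \<Rightarrow> real^'d^'d) \<Rightarrow> real \<Rightarrow> real^'d^'d" where
  "bracket \<omega> W t = (if t = 0 then 0 else
     outer (incr \<omega> 0 t) (incr \<omega> 0 t) - W 0 t - transpose (W 0 t))"

subsection \<open>Integrals as limits of Riemann sums\<close>

definition partition_limit ::
  "(real \<Rightarrow> real \<Rightarrow> 'e::real_normed_vector) \<Rightarrow> real \<Rightarrow> 'e \<Rightarrow> bool" where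
  "partition_limit \<Xi> t I \<longleftrightarrow> (\<forall>\<epsilon>>0. \<exists>\<delta>>0. \<forall>(N::nat) p.
     p 0 = 0 \<and> p N = t \<and> (\<forall>k<N. p k < p (Suc k) \<and> p (Suc k) - p k < \<delta>) \<longrightarrow>
     norm ((\<Sum>k<N. \<Xi> (p k) (p (Suc k))) - I) < \<epsilon>)"

definition has_rough_integral ::
  "'d path \<Rightarrow> (real \<Rightarrow> real \<Rightarrow> real^'d^'d) \<Rightarrow> (real \<Rightarrow> 'e::real_normed_vector^'d) \<Rightarrow>
   (real \<Rightarrow> 'e^'d^'d) \<Rightarrow> real \<Rightarrow> 'e \<Rightarrow> bool" where
  "has_rough_integral \<omega> W \<theta> \<theta>' t I \<longleftrightarrow> partition_limit (\<lambda>s u.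
     (\<Sum>i\<in>UNIV. (incr \<omega> s u $ i) *\<^sub>R \<theta> s $ i) +
     (\<Sum>i\<in>UNIV. \<Sum>j\<in>UNIV. (W s u $ j $ i) *\<^sub>R \<theta>' s $ j $ i)) t I"

text \<open>The Young integral of \<open>c : dm\<close>, used for \<open>m = \<langle>\<omega>\<rangle>\<close>, which in general is only Hoelder
  continuous.\<close>

definition has_young_integral ::
  "(real \<Rightarrow> real^'d^'d) \<Rightarrow> (real \<Rightarrow> 'e::real_normed_vector^'d^'d) \<Rightarrow> real \<Rightarrow> 'e \<Rightarrow> bool" where
  "has_young_integral m c t I \<longleftrightarrow> partition_limit (\<lambda>s u.
     \<Sum>p\<in>UNIV. \<Sum>q\<in>UNIV. (incr m s u $ p $ q) *\<^sub>R c s $ p $ q) t I"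

subsection \<open>Controlled paths\<close>

text \<open>As derivatives with respect to \<open>\<omega>\<close> need not be unique, controlled paths are treated as
  pairs \<open>(\<theta>, \<theta>')\<close>.\<close>

definition remainder ::
  "'d path \<Rightarrow> (real \<Rightarrow> 'e::real_normed_vector) \<Rightarrow> (real \<Rightarrow> 'e^'d) \<Rightarrow> real \<Rightarrow> real \<Rightarrow> 'e" where
  "remainder \<omega> \<theta> \<theta>' s t = incr \<theta> s t - (\<Sum>i\<in>UNIV. (incr \<omega> s t $ i) *\<^sub>R \<theta>' s $ i)"

definition controlled1 ::
  "real \<Rightarrow> 'd path \<Rightarrow> real \<Rightarrow> real \<Rightarrow> (real \<Rightarrow> 'e::real_normed_vector) \<Rightarrow> (real \<Rightarrow> 'e^'d) \<Rightarrow> bool" where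
  "controlled1 T \<omega> \<alpha> \<beta> \<theta> \<theta>' \<longleftrightarrow>
     hoelder T \<beta> \<theta> \<and> hoelder T \<beta> \<theta>' \<and> hoelder2 T (\<alpha> + \<beta>) (remainder \<omega> \<theta> \<theta>')"

definition controlled_norm ::
  "real \<Rightarrow> 'd path \<Rightarrow> real \<Rightarrow> real \<Rightarrow> (real \<Rightarrow> 'e::real_normed_vector) \<Rightarrow> (real \<Rightarrow> 'e^'d) \<Rightarrow> ennreal" where
  "controlled_norm T \<omega> \<alpha> \<beta> \<theta> \<theta>' =
     hoelder_norm T \<beta> \<theta>' + hoelder2_norm T (\<alpha> + \<beta>) (remainder \<omega> \<theta> \<theta>')"

definition controlled_norm0 ::
  "real \<Rightarrow> 'd path \<Rightarrow> real \<Rightarrow> real \<Rightarrow> (real \<Rightarrow> 'e::real_normed_vector) \<Rightarrow> (real \<Rightarrow> 'e^'d) \<Rightarrow> ennreal" where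
  "controlled_norm0 T \<omega> \<alpha> \<beta> \<theta> \<theta>' = controlled_norm T \<omega> \<alpha> \<beta> \<theta> \<theta>' + ennreal (norm (\<theta>' 0))"

text \<open>The distance of \<open>(\<theta>, \<theta>')\<close>, controlled by \<open>\<omega>\<close>, and \<open>(\<eta>, \<eta>')\<close>, controlled by \<open>\<zeta>\<close>.\<close>

definition controlled_dist ::
  "real \<Rightarrow> real \<Rightarrow> real \<Rightarrow> 'd path \<Rightarrow> 'd path \<Rightarrow>
   (real \<Rightarrow> 'e::real_normed_vector) \<Rightarrow> (real \<Rightarrow> 'e^'d) \<Rightarrow>
   (real \<Rightarrow> 'e) \<Rightarrow> (real \<Rightarrow> 'e^'d) \<Rightarrow> ennreal" where
  "controlled_dist T \<alpha> \<beta> \<omega> \<zeta> \<theta> \<theta>' \<eta> \<eta>' =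
     hoelder_norm T \<beta> (\<lambda>t. \<theta>' t - \<eta>' t) +
     hoelder2_norm T (\<alpha> + \<beta>) (\<lambda>s t. remainder \<omega> \<theta> \<theta>' s t - remainder \<zeta> \<eta> \<eta>' s t)"

text \<open>\<open>\<theta>''\<close> is the derivative of \<open>\<theta>'\<close> and \<open>D\<close> the time derivative.  The column \<open>(\<theta>')\<^sup>*\<close> has
  derivative matrix \<open>transpose (\<theta>'' t)\<close>, whose entry \<open>(i, j)\<close> is the derivative of \<open>\<theta>' $ i\<close>
  in direction \<open>j\<close>.\<close>

definition controlled2_with ::
  "real \<Rightarrow> 'd path \<Rightarrow> (real \<Rightarrow> real \<Rightarrow> real^'d^'d) \<Rightarrow> real \<Rightarrow> real \<Rightarrow>
   (real \<Rightarrow> 'e::real_normed_vector) \<Rightarrow> (real \<Rightarrow> 'e^'d) \<Rightarrow> (real \<Rightarrow> 'e^'d^'d) \<Rightarrow> (real \<Rightarrow> 'e^'d^'d) \<Rightarrow> bool" where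
  "controlled2_with T \<omega> W \<alpha> \<beta> \<theta> \<theta>' \<theta>'' D \<longleftrightarrow>
     controlled1 T \<omega> \<alpha> \<beta> \<theta> \<theta>' \<and> controlled1 T \<omega> \<alpha> \<beta> \<theta>' \<theta>'' \<and>
     hoelder T \<beta> D \<and> (\<forall>t\<in>{0..T}. transpose (D t) = D t) \<and>
     (\<forall>t\<in>{0..T}. \<exists>I J. has_rough_integral \<omega> W \<theta>' \<theta>'' t I \<and>
        has_young_integral (bracket \<omega> W) (\<lambda>s. D s + (1/2) *\<^sub>R transpose (\<theta>'' s)) t J \<and>
        incr \<theta> 0 t = I + J)"

definition controlled2 ::
  "real \<Rightarrow> 'd path \<Rightarrow> (real \<Rightarrow> real \<Rightarrow> real^'d^'d) \<Rightarrow> real \<Rightarrow> real \<Rightarrow>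
   (real \<Rightarrow> 'e::real_normed_vector) \<Rightarrow> (real \<Rightarrow> 'e^'d) \<Rightarrow> bool" where
  "controlled2 T \<omega> W \<alpha> \<beta> \<theta> \<theta>' \<longleftrightarrow> (\<exists>\<theta>'' D. controlled2_with T \<omega> W \<alpha> \<beta> \<theta> \<theta>' \<theta>'' D)"

subsection \<open>Spaces of functions of time and space\<close>

definition Dy :: "(real \<Rightarrow> 'y::euclidean_space \<Rightarrow> 'e::real_normed_vector) \<Rightarrow> real \<Rightarrow> 'y \<Rightarrow> 'y \<Rightarrow>\<^sub>L 'e" where
  "Dy g t y = Blinfun (frechet_derivative (g t) (at y))"

definition bounded_on_bounded ::
  "real \<Rightarrow> (real \<Rightarrow> 'y::euclidean_space \<Rightarrow> 'e::real_normed_vector) \<Rightarrow> bool" where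
  "bounded_on_bounded T g \<longleftrightarrow> (\<forall>S. bounded S \<longrightarrow> bounded ((\<lambda>(t, y). g t y) ` ({0..T} \<times> S)))"

definition C1_loc :: "real \<Rightarrow> (real \<Rightarrow> 'y::euclidean_space \<Rightarrow> 'e::real_normed_vector) \<Rightarrow> bool" where
  "C1_loc T g \<longleftrightarrow> (\<forall>t\<in>{0..T}. \<forall>y. g t differentiable (at y)) \<and>
     bounded_on_bounded T g \<and> bounded_on_bounded T (Dy g)"

definition C2_loc :: "real \<Rightarrow> (real \<Rightarrow> 'y::euclidean_space \<Rightarrow> 'e::real_normed_vector) \<Rightarrow> bool" where
  "C2_loc T g \<longleftrightarrow> C1_loc T g \<and> C1_loc T (Dy g)"

definition norm0 :: "real \<Rightarrow> (real \<Rightarrow> 'y::euclidean_space \<Rightarrow> 'e::real_normed_vector) \<Rightarrow> ennreal" where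
  "norm0 T g = (SUP (t, y)\<in>{0..T} \<times> UNIV. ennreal (norm (g t y)))"

definition norm1 :: "real \<Rightarrow> (real \<Rightarrow> 'y::euclidean_space \<Rightarrow> 'e::real_normed_vector) \<Rightarrow> ennreal" where
  "norm1 T g = norm0 T g + norm0 T (Dy g)"

definition norm2 :: "real \<Rightarrow> (real \<Rightarrow> 'y::euclidean_space \<Rightarrow> 'e::real_normed_vector) \<Rightarrow> ennreal" where
  "norm2 T g = norm0 T g + norm0 T (Dy g) + norm0 T (Dy (Dy g))"

definition hoelder_in_time ::
  "real \<Rightarrow> real \<Rightarrow> (real \<Rightarrow> 'y::euclidean_space \<Rightarrow> 'e::real_normed_vector) \<Rightarrow> bool" where
  "hoelder_in_time T \<beta> g \<longleftrightarrow> (\<forall>y. hoelder T \<beta> (\<lambda>t. g t y) \<and>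
     ((\<lambda>z. hoelder_norm T \<beta> (\<lambda>t. g t z - g t y)) \<longlongrightarrow> 0) (at y))"

definition C1_hoelder_loc ::
  "real \<Rightarrow> real \<Rightarrow> (real \<Rightarrow> 'y::euclidean_space \<Rightarrow> 'e::real_normed_vector) \<Rightarrow> bool" where
  "C1_hoelder_loc T \<beta> g \<longleftrightarrow> C1_loc T g \<and> hoelder_in_time T \<beta> g \<and> hoelder_in_time T \<beta> (Dy g)"

definition C2_hoelder_loc ::
  "real \<Rightarrow> real \<Rightarrow> (real \<Rightarrow> 'y::euclidean_space \<Rightarrow> 'e::real_normed_vector) \<Rightarrow> bool" where
  "C2_hoelder_loc T \<beta> g \<longleftrightarrow> C2_loc T g \<and>
     hoelder_in_time T \<beta> g \<and> hoelder_in_time T \<beta> (Dy g) \<and> hoelder_in_time T \<beta> (Dy (Dy g))"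

definition sup_hoelder_norm ::
  "real \<Rightarrow> real \<Rightarrow> (real \<Rightarrow> 'y::euclidean_space \<Rightarrow> 'e::real_normed_vector) \<Rightarrow> ennreal" where
  "sup_hoelder_norm T \<beta> g = (SUP y. hoelder_norm T \<beta> (\<lambda>t. g t y))"

definition norm1_hoelder ::
  "real \<Rightarrow> real \<Rightarrow> (real \<Rightarrow> 'y::euclidean_space \<Rightarrow> 'e::real_normed_vector) \<Rightarrow> ennreal" where
  "norm1_hoelder T \<beta> g = norm1 T g + (sup_hoelder_norm T \<beta> g + sup_hoelder_norm T \<beta> (Dy g))"

definition norm2_hoelder ::
  "real \<Rightarrow> real \<Rightarrow> (real \<Rightarrow> 'y::euclidean_space \<Rightarrow> 'e::real_normed_vector) \<Rightarrow> ennreal" where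
  "norm2_hoelder T \<beta> g = norm2 T g +
     (sup_hoelder_norm T \<beta> g + sup_hoelder_norm T \<beta> (Dy g) + sup_hoelder_norm T \<beta> (Dy (Dy g)))"

definition C2_hoelder ::
  "real \<Rightarrow> real \<Rightarrow> (real \<Rightarrow> 'y::euclidean_space \<Rightarrow> 'e::real_normed_vector) \<Rightarrow> bool" where
  "C2_hoelder T \<beta> g \<longleftrightarrow> C2_hoelder_loc T \<beta> g \<and> norm2_hoelder T \<beta> g < \<infinity>"

text \<open>A function \<open>g\<close> controlled in time is a pair \<open>(g, g')\<close>, where \<open>g'\<close> is its derivative with
  respect to \<open>\<omega>\<close>.  Its space derivative is the pair \<open>(Dy g, Dy_deriv g')\<close>: the derivative with
  respect to \<open>\<omega>\<close> carried by \<open>Dy g\<close> is the space derivative of \<open>g'\<close>, taken componentwise (the two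
  differentiations commute, automatically so when derivatives with respect to \<open>\<omega>\<close> are unique).\<close>

definition Dy_deriv ::
  "(real \<Rightarrow> 'y::euclidean_space \<Rightarrow> 'e::real_normed_vector^'d) \<Rightarrow> real \<Rightarrow> 'y \<Rightarrow> ('y \<Rightarrow>\<^sub>L 'e)^'d" where
  "Dy_deriv g' t y = (\<chi> j. Dy (\<lambda>t y. g' t y $ j) t y)"

definition controlled_in_time ::
  "real \<Rightarrow> 'd path \<Rightarrow> real \<Rightarrow> real \<Rightarrow> (real \<Rightarrow> 'y::euclidean_space \<Rightarrow> 'e::real_normed_vector) \<Rightarrow>
   (real \<Rightarrow> 'y \<Rightarrow> 'e^'d) \<Rightarrow> bool" where
  "controlled_in_time T \<omega> \<alpha> \<beta> g g' \<longleftrightarrow> (\<forall>y.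
     controlled1 T \<omega> \<alpha> \<beta> (\<lambda>t. g t y) (\<lambda>t. g' t y) \<and>
     ((\<lambda>z. controlled_norm0 T \<omega> \<alpha> \<beta> (\<lambda>t. g t z - g t y) (\<lambda>t. g' t z - g' t y)) \<longlongrightarrow> 0) (at y))"

definition C12_loc ::
  "real \<Rightarrow> 'd path \<Rightarrow> real \<Rightarrow> real \<Rightarrow> (real \<Rightarrow> 'y::euclidean_space \<Rightarrow> 'e::real_normed_vector) \<Rightarrow>
   (real \<Rightarrow> 'y \<Rightarrow> 'e^'d) \<Rightarrow> bool" where
  "C12_loc T \<omega> \<alpha> \<beta> g g' \<longleftrightarrow> C2_loc T g \<and>
     controlled_in_time T \<omega> \<alpha> \<beta> g g' \<and> controlled_in_time T \<omega> \<alpha> \<beta> (Dy g) (Dy_deriv g') \<and>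
     C1_hoelder_loc T \<beta> g'"

definition norm12 ::
  "real \<Rightarrow> 'd path \<Rightarrow> real \<Rightarrow> real \<Rightarrow> (real \<Rightarrow> 'y::euclidean_space \<Rightarrow> 'e::real_normed_vector) \<Rightarrow>
   (real \<Rightarrow> 'y \<Rightarrow> 'e^'d) \<Rightarrow> ennreal" where
  "norm12 T \<omega> \<alpha> \<beta> g g' = norm2 T g + norm1 T g' +
     (SUP y. controlled_norm T \<omega> \<alpha> \<beta> (\<lambda>t. g t y) (\<lambda>t. g' t y) +
             controlled_norm T \<omega> \<alpha> \<beta> (\<lambda>t. Dy g t y) (\<lambda>t. Dy_deriv g' t y))"

definition C12 ::
  "real \<Rightarrow> 'd path \<Rightarrow> real \<Rightarrow> real \<Rightarrow> (real \<Rightarrow> 'y::euclidean_space \<Rightarrow> 'e::real_normed_vector) \<Rightarrow>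
   (real \<Rightarrow> 'y \<Rightarrow> 'e^'d) \<Rightarrow> bool" where
  "C12 T \<omega> \<alpha> \<beta> g g' \<longleftrightarrow> C12_loc T \<omega> \<alpha> \<beta> g g' \<and> norm12 T \<omega> \<alpha> \<beta> g g' < \<infinity>"

definition dist12 ::
  "real \<Rightarrow> real \<Rightarrow> real \<Rightarrow> 'd path \<Rightarrow> 'd path \<Rightarrow>
   (real \<Rightarrow> 'y::euclidean_space \<Rightarrow> 'e::real_normed_vector) \<Rightarrow> (real \<Rightarrow> 'y \<Rightarrow> 'e^'d) \<Rightarrow>
   (real \<Rightarrow> 'y \<Rightarrow> 'e) \<Rightarrow> (real \<Rightarrow> 'y \<Rightarrow> 'e^'d) \<Rightarrow> ennreal" where
  "dist12 T \<alpha> \<beta> \<omega> \<zeta> g g' h h' =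
     norm2 T (\<lambda>t y. g t y - h t y) + norm1 T (\<lambda>t y. g' t y - h' t y) +
     (SUP y. controlled_dist T \<alpha> \<beta> \<omega> \<zeta> (\<lambda>t. g t y) (\<lambda>t. g' t y) (\<lambda>t. h t y) (\<lambda>t. h' t y) +
             controlled_dist T \<alpha> \<beta> \<omega> \<zeta> (\<lambda>t. Dy g t y) (\<lambda>t. Dy_deriv g' t y)
               (\<lambda>t. Dy h t y) (\<lambda>t. Dy_deriv h' t y))"

definition C23 ::
  "real \<Rightarrow> 'd path \<Rightarrow> (real \<Rightarrow> real \<Rightarrow> real^'d^'d) \<Rightarrow> real \<Rightarrow> real \<Rightarrow>
   (real \<Rightarrow> 'y::euclidean_space \<Rightarrow> 'e::real_normed_vector) \<Rightarrow> (real \<Rightarrow> 'y \<Rightarrow> 'e^'d) \<Rightarrow> bool" where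
  "C23 T \<omega> W \<alpha> \<beta> g g' \<longleftrightarrow> C12_loc T \<omega> \<alpha> \<beta> g g' \<and> C12_loc T \<omega> \<alpha> \<beta> (Dy g) (Dy_deriv g') \<and>
     (\<exists>g'' D. C12_loc T \<omega> \<alpha> \<beta> g' g'' \<and> C1_hoelder_loc T \<beta> D \<and>
        (\<forall>y. controlled2_with T \<omega> W \<alpha> \<beta> (\<lambda>t. g t y) (\<lambda>t. g' t y) (\<lambda>t. g'' t y) (\<lambda>t. D t y)) \<and>
        norm12 T \<omega> \<alpha> \<beta> g g' + norm12 T \<omega> \<alpha> \<beta> g' g'' +
          norm12 T \<omega> \<alpha> \<beta> (Dy g) (Dy_deriv g') < \<infinity>)"

subsection \<open>The Brownian setting\<close>

text \<open>Extensionality makes \<open>Omega0 T\<close> a faithful copy of the continuous paths on \<open>{0..T}\<close>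
  starting at \<open>0\<close>.\<close>

definition Omega0 :: "real \<Rightarrow> ('d::finite) path set" where
  "Omega0 T = {\<omega> \<in> extensional {0..T}. continuous_on {0..T} \<omega> \<and> \<omega> 0 = 0}"

definition dyadic :: "real \<Rightarrow> nat \<Rightarrow> nat \<Rightarrow> real" where
  "dyadic T n i = real i * T / 2 ^ n"

definition dyadic_sum :: "real \<Rightarrow> 'd path \<Rightarrow> real \<Rightarrow> nat \<Rightarrow> real^'d^'d" where
  "dyadic_sum T \<omega> t n = (\<Sum>i<2^n. outer (\<omega> (dyadic T n i))
     (incr \<omega> (min (dyadic T n i) t) (min (dyadic T n (Suc i)) t)))"

definition Phi_ereal :: "real \<Rightarrow> ('d::finite) path \<Rightarrow> real \<Rightarrow> 'd \<Rightarrow> 'd \<Rightarrow> ereal" where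
  "Phi_ereal T \<omega> t i j = limsup (\<lambda>n. ereal (dyadic_sum T \<omega> t n $ i $ j))"

definition Phi :: "real \<Rightarrow> 'd path \<Rightarrow> real \<Rightarrow> real^'d^'d" where
  "Phi T \<omega> t = (\<chi> i j. real_of_ereal (Phi_ereal T \<omega> t i j))"

definition lift :: "real \<Rightarrow> 'd path \<Rightarrow> real \<Rightarrow> real \<Rightarrow> real^'d^'d" where
  "lift T \<omega> s t = Phi T \<omega> t - Phi T \<omega> s - outer (\<omega> s) (incr \<omega> s t)"

definition path_bracket :: "real \<Rightarrow> 'd path \<Rightarrow> real \<Rightarrow> real^'d^'d" where
  "path_bracket T \<omega> t = outer (\<omega> t) (\<omega> t) - Phi T \<omega> t - transpose (Phi T \<omega> t)"

text \<open>Since \<open>real_of_ereal\<close> maps \<open>\<plusminus>\<infinity>\<close> to \<open>0\<close>, finiteness of the upper limits has to be required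
  explicitly.\<close>

definition A_set :: "real \<Rightarrow> real \<Rightarrow> ('d::finite) path set" where
  "A_set T \<alpha> = {\<omega> \<in> Omega0 T.
     (\<forall>t\<in>{0..T}. \<forall>i j. \<bar>Phi_ereal T \<omega> t i j\<bar> \<noteq> \<infinity>) \<and>
     hoelder2_norm T (2 * \<alpha>) (lift T \<omega>) < \<infinity> \<and>
     (\<forall>t\<in>{0..T}. path_bracket T \<omega> t = t *\<^sub>R mat 1) \<and>
     (\<forall>s \<in> \<rat> \<inter> {0..<T}. truly_rough_at \<alpha> \<omega> s)}"

definition Omega :: "real \<Rightarrow> ('d::finite) path set" where
  "Omega T = {\<omega> \<in> Omega0 T. \<forall>\<alpha>\<in>{1/3<..<1/2}. rough_path T \<alpha> \<omega> (lift T \<omega>) \<and> \<omega> \<in> A_set T \<alpha>}"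

definition path_dist :: "real \<Rightarrow> real \<Rightarrow> ('d::finite) path \<Rightarrow> 'd path \<Rightarrow> ennreal" where
  "path_dist T \<alpha> \<omega> \<zeta> = hoelder_norm T \<alpha> (\<lambda>t. \<omega> t - \<zeta> t) +
     hoelder2_norm T (2 * \<alpha>) (\<lambda>s t. lift T \<omega> s t - lift T \<zeta> s t)"

definition natural_filtration :: "real \<Rightarrow> real \<Rightarrow> ('d::finite) path measure" where
  "natural_filtration T t =
     sigma (Omega T) {{\<omega> \<in> Omega T. \<omega> s \<in> A} | s A. s \<in> {0..t} \<and> A \<in> sets borel}"

definition progressively_measurable ::
  "real \<Rightarrow> (real \<Rightarrow> 'y::euclidean_space \<Rightarrow> ('d::finite) path \<Rightarrow> 'e::euclidean_space) \<Rightarrow> bool" where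
  "progressively_measurable T f \<longleftrightarrow> (\<forall>t\<in>{0..T}. (\<lambda>(s, y, \<omega>). f s y \<omega>) \<in>
     restrict_space borel {0..t} \<Otimes>\<^sub>M borel \<Otimes>\<^sub>M natural_filtration T t \<rightarrow>\<^sub>M borel)"

subsection \<open>Pathwise solutions\<close>

text \<open>\<open>g'\<close> is the derivative of \<open>g\<close> and \<open>Y'\<close> that of \<open>Y\<close> with respect to \<open>\<omega>\<close>; the result is the
  derivative of \<open>\<lambda>t. g t (Y t)\<close> given by the chain rule.\<close>

definition chain_deriv ::
  "(real \<Rightarrow> 'y::euclidean_space \<Rightarrow> 'e::real_normed_vector) \<Rightarrow> (real \<Rightarrow> 'y \<Rightarrow> 'e^'d) \<Rightarrow>
   (real \<Rightarrow> 'y) \<Rightarrow> (real \<Rightarrow> 'y^'d) \<Rightarrow> real \<Rightarrow> 'e^'d" where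
  "chain_deriv g g' Y Y' t = (\<chi> j. g' t (Y t) $ j + blinfun_apply (Dy g t (Y t)) (Y' t $ j))"

text \<open>\<open>\<sigma>'\<close> is the derivative of \<open>\<sigma>\<close> with respect to \<open>\<omega>\<close>.  The drift coefficient is
  \<open>b I\<^sub>d / d\<close>.\<close>

definition solves_at ::
  "real \<Rightarrow> 'd path \<Rightarrow> real \<Rightarrow> real \<Rightarrow> (real \<Rightarrow> 'e::euclidean_space \<Rightarrow> 'e) \<Rightarrow>
   (real \<Rightarrow> 'e \<Rightarrow> 'e^'d) \<Rightarrow> (real \<Rightarrow> 'e \<Rightarrow> 'e^'d^'d) \<Rightarrow> 'e \<Rightarrow> (real \<Rightarrow> 'e) \<Rightarrow> bool" where
  "solves_at T \<omega> \<alpha> \<beta> b \<sigma> \<sigma>' x Y \<longleftrightarrow>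
     controlled1 T \<omega> \<alpha> \<beta> Y (\<lambda>t. \<sigma> t (Y t)) \<and>
     controlled1 T \<omega> \<alpha> \<beta> (\<lambda>t. \<sigma> t (Y t)) (chain_deriv \<sigma> \<sigma>' Y (\<lambda>t. \<sigma> t (Y t))) \<and>
     (\<forall>t\<in>{0..T}. \<exists>I J.
        has_rough_integral \<omega> (lift T \<omega>) (\<lambda>s. \<sigma> s (Y s))
          (chain_deriv \<sigma> \<sigma>' Y (\<lambda>s. \<sigma> s (Y s))) t I \<and>
        has_young_integral (path_bracket T \<omega>)
          (\<lambda>s. \<chi> p q. if p = q then (1 / real CARD('d)) *\<^sub>R b s (Y s) else 0) t J \<and>
        Y t = x + I + J)"

definition is_solution ::
  "real \<Rightarrow> ('d path \<Rightarrow> real) \<Rightarrow> ('d path \<Rightarrow> real) \<Rightarrow>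
   (real \<Rightarrow> 'e::euclidean_space \<Rightarrow> 'd path \<Rightarrow> 'e) \<Rightarrow> (real \<Rightarrow> 'e \<Rightarrow> 'd path \<Rightarrow> 'e^'d) \<Rightarrow>
   (real \<Rightarrow> 'e \<Rightarrow> 'd path \<Rightarrow> 'e^'d^'d) \<Rightarrow> 'e \<Rightarrow> ('d path \<Rightarrow> real \<Rightarrow> 'e) \<Rightarrow> bool" where
  "is_solution T \<alpha> \<beta> b \<sigma> \<sigma>' x X \<longleftrightarrow> (\<forall>\<omega>\<in>Omega T.
     solves_at T \<omega> (\<alpha> \<omega>) (\<beta> \<omega>) (\<lambda>t y. b t y \<omega>) (\<lambda>t y. \<sigma> t y \<omega>) (\<lambda>t y. \<sigma>' t y \<omega>) x (X \<omega>))"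

text \<open>Continuity of the coefficients in \<open>\<omega>\<close>.  The distance of \<open>\<sigma>\<close> is required to be defined for
  all large \<open>n\<close>.\<close>

definition continuous_coefficients ::
  "real \<Rightarrow> ('d path \<Rightarrow> real) \<Rightarrow> ('d path \<Rightarrow> real) \<Rightarrow>
   (real \<Rightarrow> 'e::euclidean_space \<Rightarrow> 'd path \<Rightarrow> 'e) \<Rightarrow> (real \<Rightarrow> 'e \<Rightarrow> 'd path \<Rightarrow> 'e^'d) \<Rightarrow>
   (real \<Rightarrow> 'e \<Rightarrow> 'd path \<Rightarrow> 'e^'d^'d) \<Rightarrow> bool" where
  "continuous_coefficients T \<alpha> \<beta> b \<sigma> \<sigma>' \<longleftrightarrow> (\<forall>\<omega>\<in>Omega T. \<forall>\<omega>n::nat \<Rightarrow> 'd path.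
     (\<forall>n. \<omega>n n \<in> Omega T) \<and> (\<lambda>n. path_dist T (\<alpha> \<omega>) (\<omega>n n) \<omega>) \<longlonglongrightarrow> 0 \<longrightarrow>
     (\<forall>\<^sub>F n in sequentially.
        C12 T (\<omega>n n) (\<alpha> \<omega>) (\<beta> \<omega>) (\<lambda>t y. \<sigma> t y (\<omega>n n)) (\<lambda>t y. \<sigma>' t y (\<omega>n n))) \<and>
     (\<lambda>n. norm1_hoelder T (\<beta> \<omega>) (\<lambda>t y. b t y (\<omega>n n) - b t y \<omega>) +
          dist12 T (\<alpha> \<omega>) (\<beta> \<omega>) \<omega> (\<omega>n n)
            (\<lambda>t y. \<sigma> t y \<omega>) (\<lambda>t y. \<sigma>' t y \<omega>)
            (\<lambda>t y. \<sigma> t y (\<omega>n n)) (\<lambda>t y. \<sigma>' t y (\<omega>n n))) \<longlonglongrightarrow> 0)"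

end

theory Submission
  imports Defs "HOL-Complex_Analysis.Great_Picard"
begin

text \<open>
  A path \<open>Y\<close> solves the equation iff it starts at \<open>x\<close> and agrees with the second-order Euler step
  \<open>F s t y = y + \<sigma> s y \<cdot> \<omega>\<^sub>s\<^sub>t + c s y : \<omega>\<omega>\<^sub>s\<^sub>t + b s y (t - s)\<close> up to \<open>O((t - s)\<^sup>\<gamma>)\<close>,
  \<open>\<gamma> = 2\<alpha> + \<beta> > 1\<close> (Davie); here \<open>c\<close> is the chain-rule derivative of \<open>\<sigma>(t, Y\<^sub>t)\<close>.  The steps \<open>F s t\<close>
  compose up to \<open>O((t - s)\<^sup>\<gamma>)\<close>, so bisection turns any Davie bound with exponent above 1 into one
  with exponent \<open>\<gamma>\<close> and a constant depending only on the bounds of the coefficients.  In particular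
  the exponents \<open>\<alpha>(\<omega>\<^sub>n)\<close> attached to approximating paths do not matter.  Euler schemes satisfy the
  same bound, and compactness gives existence.  For \<open>\<sigma>\<close> of class \<open>C\<^sup>2\<^sup>,\<^sup>3\<close> the composition
  defect is also Lipschitz in \<open>y\<close>, and bisection applied to the difference of two solutions gives
  uniqueness.  Uniform convergence in \<open>\<omega>\<close> then follows from compactness and uniqueness, and it
  upgrades to the controlled distance by interpolation, since \<open>\<gamma> > \<alpha> + \<beta>\<close>.
\<close>

section \<open>Almost flows and Davie solutions\<close>

text \<open>The continuity hypothesis measures coefficients by \<open>norm1_hoelder\<close> and
  \<open>dist12\<close>, one space derivative weaker than the norms of \<open>C2_hoelder\<close> and
  \<open>C23\<close> on which uniqueness rests. The approximating flows therefore share the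
  constants of \<open>almost_flow\<close>, but no bound uniform in n is at hand for the Lipschitz
  constants of their defects. This forces the detour through compactness, in which only the limit
  flow has to be smooth. The exponent \<gamma> comes from cancellation. By Chen's relation,
  composing two steps leaves a path increment times a remainder of \<sigma>, a second-level
  increment times an increment of c, and a time increment times an increment of b, of orders
  \<alpha> + (\<alpha> + \<beta>), 2 \<alpha> + \<beta> and 1 + \<beta>. Differentiating F in y
  yields an Euler step of the linearised equation, to which the same algebra applies; this is where
  third space derivatives of \<sigma> enter. Paths in \<open>Omega T\<close> have bracket t I_d, so
  Young integrals reduce to ordinary ones and only traces of their integrands matter.\<close>

lemma powr_half: "0 \<le> x \<Longrightarrow> (x / 2) powr p = x powr p / 2 powr p" for x p :: real
  by (simp add: powr_divide)

text \<open>The recursion \<open>n(\<tau>) \<le> q n(\<tau>/2) + K \<tau>\<^sup>\<gamma>\<close> forgets the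
    initial bound if
  \<open>q < 2\<^sup>\<gamma>\<^sup>'\<close>.\<close>
lemma bisection_bound:
  fixes N :: "real \<Rightarrow> real \<Rightarrow> real"
  assumes q: "0 \<le> q" "1 + q < 2 powr \<gamma>" "1 + q < 2 powr \<gamma>'"
    and loc: "\<And>s t. a \<le> s \<Longrightarrow> s < t \<Longrightarrow> t \<le> b \<Longrightarrow> t - s
        \<le> \<delta> \<Longrightarrow> N s t \<le> C * (t - s) powr \<gamma>'"
    and split: "\<And>s r t. a \<le> s \<Longrightarrow> s < r \<Longrightarrow> r < t \<Longrightarrow> t
        \<le> b \<Longrightarrow> t - s \<le> \<delta> \<Longrightarrow>
      N s t \<le> N r t + q * N s r + K * (t - s) powr \<gamma>"
    and st: "a \<le> s" "s < t" "t \<le> b" "t - s \<le> \<delta>"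
  shows "N s t \<le> K / (1 - (1 + q) / 2 powr \<gamma>) * (t - s) powr \<gamma>"
proof -
  define \<rho> where "\<rho> = (1 + q) / 2 powr \<gamma>"
  define \<rho>' where "\<rho>' = (1 + q) / 2 powr \<gamma>'"
  have \<rho>: "0 \<le> \<rho>" "\<rho> < 1" "0 \<le> \<rho>'" "\<rho>' < 1"
    using q by (simp_all add: \<rho>_def \<rho>'_def)
  \<comment> \<open>After k halvings the bound put in survives only with the factor \<rho>'^k, while
    the defects K of all levels add up to a partial geometric series; letting k grow removes the
    former.\<close>
  have main: "N s t \<le> K * (t - s) powr \<gamma> * (\<Sum>i<k. \<rho> ^ i) + C * (t - s) powr \<gamma>' *
      \<rho>' ^ k"
    if "a \<le> s" "s < t" "t \<le> b" "t - s \<le> \<delta>" for k s t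
    using that
  proof (induction k arbitrary: s t)
    case 0
    then show ?case using loc by simp
  next
    case (Suc k)
    define r where "r = (s + t) / 2"
    have r: "s < r" "r < t" "r - s = (t - s) / 2" "t - r = (t - s) / 2"
      using Suc.prems by (auto simp: r_def field_simps)
    define B where "B = K * ((t - s) / 2) powr \<gamma> * (\<Sum>i<k. \<rho> ^ i) + C * ((t - s) / 2) powr
        \<gamma>' * \<rho>' ^ k"
    have 1: "N s r \<le> B" "N r t \<le> B"
      using Suc.IH[of s r] Suc.IH[of r t] Suc.prems r by (auto simp: B_def)
    have "N s t \<le> N r t + q * N s r + K * (t - s) powr \<gamma>"
      using Suc.prems r by (intro split) auto
    also have "\<dots> \<le> B + q * B + K * (t - s) powr \<gamma>"
      using 1 q by (simp add: add_mono mult_left_mono)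
    also have "\<dots> = (1 + q) * B + K * (t - s) powr \<gamma>"
      by (simp add: algebra_simps)
    also have "(1 + q) * B = K * (t - s) powr \<gamma> * (\<rho> * (\<Sum>i<k. \<rho> ^ i)) + C * (t - s) powr
        \<gamma>' * \<rho>' ^ Suc k"
      using Suc.prems by (simp add: B_def \<rho>_def \<rho>'_def powr_half algebra_simps)
    also have "\<rho> * (\<Sum>i<k. \<rho> ^ i) = (\<Sum>i<Suc k. \<rho> ^ i) - 1"
      by (simp add: sum.lessThan_Suc_shift sum_distrib_left del: sum.lessThan_Suc)
    finally show ?case by (simp add: algebra_simps)
  qed
  have "(\<lambda>k. K * (t - s) powr \<gamma> * (\<Sum>i<k. \<rho> ^ i) + C * (t - s) powr \<gamma>' * \<rho>' ^ k)
    \<longlonglongrightarrow> K * (t - s) powr \<gamma> * (1 / (1 - \<rho>)) + C * (t - s) powr \<gamma>' * 0"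
    using \<rho> geometric_sums[of \<rho>]
    by (intro tendsto_intros LIMSEQ_realpow_zero) (auto simp: sums_def)
  then have "N s t \<le> K * (t - s) powr \<gamma> * (1 / (1 - \<rho>)) + C * (t - s) powr \<gamma>' * 0"
    by (rule LIMSEQ_le_const) (use main st in blast)
  then show ?thesis by (simp add: \<rho>_def)
qed

text \<open>\<open>lip\<close> bounds the deviation of F s t from the identity, so that transport
  over a short interval costs a factor close to 1; an arbitrary Lipschitz constant would not satisfy
  1 + q < 2^\<gamma> in the bisection. The constants are parameters because families of flows must
  share them.\<close>

locale almost_flow =
  fixes T K L \<gamma> \<eta> :: real and F :: "real \<Rightarrow> real \<Rightarrow> 'e::euclidean_space
      \<Rightarrow> 'e"
  assumes T_pos: "0 < T" and K_nonneg: "0 \<le> K" and L_nonneg: "0 \<le> L" and \<gamma>_gt1: "1 < \<gamma>"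
      and \<eta>_pos: "0 < \<eta>"
    and \<eta>_le: "\<eta> \<le> \<gamma>"
    and dev: "\<And>s t y. 0 \<le> s \<Longrightarrow> s < t \<Longrightarrow> t \<le> T \<Longrightarrow> norm
        (F s t y - y) \<le> L * (t - s) powr \<eta>"
    and lip: "\<And>s t y z. 0 \<le> s \<Longrightarrow> s < t \<Longrightarrow> t \<le> T \<Longrightarrow>
      norm ((F s t y - y) - (F s t z - z)) \<le> L * (t - s) powr \<eta> * norm (y - z)"
    and defect: "\<And>s r t y. 0 \<le> s \<Longrightarrow> s < r \<Longrightarrow> r < t \<Longrightarrow> t
        \<le> T \<Longrightarrow>
      norm (F r t (F s r y) - F s t y) \<le> K * (t - s) powr \<gamma>"

text \<open>The value 0 on degenerate intervals makes splitting at an end point hold trivially; the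
  grid argument cuts off possibly empty pieces.\<close>

definition davie_error :: "(real \<Rightarrow> real \<Rightarrow> 'e \<Rightarrow> 'e) \<Rightarrow> (real
    \<Rightarrow> 'e::real_normed_vector) \<Rightarrow> real \<Rightarrow> real \<Rightarrow> 'e" where
  "davie_error F Y s t = (if s < t then Y t - F s t (Y s) else 0)"

definition davie_bound :: "real \<Rightarrow> (real \<Rightarrow> real \<Rightarrow> 'e \<Rightarrow> 'e)
    \<Rightarrow> real \<Rightarrow> real \<Rightarrow> (real \<Rightarrow> 'e::real_normed_vector)
    \<Rightarrow> bool" where
  "davie_bound T F C \<gamma> Y \<longleftrightarrow> (\<forall>s t. 0 \<le> s \<and> s < t \<and> t \<le> T
      \<longrightarrow> norm (Y t - F s t (Y s)) \<le> C * (t - s) powr \<gamma>)"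

section \<open>A priori bounds by bisection and doubling\<close>

context almost_flow
begin

lemma lip':
  assumes "0 \<le> s" "s < t" "t \<le> T"
  shows "norm (F s t y - F s t z) \<le> (1 + L * (t - s) powr \<eta>) * norm (y - z)"
proof -
  have "F s t y - F s t z = ((F s t y - y) - (F s t z - z)) + (y - z)" by simp
  then have "norm (F s t y - F s t z) \<le> norm ((F s t y - y) - (F s t z - z)) + norm (y - z)"
    by (metis norm_triangle_ineq)
  then show ?thesis using lip[OF assms, of y z] by (simp add: algebra_simps)
qed

text \<open>Insert F r t (Y r) and F r t (F s r (Y s)): this leaves the error on [r, t], the
  transported error on [s, r] and the composition defect. Bounding t - r by a free h gives a factor
  near 1 on short intervals and a crude one for h = T.\<close>

lemma davie_error_split:
  assumes "0 \<le> s" "s \<le> r" "r \<le> t" "t \<le> T" "t - r \<le> h"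
  shows "norm (davie_error F Y s t) \<le> norm (davie_error F Y r t) +
    (1 + L * h powr \<eta>) * norm (davie_error F Y s r) + K * (t - s) powr \<gamma>"
proof -
  have 0: "0 \<le> L * h powr \<eta>" "0 \<le> K * (t - s) powr \<gamma>"
    using L_nonneg K_nonneg by simp_all
  have h: "L * (t - r) powr \<eta> \<le> L * h powr \<eta>"
    using assms L_nonneg \<eta>_pos by (intro mult_left_mono powr_mono2) auto
  consider "s = r" | "r = t" | "s < r" "r < t" using assms by linarith
  then show ?thesis
  proof cases
    case 1
    then show ?thesis using 0 by (simp add: davie_error_def)
  next
    case 2
    have "0 \<le> L * h powr \<eta> * norm (davie_error F Y s t)" using 0 by simp
    then show ?thesis using 0 2 by (simp add: davie_error_def algebra_simps)
  next
    case 3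
    have "Y t - F s t (Y s) = (Y t - F r t (Y r)) + (F r t (Y r) - F r t (F s r (Y s)))
      + (F r t (F s r (Y s)) - F s t (Y s))" by simp
    then have "norm (Y t - F s t (Y s)) \<le> norm (Y t - F r t (Y r))
      + norm (F r t (Y r) - F r t (F s r (Y s))) + norm (F r t (F s r (Y s)) - F s t (Y s))"
      by (smt (verit) norm_triangle_ineq)
    also have "norm (F r t (Y r) - F r t (F s r (Y s))) \<le> (1 + L * (t - r) powr \<eta>) * norm (Y r - F s r (Y s))"
      using 3 assms by (intro lip') auto
    also have "\<dots> \<le> (1 + L * h powr \<eta>) * norm (Y r - F s r (Y s))"
      using h by (intro mult_right_mono) auto
    also have "norm (F r t (F s r (Y s)) - F s t (Y s)) \<le> K * (t - s) powr \<gamma>"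
      using 3 assms by (intro defect) auto
    finally show ?thesis using 3 by (simp add: davie_error_def)
  qed
qed

text \<open>Neither C nor \<gamma>' appears in the resulting constant; only the scale \<delta> has
  to be compatible with \<gamma>'.\<close>

lemma bisect_davie_error:
  assumes q: "2 + L * \<delta> powr \<eta> < 2 powr \<gamma>" "2 + L * \<delta> powr \<eta> < 2 powr \<gamma>'"
    and loc: "\<And>s t. 0 \<le> s \<Longrightarrow> s < t \<Longrightarrow> t \<le> T \<Longrightarrow> t - s
        \<le> \<delta> \<Longrightarrow> norm (davie_error F Y s t) \<le> C * (t - s) powr \<gamma>'"
    and st: "0 \<le> s" "s < t" "t \<le> T" "t - s \<le> \<delta>"
  shows "norm (davie_error F Y s t) \<le> K / (1 - (2 + L * \<delta> powr \<eta>) / 2 powr \<gamma>) * (t - s)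
      powr \<gamma>"
  using bisection_bound[of "1 + L * \<delta> powr \<eta>" \<gamma> \<gamma>' 0 T \<delta> "\<lambda>s t. norm
      (davie_error F Y s t)" C K s t]
    L_nonneg q loc davie_error_split st by force

text \<open>Above the scale where bisection contracts, one split in the middle costs this affine
  map, with the crude factor for h = T. Finitely many doublings reach length T, their number
  depending on \<delta> and T only.\<close>

definition doubled :: "real \<Rightarrow> real" where
  "doubled C = (2 + L * T powr \<eta>) * C + K"

lemma doubling:
  assumes loc: "\<And>s t. 0 \<le> s \<Longrightarrow> s < t \<Longrightarrow> t \<le> T \<Longrightarrow> t -
      s \<le> \<delta> \<Longrightarrow> norm (davie_error F Y s t) \<le> C * (t - s) powr \<gamma>"
    and C: "0 \<le> C"
    and st: "0 \<le> s" "s < t" "t \<le> T" "t - s \<le> 2 * \<delta>"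
  shows "norm (davie_error F Y s t) \<le> doubled C * (t - s) powr \<gamma>"
proof -
  define r where "r = (s + t) / 2"
  have r: "s < r" "r < t" "r - s = (t - s) / 2" "t - r = (t - s) / 2"
    using st by (auto simp: r_def field_simps)
  have le: "C * ((t - s) / 2) powr \<gamma> \<le> C * (t - s) powr \<gamma>"
    using C st \<gamma>_gt1 by (intro mult_left_mono powr_mono2) auto
  have 1: "norm (davie_error F Y s r) \<le> C * (t - s) powr \<gamma>" "norm (davie_error F Y r t) \<le> C * (t
      - s) powr \<gamma>"
    using loc[of s r] loc[of r t] le st r by auto
  have "norm (davie_error F Y s t) \<le> norm (davie_error F Y r t) +
      (1 + L * T powr \<eta>) * norm (davie_error F Y s r) + K * (t - s) powr \<gamma>"
    using st r by (intro davie_error_split) auto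
  also have "\<dots> \<le> C * (t - s) powr \<gamma> + (1 + L * T powr \<eta>) * (C * (t - s) powr \<gamma>) +
      K * (t - s) powr \<gamma>"
    using 1 L_nonneg K_nonneg by (intro add_mono mult_left_mono) auto
  finally show ?thesis by (simp add: doubled_def algebra_simps)
qed

lemma doubled_nonneg: "0 \<le> C \<Longrightarrow> 0 \<le> doubled C"
  using L_nonneg K_nonneg by (simp add: doubled_def)

lemma doubling_iterate:
  assumes loc: "\<And>s t. 0 \<le> s \<Longrightarrow> s < t \<Longrightarrow> t \<le> T \<Longrightarrow> t -
      s \<le> \<delta> \<Longrightarrow> norm (davie_error F Y s t) \<le> C * (t - s) powr \<gamma>"
    and C: "0 \<le> C" and N: "T \<le> 2 ^ N * \<delta>"
  shows "davie_bound T F ((doubled ^^ N) C) \<gamma> Y"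
proof -
  have nonneg: "0 \<le> (doubled ^^ n) C" for n
    by (induction n) (auto simp: C doubled_nonneg)
  have "norm (davie_error F Y s t) \<le> (doubled ^^ n) C * (t - s) powr \<gamma>"
    if "0 \<le> s" "s < t" "t \<le> T" "t - s \<le> 2 ^ n * \<delta>" for n s t
    using that
  proof (induction n arbitrary: s t)
    case (Suc n)
    show ?case
      using doubling[of "2 ^ n * \<delta>" Y "(doubled ^^ n) C" s t] Suc nonneg by (simp add: mult.assoc)
  qed (use loc in auto)
  then show ?thesis
    using N by (force simp: davie_bound_def davie_error_def)
qed

end

lemma small_scale:
  fixes L \<eta> q :: real
  assumes "0 < \<eta>" "0 \<le> L" "0 < q"
  obtains \<delta> where "0 < \<delta>" "L * \<delta> powr \<eta> < q"
proof
  \<comment> \<open>Dividing by L + 1 rather than L covers L = 0.\<close>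
  define \<delta> where "\<delta> = (q / (2 * (L + 1))) powr (1 / \<eta>)"
  show "0 < \<delta>" using assms by (simp add: \<delta>_def)
  have "L * \<delta> powr \<eta> = L * (q / (2 * (L + 1)))"
    using assms by (simp add: \<delta>_def powr_powr)
  also have "\<dots> < q" using assms using assms mult_nonneg_nonneg[of L q] add_nonneg_pos[of "L * q" "q * 2"]
      by (simp add: field_simps)
  finally show "L * \<delta> powr \<eta> < q" .
qed

lemma exists_doubling:
  assumes "0 < (\<delta>::real)" obtains N :: nat where "T \<le> 2 ^ N * \<delta>"
proof -
  obtain N :: nat where "T / \<delta> < 2 ^ N" using real_arch_pow[of 2 "T/\<delta>"] by auto
  then have "T \<le> 2 ^ N * \<delta>" using assms by (simp add: field_simps)
  then show ?thesis by (rule that)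
qed

lemma two_powr_gt: "1 < p \<Longrightarrow> 2 < (2::real) powr p"
  using powr_less_mono[of 1 p 2] by simp

text \<open>The scale \<delta> has to serve both exponents, so the constant still depends on
  \<gamma>'; only the exponent is improved here. \<open>davie_apriori\<close> removes the dependence
  in a second pass.\<close>

lemma (in almost_flow) apriori_global:
  assumes "davie_bound T F C' \<gamma>' Y" "1 < \<gamma>'" shows "\<exists>C\<ge>0. davie_bound T F C \<gamma> Y"
proof -
  define Q where "Q = min (2 powr \<gamma>) (2 powr \<gamma>')"
  have "2 < Q" using two_powr_gt \<gamma>_gt1 assms by (simp add: Q_def)
  then obtain \<delta> where \<delta>: "0 < \<delta>" "L * \<delta> powr \<eta> < Q - 2"
    using small_scale[of \<eta> L "Q - 2"] \<eta>_pos L_nonneg by auto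
  obtain N where N: "T \<le> 2 ^ N * \<delta>" using exists_doubling \<delta> by blast
  define K1 where "K1 = K / (1 - (2 + L * \<delta> powr \<eta>) / 2 powr \<gamma>)"
  have K1: "0 \<le> K1" using \<delta> K_nonneg by (auto simp: K1_def Q_def intro!: divide_nonneg_nonneg)
  have "norm (davie_error F Y s t) \<le> K1 * (t - s) powr \<gamma>"
    if "0 \<le> s" "s < t" "t \<le> T" "t - s \<le> \<delta>" for s t
    unfolding K1_def
    by (rule bisect_davie_error[of \<delta> \<gamma>' Y C']) (use \<delta> that assms in \<open>auto simp:
        Q_def davie_bound_def davie_error_def\<close>)
  from doubling_iterate[OF this K1 N] have "davie_bound T F ((doubled ^^ N) K1) \<gamma> Y" .
  moreover have "0 \<le> (doubled ^^ N) K1"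
    by (induction N) (auto simp: K1 doubled_nonneg)
  ultimately show ?thesis by blast
qed

text \<open>A second bisection, started from the bound with exponent \<gamma> that
  \<open>apriori_global\<close> provides: now \<delta> is chosen from L, \<eta> and \<gamma> alone,
  so the constant is the same for all flows with these parameters and all their Davie
  solutions.\<close>

lemma davie_apriori:
  assumes "0 < T" "0 \<le> K" "0 \<le> L" "1 < \<gamma>" "0 < \<eta>"
  shows "\<exists>C\<ge>0. \<forall>(F :: real \<Rightarrow> real \<Rightarrow> 'e::euclidean_space
      \<Rightarrow> 'e) Y C' \<gamma>'. almost_flow T K L \<gamma> \<eta> F \<longrightarrow>
      davie_bound T F C' \<gamma>' Y \<longrightarrow> 1 < \<gamma>' \<longrightarrow> davie_bound T F C \<gamma> Y"
proof -
  obtain \<delta> where \<delta>: "0 < \<delta>" "L * \<delta> powr \<eta> < 2 powr \<gamma> - 2"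
    using small_scale[of \<eta> L "2 powr \<gamma> - 2"] two_powr_gt assms by auto
  obtain N where N: "T \<le> 2 ^ N * \<delta>" using exists_doubling \<delta> by blast
  define K1 where "K1 = K / (1 - (2 + L * \<delta> powr \<eta>) / 2 powr \<gamma>)"
  have K1: "0 \<le> K1" using \<delta> assms by (auto simp: K1_def intro!: divide_nonneg_nonneg)
  \<comment> \<open>This is \<open>doubled\<close>, restated outside the locale because the constant
    must be fixed before F.\<close>
  define D where "D = (\<lambda>C. (2 + L * T powr \<eta>) * C + K)"
  have D: "0 \<le> (D ^^ N) K1"
    by (induction N) (use K1 assms in \<open>auto simp: D_def\<close>)
  show ?thesis
  proof (intro exI[of _ "(D ^^ N) K1"] conjI D allI impI)
    fix F :: "real \<Rightarrow> real \<Rightarrow> 'e \<Rightarrow> 'e" and Y C' \<gamma>'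
    assume F: "almost_flow T K L \<gamma> \<eta> F" and Y: "davie_bound T F C' \<gamma>' Y" "1 < \<gamma>'"
    interpret almost_flow T K L \<gamma> \<eta> F by (rule F)
    obtain C1 where C1: "davie_bound T F C1 \<gamma> Y" using apriori_global[OF Y] by blast
    have "norm (davie_error F Y s t) \<le> K1 * (t - s) powr \<gamma>"
      if "0 \<le> s" "s < t" "t \<le> T" "t - s \<le> \<delta>" for s t
      unfolding K1_def
      by (rule bisect_davie_error[of \<delta> \<gamma> Y C1]) (use \<delta> that C1 in \<open>auto simp:
          davie_bound_def davie_error_def\<close>)
    from doubling_iterate[OF this K1 N] show "davie_bound T F ((D ^^ N) K1) \<gamma> Y"
      by (simp add: D_def doubled_def[abs_def])
  qed
qed

section \<open>Euler schemes on uniform grids\<close>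

context almost_flow
begin

definition grid_solution :: "real \<Rightarrow> (real \<Rightarrow> 'e) \<Rightarrow> bool" where
  "grid_solution h Y \<longleftrightarrow> (\<forall>k. real (Suc k) * h \<le> T \<longrightarrow>
      Y (real (Suc k) * h) = F (real k * h) (real (Suc k) * h) (Y (real k * h)))"

text \<open>A grid interval need not have a grid midpoint, so it is cut into [i, m], the single cell
  [m, m + 1] and [m + 1, j]. The error of the cell is 0 because Y follows the scheme there.
  Splitting twice produces the square of the transport factor.\<close>

lemma three_split:
  fixes h :: real
  assumes h: "0 < h" and grid: "grid_solution h Y"
    and ij: "i \<le> m" "m < j" "real j * h \<le> T" and \<tau>: "(real j - real i) * h \<le> \<tau>"
  shows "norm (davie_error F Y (real i * h) (real j * h)) \<le>
    norm (davie_error F Y (real (Suc m) * h) (real j * h)) +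
    (1 + L * \<tau> powr \<eta>)\<^sup>2 * norm (davie_error F Y (real i * h) (real m * h)) +
    (2 + L * \<tau> powr \<eta>) * K * ((real j - real i) * h) powr \<gamma>"
proof -
  define Q where "Q = 1 + L * \<tau> powr \<eta>"
  have Q: "1 \<le> Q" using L_nonneg by (simp add: Q_def)
  define P where "P = K * ((real j - real i) * h) powr \<gamma>"
  have P: "0 \<le> P" using K_nonneg by (simp add: P_def)
  have le: "real i * h \<le> real m * h" "real m * h < real (Suc m) * h" "real (Suc m) * h \<le> real j * h"
    using ij h by (auto intro!: mult_right_mono)
  have leT: "real (Suc m) * h \<le> T" using le ij by linarith
  have sub: "real (Suc m) * h - real m * h \<le> \<tau>" "real j * h - real (Suc m) * h \<le> \<tau>"
    using \<tau> le by (auto simp: left_diff_distrib)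
  have 0: "davie_error F Y (real m * h) (real (Suc m) * h) = 0"
    using grid le ij by (simp add: davie_error_def grid_solution_def)
  have "norm (davie_error F Y (real i * h) (real (Suc m) * h)) \<le>
      norm (davie_error F Y (real m * h) (real (Suc m) * h)) + Q * norm (davie_error F Y (real i * h) (real m * h))
      + K * (real (Suc m) * h - real i * h) powr \<gamma>"
    unfolding Q_def using le leT ij sub h by (intro davie_error_split) (auto simp del: of_nat_Suc)
  also have "K * (real (Suc m) * h - real i * h) powr \<gamma> \<le> P"
    unfolding P_def using le ij K_nonneg \<gamma>_gt1 by (intro mult_left_mono powr_mono2) (auto simp:
        left_diff_distrib)
  finally have 1: "norm (davie_error F Y (real i * h) (real (Suc m) * h)) \<le>
      Q * norm (davie_error F Y (real i * h) (real m * h)) + P" using 0 by simp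
  have "norm (davie_error F Y (real i * h) (real j * h)) \<le>
      norm (davie_error F Y (real (Suc m) * h) (real j * h)) + Q * norm (davie_error F Y (real i * h) (real
          (Suc m) * h))
      + K * (real j * h - real i * h) powr \<gamma>"
    unfolding Q_def using le leT ij sub h by (intro davie_error_split) (auto simp del: of_nat_Suc)
  also have "\<dots> \<le> norm (davie_error F Y (real (Suc m) * h) (real j * h)) +
      Q * (Q * norm (davie_error F Y (real i * h) (real m * h)) + P) + P"
    using 1 Q by (intro add_mono mult_left_mono) (auto simp: P_def left_diff_distrib)
  finally show ?thesis by (simp add: P_def Q_def power2_eq_square algebra_simps)
qed

text \<open>On a grid, bisection ends at single points, where the error is 0, so induction on j - i
  replaces the limit and the constant is independent of the mesh. This uniformity in h is what makes
  the schemes compact.\<close>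

lemma grid_bound:
  "\<exists>C\<ge>0. \<forall>h Y i j. 0 < h \<longrightarrow> grid_solution h Y \<longrightarrow> i \<le> j
      \<longrightarrow> real j * h \<le> T \<longrightarrow>
    norm (davie_error F Y (real i * h) (real j * h)) \<le> C * ((real j - real i) * h) powr \<gamma>"
proof -
  \<comment> \<open>Q < 1 + e and e \<le> 1 give Q^2 \<le> 1 + 3 e, hence 1 + Q^2 < 2^\<gamma>: the
    three-way split spends the factor Q twice.\<close>
  define e where "e = min 1 ((2 powr \<gamma> - 2) / 4)"
  have e: "0 < e" "e \<le> 1" "4 * e \<le> 2 powr \<gamma> - 2"
    using two_powr_gt[OF \<gamma>_gt1] by (auto simp: e_def min_def)
  obtain \<delta> where \<delta>: "0 < \<delta>" "L * \<delta> powr \<eta> < e"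
    using small_scale[of \<eta> L e] \<eta>_pos L_nonneg e by auto
  define Q where "Q = 1 + L * \<delta> powr \<eta>"
  have Q1: "1 \<le> Q" "Q < 1 + e" using \<delta> L_nonneg by (simp_all add: Q_def)
  have "Q\<^sup>2 < (1 + e)\<^sup>2" using Q1 by (intro power_strict_mono) auto
  also have "(1 + e)\<^sup>2 \<le> 1 + 3 * e" using e mult_left_mono[of e 1 e] by (simp add: power2_eq_square
      algebra_simps)
  finally have Q: "1 + Q\<^sup>2 < 2 powr \<gamma>" using e by simp
  define \<rho> where "\<rho> = (1 + Q\<^sup>2) / 2 powr \<gamma>"
  have \<rho>: "0 \<le> \<rho>" "\<rho> < 1" using Q by (auto simp: \<rho>_def)
  \<comment> \<open>C0 is the fixed point of C |-> C \<rho> + (1 + Q) K, so one induction step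
    reproduces it.\<close>
  define C0 where "C0 = (1 + Q) * K / (1 - \<rho>)"
  have C0: "0 \<le> C0" "C0 * \<rho> + (1 + Q) * K = C0"
    using \<rho> Q1 K_nonneg by (auto simp: C0_def field_simps)
  obtain N where N: "T \<le> 2 ^ N * \<delta>" using exists_doubling \<delta> by blast
  define R where "R = 1 + L * T powr \<eta>"
  have R: "1 \<le> R" using L_nonneg by (simp add: R_def)
  \<comment> \<open>The cost of one doubling of the length beyond \<delta>, with the crude factor R
    in place of Q.\<close>
  define D where "D C = C * (1 + R\<^sup>2) + (1 + R) * K" for C
  have D: "0 \<le> (D ^^ n) C0" for n
    by (induction n) (use C0 K_nonneg R in \<open>auto simp: D_def\<close>)
  show ?thesis
  proof (intro exI[of _ "(D ^^ N) C0"] conjI D allI impI)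
    fix h :: real and Y and i j :: nat
    assume h: "0 < h" and grid: "grid_solution h Y"
      and ij: "i \<le> j" "real j * h \<le> T"
    define J where "J i j = norm (davie_error F Y (real i * h) (real j * h))" for i j
    \<comment> \<open>Leaving out the cell [m, m + 1] keeps both remaining pieces within half the
      length, whatever the parity of j - i.\<close>
    have mid: "real (i + (j - i) div 2) \<le> real j" "real (i + (j - i) div 2) - real i \<le> (real j - real i) / 2"
      "real j - real (Suc (i + (j - i) div 2)) \<le> (real j - real i) / 2" if "i < j" for i j
      using that by (auto simp: field_simps)
    have base: "J i j \<le> C0 * ((real j - real i) * h) powr \<gamma>"
      if "i \<le> j" "real j * h \<le> T" "(real j - real i) * h \<le> \<delta>" for i j
      using that
    proof (induction "j - i" arbitrary: i j rule: less_induct)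
      case less
      show ?case
      proof (cases "i = j")
        case True
        then show ?thesis by (simp add: J_def davie_error_def)
      next
        case False
        define \<tau> where "\<tau> = (real j - real i) * h"
        define m where "m = i + (j - i) div 2"
        have m: "i \<le> m" "m < j" using False less.prems by (auto simp: m_def)
        have md: "(real m - real i) * h \<le> \<tau> / 2" "(real j - real (Suc m)) * h \<le> \<tau> / 2"
          using mid[of i j] False less.prems h mult_right_mono[of "real m - real i" "(real j - real i)/2" h]
            mult_right_mono[of "real j - real (Suc m)" "(real j - real i)/2" h]
          by (simp_all add: m_def \<tau>_def)
        have T: "real m * h \<le> T" using m less.prems h by (smt (verit) mult_right_mono of_nat_less_iff)
        have \<tau>: "0 < \<tau>" "\<tau> \<le> \<delta>" using False less.prems h by (auto simp: \<tau>_def)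
        have "J i m \<le> C0 * ((real m - real i) * h) powr \<gamma>"
          using less.hyps[of m i] m less.prems md \<tau> T by auto
        also have "\<dots> \<le> C0 * (\<tau> / 2) powr \<gamma>"
          using C0 md m h \<gamma>_gt1 by (intro mult_left_mono powr_mono2) auto
        finally have 1: "J i m \<le> C0 * (\<tau> / 2) powr \<gamma>" .
        have "J (Suc m) j \<le> C0 * ((real j - real (Suc m)) * h) powr \<gamma>"
          using less.hyps[of j "Suc m"] m less.prems md \<tau> by auto
        also have "\<dots> \<le> C0 * (\<tau> / 2) powr \<gamma>"
          using C0 md m h \<gamma>_gt1 by (intro mult_left_mono powr_mono2) auto
        finally have 2: "J (Suc m) j \<le> C0 * (\<tau> / 2) powr \<gamma>" .
        have "J i j \<le> J (Suc m) j + Q\<^sup>2 * J i m + (1 + Q) * K * \<tau> powr \<gamma>"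
          using three_split[OF h grid, of i m j \<delta>] m less.prems by (simp add: J_def Q_def \<tau>_def)
        also have "\<dots> \<le> C0 * (\<tau> / 2) powr \<gamma> + Q\<^sup>2 * (C0 * (\<tau> / 2) powr
            \<gamma>) + (1 + Q) * K * \<tau> powr \<gamma>"
          using 1 2 by (simp add: add_mono mult_left_mono)
        also have "\<dots> = (C0 * \<rho> + (1 + Q) * K) * \<tau> powr \<gamma>"
          using \<tau> by (simp add: \<rho>_def powr_half field_simps)
        finally show ?thesis using C0 by (simp add: \<tau>_def)
      qed
    qed
    have "J i j \<le> (D ^^ n) C0 * ((real j - real i) * h) powr \<gamma>"
      if "i \<le> j" "real j * h \<le> T" "(real j - real i) * h \<le> 2 ^ n * \<delta>" for n i j
      using that
    proof (induction n arbitrary: i j)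
      case 0
      then show ?case using base by simp
    next
      case (Suc n)
      show ?case
      proof (cases "i = j")
        case True
        then show ?thesis by (simp add: J_def davie_error_def)
      next
        case False
        define C where "C = (D ^^ n) C0"
        have C: "0 \<le> C" using D by (simp add: C_def)
        define \<tau> where "\<tau> = (real j - real i) * h"
        define m where "m = i + (j - i) div 2"
        have m: "i \<le> m" "m < j" using False Suc.prems by (auto simp: m_def)
        have md: "(real m - real i) * h \<le> \<tau> / 2" "(real j - real (Suc m)) * h \<le> \<tau> / 2"
          using mid[of i j] False Suc.prems h mult_right_mono[of "real m - real i" "(real j - real i)/2" h]
            mult_right_mono[of "real j - real (Suc m)" "(real j - real i)/2" h]
          by (simp_all add: m_def \<tau>_def)
        have T: "real m * h \<le> T" using m Suc.prems h by (smt (verit) mult_right_mono of_nat_less_iff)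
        have \<tau>: "0 < \<tau>" "\<tau> \<le> 2 * (2 ^ n * \<delta>)"
          using False Suc.prems h by (auto simp: \<tau>_def algebra_simps)
        have "\<tau> \<le> real j * h" unfolding \<tau>_def using h by (intro mult_right_mono) auto
        then have \<tau>T: "\<tau> \<le> T" using Suc.prems by simp
        have "J i m \<le> C * ((real m - real i) * h) powr \<gamma>"
          unfolding C_def using m md \<tau> T by (intro Suc.IH) auto
        also have "\<dots> \<le> C * \<tau> powr \<gamma>"
          using C md m h \<gamma>_gt1 \<tau> by (intro mult_left_mono powr_mono2) auto
        finally have 1: "J i m \<le> C * \<tau> powr \<gamma>" .
        have "J (Suc m) j \<le> C * ((real j - real (Suc m)) * h) powr \<gamma>"
          unfolding C_def using m md \<tau> Suc.prems by (intro Suc.IH) auto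
        also have "\<dots> \<le> C * \<tau> powr \<gamma>"
          using C md m h \<gamma>_gt1 \<tau> by (intro mult_left_mono powr_mono2) auto
        finally have 2: "J (Suc m) j \<le> C * \<tau> powr \<gamma>" .
        have "J i j \<le> J (Suc m) j + R\<^sup>2 * J i m + (1 + R) * K * \<tau> powr \<gamma>"
          using three_split[OF h grid, of i m j T] m Suc.prems \<tau>T by (simp add: J_def R_def \<tau>_def)
        also have "\<dots> \<le> C * \<tau> powr \<gamma> + R\<^sup>2 * (C * \<tau> powr \<gamma>) + (1 + R) *
            K * \<tau> powr \<gamma>"
          using 1 2 by (simp add: add_mono mult_left_mono)
        also have "\<dots> = D C * \<tau> powr \<gamma>" by (simp add: D_def algebra_simps)
        finally show ?thesis by (simp add: \<tau>_def C_def)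
      qed
    qed
    moreover have "(real j - real i) * h \<le> real j * h" using h by (intro mult_right_mono) auto
    then have "(real j - real i) * h \<le> 2 ^ N * \<delta>"
      using ij N by linarith
    ultimately show "norm (davie_error F Y (real i * h) (real j * h)) \<le> (D ^^ N) C0 * ((real j - real i) *
        h) powr \<gamma>"
      using ij by (auto simp: J_def)
  qed
qed

end

section \<open>Existence of Davie solutions\<close>

lemma hoelder_imp_uniformly_continuous:
  fixes Y :: "real \<Rightarrow> 'e::real_normed_vector"
  assumes \<eta>_pos: "0 < \<eta>" and Y: "\<And>s t. s \<in> D \<Longrightarrow> t \<in> D \<Longrightarrow> s
      < t \<Longrightarrow> norm (Y t - Y s) \<le> B * (t - s) powr \<eta>" and B: "0 \<le> B"
  shows "uniformly_continuous_on D Y"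
  unfolding uniformly_continuous_on_def
proof (intro allI impI)
  fix e :: real assume "0 < e"
  then obtain d where d: "0 < d" "B * d powr \<eta> < e" using small_scale[of \<eta> B e] \<eta>_pos B by blast
  have le: "norm (Y t - Y s) < e" if "s \<in> D" "t \<in> D" "s < t" "t - s < d" for s t
  proof -
    have "norm (Y t - Y s) \<le> B * (t - s) powr \<eta>" using Y that by blast
    also have "\<dots> \<le> B * d powr \<eta>" using that B \<eta>_pos by (intro mult_left_mono powr_mono2) auto
    finally show ?thesis using d by simp
  qed
  show "\<exists>d>0. \<forall>s\<in>D. \<forall>t\<in>D. dist t s < d \<longrightarrow> dist (Y t) (Y s) < e"
  proof (intro exI[of _ d] conjI ballI impI)
    fix s t assume "s \<in> D" "t \<in> D" "dist t s < d"
    then show "dist (Y t) (Y s) < e"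
      using le[of s t] le[of t s] \<open>0 < e\<close> norm_minus_commute[of "Y s" "Y t"]
      by (cases s t rule: linorder_cases) (auto simp: dist_norm)
  qed (use d in auto)
qed

context almost_flow
begin

lemma lip_T:
  assumes "0 \<le> s" "s < t" "t \<le> T"
  shows "norm (F s t y - F s t z) \<le> (1 + L * T powr \<eta>) * norm (y - z)"
proof -
  have "(t - s) powr \<eta> \<le> T powr \<eta>" using assms \<eta>_pos by (intro powr_mono2) auto
  then have "(1 + L * (t - s) powr \<eta>) * norm (y - z) \<le> (1 + L * T powr \<eta>) * norm (y - z)"
    using L_nonneg by (intro mult_right_mono add_mono mult_left_mono) auto
  with lip'[OF assms, of y z] show ?thesis by linarith
qed

lemma davie_bound_hoelder:
  assumes "davie_bound T F C \<gamma> Y" "0 \<le> C" "0 \<le> s" "s < t" "t \<le> T"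
  shows "norm (Y t - Y s) \<le> (C * T powr (\<gamma> - \<eta>) + L) * (t - s) powr \<eta>"
proof -
  have "norm (Y t - Y s) \<le> norm (Y t - F s t (Y s)) + norm (F s t (Y s) - Y s)"
    using norm_triangle_ineq[of "Y t - F s t (Y s)" "F s t (Y s) - Y s"] by simp
  also have "\<dots> \<le> C * (t - s) powr \<gamma> + L * (t - s) powr \<eta>"
    using assms dev[of s t "Y s"] by (intro add_mono) (auto simp: davie_bound_def)
  also have "C * (t - s) powr \<gamma> \<le> C * (T powr (\<gamma> - \<eta>) * (t - s) powr \<eta>)"
  proof -
    have "(t - s) powr \<gamma> = (t - s) powr (\<gamma> - \<eta>) * (t - s) powr \<eta>"
      by (simp add: powr_add[symmetric])
    also have "\<dots> \<le> T powr (\<gamma> - \<eta>) * (t - s) powr \<eta>"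
      using assms \<eta>_le by (intro mult_right_mono powr_mono2) auto
    finally show ?thesis using assms by (intro mult_left_mono)
  qed
  finally show ?thesis by (simp add: algebra_simps)
qed

text \<open>Dyadic grids are nested, so two dyadic times lie on all fine grids and the bound for the
  schemes passes to the limit there. The limit is Hoelder on the dyadic times, extends continuously,
  and keeps the bound because F is continuous in (s, t).\<close>

lemma exists_davie:
  assumes cont: "\<And>y. continuous_on (time2 T) (\<lambda>(s, t). F s t y)"
  shows "\<exists>Y C. 0 \<le> C \<and> Y 0 = x \<and> davie_bound T F C \<gamma> Y"
proof -
  from grid_bound obtain C where C: "0 \<le> C" and grid: "\<forall>h Y i j. 0 < h \<longrightarrow>
      grid_solution h Y \<longrightarrow> i \<le> j \<longrightarrow>
      real j * h \<le> T \<longrightarrow> norm (davie_error F Y (real i * h) (real j * h)) \<le> C * ((real j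
          - real i) * h) powr \<gamma>"
    by (elim exE conjE)
  define h where "h n = T / 2 ^ n" for n
  have h: "0 < h n" for n using T_pos by (simp add: h_def)
  define E where "E n = rec_nat x (\<lambda>k y. F (real k * h n) (real (Suc k) * h n) y)" for n
  \<comment> \<open>Rounding t down to the grid only makes Y n a function of all times; the
    estimates are read off at grid points.\<close>
  define Y where "Y n t = E n (nat \<lfloor>t / h n\<rfloor>)" for n t
  have Y: "Y n (real k * h n) = E n k" for n k
    using h[of n] by (simp add: Y_def)
  have Euler: "grid_solution (h n) (Y n)" for n
    unfolding grid_solution_def Y by (simp add: E_def)
  have Y0: "Y n 0 = x" for n by (simp add: Y_def E_def)
  have err: "norm (davie_error F (Y n) (real i * h n) (real j * h n)) \<le> C * ((real j - real i) * h n) powr \<gamma>"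
    if "i \<le> j" "real j * h n \<le> T" for n i j
  proof -
    note 1 = grid[THEN spec, of "h n", THEN spec, of "Y n", THEN spec, of i, THEN spec, of j]
    show ?thesis by (rule 1[THEN mp, THEN mp, THEN mp, THEN mp]) (fact h Euler that)+
  qed
  define D where "D = (\<lambda>(k, m). real k * h m) ` {(k, m). real k * h m \<le> T}"
  have D_sub: "D \<subseteq> {0..T}" using h[THEN less_imp_le] by (auto simp: D_def)
  have "countable D" unfolding D_def by (intro countable_image countableI_type)
  define B where "B = norm x + C * T powr \<gamma> + L * T powr \<eta>"
  have bound: "norm (Y n t) \<le> B" if "t \<in> D" for n t
  proof -
    define k where "k = nat \<lfloor>t / h n\<rfloor>"
    have t: "0 \<le> t" "t \<le> T" using that D_sub by auto
    then have "real k \<le> t / h n" using h[of n] by (simp add: k_def)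
    then have k: "real k * h n \<le> T" using h[of n] t by (simp add: field_simps)
    have eq: "Y n t = Y n (real k * h n)" unfolding Y by (simp add: Y_def k_def)
    show ?thesis
    proof (cases "k = 0")
      case True
      then show ?thesis using C L_nonneg Y0 unfolding eq by (auto simp: B_def)
    next
      case False
      then have k0: "0 < real k * h n" using h by simp
      have e: "norm (Y n (real k * h n) - F 0 (real k * h n) x) \<le> C * T powr \<gamma>"
      proof -
        have "norm (Y n (real k * h n) - F 0 (real k * h n) x) \<le> C * (real k * h n) powr \<gamma>"
          using err[of 0 k n] k k0 Y0 by (simp add: davie_error_def)
        also have "\<dots> \<le> C * T powr \<gamma>"
          using C k k0 \<gamma>_gt1 by (intro mult_left_mono powr_mono2) auto
        finally show ?thesis .
      qed
      have "norm (F 0 (real k * h n) x - x) \<le> L * (real k * h n) powr \<eta>"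
        using dev[of 0 "real k * h n" x] k k0 by simp
      also have "\<dots> \<le> L * T powr \<eta>"
        using L_nonneg k k0 \<eta>_pos by (intro mult_left_mono powr_mono2) auto
      finally have d: "norm (F 0 (real k * h n) x - x) \<le> L * T powr \<eta>" .
      have "Y n (real k * h n) = (Y n (real k * h n) - F 0 (real k * h n) x) + (F 0 (real k * h n) x - x) + x" by simp
      then have "norm (Y n (real k * h n)) \<le> norm (Y n (real k * h n) - F 0 (real k * h n) x) +
         norm (F 0 (real k * h n) x - x) + norm x"
        using norm_triangle_ineq[of "(Y n (real k * h n) - F 0 (real k * h n) x) + (F 0 (real k * h n) x - x)" x]
          norm_triangle_ineq[of "Y n (real k * h n) - F 0 (real k * h n) x" "F 0 (real k * h n) x - x"] by simp
      then show ?thesis unfolding eq B_def using e d by linarith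
    qed
  qed
  \<comment> \<open>A diagonal subsequence converging at every dyadic time.\<close>
  obtain r where r: "strict_mono (r::nat \<Rightarrow> nat)" and "\<And>t. t \<in> D \<Longrightarrow>
      \<exists>l. (\<lambda>n. Y (r n) t) \<longlonglongrightarrow> l"
    by (rule function_convergent_subsequence[of D Y B, OF \<open>countable D\<close> bound]) (assumption, rule that)
  then obtain l where l: "\<And>t. t \<in> D \<Longrightarrow> (\<lambda>n. Y (r n) t)
      \<longlonglongrightarrow> l t" by metis
  have refine: "real k * h m = real (k * 2 ^ (n - m)) * h n" if "m \<le> n" for k m n
  proof -
    have "(2::real) ^ n = 2 ^ m * 2 ^ (n - m)" using that by (simp flip: power_add)
    then show ?thesis by (simp add: h_def)
  qed
  have l_davie: "norm (l t - F s t (l s)) \<le> C * (t - s) powr \<gamma>" if "s \<in> D" "t \<in> D" "s < t" for s t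
  proof -
    have st: "0 \<le> s" "t \<le> T" using that D_sub by auto
    have "\<exists>k m. t = real k * h m" if "t \<in> D" for t
      using that unfolding D_def by (auto intro: exI)
    from this[OF that(1)] this[OF that(2)] obtain k m k' m' where s: "s = real k * h m" and t: "t = real k' * h m'"
      by (elim exE)
    have ev: "norm (Y n t - F s t (Y n s)) \<le> C * (t - s) powr \<gamma>" if "max m m' \<le> n" for n
    proof -
      define i j where "i = k * 2 ^ (n - m)" and "j = k' * 2 ^ (n - m')"
      have ij: "s = real i * h n" "t = real j * h n"
        using refine[of m n k] refine[of m' n k'] that s t by (auto simp: i_def j_def)
      then have "i \<le> j" using \<open>s < t\<close> h[of n] by (simp add: mult_less_cancel_right)
      then show ?thesis using err[of i j n] st \<open>s < t\<close> ij by (simp add: davie_error_def left_diff_distrib)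
    qed
    have "(\<lambda>n. F s t (Y (r n) s)) \<longlonglongrightarrow> F s t (l s)"
    proof (rule LIM_zero_cancel[OF Lim_null_comparison])
      show "\<forall>\<^sub>F n in sequentially. norm (F s t (Y (r n) s) - F s t (l s)) \<le> (1 + L * T powr
          \<eta>) * norm (Y (r n) s - l s)"
        using lip_T[OF st(1) \<open>s < t\<close> st(2)] by simp
    next
      have "(\<lambda>n. (1 + L * T powr \<eta>) * norm (Y (r n) s - l s)) \<longlonglongrightarrow> (1 + L * T
          powr \<eta>) * norm (l s - l s)"
        by (intro tendsto_intros l that)
      then show "(\<lambda>n. (1 + L * T powr \<eta>) * norm (Y (r n) s - l s)) \<longlonglongrightarrow> 0" by simp
    qed
    then have "(\<lambda>n. norm (Y (r n) t - F s t (Y (r n) s))) \<longlonglongrightarrow> norm (l t - F s t (l s))"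
      by (intro tendsto_intros l that)
    then show ?thesis
    proof (rule LIMSEQ_le_const2)
      show "\<exists>N. \<forall>n\<ge>N. norm (Y (r n) t - F s t (Y (r n) s)) \<le> C * (t - s) powr \<gamma>"
        by (intro exI[of _ "max m m'"] allI impI ev) (rule order_trans[OF _ seq_suble[OF r]])
    qed
  qed
  have l_hoelder: "norm (l t - l s) \<le> (C * T powr (\<gamma> - \<eta>) + L) * (t - s) powr \<eta>" if "s
      \<in> D" "t \<in> D" "s < t" for s t
  proof -
    have st: "0 \<le> s" "t \<le> T" using that D_sub by auto
    have "norm (l t - l s) \<le> norm (l t - F s t (l s)) + norm (F s t (l s) - l s)"
      using norm_triangle_ineq[of "l t - F s t (l s)" "F s t (l s) - l s"] by simp
    also have "\<dots> \<le> C * (t - s) powr \<gamma> + L * (t - s) powr \<eta>"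
      using l_davie that dev[of s t "l s"] st by (intro add_mono) auto
    also have "C * (t - s) powr \<gamma> \<le> C * (T powr (\<gamma> - \<eta>) * (t - s) powr \<eta>)"
    proof -
      have "(t - s) powr \<gamma> = (t - s) powr (\<gamma> - \<eta>) * (t - s) powr \<eta>"
        by (simp add: powr_add[symmetric])
      also have "\<dots> \<le> T powr (\<gamma> - \<eta>) * (t - s) powr \<eta>"
        using that st \<eta>_le by (intro mult_right_mono powr_mono2) auto
      finally show ?thesis using C by (intro mult_left_mono)
    qed
    finally show ?thesis by (simp add: algebra_simps)
  qed
  have "uniformly_continuous_on D l"
    using C L_nonneg by (intro hoelder_imp_uniformly_continuous[OF \<eta>_pos l_hoelder]) auto
  then obtain g where g: "uniformly_continuous_on (closure D) g" "\<And>t. t \<in> D \<Longrightarrow> l t = g t"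
    using uniformly_continuous_on_extension_on_closure by metis
  \<comment> \<open>The last grid point of level n at or before t. Approximating s and t by such
    points carries the bounds over from the dyadic times to all times.\<close>
  define a where "a n t = real (nat \<lfloor>t / h n\<rfloor>) * h n" for n t
  have a: "a n t \<in> D" "a n t \<le> t" "t - h n \<le> a n t" if "0 \<le> t" "t \<le> T" for n t
  proof -
    have "0 \<le> t / h n" using that h[of n] by simp
    then have "real (nat \<lfloor>t / h n\<rfloor>) \<le> t / h n" "t / h n - 1 \<le> real (nat \<lfloor>t / h
        n\<rfloor>)" by linarith+
    then show 1: "a n t \<le> t" "t - h n \<le> a n t" using h[of n] by (simp_all add: a_def field_simps)
    define k where "k = nat \<lfloor>t / h n\<rfloor>"
    have "a n t = real k * h n" by (simp only: a_def k_def)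
    moreover from this have "real k * h n \<le> T" using 1 that by linarith
    ultimately show "a n t \<in> D" unfolding D_def by (intro image_eqI[where x="(k, n)"]) auto
  qed
  have "(\<lambda>n. T * (1 / 2) ^ n) \<longlonglongrightarrow> T * 0" by (intro tendsto_intros
      LIMSEQ_realpow_zero) auto
  then have h0: "h \<longlonglongrightarrow> 0" by (simp add: h_def[abs_def] power_one_over field_simps)
  have a_lim: "(\<lambda>n. a n t) \<longlonglongrightarrow> t" if "0 \<le> t" "t \<le> T" for t
  proof (rule tendsto_sandwich)
    show "(\<lambda>n. t - h n) \<longlonglongrightarrow> t" using tendsto_diff[OF tendsto_const h0, of t] by simp
  qed (use a[OF that] in auto)
  have closure: "{0..T} \<subseteq> closure D"
  proof
    fix t assume "t \<in> {0..T}"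
    then show "t \<in> closure D"
      unfolding closure_sequential by (intro exI[of _ "\<lambda>n. a n t"] conjI allI a_lim a(1)) auto
  qed
  have g_cont: "continuous_on {0..T} g"
    using g closure uniformly_continuous_imp_continuous continuous_on_subset by blast
  have g_lim: "(\<lambda>n. g (a n t)) \<longlonglongrightarrow> g t" if "0 \<le> t" "t \<le> T" for t
    by (rule continuous_on_tendsto_compose[OF g_cont a_lim[OF that]])
      (use that in \<open>auto intro!: always_eventually subsetD[OF D_sub a(1)[OF that], simplified]\<close>)
  have "0 \<in> D" using T_pos by (auto simp: D_def intro!: image_eqI[where x="(0, 0)"])
  have "davie_bound T F C \<gamma> g"
    unfolding davie_bound_def
  proof (intro allI impI, elim conjE)
    fix s t assume st: "0 \<le> s" "s < t" "t \<le> T"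
    have ls: "(\<lambda>n. a n s) \<longlonglongrightarrow> s" "(\<lambda>n. a n t) \<longlonglongrightarrow>
        t" using a_lim st by auto
    have "\<forall>\<^sub>F n in sequentially. 0 < a n t - a n s"
      by (rule order_tendstoD(1)[OF tendsto_diff[OF ls(2) ls(1)]]) (use st in simp)
    then have ev: "\<forall>\<^sub>F n in sequentially. a n s < a n t" by simp
    have in2: "\<forall>\<^sub>F n in sequentially. (a n s, a n t) \<in> time2 T"
      using ev by eventually_elim (use subsetD[OF D_sub a(1)[of s]] subsetD[OF D_sub a(1)[of t]] st in
          \<open>auto simp: time2_def\<close>)
    have "(s, t) \<in> time2 T" using st by (simp add: time2_def)
    from continuous_on_tendsto_compose[OF cont[of "g s"] tendsto_Pair[OF ls] this in2]
    have 1: "(\<lambda>n. F (a n s) (a n t) (g s)) \<longlonglongrightarrow> F s t (g s)" by simp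
    have "(\<lambda>n. F (a n s) (a n t) (g (a n s)) - F (a n s) (a n t) (g s)) \<longlonglongrightarrow> 0"
    proof (rule Lim_null_comparison)
      show "\<forall>\<^sub>F n in sequentially. norm (F (a n s) (a n t) (g (a n s)) - F (a n s) (a n t) (g s))
         \<le> (1 + L * T powr \<eta>) * norm (g (a n s) - g s)"
        using in2 by eventually_elim (rule lip_T, auto simp: time2_def)
      have "(\<lambda>n. (1 + L * T powr \<eta>) * norm (g (a n s) - g s)) \<longlonglongrightarrow> (1 + L * T
          powr \<eta>) * norm (g s - g s)"
        using st by (intro tendsto_intros g_lim) auto
      then show "(\<lambda>n. (1 + L * T powr \<eta>) * norm (g (a n s) - g s)) \<longlonglongrightarrow> 0" by simp
    qed
    from tendsto_add[OF this 1] have 2: "(\<lambda>n. F (a n s) (a n t) (g (a n s))) \<longlonglongrightarrow>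
        F s t (g s)" by simp
    have 3: "(\<lambda>n. norm (g (a n t) - F (a n s) (a n t) (g (a n s)))) \<longlonglongrightarrow> norm (g t
        - F s t (g s))"
      using st by (intro tendsto_intros g_lim 2) auto
    have 4: "(\<lambda>n. C * (a n t - a n s) powr \<gamma>) \<longlonglongrightarrow> C * (t - s) powr \<gamma>"
      using st by (intro tendsto_intros ls) auto
    show "norm (g t - F s t (g s)) \<le> C * (t - s) powr \<gamma>"
    proof (rule tendsto_le[OF _ 4 3])
      show "\<forall>\<^sub>F n in sequentially. norm (g (a n t) - F (a n s) (a n t) (g (a n s))) \<le> C * (a
          n t - a n s) powr \<gamma>"
      proof (use ev in eventually_elim)
        fix n assume "a n s < a n t"
        moreover have "a n s \<in> D" "a n t \<in> D" using a st by auto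
        ultimately show "norm (g (a n t) - F (a n s) (a n t) (g (a n s))) \<le> C * (a n t - a n s) powr \<gamma>"
          using l_davie g(2) by metis
      qed
    qed simp
  qed
  moreover have "g 0 = x"
    using l[OF \<open>0 \<in> D\<close>] g(2)[OF \<open>0 \<in> D\<close>] Y0 by (simp add: LIMSEQ_const_iff)
  ultimately show ?thesis using C by blast
qed

end

text \<open>\<open>lip2\<close> is the second-difference estimate of a map whose derivative is
  bounded and Lipschitz. With a and c the values of two solutions and b and d their Euler
  predictions, it compares how F transports the two errors a - b and c - d.\<close>

locale smooth_flow = almost_flow +
  assumes defect_lip: "\<And>s r t y z. 0 \<le> s \<Longrightarrow> s < r \<Longrightarrow> r < t
      \<Longrightarrow> t \<le> T \<Longrightarrow>
      norm ((F r t (F s r y) - F s t y) - (F r t (F s r z) - F s t z)) \<le> K * (t - s) powr \<gamma> * norm (y - z)"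
    and lip2: "\<And>s t a b c d. 0 \<le> s \<Longrightarrow> s < t \<Longrightarrow> t \<le> T \<Longrightarrow>
      norm ((F s t a - a) - (F s t b - b) - ((F s t c - c) - (F s t d - d)))
        \<le> L * (t - s) powr \<eta> * (norm ((a - b) - (c - d)) + (norm (a - c) + norm (b - d)) * norm (c - d))"
begin

text \<open>Bisection for the difference of the two Davie errors, with a source proportional to a
  bound M on the distance of the solutions. On a short interval where they start together this
  improves M to M / 2, and iteration leaves only 0.\<close>

lemma davie_unique_local:
  assumes Y: "davie_bound T F C \<gamma> Y" and Z: "davie_bound T F C \<gamma> Z" and C: "0 \<le> C"
  obtains \<delta> where "0 < \<delta>"
    "\<And>u t. 0 \<le> u \<Longrightarrow> u \<le> t \<Longrightarrow> t \<le> T \<Longrightarrow> t - u \<le>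
        \<delta> \<Longrightarrow> Y u = Z u \<Longrightarrow> Y t = Z t"
proof -
  define P where "P = 1 + L * T powr \<eta>"
  have P: "1 \<le> P" using L_nonneg by (simp add: P_def)
  obtain \<delta>1 where \<delta>1: "0 < \<delta>1" "L * \<delta>1 powr \<eta> < 2 powr \<gamma> - 2"
    using small_scale[of \<eta> L "2 powr \<gamma> - 2"] two_powr_gt \<gamma>_gt1 \<eta>_pos L_nonneg by auto
  define q where "q = 1 + L * \<delta>1 powr \<eta>"
  have q: "0 \<le> q" "1 + q < 2 powr \<gamma>" using \<delta>1 L_nonneg by (auto simp: q_def)
  \<comment> \<open>The first part is the Lipschitz defect. In the second, \<open>lip2\<close> meets
    norm (a - c) + norm (b - d) \<le> (1 + P) M together with norm (c - d) \<le> C (t -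
    s)^\<gamma>.\<close>
  define K' where "K' = K + L * T powr \<eta> * (1 + P) * C"
  have K': "0 \<le> K'" using K_nonneg L_nonneg C P by (simp add: K'_def)
  define K2 where "K2 = K' / (1 - (1 + q) / 2 powr \<gamma>)"
  have K2: "0 \<le> K2" using q K' by (auto simp: K2_def intro!: divide_nonneg_nonneg)
  obtain \<delta>2 where \<delta>2: "0 < \<delta>2" "K2 * \<delta>2 powr \<gamma> < 1 / 2"
    using small_scale[of \<gamma> K2 "1/2"] \<gamma>_gt1 K2 by auto
  define \<delta> where "\<delta> = min \<delta>1 \<delta>2"
  have \<delta>: "0 < \<delta>" "\<delta> \<le> \<delta>1" "\<delta> \<le> \<delta>2" using \<delta>1 \<delta>2
      by (auto simp: \<delta>_def)
  have step: "norm (Y t - Z t) \<le> M / 2"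
    if u: "0 \<le> u" "v \<le> T" "v - u \<le> \<delta>" "Y u = Z u" and M: "\<And>t. u \<le> t
        \<Longrightarrow> t \<le> v \<Longrightarrow> norm (Y t - Z t) \<le> M"
      and t: "u \<le> t" "t \<le> v" for u v M t
  proof (cases "u = t")
    case True
    then show ?thesis using u M[of u] t by auto
  next
    case False
    have M0: "0 \<le> M" using M[of u] u t by auto
    define N where "N s t = norm ((Y t - F s t (Y s)) - (Z t - F s t (Z s)))" for s t
    have split: "N s t \<le> N r t + q * N s r + K' * M * (t - s) powr \<gamma>"
      if st: "u \<le> s" "s < r" "r < t" "t \<le> v" for s r t
    proof -
      have 0: "0 \<le> s" "t \<le> T" using st u by auto
      define a b c d where "a = Y r" and "b = F s r (Y s)" and "c = Z r" and "d = F s r (Z s)"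
      have cd: "norm (c - d) \<le> C * (t - s) powr \<gamma>"
      proof -
        have "norm (c - d) \<le> C * (r - s) powr \<gamma>"
          using Z st 0 by (simp add: davie_bound_def c_def d_def)
        also have "\<dots> \<le> C * (t - s) powr \<gamma>"
          using C st \<gamma>_gt1 by (intro mult_left_mono powr_mono2) auto
        finally show ?thesis .
      qed
      have ac: "norm (a - c) \<le> M" using M st by (simp add: a_def c_def)
      have "norm (b - d) \<le> P * norm (Y s - Z s)"
        using lip_T[of s r] st 0 by (simp add: b_def d_def P_def)
      also have "\<dots> \<le> P * M" using P M st by (intro mult_left_mono) auto
      finally have bd: "norm (b - d) \<le> P * M" .
      have h1: "(t - r) powr \<eta> \<le> \<delta>1 powr \<eta>" using st u \<delta> \<eta>_pos by (intro
          powr_mono2) auto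
      have h2: "(t - r) powr \<eta> \<le> T powr \<eta>" using st 0 \<eta>_pos by (intro powr_mono2) auto
      have "norm ((F r t a - a) - (F r t b - b) - ((F r t c - c) - (F r t d - d)))
        \<le> L * (t - r) powr \<eta> * (norm ((a - b) - (c - d)) + (norm (a - c) + norm (b - d)) * norm (c - d))"
        using lip2[of r t a b c d] st 0 by simp
      also have "\<dots> = L * (t - r) powr \<eta> * norm ((a - b) - (c - d))
          + L * (t - r) powr \<eta> * ((norm (a - c) + norm (b - d)) * norm (c - d))"
        by (simp add: algebra_simps)
      also have "\<dots> \<le> L * \<delta>1 powr \<eta> * norm ((a - b) - (c - d))
          + L * T powr \<eta> * ((M + P * M) * (C * (t - s) powr \<gamma>))"
        using L_nonneg h1 h2 ac bd cd M0 P C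
        by (intro add_mono mult_mono mult_nonneg_nonneg add_nonneg_nonneg) auto
      finally have A: "norm ((F r t a - a) - (F r t b - b) - ((F r t c - c) - (F r t d - d))) \<le> \<dots>" .
      have B: "norm ((F r t (F s r (Y s)) - F s t (Y s)) - (F r t (F s r (Z s)) - F s t (Z s))) \<le> K * (t -
          s) powr \<gamma> * M"
      proof -
        have "norm ((F r t (F s r (Y s)) - F s t (Y s)) - (F r t (F s r (Z s)) - F s t (Z s)))
           \<le> K * (t - s) powr \<gamma> * norm (Y s - Z s)" using defect_lip st 0 by simp
        also have "\<dots> \<le> K * (t - s) powr \<gamma> * M" using K_nonneg M st by (intro mult_left_mono) auto
        finally show ?thesis .
      qed
      have nab: "norm ((a - b) - (c - d)) = N s r" by (simp add: N_def a_def b_def c_def d_def)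
      have "(Y t - F s t (Y s)) - (Z t - F s t (Z s)) =
         ((Y t - F r t (Y r)) - (Z t - F r t (Z r)))
         + (((F r t a - a) - (F r t b - b) - ((F r t c - c) - (F r t d - d))) + ((a - b) - (c - d)))
         + ((F r t (F s r (Y s)) - F s t (Y s)) - (F r t (F s r (Z s)) - F s t (Z s)))"
        by (simp add: a_def b_def c_def d_def)
      then have "N s t \<le> N r t + (norm ((F r t a - a) - (F r t b - b) - ((F r t c - c) - (F r t d - d)))
          + norm ((a - b) - (c - d)))
         + norm ((F r t (F s r (Y s)) - F s t (Y s)) - (F r t (F s r (Z s)) - F s t (Z s)))"
        unfolding N_def by (simp only:) (intro norm_triangle_le add_mono order_refl)
      then have "N s t \<le> N r t + (L * \<delta>1 powr \<eta> * N s r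
          + L * T powr \<eta> * ((M + P * M) * (C * (t - s) powr \<gamma>)) + N s r) + K * (t - s) powr \<gamma> * M"
        using A B unfolding nab by linarith
      then show ?thesis by (simp add: q_def K'_def algebra_simps)
    qed
    have loc: "N s t \<le> 2 * C * (t - s) powr \<gamma>" if "u \<le> s" "s < t" "t \<le> v" for s t
    proof -
      have "norm (Y t - F s t (Y s)) \<le> C * (t - s) powr \<gamma>" "norm (Z t - F s t (Z s)) \<le> C * (t -
          s) powr \<gamma>"
        using Y Z that u by (auto simp: davie_bound_def)
      then show ?thesis unfolding N_def
        using norm_triangle_ineq4[of "Y t - F s t (Y s)" "Z t - F s t (Z s)"] by linarith
    qed
    \<comment> \<open>The crude bound 2 C on N only starts the bisection; the result is proportional
      to M.\<close>
    have "N u t \<le> K' * M / (1 - (1 + q) / 2 powr \<gamma>) * (t - u) powr \<gamma>"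
      by (rule bisection_bound[where a = u and b = v and \<gamma>' = \<gamma> and \<delta> = "v - u"])
        (use q loc split t False in auto)
    also have "\<dots> = K2 * (t - u) powr \<gamma> * M" by (simp add: K2_def)
    also have "\<dots> \<le> K2 * \<delta>2 powr \<gamma> * M"
      using K2 M0 t u \<delta> \<gamma>_gt1 by (intro mult_right_mono mult_left_mono powr_mono2) auto
    also have "\<dots> \<le> 1 / 2 * M" using \<delta>2 M0 by (intro mult_right_mono) auto
    \<comment> \<open>Y u = Z u, so the Euler predictions from u cancel and N u t is the distance at
      t.\<close>
    finally show ?thesis using u by (simp add: N_def)
  qed
  show ?thesis
  proof (rule that[OF \<delta>(1)])
    fix u t assume ut: "0 \<le> u" "u \<le> t" "t \<le> T" "t - u \<le> \<delta>" "Y u = Z u"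
    \<comment> \<open>A bounds the oscillation of any Davie solution with constant C, hence 2 A the
      distance of two that agree at u.\<close>
    define A where "A = (C * T powr (\<gamma> - \<eta>) + L) * T powr \<eta>"
    define M where "M = 2 * A"
    have M0: "norm (Y r - Z r) \<le> M" if r: "u \<le> r" "r \<le> t" for r
    proof (cases "u = r")
      case True
      then show ?thesis using ut C L_nonneg by (simp add: M_def A_def)
    next
      case False
      have "norm (X r - X u) \<le> A" if "davie_bound T F C \<gamma> X" for X
      proof -
        have "norm (X r - X u) \<le> (C * T powr (\<gamma> - \<eta>) + L) * (r - u) powr \<eta>"
          using davie_bound_hoelder[OF that C, of u r] r ut False by simp
        also have "\<dots> \<le> (C * T powr (\<gamma> - \<eta>) + L) * T powr \<eta>"
          using C L_nonneg r ut \<eta>_pos by (intro mult_left_mono powr_mono2) auto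
        finally show ?thesis by (simp add: A_def)
      qed
      from this[OF Y] this[OF Z] show ?thesis
        using norm_triangle_ineq4[of "Y r - Y u" "Z r - Z u"] ut by (simp add: M_def)
    qed
    have "norm (Y r - Z r) \<le> M / 2 ^ n" if "u \<le> r" "r \<le> t" for n r
      using that
    proof (induction n arbitrary: r)
      case (Suc n)
      then show ?case using step[of u t "M / 2 ^ n" r] ut by simp
    qed (use M0 in auto)
    then have "norm (Y t - Z t) \<le> M * (1 / 2) ^ n" for n
      using ut by (simp add: power_one_over)
    moreover have "(\<lambda>n. M * (1 / 2) ^ n) \<longlonglongrightarrow> M * 0"
      by (intro tendsto_intros LIMSEQ_realpow_zero) auto
    ultimately have "norm (Y t - Z t) \<le> M * 0"
      by (intro LIMSEQ_le_const[of "\<lambda>n. M * (1 / 2) ^ n"]) auto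
    then show "Y t = Z t" by simp
  qed
qed

text \<open>The step \<delta> of the local result does not depend on the starting time, so equality
  propagates from 0.\<close>

lemma davie_unique:
  assumes Y: "davie_bound T F C \<gamma> Y" and Z: "davie_bound T F C' \<gamma> Z" and "Y 0 = Z 0" "0 \<le> t"
      "t \<le> T"
  shows "Y t = Z t"
proof -
  define D where "D = max 0 (max C C')"
  have D: "davie_bound T F D \<gamma> X" if "davie_bound T F c \<gamma> X" "c \<le> D" for c X
    unfolding davie_bound_def
  proof (intro allI impI, elim conjE)
    fix s t assume "0 \<le> s" "s < t" "t \<le> T"
    then have "norm (X t - F s t (X s)) \<le> c * (t - s) powr \<gamma>" using that by (auto simp: davie_bound_def)
    also have "\<dots> \<le> D * (t - s) powr \<gamma>" using that by (intro mult_right_mono) auto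
    finally show "norm (X t - F s t (X s)) \<le> D * (t - s) powr \<gamma>" .
  qed
  have "davie_bound T F D \<gamma> Y" "davie_bound T F D \<gamma> Z" "0 \<le> D"
    using D[OF Y] D[OF Z] by (auto simp: D_def)
  then obtain \<delta> where \<delta>: "0 < \<delta>"
    and loc: "\<And>u t. 0 \<le> u \<Longrightarrow> u \<le> t \<Longrightarrow> t \<le> T \<Longrightarrow> t
        - u \<le> \<delta> \<Longrightarrow> Y u = Z u \<Longrightarrow> Y t = Z t"
    using davie_unique_local[of D Y Z] by blast
  have "Y t = Z t" if "0 \<le> t" "t \<le> T" "t \<le> real n * \<delta>" for n t
    using that
  proof (induction n arbitrary: t)
    case 0
    then show ?case using assms by simp
  next
    case (Suc n)
    define u where "u = max 0 (t - \<delta>)"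
    have "Y u = Z u" using Suc \<delta> by (intro Suc.IH) (auto simp: u_def algebra_simps)
    then show ?case using loc[of u t] Suc.prems \<delta> by (auto simp: u_def)
  qed
  moreover obtain n :: nat where "t \<le> real n * \<delta>"
    using reals_Archimedean3[OF \<delta>] less_imp_le by blast
  ultimately show ?thesis using assms by blast
qed

text \<open>Uniform convergence by compactness: limits of subsequences are Davie solutions of the limit
  flow, which are unique.\<close>
lemma davie_stability:
  fixes Fn :: "nat \<Rightarrow> real \<Rightarrow> real \<Rightarrow> 'a \<Rightarrow> 'a"
  assumes flow: "\<And>n. almost_flow T K' L' \<gamma> \<eta> (Fn n)"
    and lim: "\<And>s t y. 0 \<le> s \<Longrightarrow> s < t \<Longrightarrow> t \<le> T \<Longrightarrow>
        (\<lambda>n. Fn n s t y) \<longlonglongrightarrow> F s t y"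
    and Yn: "\<And>n. davie_bound T (Fn n) C' \<gamma> (Yn n)" "\<And>n. Yn n 0 = x"
    and Y: "davie_bound T F C \<gamma> Y" "Y 0 = x" and C': "0 \<le> C'"
  shows "uniform_limit {0..T} Yn Y sequentially"
proof (rule ccontr)
  interpret n: almost_flow T K' L' \<gamma> \<eta> "Fn n" for n by (rule flow)
  have L': "0 \<le> L'" using n.L_nonneg .
  assume "\<not> ?thesis"
  then obtain e where e: "0 < e" "\<not> (\<forall>\<^sub>F n in sequentially. \<forall>t\<in>{0..T}. dist (Yn
      n t) (Y t) < e)"
    by (auto simp: uniform_limit_iff)
  \<comment> \<open>A subsequence that never comes uniformly within e of Y. Arzela-Ascoli extracts a
    uniform limit g from it, which is then shown to be Y.\<close>
  then obtain r :: "nat \<Rightarrow> nat" where r: "strict_mono r" "\<And>n. \<not> (\<forall>t\<in>{0..T}.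
      dist (Yn (r n) t) (Y t) < e)"
    using not_eventually_sequentiallyD by blast
  define B where "B = C' * T powr (\<gamma> - \<eta>) + L'"
  have B: "0 \<le> B" using C' L' by (simp add: B_def)
  have hoelder: "norm (Yn n t - Yn n s) \<le> B * (t - s) powr \<eta>" if "0 \<le> s" "s < t" "t \<le> T" for n s t
    unfolding B_def by (rule n.davie_bound_hoelder[OF Yn(1) C' that])
  have "\<exists>g k. continuous_on {0..T} g \<and> strict_mono (k :: nat \<Rightarrow> nat) \<and>
      (\<forall>e>0. \<exists>N. \<forall>n t. n \<ge> N \<and> t \<in> {0..T} \<longrightarrow> norm (Yn (r (k
          n)) t - g t) < e)"
  proof (rule Arzela_Ascoli[of "{0..T}" "\<lambda>n. Yn (r n)" "norm x + B * T powr \<eta>"])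
    fix n t assume t: "t \<in> {0..T}"
    show "norm (Yn (r n) t) \<le> norm x + B * T powr \<eta>"
    proof (cases "t = 0")
      case True
      then show ?thesis using Yn B by simp
    next
      case False
      have "norm (Yn (r n) t - x) \<le> B * t powr \<eta>"
        using hoelder[of 0 t "r n"] t False Yn by simp
      also have "\<dots> \<le> B * T powr \<eta>" using B t \<eta>_pos by (intro mult_left_mono powr_mono2) auto
      finally show ?thesis using norm_triangle_sub[of "Yn (r n) t" x] by linarith
    qed
  next
    fix s e assume s: "s \<in> {0..T}" and e: "0 < (e::real)"
    then obtain d where d: "0 < d" "B * d powr \<eta> < e" using small_scale[of \<eta> B e] \<eta>_pos B by auto
    have le: "norm (Yn n t - Yn n s) < e" if "0 \<le> s" "t \<le> T" "s < t" "t - s < d" for s t n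
    proof -
      have "norm (Yn n t - Yn n s) \<le> B * (t - s) powr \<eta>" using hoelder that by blast
      also have "\<dots> \<le> B * d powr \<eta>" using that B \<eta>_pos by (intro mult_left_mono powr_mono2) auto
      finally show ?thesis using d by simp
    qed
    show "\<exists>d>0. \<forall>n t. t \<in> {0..T} \<and> norm (s - t) < d \<longrightarrow> norm (Yn (r n) s
        - Yn (r n) t) < e"
    proof (intro exI[of _ d] conjI allI impI d)
      fix n t assume "t \<in> {0..T} \<and> norm (s - t) < d"
      then show "norm (Yn (r n) s - Yn (r n) t) < e"
        using le[of s t "r n"] le[of t s "r n"] s e norm_minus_commute[of "Yn (r n) s" "Yn (r n) t"]
        by (cases s t rule: linorder_cases) auto
    qed
  next
    fix g and k :: "nat \<Rightarrow> nat"
    assume "continuous_on {0..T} g" "strict_mono k"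
      "\<And>e. 0 < e \<Longrightarrow> \<exists>N. \<forall>n t. n \<ge> N \<and> t \<in> {0..T}
          \<longrightarrow> norm (Yn (r (k n)) t - g t) < e"
    then show "\<exists>g k. continuous_on {0..T} g \<and> strict_mono (k :: nat \<Rightarrow> nat) \<and>
      (\<forall>e>0. \<exists>N. \<forall>n t. n \<ge> N \<and> t \<in> {0..T} \<longrightarrow> norm (Yn (r (k
          n)) t - g t) < e)"
      by blast
  qed simp
  then obtain g k where k: "strict_mono (k :: nat \<Rightarrow> nat)"
    and gk: "\<forall>e>0. \<exists>N. \<forall>n t. n \<ge> N \<and> t \<in> {0..T} \<longrightarrow> norm (Yn
        (r (k n)) t - g t) < e"
    by (elim exE conjE)
  define m where "m n = r (k n)" for n
  have m: "filterlim m sequentially sequentially"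
    unfolding m_def using strict_mono_o[OF r(1) k] by (intro filterlim_subseq) (simp add: o_def)
  have g: "(\<lambda>n. Yn (m n) t) \<longlonglongrightarrow> g t" if "t \<in> {0..T}" for t
    unfolding LIMSEQ_def dist_norm m_def
  proof (intro allI impI)
    fix e :: real assume "0 < e"
    then obtain N where "\<forall>n t. n \<ge> N \<and> t \<in> {0..T} \<longrightarrow> norm (Yn (r (k n)) t -
        g t) < e" using gk by metis
    then show "\<exists>N. \<forall>n\<ge>N. norm (Yn (r (k n)) t - g t) < e" using that by metis
  qed
  have "davie_bound T F C' \<gamma> g"
    unfolding davie_bound_def
  proof (intro allI impI, elim conjE)
    fix s t assume st: "0 \<le> s" "s < t" "t \<le> T"
    have 1: "(\<lambda>n. Fn (m n) s t (g s)) \<longlonglongrightarrow> F s t (g s)"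
      using lim[OF st, of "g s"] m by (rule filterlim_compose)
    \<comment> \<open>The flows converge only pointwise in y; their common Lipschitz bound allows
      the argument to move.\<close>
    have "(\<lambda>n. Fn (m n) s t (Yn (m n) s) - Fn (m n) s t (g s)) \<longlonglongrightarrow> 0"
    proof (rule Lim_null_comparison)
      show "\<forall>\<^sub>F n in sequentially. norm (Fn (m n) s t (Yn (m n) s) - Fn (m n) s t (g s))
         \<le> (1 + L' * T powr \<eta>) * norm (Yn (m n) s - g s)"
        using n.lip_T[OF st] by simp
      have "(\<lambda>n. (1 + L' * T powr \<eta>) * norm (Yn (m n) s - g s)) \<longlonglongrightarrow> (1 + L'
          * T powr \<eta>) * norm (g s - g s)"
        using st by (intro tendsto_intros g) auto
      then show "(\<lambda>n. (1 + L' * T powr \<eta>) * norm (Yn (m n) s - g s)) \<longlonglongrightarrow> 0" by simp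
    qed
    from tendsto_add[OF this 1] have 2: "(\<lambda>n. Fn (m n) s t (Yn (m n) s)) \<longlonglongrightarrow> F s
        t (g s)" by simp
    have 3: "(\<lambda>n. norm (Yn (m n) t - Fn (m n) s t (Yn (m n) s))) \<longlonglongrightarrow> norm (g t -
        F s t (g s))"
      using st by (intro tendsto_intros g 2) auto
    then show "norm (g t - F s t (g s)) \<le> C' * (t - s) powr \<gamma>"
      by (rule LIMSEQ_le_const2) (use Yn(1) st in \<open>auto simp: davie_bound_def\<close>)
  qed
  moreover have "g 0 = x"
    using g[of 0] Yn(2) T_pos by (simp add: LIMSEQ_const_iff)
  ultimately have gY: "g t = Y t" if "t \<in> {0..T}" for t
    using davie_unique[of C' g C Y t] Y that by auto
  obtain N where "\<forall>n t. n \<ge> N \<and> t \<in> {0..T} \<longrightarrow> norm (Yn (r (k n)) t - g t) <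
      e" using gk e(1) by metis
  then have "\<forall>t\<in>{0..T}. norm (Yn (r (k N)) t - g t) < e" by blast
  then show False using r(2)[of "k N"] gY by (simp add: dist_norm)
qed

end

section \<open>Partition limits and sewing\<close>

lemma partition_mono:
  fixes p :: "nat \<Rightarrow> real"
  assumes "\<And>k. k < N \<Longrightarrow> p k < p (Suc k)" "i \<le> j" "j \<le> N"
  shows "p i \<le> p j"
  using assms(2,3)
proof (induction j rule: dec_induct)
  case (step m)
  then show ?case using assms(1)[of m] by simp
qed simp

text \<open>A cell contributes an error of at most C \<delta>^(\<gamma> - 1) times its length, and
  the lengths add up to t.\<close>

lemma partition_limit_of_expansion:
  fixes \<Xi> :: "real \<Rightarrow> real \<Rightarrow> 'e::real_normed_vector"
  assumes exp: "\<And>s u. 0 \<le> s \<Longrightarrow> s < u \<Longrightarrow> u \<le> T \<Longrightarrow> norm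
      (K u - K s - \<Xi> s u) \<le> C * (u - s) powr \<gamma>"
    and "1 < \<gamma>" "0 \<le> C" "0 \<le> t" "t \<le> T"
  shows "partition_limit \<Xi> t (K t - K 0)"
  unfolding partition_limit_def
proof (intro allI impI)
  fix \<epsilon> :: real assume "0 < \<epsilon>"
  then obtain \<delta> where \<delta>: "0 < \<delta>" "C * t * \<delta> powr (\<gamma> - 1) < \<epsilon>"
    using small_scale[of "\<gamma> - 1" "C * t" \<epsilon>] assms by auto
  show "\<exists>\<delta>>0. \<forall>(N::nat) p. p 0 = 0 \<and> p N = t \<and> (\<forall>k<N. p k < p (Suc k)
      \<and> p (Suc k) - p k < \<delta>) \<longrightarrow>
     norm ((\<Sum>k<N. \<Xi> (p k) (p (Suc k))) - (K t - K 0)) < \<epsilon>"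
  proof (intro exI[of _ \<delta>] conjI allI impI \<delta>(1))
    fix N :: nat and p :: "nat \<Rightarrow> real"
    assume p: "p 0 = 0 \<and> p N = t \<and> (\<forall>k<N. p k < p (Suc k) \<and> p (Suc k) - p k < \<delta>)"
    have rng: "0 \<le> p k" "p k \<le> t" if "k \<le> N" for k
      using partition_mono[of N p 0 k] partition_mono[of N p k N] that p by auto
    have "(\<Sum>k<N. \<Xi> (p k) (p (Suc k))) - (K t - K 0) =
      (\<Sum>k<N. \<Xi> (p k) (p (Suc k)) - (K (p (Suc k)) - K (p k)))"
      using p sum_lessThan_telescope[of "\<lambda>k. K (p k)" N] by (simp add: sum_subtractf)
    also have "norm \<dots> \<le> (\<Sum>k<N. C * \<delta> powr (\<gamma> - 1) * (p (Suc k) - p k))"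
    proof (rule sum_norm_le)
      fix k assume "k \<in> {..<N}"
      then have k: "0 \<le> p k" "p k < p (Suc k)" "p (Suc k) \<le> T" "p (Suc k) - p k < \<delta>"
        using p rng[of k] rng[of "Suc k"] assms by auto
      have "norm (\<Xi> (p k) (p (Suc k)) - (K (p (Suc k)) - K (p k))) \<le> C * (p (Suc k) - p k) powr \<gamma>"
        using exp[OF k(1-3)] by (simp add: norm_minus_commute)
      also have "(p (Suc k) - p k) powr \<gamma> = (p (Suc k) - p k) powr (\<gamma> - 1) * (p (Suc k) - p k)"
        using k by (simp add: powr_mult_base powr_diff)
      also have "\<dots> \<le> \<delta> powr (\<gamma> - 1) * (p (Suc k) - p k)"
        using k assms by (intro mult_right_mono powr_mono2) auto
      finally show "norm (\<Xi> (p k) (p (Suc k)) - (K (p (Suc k)) - K (p k))) \<le> C * \<delta> powr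
          (\<gamma> - 1) * (p (Suc k) - p k)"
        using assms by (simp add: mult.assoc mult_left_mono)
    qed
    also have "\<dots> = C * \<delta> powr (\<gamma> - 1) * t"
      using p sum_lessThan_telescope[of p N] by (simp flip: sum_distrib_left)
    finally show "norm ((\<Sum>k<N. \<Xi> (p k) (p (Suc k))) - (K t - K 0)) < \<epsilon>"
      using \<delta> by (simp add: mult_ac)
  qed
qed

lemma partition_limit_cong:
  assumes "\<And>s u. 0 \<le> s \<Longrightarrow> s < u \<Longrightarrow> u \<le> t \<Longrightarrow> \<Xi> s u
      = \<Xi>' s u" "partition_limit \<Xi> t I"
  shows "partition_limit \<Xi>' t I"
  unfolding partition_limit_def
proof (intro allI impI)
  fix \<epsilon> :: real assume "0 < \<epsilon>"
  then obtain \<delta> where \<delta>: "0 < \<delta>" and lim: "\<And>N p. p 0 = 0 \<and> p N = t \<and>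
      (\<forall>k<N. p k < p (Suc k) \<and> p (Suc k) - p k < \<delta>) \<Longrightarrow>
     norm ((\<Sum>k<N. \<Xi> (p k) (p (Suc k))) - I) < \<epsilon>"
    using assms(2) unfolding partition_limit_def by meson
  show "\<exists>\<delta>>0. \<forall>(N::nat) p. p 0 = 0 \<and> p N = t \<and> (\<forall>k<N. p k < p (Suc k)
      \<and> p (Suc k) - p k < \<delta>) \<longrightarrow>
     norm ((\<Sum>k<N. \<Xi>' (p k) (p (Suc k))) - I) < \<epsilon>"
  proof (intro exI[of _ \<delta>] conjI allI impI \<delta>(1))
    fix N :: nat and p :: "nat \<Rightarrow> real"
    assume p: "p 0 = 0 \<and> p N = t \<and> (\<forall>k<N. p k < p (Suc k) \<and> p (Suc k) - p k < \<delta>)"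
    have rng: "0 \<le> p k" "p k \<le> t" if "k \<le> N" for k
      using partition_mono[of N p 0 k] partition_mono[of N p k N] that p by auto
    have "(\<Sum>k<N. \<Xi>' (p k) (p (Suc k))) = (\<Sum>k<N. \<Xi> (p k) (p (Suc k)))"
      using p rng by (intro sum.cong refl assms(1)[symmetric]) (auto simp: Suc_leI)
    then show "norm ((\<Sum>k<N. \<Xi>' (p k) (p (Suc k))) - I) < \<epsilon>" using lim p by simp
  qed
qed

lemma partition_limit_add:
  assumes "partition_limit \<Xi> t I" "partition_limit \<Xi>' t I'"
  shows "partition_limit (\<lambda>s u. \<Xi> s u + \<Xi>' s u) t (I + I')"
  unfolding partition_limit_def
proof (intro allI impI)
  fix \<epsilon> :: real assume "0 < \<epsilon>"
  then have "0 < \<epsilon> / 2" by simp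
  obtain \<delta> where \<delta>: "0 < \<delta>" and lim: "\<And>N p. p 0 = 0 \<and> p N = t \<and>
      (\<forall>k<N. p k < p (Suc k) \<and> p (Suc k) - p k < \<delta>) \<Longrightarrow>
     norm ((\<Sum>k<N. \<Xi> (p k) (p (Suc k))) - I) < \<epsilon> / 2"
    using assms(1) \<open>0 < \<epsilon> / 2\<close> unfolding partition_limit_def by meson
  obtain \<delta>' where \<delta>': "0 < \<delta>'" and lim': "\<And>N p. p 0 = 0 \<and> p N = t \<and>
      (\<forall>k<N. p k < p (Suc k) \<and> p (Suc k) - p k < \<delta>') \<Longrightarrow>
     norm ((\<Sum>k<N. \<Xi>' (p k) (p (Suc k))) - I') < \<epsilon> / 2"
    using assms(2) \<open>0 < \<epsilon> / 2\<close> unfolding partition_limit_def by meson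
  show "\<exists>\<delta>>0. \<forall>(N::nat) p. p 0 = 0 \<and> p N = t \<and> (\<forall>k<N. p k < p (Suc k)
      \<and> p (Suc k) - p k < \<delta>) \<longrightarrow>
     norm ((\<Sum>k<N. \<Xi> (p k) (p (Suc k)) + \<Xi>' (p k) (p (Suc k))) - (I + I')) < \<epsilon>"
  proof (intro exI[of _ "min \<delta> \<delta>'"] conjI allI impI)
    fix N :: nat and p :: "nat \<Rightarrow> real"
    assume p: "p 0 = 0 \<and> p N = t \<and> (\<forall>k<N. p k < p (Suc k) \<and> p (Suc k) - p k < min
        \<delta> \<delta>')"
    have "norm ((\<Sum>k<N. \<Xi> (p k) (p (Suc k))) - I) < \<epsilon> / 2" "norm ((\<Sum>k<N. \<Xi>' (p k) (p
        (Suc k))) - I') < \<epsilon> / 2"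
      by (rule lim, use p in simp) (rule lim', use p in simp)
    then have "norm (((\<Sum>k<N. \<Xi> (p k) (p (Suc k))) - I) + ((\<Sum>k<N. \<Xi>' (p k) (p (Suc k))) - I'))
        < \<epsilon>"
      using norm_triangle_ineq by (smt (verit) field_sum_of_halves)
    then show "norm ((\<Sum>k<N. \<Xi> (p k) (p (Suc k)) + \<Xi>' (p k) (p (Suc k))) - (I + I')) < \<epsilon>"
      by (simp add: sum.distrib algebra_simps)
  qed (use \<delta> \<delta>' in simp)
qed

lemma partition_limit_diff:
  assumes "partition_limit \<Xi> t I" "partition_limit \<Xi>' t I'"
  shows "partition_limit (\<lambda>s u. \<Xi> s u - \<Xi>' s u) t (I - I')"
proof -
  have "partition_limit (\<lambda>s u. - \<Xi>' s u) t (- I')"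
  proof -
    have "norm ((\<Sum>k<N. - \<Xi>' (p k) (p (Suc k))) - (- I')) = norm ((\<Sum>k<N. \<Xi>' (p k) (p (Suc k)))
        - I')" for p and N :: nat
      by (simp add: sum_negf norm_minus_commute)
    then show ?thesis using assms(2) unfolding partition_limit_def by simp
  qed
  from partition_limit_add[OF assms(1) this] show ?thesis by simp
qed

lemma sum_lessThan_add: "(\<Sum>k<m + n. f k) = (\<Sum>k<m. f k) + (\<Sum>k<n. f (m + k))" for m n :: nat
  by (induction n) (auto simp: algebra_simps)

text \<open>\<open>partition_limit\<close> only knows partitions starting at 0. Prefixing the
  uniform partition of [s, t] with a fine one of [0, s] isolates the integral over [s, t].\<close>

lemma partition_limit_interval:
  fixes \<Xi> :: "real \<Rightarrow> real \<Rightarrow> 'e::real_normed_vector"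
  assumes "partition_limit \<Xi> s I" "partition_limit \<Xi> t I'" "0 \<le> s" "s < t"
  shows "(\<lambda>n. \<Sum>i<2 ^ n. \<Xi> (s + real i * ((t - s) / 2 ^ n)) (s + real (Suc i) * ((t - s) / 2 ^
      n))) \<longlonglongrightarrow> I' - I"
  unfolding LIMSEQ_def
proof (intro allI impI)
  fix \<epsilon> :: real assume "0 < \<epsilon>"
  then have "0 < \<epsilon> / 2" by simp
  obtain \<delta> where \<delta>: "0 < \<delta>" and lim: "\<And>N p. p 0 = 0 \<and> p N = s \<and>
      (\<forall>k<N. p k < p (Suc k) \<and> p (Suc k) - p k < \<delta>) \<Longrightarrow>
     norm ((\<Sum>k<N. \<Xi> (p k) (p (Suc k))) - I) < \<epsilon> / 2"
    using assms(1) \<open>0 < \<epsilon> / 2\<close> unfolding partition_limit_def by meson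
  obtain \<delta>' where \<delta>': "0 < \<delta>'" and lim': "\<And>N p. p 0 = 0 \<and> p N = t \<and>
      (\<forall>k<N. p k < p (Suc k) \<and> p (Suc k) - p k < \<delta>') \<Longrightarrow>
     norm ((\<Sum>k<N. \<Xi> (p k) (p (Suc k))) - I') < \<epsilon> / 2"
    using assms(2) \<open>0 < \<epsilon> / 2\<close> unfolding partition_limit_def by meson
  obtain n0 :: nat where n0: "t / min \<delta> \<delta>' < 2 ^ n0" using real_arch_pow[of 2 "t / min \<delta>
      \<delta>'"] by auto
  have "dist (\<Sum>i<2 ^ n. \<Xi> (s + real i * ((t - s) / 2 ^ n)) (s + real (Suc i) * ((t - s) / 2 ^ n))) (I'
      - I) < \<epsilon>"
    if n: "n0 \<le> n" for n
  proof -
    have pow: "(2::real) ^ n0 \<le> 2 ^ n" using n by (simp add: power_increasing)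
    define m where "m = min \<delta> \<delta>'"
    have "0 < m" using \<delta> \<delta>' by (simp add: m_def)
    moreover have "t / m < 2 ^ n" using n0 pow unfolding m_def by linarith
    ultimately have mesh: "t / 2 ^ n < min \<delta> \<delta>'" unfolding m_def[symmetric] by (simp add: field_simps)
    define h where "h = (t - s) / 2 ^ n"
    define h0 where "h0 = s / 2 ^ n"
    have h: "0 < h" "h < min \<delta> \<delta>'" "0 \<le> h0" "h0 < min \<delta> \<delta>'"
    proof -
      have "(t - s) / 2 ^ n \<le> t / 2 ^ n" "s / 2 ^ n \<le> t / 2 ^ n" using assms by (auto intro: divide_right_mono)
      then show "0 < h" "h < min \<delta> \<delta>'" "0 \<le> h0" "h0 < min \<delta> \<delta>'" using mesh
          assms by (auto simp: h_def h0_def)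
    qed
    define M :: nat where "M = (if s = 0 then 0 else 2 ^ n)"
    have Mh: "real M * h0 = s" by (simp add: M_def h0_def)
    have h0_pos: "0 < h0" if "0 < M" using that assms by (auto simp: M_def h0_def split: if_splits)
    define p where "p k = (if k \<le> M then real k * h0 else s + real (k - M) * h)" for k
    have pM: "p (M + k) = s + real k * h" for k using Mh by (simp add: p_def)
    have inc: "p k < p (Suc k) \<and> p (Suc k) - p k < min \<delta> \<delta>'" for k
    proof (cases "k < M")
      case True
      then show ?thesis using h0_pos h by (auto simp: p_def algebra_simps)
    next
      case False
      then obtain j where "k = M + j" using le_Suc_ex by (metis not_less)
      then show ?thesis using pM[of j] pM[of "Suc j"] h by (auto simp: algebra_simps)
    qed
    have ends: "p 0 = 0" "p M = s" "p (M + 2 ^ n) = t"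
      using Mh pM[of "2 ^ n"] assms by (auto simp: p_def h_def)
    have 1: "norm ((\<Sum>k<M. \<Xi> (p k) (p (Suc k))) - I) < \<epsilon> / 2" using inc ends by (intro lim) auto
    have 2: "norm ((\<Sum>k<M + 2 ^ n. \<Xi> (p k) (p (Suc k))) - I') < \<epsilon> / 2" using inc ends by
        (intro lim') auto
    define S where "S = (\<Sum>i<2 ^ n. \<Xi> (s + real i * h) (s + real (Suc i) * h))"
    have "(\<Sum>k<M + 2 ^ n. \<Xi> (p k) (p (Suc k))) = (\<Sum>k<M. \<Xi> (p k) (p (Suc k))) + S"
      unfolding sum_lessThan_add S_def using pM[of "Suc _"] by (simp add: pM)
    then have eq: "S - (I' - I) = ((\<Sum>k<M + 2 ^ n. \<Xi> (p k) (p (Suc k))) - I') - ((\<Sum>k<M. \<Xi> (p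
        k) (p (Suc k))) - I)"
      by simp
    have "norm (S - (I' - I)) < \<epsilon>"
      unfolding eq using 1 2 norm_triangle_ineq4[of "(\<Sum>k<M + 2 ^ n. \<Xi> (p k) (p (Suc k))) - I'"
          "(\<Sum>k<M. \<Xi> (p k) (p (Suc k))) - I"]
      by linarith
    then show ?thesis by (simp add: S_def h_def dist_norm)
  qed
  then show "\<exists>n0. \<forall>n\<ge>n0. dist (\<Sum>i<2 ^ n. \<Xi> (s + real i * ((t - s) / 2 ^ n)) (s +
      real (Suc i) * ((t - s) / 2 ^ n))) (I' - I) < \<epsilon>"
    by blast
qed

text \<open>The sewing estimate, with existence of the limits given: refining the 2^n cells of
  [s, t] once changes the sum by at most 2^n C ((t - s) / 2^n)^\<gamma>, which is summable in n
  since \<gamma> > 1.\<close>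

lemma expansion_of_partition_limit:
  fixes \<Xi> :: "real \<Rightarrow> real \<Rightarrow> 'e::real_normed_vector"
  assumes \<delta>\<Xi>: "\<And>s r t. 0 \<le> s \<Longrightarrow> s < r \<Longrightarrow> r < t
      \<Longrightarrow> t \<le> T \<Longrightarrow> norm (\<Xi> s t - \<Xi> s r - \<Xi> r t) \<le> C * (t - s)
      powr \<gamma>"
    and "1 < \<gamma>" and lim: "\<And>t. 0 \<le> t \<Longrightarrow> t \<le> T \<Longrightarrow>
        partition_limit \<Xi> t (K t)"
    and st: "0 \<le> s" "s < t" "t \<le> T"
  shows "norm (K t - K s - \<Xi> s t) \<le> C / (1 - 2 / 2 powr \<gamma>) * (t - s) powr \<gamma>"
proof -
  define x where "x n i = s + real i * ((t - s) / 2 ^ n)" for n i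
  define S where "S n = (\<Sum>i<2 ^ n. \<Xi> (x n i) (x n (Suc i)))" for n
  define \<rho> where "\<rho> = 2 / (2::real) powr \<gamma>"
  have \<rho>: "0 \<le> \<rho>" "\<rho> < 1" using two_powr_gt[OF \<open>1 < \<gamma>\<close>] by (auto simp:
      \<rho>_def)
  have x2: "x n i = x (Suc n) (2 * i)" for n i by (simp add: x_def)
  have even_odd: "(\<Sum>i<2 * m. f i) = (\<Sum>i<m. f (2 * i) + f (Suc (2 * i)))" for m and f :: "nat \<Rightarrow> 'e"
    by (induction m) (auto simp: algebra_simps)
  have step: "norm (S (Suc n) - S n) \<le> C * (t - s) powr \<gamma> * \<rho> ^ n" for n
  proof -
    define D where "D i = \<Xi> (x n i) (x n (Suc i)) - \<Xi> (x n i) (x (Suc n) (Suc (2 * i))) - \<Xi> (x (Suc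
        n) (Suc (2 * i))) (x n (Suc i))" for i
    have "S (Suc n) = (\<Sum>i<2 ^ n. \<Xi> (x n i) (x (Suc n) (Suc (2 * i))) + \<Xi> (x (Suc n) (Suc (2 * i)))
        (x n (Suc i)))"
      unfolding S_def x2[of n] power_Suc even_odd by simp
    then have "S n - S (Suc n) = (\<Sum>i<2 ^ n. D i)"
      by (simp add: S_def D_def sum_subtractf sum.distrib algebra_simps)
    also have "norm \<dots> \<le> (\<Sum>i<(2::nat) ^ n. C * ((t - s) / 2 ^ n) powr \<gamma>)"
    proof (rule sum_norm_le)
      fix i assume i: "i \<in> {..<(2::nat) ^ n}"
      have "real (Suc i) \<le> 2 ^ n" using i by (simp add: Suc_le_eq flip: of_nat_Suc of_nat_power)
      then have "real (Suc i) * ((t - s) / 2 ^ n) \<le> 2 ^ n * ((t - s) / 2 ^ n)" using st by (intro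
          mult_right_mono) auto
      then have "x n (Suc i) \<le> t" by (simp add: x_def)
      moreover have "x n i < x (Suc n) (Suc (2 * i))" "x (Suc n) (Suc (2 * i)) < x n (Suc i)" "x n (Suc i) - x
          n i = (t - s) / 2 ^ n"
        using st by (auto simp: x_def field_simps)
      moreover have "0 \<le> x n i" using st by (simp add: x_def)
      ultimately show "norm (D i) \<le> C * ((t - s) / 2 ^ n) powr \<gamma>"
        unfolding D_def using \<delta>\<Xi>[of "x n i" "x (Suc n) (Suc (2 * i))" "x n (Suc i)"] st by simp
    qed
    also have "\<dots> = C * (t - s) powr \<gamma> * \<rho> ^ n"
      using st by (simp add: \<rho>_def powr_divide power_divide powr_power field_simps powr_realpow[symmetric]
          powr_powr)
    finally show ?thesis by (simp add: norm_minus_commute)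
  qed
  have C0: "0 \<le> C * (t - s) powr \<gamma>" using order_trans[OF norm_ge_zero step[of 0]] by simp
  have "norm (S n - \<Xi> s t) \<le> C * (t - s) powr \<gamma> * (\<Sum>i<n. \<rho> ^ i)" for n
  proof (induction n)
    case 0
    then show ?case by (simp add: S_def x_def)
  next
    case (Suc n)
    have "norm (S (Suc n) - \<Xi> s t) \<le> norm (S (Suc n) - S n) + norm (S n - \<Xi> s t)"
      using norm_triangle_ineq[of "S (Suc n) - S n" "S n - \<Xi> s t"] by simp
    then show ?case using step[of n] Suc by (simp add: algebra_simps)
  qed
  moreover have "C * (t - s) powr \<gamma> * (\<Sum>i<n. \<rho> ^ i) \<le> C / (1 - \<rho>) * (t - s) powr
      \<gamma>" for n
  proof -
    have "(\<Sum>i<n. \<rho> ^ i) \<le> 1 / (1 - \<rho>)"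
      using sum_le_suminf[OF summable_geometric, of \<rho> "{..<n}"] \<rho> suminf_geometric[of \<rho>] by auto
    from mult_left_mono[OF this C0] show ?thesis by simp
  qed
  ultimately have bound: "norm (S n - \<Xi> s t) \<le> C / (1 - \<rho>) * (t - s) powr \<gamma>" for n
    using order_trans by blast
  have "S \<longlonglongrightarrow> K t - K s"
    unfolding S_def x_def using st by (intro partition_limit_interval lim) auto
  then have "(\<lambda>n. norm (S n - \<Xi> s t)) \<longlonglongrightarrow> norm (K t - K s - \<Xi> s t)"
    by (intro tendsto_intros)
  then show ?thesis
    unfolding \<rho>_def[symmetric] by (rule LIMSEQ_le_const2) (use bound in blast)
qed

section \<open>Contractions and second-order calculus\<close>

definition contract1 :: "real^'d \<Rightarrow> 'f::real_normed_vector^'d \<Rightarrow> 'f" where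
  "contract1 v x = (\<Sum>i\<in>UNIV. v $ i *\<^sub>R x $ i)"

definition contract2 :: "real^'d^'d \<Rightarrow> 'f::real_normed_vector^'d^'d \<Rightarrow> 'f" where
  "contract2 V x = (\<Sum>i\<in>UNIV. \<Sum>j\<in>UNIV. V $ j $ i *\<^sub>R x $ j $ i)"

definition bmap :: "('e::real_normed_vector \<Rightarrow>\<^sub>L 'f::real_normed_vector) \<Rightarrow> 'e^'d
    \<Rightarrow> 'f^'d" where
  "bmap B x = (\<chi> j. blinfun_apply B (x $ j))"

text \<open>\<open>Dy_deriv\<close> stores a space derivative as a vector of operators, one for each
  direction of the path; this reads such a vector as a single linear map.\<close>

definition vmap :: "('e::real_normed_vector \<Rightarrow>\<^sub>L 'f::real_normed_vector)^'d \<Rightarrow> 'e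
    \<Rightarrow> 'f^'d" where
  "vmap B h = (\<chi> j. blinfun_apply (B $ j) h)"

lemma sum_norm_mult_le_vec:
  fixes v :: "'a::real_normed_vector^'d" and x :: "'b::real_normed_vector^'d"
  shows "(\<Sum>i\<in>UNIV. norm (v $ i) * norm (x $ i)) \<le> norm v * norm x"
  unfolding norm_vec_def using L2_set_mult_ineq[of "\<lambda>i. norm (v $ i)" "\<lambda>i. norm (x $ i)" UNIV] by simp

lemma norm_contract1_le: "norm (contract1 v x) \<le> norm v * norm x"
proof -
  have "norm (contract1 v x) \<le> (\<Sum>i\<in>UNIV. norm (v $ i) * norm (x $ i))"
    unfolding contract1_def by (rule sum_norm_le) simp
  then show ?thesis using sum_norm_mult_le_vec order_trans by blast
qed

lemma contract2_contract1: "contract2 V x = (\<Sum>j\<in>UNIV. contract1 (V $ j) (x $ j))"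
  unfolding contract2_def contract1_def by (rule sum.swap)

lemma norm_contract2_le: "norm (contract2 V x) \<le> norm V * norm x"
proof -
  have "norm (contract2 V x) \<le> (\<Sum>j\<in>UNIV. norm (V $ j) * norm (x $ j))"
    unfolding contract2_contract1 by (rule sum_norm_le) (rule norm_contract1_le)
  then show ?thesis using sum_norm_mult_le_vec order_trans by blast
qed

lemma norm_vec_le_mult:
  fixes x :: "'a::real_normed_vector^'d" and y :: "'b::real_normed_vector^'d"
  assumes "\<And>i. norm (x $ i) \<le> c * norm (y $ i)" "0 \<le> c"
  shows "norm x \<le> c * norm y"
proof -
  have "norm x \<le> L2_set (\<lambda>i. c * norm (y $ i)) UNIV"
    unfolding norm_vec_def by (rule L2_set_mono) (use assms in auto)
  then show ?thesis using assms by (simp add: norm_vec_def L2_set_right_distrib)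
qed

lemma norm_bmap_le: "norm (bmap B x) \<le> norm B * norm x"
  by (rule norm_vec_le_mult) (auto simp: bmap_def norm_blinfun)

lemma norm_vmap_le: "norm (vmap B h) \<le> norm B * norm h"
proof -
  have "norm (vmap B h) \<le> norm h * norm B"
    by (rule norm_vec_le_mult) (auto simp: vmap_def mult.commute[of "norm h"] norm_blinfun)
  then show ?thesis by (simp add: mult.commute)
qed

interpretation contract1: bounded_bilinear contract1
proof
  show "\<exists>K. \<forall>a b. norm (contract1 a b) \<le> norm a * norm b * K"
    by (intro exI[of _ 1]) (simp add: norm_contract1_le)
qed (simp_all add: contract1_def scaleR_add_left scaleR_add_right sum.distrib scaleR_sum_right mult.commute)

interpretation contract2: bounded_bilinear contract2
proof
  show "\<exists>K. \<forall>a b. norm (contract2 a b) \<le> norm a * norm b * K"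
    by (intro exI[of _ 1]) (simp add: norm_contract2_le)
qed (simp_all add: contract2_def scaleR_add_left scaleR_add_right sum.distrib scaleR_sum_right mult.commute)

interpretation bmap: bounded_bilinear bmap
proof
  show "\<exists>K. \<forall>a b. norm (bmap a b) \<le> norm a * norm b * K"
    by (intro exI[of _ 1]) (simp add: norm_bmap_le)
qed (simp_all add: bmap_def vec_eq_iff blinfun.bilinear_simps)

interpretation vmap: bounded_bilinear vmap
proof
  show "\<exists>K. \<forall>a b. norm (vmap a b) \<le> norm a * norm b * K"
    by (intro exI[of _ 1]) (simp add: norm_vmap_le)
qed (simp_all add: vmap_def vec_eq_iff blinfun.bilinear_simps)

lemma contract1_bmap: "contract1 w (bmap B x) = blinfun_apply B (contract1 w x)"
  by (simp add: contract1_def bmap_def blinfun.sum_right blinfun.scaleR_right)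

lemma blinfun_contract1: "blinfun_apply (contract1 w B) h = contract1 w (vmap B h)"
  by (simp add: contract1_def vmap_def blinfun.sum_left blinfun.scaleR_left)

text \<open>In Chen's relation the earlier increment u meets the outermost index, the derivative
  direction, and the later increment v the index of the integrand.\<close>

lemma contract2_outer: "contract2 (outer u v) x = contract1 v (contract1 u x)"
  by (simp add: contract1_def contract2_def outer_def scaleR_sum_right mult.commute)

section \<open>Taylor bounds, symmetry of second derivatives, second differences\<close>

lemma taylor_bound:
  fixes f :: "'a::real_normed_vector \<Rightarrow> 'b::real_normed_vector"
  assumes f: "\<And>x. (f has_derivative blinfun_apply (Df x)) (at x)"
    and lip: "\<And>x y. norm (Df x - Df y) \<le> M * norm (x - y)" and "0 \<le> M"
  shows "norm (f z - f y - blinfun_apply (Df y) (z - y)) \<le> M * (norm (z - y))\<^sup>2"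
proof -
  define S where "S = closed_segment y z"
  have "norm (f z - f y - blinfun_apply (Df y) (z - y)) \<le> norm (z - y) * (M * norm (z - y))"
  proof (rule differentiable_bound_linearization[where S = S])
    show "y + t *\<^sub>R (z - y) \<in> S" if "t \<in> {0..1}" for t
      using that by (auto simp: S_def in_segment algebra_simps intro!: exI[of _ t])
    show "(f has_derivative blinfun_apply (Df x)) (at x within S)" for x
      using f by (rule has_derivative_at_withinI)
    show "onorm (blinfun_apply (Df x) - blinfun_apply (Df y)) \<le> M * norm (z - y)" if "x \<in> S" for x
      unfolding fun_diff_def
    proof (rule onorm_bound)
      fix h
      have "norm (blinfun_apply (Df x) h - blinfun_apply (Df y) h) \<le> norm (Df x - Df y) * norm h"
        using norm_blinfun[of "Df x - Df y" h] by (simp add: blinfun.diff_left)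
      also have "norm (Df x - Df y) \<le> M * norm (z - y)"
        using lip[of x y] segment_bound(1)[of x y z] that \<open>0 \<le> M\<close>
        by (simp add: S_def norm_minus_commute) (meson mult_left_mono order_trans)
      finally show "norm (blinfun_apply (Df x) h - blinfun_apply (Df y) h) \<le> M * norm (z - y) * norm h"
        by (simp add: mult_right_mono)
    qed (use \<open>0 \<le> M\<close> in auto)
    show "y \<in> S" by (simp add: S_def)
  qed
  then show ?thesis by (simp add: power2_eq_square mult_ac)
qed

text \<open>The second difference \<open>\<phi>\<close> is symmetric in u and v and equals \<tau>^2
  times the second derivative up to order \<tau>^3, by the Lipschitz bound. Dividing by \<tau>^2 and
  letting \<tau> tend to 0 gives symmetry.\<close>

lemma symmetric_second_derivative_lipschitz:
  fixes f :: "'a::real_normed_vector \<Rightarrow> 'b::real_normed_vector"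
  assumes f: "\<And>x. (f has_derivative blinfun_apply (Df x)) (at x)"
    and Df: "\<And>x. (Df has_derivative blinfun_apply (D2 x)) (at x)"
    and lip: "\<And>x y. norm (D2 x - D2 y) \<le> M * norm (x - y)" and "0 \<le> M"
  shows "blinfun_apply (blinfun_apply (D2 x) u) v = blinfun_apply (blinfun_apply (D2 x) v) u"
proof -
  define \<phi> where "\<phi> u v \<tau> = f (x + \<tau> *\<^sub>R u + \<tau> *\<^sub>R v) - f (x + \<tau>
      *\<^sub>R u) - f (x + \<tau> *\<^sub>R v) + f x" for u v and \<tau> :: real
  define C where "C u v = M * ((norm v)\<^sup>2 + norm u * norm v) * norm u" for u v :: 'a
  have main: "norm (\<phi> u v \<tau> - \<tau>\<^sup>2 *\<^sub>R blinfun_apply (blinfun_apply (D2 x) v) u)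
      \<le> C u v * \<tau> ^ 3" if \<tau>: "0 < \<tau>" for u v \<tau>
  proof -
    define B where "B = blinfun_apply (D2 x) (\<tau> *\<^sub>R v)"
    \<comment> \<open>The increment of g over [0, \<tau>] is the second difference minus its
      expected value, so only a bound of order \<tau>^2 on the derivative of g is needed.\<close>
    define g where "g s = f (x + s *\<^sub>R u + \<tau> *\<^sub>R v) - f (x + s *\<^sub>R u) - s *\<^sub>R
        blinfun_apply B u" for s :: real
    have dg: "(g has_derivative (\<lambda>h. h *\<^sub>R (blinfun_apply (Df (x + s *\<^sub>R u + \<tau>
        *\<^sub>R v) - Df (x + s *\<^sub>R u) - B) u)))
       (at s within {0..\<tau>})" for s
    proof -
      have 1: "((\<lambda>s. f (x + s *\<^sub>R u + z)) has_derivative (\<lambda>h. blinfun_apply (Df (x + s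
          *\<^sub>R u + z)) (h *\<^sub>R u))) (at s within {0..\<tau>})" for z
        by (rule has_derivative_compose[OF _ f, where f = "\<lambda>s. x + s *\<^sub>R u + z"]) (auto intro!:
            derivative_eq_intros)
      show ?thesis unfolding g_def
        by (rule has_derivative_eq_rhs[OF has_derivative_diff[OF has_derivative_diff[OF 1 1[of 0, simplified]]
           has_derivative_scaleR_left[OF has_derivative_ident]]])
          (simp add: blinfun.bilinear_simps algebra_simps)
    qed
    have "norm (g \<tau> - g 0) \<le> (M * (\<tau>\<^sup>2 * ((norm v)\<^sup>2 + norm u * norm v)) * norm u) *
        norm (\<tau> - 0)"
    proof (rule differentiable_bound[where S = "{0..\<tau>}", OF _ dg])
      fix s assume s: "s \<in> {0..\<tau>}"
      define z where "z = x + s *\<^sub>R u"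
      have 1: "norm (Df (z + \<tau> *\<^sub>R v) - Df z - blinfun_apply (D2 z) (\<tau> *\<^sub>R v)) \<le> M *
          (norm (\<tau> *\<^sub>R v))\<^sup>2"
        using taylor_bound[OF Df lip \<open>0 \<le> M\<close>, of "z + \<tau> *\<^sub>R v" z] by simp
      have "norm (blinfun_apply (D2 z - D2 x) (\<tau> *\<^sub>R v)) \<le> norm (D2 z - D2 x) * norm (\<tau>
          *\<^sub>R v)"
        by (rule norm_blinfun)
      also have "norm (D2 z - D2 x) \<le> M * (\<tau> * norm u)"
      proof -
        have "norm (D2 z - D2 x) \<le> M * (s * norm u)" using lip[of z x] s by (simp add: z_def)
        also have "\<dots> \<le> M * (\<tau> * norm u)" using s \<open>0 \<le> M\<close> by (intro
            mult_left_mono mult_right_mono) auto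
        finally show ?thesis .
      qed
      finally have 2: "norm (blinfun_apply (D2 z - D2 x) (\<tau> *\<^sub>R v)) \<le> M * (\<tau> * norm u) *
          norm (\<tau> *\<^sub>R v)"
        by (simp add: mult_right_mono)
      have "Df (z + \<tau> *\<^sub>R v) - Df z - B = (Df (z + \<tau> *\<^sub>R v) - Df z - blinfun_apply (D2 z)
          (\<tau> *\<^sub>R v)) + blinfun_apply (D2 z - D2 x) (\<tau> *\<^sub>R v)"
        by (simp add: B_def blinfun.diff_left)
      then have "norm (Df (z + \<tau> *\<^sub>R v) - Df z - B) \<le> M * (norm (\<tau> *\<^sub>R v))\<^sup>2 +
          M * (\<tau> * norm u) * norm (\<tau> *\<^sub>R v)"
        using norm_triangle_le[OF add_mono[OF 1 2]] by (simp only:)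
      also have "\<dots> = M * (\<tau>\<^sup>2 * ((norm v)\<^sup>2 + norm u * norm v))"
        using \<tau> by (simp add: power2_eq_square algebra_simps)
      finally have 3: "norm (Df (z + \<tau> *\<^sub>R v) - Df z - B) \<le> M * (\<tau>\<^sup>2 * ((norm
          v)\<^sup>2 + norm u * norm v))" .
      show "onorm (\<lambda>h. h *\<^sub>R blinfun_apply (Df (x + s *\<^sub>R u + \<tau> *\<^sub>R v) - Df (x +
          s *\<^sub>R u) - B) u) \<le> M * (\<tau>\<^sup>2 * ((norm v)\<^sup>2 + norm u * norm v)) * norm u"
      proof (rule onorm_bound)
        fix h :: real
        have "norm (blinfun_apply (Df (z + \<tau> *\<^sub>R v) - Df z - B) u) \<le> M * (\<tau>\<^sup>2 *
            ((norm v)\<^sup>2 + norm u * norm v)) * norm u"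
          using norm_blinfun[of "Df (z + \<tau> *\<^sub>R v) - Df z - B" u] mult_right_mono[OF 3, of "norm u"] by simp
        from mult_left_mono[OF this, of "\<bar>h\<bar>"]
        show "norm (h *\<^sub>R blinfun_apply (Df (x + s *\<^sub>R u + \<tau> *\<^sub>R v) - Df (x + s
            *\<^sub>R u) - B) u) \<le> M * (\<tau>\<^sup>2 * ((norm v)\<^sup>2 + norm u * norm v)) * norm u * norm h"
          by (simp add: z_def mult_ac)
      qed (use \<open>0 \<le> M\<close> in auto)
    qed (use \<tau> in auto)
    moreover have "g \<tau> - g 0 = \<phi> u v \<tau> - \<tau>\<^sup>2 *\<^sub>R blinfun_apply (blinfun_apply
        (D2 x) v) u"
      by (simp add: g_def \<phi>_def B_def blinfun.scaleR_right blinfun.scaleR_left power2_eq_square)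
    ultimately show ?thesis using \<tau> by (simp add: C_def power2_eq_square power3_eq_cube mult_ac)
  qed
  define d where "d = blinfun_apply (blinfun_apply (D2 x) u) v - blinfun_apply (blinfun_apply (D2 x) v) u"
  have bound: "norm d \<le> (C u v + C v u) * \<tau>" if \<tau>: "0 < \<tau>" for \<tau>
  proof -
    have "\<phi> v u \<tau> = \<phi> u v \<tau>" by (simp add: \<phi>_def algebra_simps)
    then have "\<tau>\<^sup>2 *\<^sub>R d = (\<phi> u v \<tau> - \<tau>\<^sup>2 *\<^sub>R blinfun_apply
        (blinfun_apply (D2 x) v) u) -
       (\<phi> v u \<tau> - \<tau>\<^sup>2 *\<^sub>R blinfun_apply (blinfun_apply (D2 x) u) v)" by (simp add:
           d_def algebra_simps)
    then have "norm (\<tau>\<^sup>2 *\<^sub>R d) \<le> C u v * \<tau> ^ 3 + C v u * \<tau> ^ 3"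
      using norm_triangle_le_diff[OF add_mono[OF main[OF \<tau>, of u v] main[OF \<tau>, of v u]]] by (simp only:)
    then have "\<tau>\<^sup>2 * norm d \<le> \<tau>\<^sup>2 * ((C u v + C v u) * \<tau>)"
      by (simp add: power2_eq_square power3_eq_cube algebra_simps)
    then show ?thesis using \<tau> by simp
  qed
  have "((\<lambda>\<tau>. (C u v + C v u) * \<tau>) \<longlongrightarrow> (C u v + C v u) * 0) (at_right 0)"
    by (intro tendsto_intros)
  then have "norm d \<le> (C u v + C v u) * 0"
    by (rule tendsto_lowerbound) (auto intro: eventually_mono[OF eventually_at_right_less[of 0]] bound)
  then show ?thesis by (simp add: d_def)
qed

text \<open>Mean value theorem for the difference of f along the segments from b to a and from d to
  c. Its derivative splits into f' on (a - b) - (c - d) and the change of f' between the two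
  segments, applied to c - d.\<close>

lemma second_difference_bound:
  fixes f :: "'a::real_normed_vector \<Rightarrow> 'b::real_normed_vector"
  assumes f: "\<And>x. (f has_derivative f' x) (at x)"
    and bd: "\<And>x h. norm (f' x h) \<le> e * norm h"
    and lip: "\<And>x y h. norm (f' x h - f' y h) \<le> e * norm (x - y) * norm h" and "0 \<le> e"
  shows "norm (f a - f b - (f c - f d)) \<le> e * (norm ((a - b) - (c - d)) + (norm (a - c) + norm (b - d)) *
      norm (c - d))"
proof -
  have lin: "linear (f' x)" for x using f has_derivative_linear by blast
  define p where "p s = b + s *\<^sub>R (a - b)" for s :: real
  define q where "q s = d + s *\<^sub>R (c - d)" for s :: real
  define g where "g s = f (p s) - f (q s)" for s
  have dg: "(g has_derivative (\<lambda>h. h *\<^sub>R (f' (p s) (a - b) - f' (q s) (c - d)))) (at s within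
      {0..1})" for s
  proof -
    have 1: "((\<lambda>s. f (p s)) has_derivative (\<lambda>h. f' (p s) (h *\<^sub>R (a - b)))) (at s within {0..1})"
      by (rule has_derivative_compose[OF _ f, where f = p]) (auto simp: p_def[abs_def] intro!: derivative_eq_intros)
    have 2: "((\<lambda>s. f (q s)) has_derivative (\<lambda>h. f' (q s) (h *\<^sub>R (c - d)))) (at s within {0..1})"
      by (rule has_derivative_compose[OF _ f, where f = q]) (auto simp: q_def[abs_def] intro!: derivative_eq_intros)
    show ?thesis unfolding g_def
      by (rule has_derivative_eq_rhs[OF has_derivative_diff[OF 1 2]])
        (simp only: linear_scale[OF lin], simp only: scaleR_diff_right)
  qed
  define R where "R = e * (norm ((a - b) - (c - d)) + (norm (a - c) + norm (b - d)) * norm (c - d))"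
  have "norm (g 1 - g 0) \<le> R * norm (1 - 0 :: real)"
  proof (rule differentiable_bound[where S = "{0..1}", OF _ dg])
    fix s :: real assume s: "s \<in> {0..1}"
    have "f' (p s) (a - b) - f' (q s) (c - d) = f' (p s) ((a - b) - (c - d)) + (f' (p s) (c - d) - f' (q s) (c - d))"
      by (simp add: linear_diff[OF lin])
    then have "norm (f' (p s) (a - b) - f' (q s) (c - d)) \<le> e * norm ((a - b) - (c - d)) + e * norm (p s -
        q s) * norm (c - d)"
      using norm_triangle_le[OF add_mono[OF bd[of "p s" "(a - b) - (c - d)"] lip[of "p s" "c - d" "q s"]]] by
          (simp only:)
    also have "norm (p s - q s) \<le> norm (a - c) + norm (b - d)"
    proof -
      have "p s - q s = s *\<^sub>R (a - c) + (1 - s) *\<^sub>R (b - d)" by (simp add: p_def q_def algebra_simps)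
      then have "norm (p s - q s) \<le> s * norm (a - c) + (1 - s) * norm (b - d)"
        using s norm_triangle_ineq[of "s *\<^sub>R (a - c)" "(1 - s) *\<^sub>R (b - d)"] by simp
      also have "\<dots> \<le> 1 * norm (a - c) + 1 * norm (b - d)" using s by (intro add_mono mult_right_mono) auto
      finally show ?thesis by simp
    qed
    finally have "norm (f' (p s) (a - b) - f' (q s) (c - d)) \<le> R"
      using \<open>0 \<le> e\<close> by (simp add: R_def algebra_simps mult_left_mono mult_right_mono)
    then have "norm (h *\<^sub>R (f' (p s) (a - b) - f' (q s) (c - d))) \<le> R * norm h" for h :: real
      using mult_left_mono[of "norm (f' (p s) (a - b) - f' (q s) (c - d))" R "\<bar>h\<bar>"] by (simp add:
          mult.commute)
    then show "onorm (\<lambda>h. h *\<^sub>R (f' (p s) (a - b) - f' (q s) (c - d))) \<le> R"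
      by (intro onorm_bound) (auto simp: R_def \<open>0 \<le> e\<close>)
  qed auto
  then show ?thesis by (simp add: g_def p_def q_def R_def algebra_simps)
qed

section \<open>Euler steps of rough differential equations\<close>

text \<open>Surplus powers of the length are absorbed into a constant; the base 1 + T \<ge> 1 makes
  one constant serve all surpluses up to 2, also for T < 1.\<close>

lemma powr_weaken:
  fixes x :: real
  assumes "0 < x" "x \<le> T" "q \<le> p" "p \<le> q + 2"
  shows "x powr p \<le> (1 + T)\<^sup>2 * x powr q"
proof -
  have "x powr p = x powr (p - q) * x powr q" by (simp add: powr_add[symmetric])
  also have "x powr (p - q) \<le> (1 + T) powr (p - q)" using assms by (intro powr_mono2) auto
  also have "(1 + T) powr (p - q) \<le> (1 + T) powr 2" using assms by (intro powr_mono) auto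
  also have "(1 + T) powr 2 = (1 + T)\<^sup>2" using assms by (simp add: powr_realpow)
  finally show ?thesis by (simp add: mult_right_mono)
qed

definition lip_hoelder :: "real \<Rightarrow> real \<Rightarrow> real \<Rightarrow> (real \<Rightarrow>
    'y::real_normed_vector \<Rightarrow> 'f::real_normed_vector) \<Rightarrow> bool" where
  "lip_hoelder T \<beta> B H \<longleftrightarrow>
     (\<forall>t y. 0 \<le> t \<and> t \<le> T \<longrightarrow> norm (H t y) \<le> B) \<and>
     (\<forall>t y z. 0 \<le> t \<and> t \<le> T \<longrightarrow> norm (H t y - H t z) \<le> B * norm (y - z)) \<and>
     (\<forall>s t y. 0 \<le> s \<and> s < t \<and> t \<le> T \<longrightarrow> norm (H t y - H s y) \<le> B *
         (t - s) powr \<beta>)"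

text \<open>Dg is an argument and enters only through Lipschitz and \<beta>-Hoelder bounds, so the
  predicate applies to \<sigma> and, one derivative higher, to D\<sigma> as well.\<close>

definition c12_bound :: "real \<Rightarrow> 'd path \<Rightarrow> real \<Rightarrow> real \<Rightarrow> real
    \<Rightarrow> (real \<Rightarrow> 'y::real_normed_vector \<Rightarrow> 'f::real_normed_vector) \<Rightarrow>
    (real \<Rightarrow> 'y \<Rightarrow> 'f^'d) \<Rightarrow> (real \<Rightarrow> 'y \<Rightarrow> 'y
        \<Rightarrow>\<^sub>L 'f) \<Rightarrow> bool" where
  "c12_bound T w \<alpha> \<beta> M g g' Dg \<longleftrightarrow>
     (\<forall>t y. 0 \<le> t \<and> t \<le> T \<longrightarrow> (g t has_derivative blinfun_apply (Dg t y))
         (at y) \<and> norm (g t y) \<le> M) \<and>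
     lip_hoelder T \<beta> M g' \<and> lip_hoelder T \<beta> M Dg \<and>
     (\<forall>s t y. 0 \<le> s \<and> s < t \<and> t \<le> T \<longrightarrow>
        norm (g t y - g s y - contract1 (w t - w s) (g' s y)) \<le> M * (t - s) powr (\<alpha> + \<beta>))"

lemma lip_hoelderD:
  assumes "lip_hoelder T \<beta> B H"
  shows "0 \<le> t \<Longrightarrow> t \<le> T \<Longrightarrow> norm (H t y) \<le> B"
    and "0 \<le> t \<Longrightarrow> t \<le> T \<Longrightarrow> norm (H t y - H t z) \<le> B * norm (y - z)"
    and "0 \<le> s \<Longrightarrow> s < t \<Longrightarrow> t \<le> T \<Longrightarrow> norm (H t y - H s y)
        \<le> B * (t - s) powr \<beta>"
  using assms unfolding lip_hoelder_def by auto

lemma c12_boundD: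
  assumes "c12_bound T w \<alpha> \<beta> M g g' Dg"
  shows "0 \<le> t \<Longrightarrow> t \<le> T \<Longrightarrow> (g t has_derivative blinfun_apply (Dg t y)) (at y)"
    and "0 \<le> t \<Longrightarrow> t \<le> T \<Longrightarrow> norm (g t y) \<le> M"
    and "lip_hoelder T \<beta> M g'" "lip_hoelder T \<beta> M Dg"
    and "0 \<le> s \<Longrightarrow> s < t \<Longrightarrow> t \<le> T \<Longrightarrow>
        norm (g t y - g s y - contract1 (w t - w s) (g' s y)) \<le> M * (t - s) powr (\<alpha> + \<beta>)"
  using assms unfolding c12_bound_def by auto

lemma lip_hoelder_add:
  assumes "lip_hoelder T \<beta> A G" "lip_hoelder T \<beta> B H"
  shows "lip_hoelder T \<beta> (A + B) (\<lambda>t y. G t y + H t y)"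
  unfolding lip_hoelder_def
proof (intro conjI allI impI)
  fix t y z assume "0 \<le> t \<and> t \<le> T"
  then show "norm (G t y + H t y) \<le> A + B"
    by (intro norm_triangle_le add_mono lip_hoelderD[OF assms(1)] lip_hoelderD[OF assms(2)]) auto
  have "norm ((G t y - G t z) + (H t y - H t z)) \<le> A * norm (y - z) + B * norm (y - z)"
    using \<open>0 \<le> t \<and> t \<le> T\<close>
    by (intro norm_triangle_le add_mono lip_hoelderD[OF assms(1)] lip_hoelderD[OF assms(2)]) auto
  then show "norm (G t y + H t y - (G t z + H t z)) \<le> (A + B) * norm (y - z)"
    by (simp add: algebra_simps)
next
  fix s t y assume "0 \<le> s \<and> s < t \<and> t \<le> T"
  then have "norm ((G t y - G s y) + (H t y - H s y)) \<le> A * (t - s) powr \<beta> + B * (t - s) powr \<beta>"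
    by (intro norm_triangle_le add_mono lip_hoelderD[OF assms(1)] lip_hoelderD[OF assms(2)]) auto
  then show "norm (G t y + H t y - (G s y + H s y)) \<le> (A + B) * (t - s) powr \<beta>"
    by (simp add: algebra_simps)
qed

lemma lip_hoelder_bilinear:
  fixes f :: "'a::real_normed_vector \<Rightarrow> 'b::real_normed_vector \<Rightarrow> 'c::real_normed_vector"
  assumes f: "bounded_bilinear f" and nf: "\<And>a b. norm (f a b) \<le> norm a * norm b"
    and G: "lip_hoelder T \<beta> A G" and H: "lip_hoelder T \<beta> B H" and AB: "0 \<le> A" "0 \<le> B"
  shows "lip_hoelder T \<beta> (2 * A * B) (\<lambda>t y. f (G t y) (H t y))"
proof -
  interpret bounded_bilinear f by (rule f)
  have le: "norm (f a b) \<le> x * y" if "norm a \<le> x" "norm b \<le> y" "0 \<le> x" for a b x y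
    using order_trans[OF nf mult_mono[OF that(1,2)]] that by simp
  have diff: "norm (f a b - f a' b') \<le> x * B + A * y" if "norm (a - a') \<le> x" "norm (b - b') \<le> y"
      "norm a' \<le> A" "norm b \<le> B" "0 \<le> x" for a b a' b' x y
  proof -
    have "f a b - f a' b' = f (a - a') b + f a' (b - b')" by (simp add: diff_left diff_right)
    then show ?thesis using that AB by (auto intro!: norm_triangle_le add_mono le)
  qed
  show ?thesis
    unfolding lip_hoelder_def
  proof (intro conjI allI impI)
    fix t y z assume t: "0 \<le> t \<and> t \<le> T"
    have "norm (f (G t y) (H t y)) \<le> A * B"
      using t AB by (intro le lip_hoelderD[OF G] lip_hoelderD[OF H]) auto
    also have "\<dots> \<le> 2 * A * B" using AB by simp
    finally show "norm (f (G t y) (H t y)) \<le> 2 * A * B" .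
    have "norm (f (G t y) (H t y) - f (G t z) (H t z)) \<le> A * norm (y - z) * B + A * (B * norm (y - z))"
      using t AB by (intro diff lip_hoelderD[OF G] lip_hoelderD[OF H]) auto
    then show "norm (f (G t y) (H t y) - f (G t z) (H t z)) \<le> 2 * A * B * norm (y - z)" by simp
  next
    fix s t y assume st: "0 \<le> s \<and> s < t \<and> t \<le> T"
    have "norm (f (G t y) (H t y) - f (G s y) (H s y)) \<le> A * (t - s) powr \<beta> * B + A * (B * (t - s)
        powr \<beta>)"
      using st AB by (intro diff lip_hoelderD[OF G] lip_hoelderD[OF H]) auto
    then show "norm (f (G t y) (H t y) - f (G s y) (H s y)) \<le> 2 * A * B * (t - s) powr \<beta>" by simp
  qed
qed

lemma lip_hoelder_mono: "lip_hoelder T \<beta> A G \<Longrightarrow> A \<le> B \<Longrightarrow> lip_hoelder T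
    \<beta> B G"
  unfolding lip_hoelder_def by (meson mult_right_mono norm_ge_zero order_trans powr_ge_zero)

text \<open>The path derivative of \<open>g t (Y t)\<close> when Y has derivative
  \<open>\<sigma> t (Y t)\<close>. Being a function of the current value alone, it lets the Euler
  step act on the state y without carrying a derivative along.\<close>

definition chain_coeff :: "(real \<Rightarrow> 'y::real_normed_vector \<Rightarrow> 'f::real_normed_vector^'d)
    \<Rightarrow> (real \<Rightarrow> 'y \<Rightarrow> 'y \<Rightarrow>\<^sub>L 'f) \<Rightarrow>
    (real \<Rightarrow> 'y \<Rightarrow> 'y^'d) \<Rightarrow> real \<Rightarrow> 'y \<Rightarrow> 'f^'d" where
  "chain_coeff g' Dg \<sigma> t y = g' t y + bmap (Dg t y) (\<sigma> t y)"

definition euler_step :: "'d path \<Rightarrow> (real \<Rightarrow> real \<Rightarrow> real^'d^'d)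
    \<Rightarrow> (real \<Rightarrow> 'e::real_normed_vector \<Rightarrow> 'e^'d) \<Rightarrow>
    (real \<Rightarrow> 'e \<Rightarrow> 'e^'d^'d) \<Rightarrow> (real \<Rightarrow> 'e \<Rightarrow> 'e)
        \<Rightarrow> real \<Rightarrow> real \<Rightarrow> 'e \<Rightarrow> 'e" where
  "euler_step w W \<sigma> c b s t y = y + contract1 (w t - w s) (\<sigma> s y) + contract2 (W s t) (c s y) +
      (t - s) *\<^sub>R b s y"

text \<open>The algebra behind every defect: Chen's relation splits contract1 v2 (contract1 v1 c)
  off the second level, which turns the increment a' - a into a first-order remainder. It serves the
  Euler step, its space derivative and the sums that define the integral.\<close>

lemma euler_composition:
  fixes W :: "real^'d^'d"
  assumes "W = W1 + W2 + outer v1 v2"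
    and "y' = y + contract1 v1 a + contract2 W1 c + r *\<^sub>R e"
  shows "y' + contract1 v2 a' + contract2 W2 c' + r' *\<^sub>R e' - (y + contract1 (v1 + v2) a + contract2 W c
      + (r + r') *\<^sub>R e)
    = contract1 v2 (a' - a - contract1 v1 c) + contract2 W2 (c' - c) + r' *\<^sub>R (e' - e)"
  unfolding assms
  by (simp add: contract1.add_left contract1.diff_right contract2.add_left contract2.diff_right contract2_outer
      scaleR_add_left scaleR_diff_right)

section \<open>The driver and the chain rule along it\<close>

locale driver =
  fixes T \<alpha> \<beta> M :: real and w :: "'d::finite path" and W :: "real \<Rightarrow> real \<Rightarrow>
      real^'d^'d"
  assumes T_pos: "0 < T" and \<alpha>: "1/3 < \<alpha>" "\<alpha> < 1/2" and \<beta>: "1 - 2 * \<alpha> <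
      \<beta>" "\<beta> \<le> \<alpha>" and M: "1 \<le> M"
    and w_bound: "\<And>s t. 0 \<le> s \<Longrightarrow> s < t \<Longrightarrow> t \<le> T \<Longrightarrow>
        norm (w t - w s) \<le> M * (t - s) powr \<alpha>"
    and W_bound: "\<And>s t. 0 \<le> s \<Longrightarrow> s < t \<Longrightarrow> t \<le> T \<Longrightarrow>
        norm (W s t) \<le> M * (t - s) powr (2 * \<alpha>)"
    and chen: "\<And>s r t. 0 \<le> s \<Longrightarrow> s < r \<Longrightarrow> r < t \<Longrightarrow> t \<le>
        T \<Longrightarrow>
      W s t = W s r + W r t + outer (w r - w s) (w t - w r)"
begin

definition P :: real where "P = (1 + T)\<^sup>2"

lemma P: "1 \<le> P" using T_pos by (simp add: P_def power2_eq_square algebra_simps)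

lemma \<beta>_pos: "0 < \<beta>" using \<alpha> \<beta> by simp

lemma weaken: "0 < x \<Longrightarrow> x \<le> T \<Longrightarrow> q \<le> p \<Longrightarrow> p \<le> q + 2
    \<Longrightarrow> x powr p \<le> P * x powr q"
  unfolding P_def by (rule powr_weaken)

text \<open>Four errors: the Taylor remainder in y, of order 2 \<alpha> \<ge> \<alpha> + \<beta>;
  the change of Dg in time against an increment of order \<alpha>; the part of y' - y not explained
  by w; and the remainder of g in time at fixed y.\<close>

lemma remainder_bound:
  assumes g: "c12_bound T w \<alpha> \<beta> M g g' Dg" and st: "0 \<le> s" "s < t" "t \<le> T" and B: "0 \<le> B"
    and u1: "norm (y' - y) \<le> B * (t - s) powr \<alpha>"
    and u2: "norm (y' - y - contract1 (w t - w s) v) \<le> B * (t - s) powr (\<alpha> + \<beta>)"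
  shows "norm (g t y' - g s y - contract1 (w t - w s) (g' s y + bmap (Dg s y) v)) \<le> (M + M * B * B * P + 2
      * M * B) * (t - s) powr (\<alpha> + \<beta>)"
proof -
  note D = c12_boundD[OF g]
  define h where "h = t - s"
  have h: "0 < h" "h \<le> T" using st by (auto simp: h_def)
  define u where "u = y' - y"
  have M0: "0 \<le> M" using M by simp
  have 1: "norm (g t y' - g t y - blinfun_apply (Dg t y) u) \<le> M * B * B * P * h powr (\<alpha> + \<beta>)"
  proof -
    have "norm (g t y' - g t y - blinfun_apply (Dg t y) u) \<le> M * (norm u)\<^sup>2"
      unfolding u_def using st M0 by (intro taylor_bound D lip_hoelderD[OF D(4)]) auto
    also have "\<dots> \<le> M * (B * h powr \<alpha>)\<^sup>2"
      using u1 M0 by (intro mult_left_mono power_mono) (auto simp: u_def h_def)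
    also have "(B * h powr \<alpha>)\<^sup>2 = B * B * h powr (2 * \<alpha>)"
      by (simp add: power2_eq_square powr_add[symmetric])
    also have "M * (B * B * h powr (2 * \<alpha>)) \<le> M * (B * B * (P * h powr (\<alpha> + \<beta>)))"
      using h \<alpha> \<beta> \<beta>_pos M0 B by (intro mult_left_mono weaken) auto
    finally show ?thesis by (simp add: mult_ac)
  qed
  have 2: "norm (blinfun_apply (Dg t y - Dg s y) u) \<le> M * B * h powr (\<alpha> + \<beta>)"
  proof -
    have "norm (blinfun_apply (Dg t y - Dg s y) u) \<le> norm (Dg t y - Dg s y) * norm u" by (rule norm_blinfun)
    also have "\<dots> \<le> (M * h powr \<beta>) * (B * h powr \<alpha>)"
      using lip_hoelderD(3)[OF D(4), of s t y] u1 st M0 by (intro mult_mono) (auto simp: u_def h_def)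
    finally show ?thesis by (simp add: powr_add mult_ac)
  qed
  have 3: "norm (blinfun_apply (Dg s y) (u - contract1 (w t - w s) v)) \<le> M * B * h powr (\<alpha> + \<beta>)"
  proof -
    have "norm (blinfun_apply (Dg s y) (u - contract1 (w t - w s) v)) \<le> norm (Dg s y) * norm (u - contract1
        (w t - w s) v)" by (rule norm_blinfun)
    also have "\<dots> \<le> M * (B * h powr (\<alpha> + \<beta>))"
      using lip_hoelderD(1)[OF D(4), of s y] u2 st M0 by (intro mult_mono) (auto simp: u_def h_def)
    finally show ?thesis by simp
  qed
  have 4: "norm (g t y - g s y - contract1 (w t - w s) (g' s y)) \<le> M * h powr (\<alpha> + \<beta>)"
    unfolding h_def by (rule D(5)) (use st in auto)
  have "g t y' - g s y - contract1 (w t - w s) (g' s y + bmap (Dg s y) v) =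
    (g t y' - g t y - blinfun_apply (Dg t y) u) + blinfun_apply (Dg t y - Dg s y) u
    + blinfun_apply (Dg s y) (u - contract1 (w t - w s) v) + (g t y - g s y - contract1 (w t - w s) (g' s y))"
    by (simp add: contract1.add_right contract1_bmap blinfun.bilinear_simps)
  also have "norm \<dots> \<le> M * B * B * P * h powr (\<alpha> + \<beta>) + M * B * h powr (\<alpha> +
      \<beta>) + M * B * h powr (\<alpha> + \<beta>) + M * h powr (\<alpha> + \<beta>)"
    by (intro norm_triangle_le[OF add_mono] 1 2 3 4)
  finally show ?thesis by (simp add: h_def algebra_simps)
qed

lemma lip_hoelder_shift:
  assumes H: "lip_hoelder T \<beta> B H" and st: "0 \<le> s" "s < t" "t \<le> T" and B: "0 \<le> B" "0 \<le> D"
    and u: "norm (y' - y) \<le> D * (t - s) powr \<alpha>"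
  shows "norm (H t y' - H s y) \<le> (B * D * P + B) * (t - s) powr \<beta>"
proof -
  have "norm (H t y' - H t y) \<le> B * norm (y' - y)" using st by (intro lip_hoelderD[OF H]) auto
  also have "\<dots> \<le> B * (D * (P * (t - s) powr \<beta>))"
  proof -
    have "(t - s) powr \<alpha> \<le> P * (t - s) powr \<beta>" using st \<alpha> \<beta> \<beta>_pos by (intro
        weaken) auto
    then show ?thesis using u B by (meson mult_left_mono order_trans)
  qed
  finally have 1: "norm (H t y' - H t y) \<le> B * (D * (P * (t - s) powr \<beta>))" .
  have 2: "norm (H t y - H s y) \<le> B * (t - s) powr \<beta>" using st by (intro lip_hoelderD[OF H]) auto
  have "norm ((H t y' - H t y) + (H t y - H s y)) \<le> B * (D * (P * (t - s) powr \<beta>)) + B * (t - s) powr \<beta>"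
    by (intro norm_triangle_le[OF add_mono] 1 2)
  then show ?thesis by (simp add: algebra_simps)
qed

text \<open>An increment of g in time is its first-order part, of order \<alpha> \<ge> \<beta>, plus
  the remainder; the Lipschitz bound in y comes from Dg.\<close>

lemma c12_lip_hoelder:
  assumes g: "c12_bound T w \<alpha> \<beta> M g g' Dg"
  shows "lip_hoelder T \<beta> (P * (M + M * M)) g"
  unfolding lip_hoelder_def
proof (intro conjI allI impI)
  note D = c12_boundD[OF g]
  have M0: "0 \<le> M" using M by simp
  have le: "M \<le> P * (M + M * M)" using mult_mono[of 1 P M "M + M * M"] M P by simp
  fix t y z assume t: "0 \<le> t \<and> t \<le> T"
  show "norm (g t y) \<le> P * (M + M * M)" using D(2)[of t y] t le by simp
  have "norm (g t y - g t z) \<le> M * norm (y - z)"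
  proof (rule differentiable_bound[where S = UNIV and f' = "\<lambda>x. blinfun_apply (Dg t x)"])
    show "onorm (blinfun_apply (Dg t x)) \<le> M" for x
      using lip_hoelderD(1)[OF D(4), of t x] t by (simp add: norm_blinfun.rep_eq)
  qed (use t D in auto)
  also have "\<dots> \<le> P * (M + M * M) * norm (y - z)" using le by (rule mult_right_mono) simp
  finally show "norm (g t y - g t z) \<le> P * (M + M * M) * norm (y - z)" .
next
  note D = c12_boundD[OF g]
  have M0: "0 \<le> M" using M by simp
  fix s t y assume st: "0 \<le> s \<and> s < t \<and> t \<le> T"
  have "norm (contract1 (w t - w s) (g' s y)) \<le> norm (w t - w s) * norm (g' s y)" by (rule norm_contract1_le)
  also have "\<dots> \<le> (M * (t - s) powr \<alpha>) * M"
    using st M0 by (intro mult_mono w_bound lip_hoelderD[OF D(3)]) auto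
  also have "\<dots> \<le> M * M * (P * (t - s) powr \<beta>)"
  proof -
    have "(t - s) powr \<alpha> \<le> P * (t - s) powr \<beta>" using st \<alpha> \<beta> \<beta>_pos by (intro
        weaken) auto
    then show ?thesis using M0 by (simp add: mult_left_mono mult_ac)
  qed
  finally have 1: "norm (contract1 (w t - w s) (g' s y)) \<le> M * M * (P * (t - s) powr \<beta>)" .
  have "norm (g t y - g s y - contract1 (w t - w s) (g' s y)) \<le> M * (t - s) powr (\<alpha> + \<beta>)"
    using st by (intro D) auto
  also have "\<dots> \<le> M * (P * (t - s) powr \<beta>)"
    using st \<alpha> \<beta> \<beta>_pos M0 by (intro mult_left_mono weaken) auto
  finally have 2: "norm (g t y - g s y - contract1 (w t - w s) (g' s y)) \<le> M * (P * (t - s) powr \<beta>)" .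
  have "norm ((g t y - g s y - contract1 (w t - w s) (g' s y)) + contract1 (w t - w s) (g' s y)) \<le> M * (P *
      (t - s) powr \<beta>) + M * M * (P * (t - s) powr \<beta>)"
    by (intro norm_triangle_le[OF add_mono] 1 2)
  then show "norm (g t y - g s y) \<le> P * (M + M * M) * (t - s) powr \<beta>" by (simp add: algebra_simps)
qed

end

lemma euler_step_expand:
  "euler_step w W \<sigma> c b s t y - y - contract1 (w t - w s) (\<sigma> s y) = contract2 (W s t) (c s y) +
      (t - s) *\<^sub>R b s y"
  by (simp add: euler_step_def)

locale rough_sde = driver T \<alpha> \<beta> M w W
  for T \<alpha> \<beta> M :: real and w :: "'d::finite path" and W +
  fixes \<sigma> :: "real \<Rightarrow> 'e::euclidean_space \<Rightarrow> 'e^'d" and \<sigma>' and D\<sigma>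
      and b :: "real \<Rightarrow> 'e \<Rightarrow> 'e"
  assumes \<sigma>: "c12_bound T w \<alpha> \<beta> M \<sigma> \<sigma>' D\<sigma>" and b: "lip_hoelder T \<beta> M b"
begin

abbreviation c :: "real \<Rightarrow> 'e \<Rightarrow> 'e^'d^'d" where "c \<equiv> chain_coeff \<sigma>'
    D\<sigma> \<sigma>"

abbreviation F :: "real \<Rightarrow> real \<Rightarrow> 'e \<Rightarrow> 'e" where "F \<equiv> euler_step w W
    \<sigma> c b"

end

section \<open>Orders of increments and defects\<close>

context driver
begin

text \<open>The constants depend on \<open>T\<close> and \<open>M\<close> only, so that equations with common
    bounds share them.\<close>
definition C2 :: real where "C2 = M + 2 * M * (P * (M + M * M))"
definition C3 :: real where "C3 = M * M + P * M * C2 + P * M"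
definition C4 :: real where "C4 = M + M * C3 * C3 * P + 2 * M * C3"
definition Kf :: real where "Kf = M * C4 + M * (C2 * C3 * P + C2) + P * (M * C3 * P + M)"

lemma C_nonneg: "0 \<le> C2" "0 \<le> C3" "0 \<le> C4" "0 \<le> Kf"
proof -
  have 0: "0 \<le> M" "0 \<le> P" using M P by auto
  then show 2: "0 \<le> C2" by (simp add: C2_def)
  with 0 show 3: "0 \<le> C3" by (simp add: C3_def)
  with 0 show 4: "0 \<le> C4" by (simp add: C4_def)
  show "0 \<le> Kf" unfolding Kf_def using 0 2 3 4 by simp
qed

text \<open>The common shape of the increments of the Euler step, of its differences and of its space
  derivative.\<close>
lemma increment_bound:
  assumes st: "0 \<le> s" "s < t" "t \<le> T"
    and x: "norm a \<le> A * n" "norm m \<le> C * n" "norm e \<le> B * n" and 0: "0 \<le> A" "0 \<le> C" "0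
        \<le> B" "0 \<le> n"
  shows "norm (contract2 (W s t) m + (t - s) *\<^sub>R e) \<le> (P * M * C + P * B) * (t - s) powr (\<alpha> +
      \<beta>) * n"
    and "norm (contract1 (w t - w s) a + contract2 (W s t) m + (t - s) *\<^sub>R e) \<le> (M * A + P * M * C +
        P * B) * (t - s) powr \<alpha> * n"
proof -
  define h where "h = t - s"
  have h: "0 < h" "h \<le> T" using st by (auto simp: h_def)
  have M0: "0 \<le> M" using M by simp
  have mcb: "norm (contract2 (W s t) m) \<le> P * M * C * h powr p * n" if p: "p \<le> 2 * \<alpha>" "0 \<le> p" for p
  proof -
    have "norm (contract2 (W s t) m) \<le> norm (W s t) * norm m" by (rule norm_contract2_le)
    also have "\<dots> \<le> (M * h powr (2 * \<alpha>)) * (C * n)"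
      using st M0 x 0 unfolding h_def by (intro mult_mono W_bound) auto
    also have "\<dots> \<le> (M * (P * h powr p)) * (C * n)"
      using h \<alpha> p M0 0 by (intro mult_right_mono mult_left_mono weaken) auto
    finally show ?thesis by (simp add: mult_ac)
  qed
  have eb: "norm (h *\<^sub>R e) \<le> P * B * h powr p * n" if p: "p \<le> 1" "0 \<le> p" for p
  proof -
    have "norm (h *\<^sub>R e) \<le> h powr 1 * (B * n)" using h x by (simp add: mult_left_mono)
    also have "\<dots> \<le> (P * h powr p) * (B * n)"
      using h p 0 by (intro mult_right_mono weaken) auto
    finally show ?thesis by (simp add: mult_ac)
  qed
  have vb: "norm (contract1 (w t - w s) a) \<le> M * A * h powr \<alpha> * n"
  proof -
    have "norm (contract1 (w t - w s) a) \<le> norm (w t - w s) * norm a" by (rule norm_contract1_le)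
    also have "\<dots> \<le> (M * h powr \<alpha>) * (A * n)"
      using st M0 x 0 unfolding h_def by (intro mult_mono w_bound) auto
    finally show ?thesis by (simp add: mult_ac)
  qed
  have "norm (contract2 (W s t) m + h *\<^sub>R e) \<le> P * M * C * h powr (\<alpha> + \<beta>) * n + P * B *
      h powr (\<alpha> + \<beta>) * n"
    using \<alpha> \<beta> \<beta>_pos by (intro norm_triangle_le[OF add_mono] mcb eb) auto
  then show "norm (contract2 (W s t) m + (t - s) *\<^sub>R e) \<le> (P * M * C + P * B) * (t - s) powr
      (\<alpha> + \<beta>) * n"
    by (simp add: h_def algebra_simps)
  have "norm (contract1 (w t - w s) a + contract2 (W s t) m + h *\<^sub>R e) \<le> M * A * h powr \<alpha> * n
      + P * M * C * h powr \<alpha> * n + P * B * h powr \<alpha> * n"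
    using \<alpha> \<beta> \<beta>_pos by (intro norm_triangle_le[OF add_mono] mcb eb vb) auto
  then show "norm (contract1 (w t - w s) a + contract2 (W s t) m + (t - s) *\<^sub>R e) \<le> (M * A + P * M *
      C + P * B) * (t - s) powr \<alpha> * n"
    by (simp add: h_def algebra_simps)
qed

text \<open>The common shape of the defect of the Euler step and of its space derivative.\<close>
lemma defect_bound:
  assumes st: "0 \<le> s" "s < r" "r < t" "t \<le> T"
    and x: "norm a \<le> A * (r - s) powr (\<alpha> + \<beta>) * n" "norm m \<le> C * (r - s) powr \<beta> * n"
        "norm e \<le> B * (r - s) powr \<beta> * n"
    and 0: "0 \<le> A" "0 \<le> C" "0 \<le> B" "0 \<le> n"
  shows "norm (contract1 (w t - w r) a + contract2 (W r t) m + (t - r) *\<^sub>R e) \<le> (M * A + M * C + P *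
      B) * (t - s) powr (2 * \<alpha> + \<beta>) * n"
proof -
  define h where "h = t - s"
  have h: "0 < h" "h \<le> T" "t - r \<le> h" "r - s \<le> h" using st by (auto simp: h_def)
  have M0: "0 \<le> M" using M by simp
  have pw: "(t - r) powr p \<le> h powr p" "(r - s) powr p \<le> h powr p" if "0 \<le> p" for p
    using h st that by (auto intro: powr_mono2)
  have "norm (contract1 (w t - w r) a) \<le> norm (w t - w r) * norm a" by (rule norm_contract1_le)
  also have "\<dots> \<le> (M * (t - r) powr \<alpha>) * (A * (r - s) powr (\<alpha> + \<beta>) * n)"
    using st M0 x 0 by (intro mult_mono w_bound) auto
  also have "\<dots> \<le> (M * h powr \<alpha>) * (A * h powr (\<alpha> + \<beta>) * n)"
    using M0 0 \<alpha> \<beta>_pos by (intro mult_mono pw) auto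
  also have "\<dots> = M * A * h powr (2 * \<alpha> + \<beta>) * n"
    using powr_add[of h \<alpha> "\<alpha> + \<beta>"] by (simp add: mult_ac)
  finally have 1: "norm (contract1 (w t - w r) a) \<le> M * A * h powr (2 * \<alpha> + \<beta>) * n" .
  have "norm (contract2 (W r t) m) \<le> norm (W r t) * norm m" by (rule norm_contract2_le)
  also have "\<dots> \<le> (M * (t - r) powr (2 * \<alpha>)) * (C * (r - s) powr \<beta> * n)"
    using st M0 x 0 by (intro mult_mono W_bound) auto
  also have "\<dots> \<le> (M * h powr (2 * \<alpha>)) * (C * h powr \<beta> * n)"
    using M0 0 \<alpha> \<beta>_pos by (intro mult_mono pw) auto
  also have "\<dots> = M * C * h powr (2 * \<alpha> + \<beta>) * n"
    by (simp add: mult_ac powr_add)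
  finally have 2: "norm (contract2 (W r t) m) \<le> M * C * h powr (2 * \<alpha> + \<beta>) * n" .
  have "norm ((t - r) *\<^sub>R e) = (t - r) * norm e" using st by simp
  also have "\<dots> \<le> h * (B * h powr \<beta> * n)"
  proof (rule mult_mono)
    have "B * (r - s) powr \<beta> * n \<le> B * h powr \<beta> * n"
      using 0 \<beta>_pos by (intro mult_right_mono mult_left_mono pw) auto
    then show "norm e \<le> B * h powr \<beta> * n" using x by simp
  qed (use h st in auto)
  also have "\<dots> = h powr (1 + \<beta>) * (B * n)" using h by (simp add: powr_add mult_ac)
  also have "\<dots> \<le> (P * h powr (2 * \<alpha> + \<beta>)) * (B * n)"
    using h \<alpha> 0 by (intro mult_right_mono weaken) auto
  finally have 3: "norm ((t - r) *\<^sub>R e) \<le> P * B * h powr (2 * \<alpha> + \<beta>) * n" by (simp add: mult_ac)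
  have "norm (contract1 (w t - w r) a + contract2 (W r t) m + (t - r) *\<^sub>R e) \<le> M * A * h powr (2 *
      \<alpha> + \<beta>) * n + M * C * h powr (2 * \<alpha> + \<beta>) * n + P * B * h powr (2 * \<alpha> +
      \<beta>) * n"
    by (intro norm_triangle_le[OF add_mono] 1 2 3)
  then show ?thesis by (simp add: h_def algebra_simps)
qed

end

section \<open>The Euler step as an almost flow\<close>

context rough_sde
begin

lemma M0: "0 \<le> M" using M by simp

lemma c_lip_hoelder: "lip_hoelder T \<beta> C2 c"
proof -
  have "0 \<le> P * (M + M * M)" using P M0 by simp
  then have "lip_hoelder T \<beta> (2 * M * (P * (M + M * M))) (\<lambda>t y. bmap (D\<sigma> t y) (\<sigma> t y))"
    by (intro lip_hoelder_bilinear[OF bmap.bounded_bilinear_axioms norm_bmap_le] c12_boundD[OF \<sigma>]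
        c12_lip_hoelder[OF \<sigma>] M0)
  from lip_hoelder_add[OF c12_boundD(3)[OF \<sigma>] this] show ?thesis
    by (simp add: C2_def chain_coeff_def[abs_def])
qed

lemma \<sigma>_lip: "0 \<le> t \<Longrightarrow> t \<le> T \<Longrightarrow> norm (\<sigma> t y - \<sigma> t z)
    \<le> M * norm (y - z)"
proof (rule differentiable_bound[where S = UNIV and f' = "\<lambda>x. blinfun_apply (D\<sigma> t x)"])
  assume t: "0 \<le> t" "t \<le> T"
  show "onorm (blinfun_apply (D\<sigma> t x)) \<le> M" for x
    using lip_hoelderD(1)[OF c12_boundD(4)[OF \<sigma>], of t x] t by (simp add: norm_blinfun.rep_eq)
  show "(\<sigma> t has_derivative blinfun_apply (D\<sigma> t x)) (at x within UNIV)" for x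
    using c12_boundD(1)[OF \<sigma>] t by simp
qed auto

text \<open>The second bound says that a single step moves y like a path controlled by w with
  derivative \<sigma>; the two bounds together are what \<open>remainder_bound\<close> asks of y' -
  y.\<close>

lemma F_dev:
  assumes st: "0 \<le> s" "s < t" "t \<le> T"
  shows "norm (F s t y - y) \<le> C3 * (t - s) powr \<alpha>"
    and "norm (F s t y - y - contract1 (w t - w s) (\<sigma> s y)) \<le> C3 * (t - s) powr (\<alpha> + \<beta>)"
proof -
  have b: "norm (\<sigma> s y) \<le> M * 1" "norm (c s y) \<le> C2 * 1" "norm (b s y) \<le> M * 1"
    using c12_boundD(2)[OF \<sigma>, of s y] lip_hoelderD(1)[OF c_lip_hoelder, of s y] lip_hoelderD(1)[OF b, of
        s y] st by auto
  show "norm (F s t y - y) \<le> C3 * (t - s) powr \<alpha>"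
    using increment_bound(2)[OF st b] M0 C_nonneg by (simp add: euler_step_def C3_def)
  have "norm (F s t y - y - contract1 (w t - w s) (\<sigma> s y)) \<le> (P * M * C2 + P * M) * (t - s) powr
      (\<alpha> + \<beta>) * 1"
    unfolding euler_step_expand using M0 C_nonneg by (intro increment_bound(1)[OF st b]) auto
  also have "\<dots> \<le> C3 * (t - s) powr (\<alpha> + \<beta>)"
    using M0 by (auto simp: C3_def intro!: mult_right_mono)
  finally show "norm (F s t y - y - contract1 (w t - w s) (\<sigma> s y)) \<le> C3 * (t - s) powr (\<alpha> +
      \<beta>)" .
qed

lemma F_lip:
  assumes st: "0 \<le> s" "s < t" "t \<le> T"
  shows "norm ((F s t y - y) - (F s t z - z)) \<le> C3 * (t - s) powr \<alpha> * norm (y - z)"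
proof -
  have b: "norm (\<sigma> s y - \<sigma> s z) \<le> M * norm (y - z)" "norm (c s y - c s z) \<le> C2 * norm (y - z)"
      "norm (b s y - b s z) \<le> M * norm (y - z)"
    using \<sigma>_lip[of s y z] lip_hoelderD(2)[OF c_lip_hoelder, of s y z] lip_hoelderD(2)[OF b, of s y z] st by auto
  have "(F s t y - y) - (F s t z - z) = contract1 (w t - w s) (\<sigma> s y - \<sigma> s z) + contract2 (W s t)
      (c s y - c s z) + (t - s) *\<^sub>R (b s y - b s z)"
    by (simp add: euler_step_def contract1.diff_right contract2.diff_right scaleR_diff_right)
  also have "norm \<dots> \<le> (M * M + P * M * C2 + P * M) * (t - s) powr \<alpha> * norm (y - z)"
    using M0 C_nonneg by (intro increment_bound(2)[OF st b]) auto
  finally show ?thesis by (simp add: C3_def)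
qed

lemma F_defect_eq:
  assumes st: "0 \<le> s" "s < r" "r < t" "t \<le> T"
  shows "F r t (F s r y) - F s t y = contract1 (w t - w r) (\<sigma> r (F s r y) - \<sigma> s y - contract1 (w
      r - w s) (c s y))
     + contract2 (W r t) (c r (F s r y) - c s y) + (t - r) *\<^sub>R (b r (F s r y) - b s y)"
  using euler_composition[OF chen[OF st] euler_step_def[of w W \<sigma> c b s r y],
    where a' = "\<sigma> r (F s r y)" and c' = "c r (F s r y)" and r' = "t - r" and e' = "b r (F s r y)"]
  by (simp add: euler_step_def[of w W \<sigma> c b r t] euler_step_def[of w W \<sigma> c b s t])

lemma \<sigma>_remainder:
  assumes st: "0 \<le> s" "s < t" "t \<le> T" and B: "0 \<le> B"
    and u1: "norm (y' - y) \<le> B * (t - s) powr \<alpha>"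
    and u2: "norm (y' - y - contract1 (w t - w s) (\<sigma> s y)) \<le> B * (t - s) powr (\<alpha> + \<beta>)"
  shows "norm (\<sigma> t y' - \<sigma> s y - contract1 (w t - w s) (c s y)) \<le> (M + M * B * B * P + 2 * M *
      B) * (t - s) powr (\<alpha> + \<beta>)"
  unfolding chain_coeff_def by (rule remainder_bound[OF \<sigma> assms])

text \<open>Orders \<alpha>, 2 \<alpha> and 1 of the driver meet orders \<alpha> + \<beta>, \<beta>
  and \<beta> of the coefficients; the last product is of order 1 + \<beta> > 2 \<alpha> + \<beta>
  as \<alpha> < 1/2.\<close>

lemma F_defect:
  assumes st: "0 \<le> s" "s < r" "r < t" "t \<le> T"
  shows "norm (F r t (F s r y) - F s t y) \<le> Kf * (t - s) powr (2 * \<alpha> + \<beta>)"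
proof -
  have sr: "0 \<le> s" "s < r" "r \<le> T" using st by auto
  note dev = F_dev[OF sr, of y]
  have 1: "norm (\<sigma> r (F s r y) - \<sigma> s y - contract1 (w r - w s) (c s y)) \<le> C4 * (r - s) powr
      (\<alpha> + \<beta>) * 1"
    using \<sigma>_remainder[OF sr C_nonneg(2) dev] by (simp add: C4_def)
  have 2: "norm (c r (F s r y) - c s y) \<le> (C2 * C3 * P + C2) * (r - s) powr \<beta> * 1"
    using lip_hoelder_shift[OF c_lip_hoelder sr C_nonneg(1,2) dev(1)] by simp
  have 3: "norm (b r (F s r y) - b s y) \<le> (M * C3 * P + M) * (r - s) powr \<beta> * 1"
    using lip_hoelder_shift[OF b sr M0 C_nonneg(2) dev(1)] by simp
  have "norm (F r t (F s r y) - F s t y) \<le> (M * C4 + M * (C2 * C3 * P + C2) + P * (M * C3 * P + M)) * (t -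
      s) powr (2 * \<alpha> + \<beta>) * 1"
    unfolding F_defect_eq[OF st] using M0 C_nonneg P by (intro defect_bound[OF st 1 2 3]) auto
  then show ?thesis by (simp add: Kf_def)
qed

sublocale almost_flow T Kf C3 "2 * \<alpha> + \<beta>" \<alpha> F
  using T_pos C_nonneg \<alpha> \<beta> \<beta>_pos F_dev(1) F_lip F_defect by unfold_locales auto

end

section \<open>Smoothness of the Euler step in space\<close>

lemma has_derivative_vmap:
  fixes f :: "'a::real_normed_vector \<Rightarrow> 'b::real_normed_vector^'d"
  assumes "\<And>j. ((\<lambda>y. f y $ j) has_derivative blinfun_apply (B $ j)) (at x)"
  shows "(f has_derivative vmap B) (at x)"
  unfolding has_derivative_def
proof
  show "bounded_linear (vmap B)" by (rule vmap.bounded_linear_right)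
  show "((\<lambda>y. (f y - f (Lim (at x) (\<lambda>x. x)) - vmap B (y - Lim (at x) (\<lambda>x. x)))
      /\<^sub>R norm (y - Lim (at x) (\<lambda>x. x))) \<longlongrightarrow> 0) (at x)"
    by (rule vec_tendstoI) (use assms in \<open>simp add: has_derivative_def vmap_def\<close>)
qed

lemma lip_hoelder_apply:
  assumes f: "bounded_bilinear f" and nf: "\<And>a b. norm (f a b) \<le> norm a * norm b" and G: "lip_hoelder T
      \<beta> A G"
  shows "lip_hoelder T \<beta> (A * norm h) (\<lambda>t y. f (G t y) h)"
proof -
  interpret bounded_bilinear f by (rule f)
  have le: "norm (f a h) \<le> x * norm h" if "norm a \<le> x" for a x
    using order_trans[OF nf mult_right_mono[OF that]] by simp
  have diff: "norm (f a h - f b h) \<le> x * norm h" if "norm (a - b) \<le> x" for a b x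
    using le[OF that] by (simp add: diff_left)
  show ?thesis
    unfolding lip_hoelder_def
  proof (intro conjI allI impI)
    fix t y z assume t: "0 \<le> t \<and> t \<le> T"
    then show "norm (f (G t y) h) \<le> A * norm h" by (intro le lip_hoelderD[OF G]) auto
    have "norm (f (G t y) h - f (G t z) h) \<le> A * norm (y - z) * norm h"
      using t by (intro diff lip_hoelderD[OF G]) auto
    then show "norm (f (G t y) h - f (G t z) h) \<le> A * norm h * norm (y - z)" by (simp add: mult_ac)
  next
    fix s t y assume st: "0 \<le> s \<and> s < t \<and> t \<le> T"
    have "norm (f (G t y) h - f (G s y) h) \<le> A * (t - s) powr \<beta> * norm h"
      using st by (intro diff lip_hoelderD[OF G]) auto
    then show "norm (f (G t y) h - f (G s y) h) \<le> A * norm h * (t - s) powr \<beta>" by (simp add: mult_ac)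
  qed
qed

lemmas lip_hoelder_blinfun = lip_hoelder_apply[OF bounded_bilinear_blinfun_apply norm_blinfun]

text \<open>The same \<sigma>1' is the path derivative of D\<sigma> and, by
  \<open>\<sigma>'_deriv\<close>, the space derivative of \<sigma>': the two differentiations
  commute. This lets the space derivative of c appear in the remainder of D\<sigma> along the
  flow.\<close>

locale smooth_sde = rough_sde +
  fixes \<sigma>1' D2\<sigma> Db
  assumes D\<sigma>: "c12_bound T w \<alpha> \<beta> M D\<sigma> \<sigma>1' D2\<sigma>"
    and \<sigma>'_deriv: "\<And>t y j. 0 \<le> t \<Longrightarrow> t \<le> T \<Longrightarrow> ((\<lambda>y.
        \<sigma>' t y $ j) has_derivative blinfun_apply (\<sigma>1' t y $ j)) (at y)"
    and b_deriv: "\<And>t y. 0 \<le> t \<Longrightarrow> t \<le> T \<Longrightarrow> (b t has_derivative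
        blinfun_apply (Db t y)) (at y)"
    and Db: "lip_hoelder T \<beta> M Db"
begin

definition Dc where
  "Dc t y h = vmap (\<sigma>1' t y) h + bmap (blinfun_apply (D2\<sigma> t y) h) (\<sigma> t y) + bmap
      (D\<sigma> t y) (blinfun_apply (D\<sigma> t y) h)"

text \<open>C5 bounds the space derivative of c, C6 the deviation of DF from the identity, N1 the
  operator norm of DF, C7 the remainder of D\<sigma> along the flow, and K2 is the Lipschitz
  constant of the defect.\<close>

definition C5 :: real where "C5 = M + 2 * M * (P * (M + M * M)) + 2 * M * M"
definition C6 :: real where "C6 = M * M + P * M * C5 + P * M"
definition N1 :: real where "N1 = 1 + C6 * P"
definition C7 :: real where "C7 = C4 + (M * C3 * P + M) * M * M + M * C6"
definition shift_const :: "real \<Rightarrow> real" where "shift_const B = B * N1 * C3 * P + B * N1 + B * C6 * P"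
definition K2 :: real where "K2 = M * C7 + M * shift_const C5 + P * shift_const M"

lemma C56_nonneg: "0 \<le> C5" "0 \<le> C6" "0 \<le> N1" "0 \<le> C7" "0 \<le> B \<Longrightarrow> 0 \<le>
    shift_const B" "0 \<le> K2"
proof -
  note 0 = M0 order_trans[OF zero_le_one P] C_nonneg
  show 5: "0 \<le> C5" using 0 by (simp add: C5_def)
  with 0 show 6: "0 \<le> C6" by (simp add: C6_def)
  with 0 show 1: "0 \<le> N1" by (simp add: N1_def)
  with 0 6 show 7: "0 \<le> C7" by (simp add: C7_def)
  show s: "0 \<le> shift_const B" if "0 \<le> B" for B
    unfolding shift_const_def using 0 6 1 that by simp
  show "0 \<le> K2" unfolding K2_def using 0 7 s[OF 5] s[OF M0] by simp
qed

text \<open>This is again a second-order Euler step, with state h, of the equation linearised at y.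
  Hence the increment bounds and the defect algebra of F apply to it unchanged.\<close>

definition DF where
  "DF s t y h = h + contract1 (w t - w s) (blinfun_apply (D\<sigma> s y) h) + contract2 (W s t) (Dc s y h) + (t
      - s) *\<^sub>R blinfun_apply (Db s y) h"

lemma c_deriv:
  assumes "0 \<le> t" "t \<le> T"
  shows "(c t has_derivative Dc t y) (at y)"
proof -
  have "(\<sigma>' t has_derivative vmap (\<sigma>1' t y)) (at y)"
    using \<sigma>'_deriv[OF assms] by (rule has_derivative_vmap)
  moreover have "((\<lambda>y. bmap (D\<sigma> t y) (\<sigma> t y)) has_derivative
      (\<lambda>h. bmap (D\<sigma> t y) (blinfun_apply (D\<sigma> t y) h) + bmap (blinfun_apply (D2\<sigma> t
          y) h) (\<sigma> t y))) (at y)"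
    using c12_boundD(1)[OF \<sigma> assms] c12_boundD(1)[OF D\<sigma> assms] by (intro bmap.FDERIV)
  ultimately show ?thesis
    unfolding chain_coeff_def[abs_def] Dc_def[abs_def]
    by (rule has_derivative_eq_rhs[OF has_derivative_add]) (simp add: algebra_simps)
qed

lemma Dc_linear: "0 \<le> t \<Longrightarrow> t \<le> T \<Longrightarrow> linear (Dc t y)"
  using c_deriv has_derivative_linear by blast

lemma Dc_lip_hoelder: "lip_hoelder T \<beta> (C5 * norm h) (\<lambda>t y. Dc t y h)"
proof -
  have 0: "0 \<le> P * (M + M * M)" using P M0 by simp
  have 1: "lip_hoelder T \<beta> (M * norm h) (\<lambda>t y. vmap (\<sigma>1' t y) h)"
    by (intro lip_hoelder_apply[OF vmap.bounded_bilinear_axioms norm_vmap_le] c12_boundD[OF D\<sigma>])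
  have 2: "lip_hoelder T \<beta> (2 * (M * norm h) * (P * (M + M * M))) (\<lambda>t y. bmap (blinfun_apply
      (D2\<sigma> t y) h) (\<sigma> t y))"
    using M0 0 by (intro lip_hoelder_bilinear[OF bmap.bounded_bilinear_axioms norm_bmap_le] c12_lip_hoelder[OF \<sigma>]
       lip_hoelder_blinfun c12_boundD[OF D\<sigma>]) auto
  have 3: "lip_hoelder T \<beta> (2 * M * (M * norm h)) (\<lambda>t y. bmap (D\<sigma> t y) (blinfun_apply
      (D\<sigma> t y) h))"
    using M0 by (intro lip_hoelder_bilinear[OF bmap.bounded_bilinear_axioms norm_bmap_le]
       lip_hoelder_blinfun c12_boundD[OF \<sigma>]) auto
  from lip_hoelder_add[OF lip_hoelder_add[OF 1 2] 3] show ?thesis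
    by (simp add: Dc_def C5_def algebra_simps)
qed

lemma F_deriv:
  assumes "0 \<le> s" "s \<le> T"
  shows "(F s t has_derivative DF s t y) (at y)"
  unfolding euler_step_def[abs_def] DF_def[abs_def]
  by (intro has_derivative_add has_derivative_ident bounded_linear.has_derivative[OF contract1.bounded_linear_right]
    bounded_linear.has_derivative[OF contract2.bounded_linear_right] bounded_linear.has_derivative[OF
        bounded_linear_scaleR_right]
    c12_boundD(1)[OF \<sigma>] c_deriv b_deriv assms)

lemma DF_bounds:
  assumes st: "0 \<le> s" "s < t" "t \<le> T"
  shows "norm (DF s t y h - h) \<le> C6 * (t - s) powr \<alpha> * norm h"
    and "norm (DF s t y h - h - (DF s t z h - h)) \<le> C6 * (t - s) powr \<alpha> * norm (y - z) * norm h"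
    and "norm (DF s t y h - h - contract1 (w t - w s) (blinfun_apply (D\<sigma> s y) h)) \<le> C6 * (t - s)
        powr (\<alpha> + \<beta>) * norm h"
proof -
  have s: "0 \<le> s" "s \<le> T" using st by auto
  note LD = lip_hoelder_blinfun[OF c12_boundD(4)[OF \<sigma>]] and LB = lip_hoelder_blinfun[OF Db]
  have b: "norm (blinfun_apply (D\<sigma> s y) h) \<le> M * norm h" "norm (Dc s y h) \<le> C5 * norm h" "norm
      (blinfun_apply (Db s y) h) \<le> M * norm h"
    using lip_hoelderD(1)[OF LD s] lip_hoelderD(1)[OF Dc_lip_hoelder s] lip_hoelderD(1)[OF LB s] by auto
  show "norm (DF s t y h - h) \<le> C6 * (t - s) powr \<alpha> * norm h"
    using increment_bound(2)[OF st b] M0 C56_nonneg by (simp add: DF_def C6_def)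
  have "norm (contract2 (W s t) (Dc s y h) + (t - s) *\<^sub>R blinfun_apply (Db s y) h) \<le> (P * M * C5 + P
      * M) * (t - s) powr (\<alpha> + \<beta>) * norm h"
    using M0 C56_nonneg by (intro increment_bound(1)[OF st b]) auto
  also have "\<dots> \<le> C6 * (t - s) powr (\<alpha> + \<beta>) * norm h"
    using M0 by (auto simp: C6_def intro!: mult_right_mono)
  finally show "norm (DF s t y h - h - contract1 (w t - w s) (blinfun_apply (D\<sigma> s y) h)) \<le> C6 * (t -
      s) powr (\<alpha> + \<beta>) * norm h"
    by (simp add: DF_def)
  have b2: "norm (blinfun_apply (D\<sigma> s y) h - blinfun_apply (D\<sigma> s z) h) \<le> M * (norm (y - z) * norm h)"
    "norm (Dc s y h - Dc s z h) \<le> C5 * (norm (y - z) * norm h)"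
    "norm (blinfun_apply (Db s y) h - blinfun_apply (Db s z) h) \<le> M * (norm (y - z) * norm h)"
    using lip_hoelderD(2)[OF LD s] lip_hoelderD(2)[OF Dc_lip_hoelder s] lip_hoelderD(2)[OF LB s] by (auto simp: mult_ac)
  have "DF s t y h - h - (DF s t z h - h) = contract1 (w t - w s) (blinfun_apply (D\<sigma> s y) h -
      blinfun_apply (D\<sigma> s z) h)
     + contract2 (W s t) (Dc s y h - Dc s z h) + (t - s) *\<^sub>R (blinfun_apply (Db s y) h - blinfun_apply
         (Db s z) h)"
    by (simp add: DF_def contract1.diff_right contract2.diff_right scaleR_diff_right)
  also have "norm \<dots> \<le> (M * M + P * M * C5 + P * M) * (t - s) powr \<alpha> * (norm (y - z) * norm h)"
    using M0 C56_nonneg by (intro increment_bound(2)[OF st b2]) auto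
  finally show "norm (DF s t y h - h - (DF s t z h - h)) \<le> C6 * (t - s) powr \<alpha> * norm (y - z) * norm h"
    by (simp add: C6_def mult_ac)
qed

lemma F_lip2:
  assumes st: "0 \<le> s" "s < t" "t \<le> T"
  shows "norm ((F s t a - a) - (F s t b' - b') - ((F s t c' - c') - (F s t d - d)))
     \<le> C6 * (t - s) powr \<alpha> * (norm ((a - b') - (c' - d)) + (norm (a - c') + norm (b' - d)) * norm (c' - d))"
proof (rule second_difference_bound[where f' = "\<lambda>y h. DF s t y h - h"])
  show "((\<lambda>y. F s t y - y) has_derivative (\<lambda>h. DF s t y h - h)) (at y)" for y
    using st by (intro has_derivative_diff F_deriv has_derivative_ident) auto
qed (use DF_bounds[OF st] C56_nonneg in auto)

text \<open>The base point moves along F and the argument h along DF. The first change is covered by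
  the Hoelder and Lipschitz bounds of H at fixed argument, the second by linearity of H and
  closeness of DF to the identity.\<close>

lemma operator_shift:
  assumes H: "\<And>h. lip_hoelder T \<beta> (B * norm h) (\<lambda>t y. H t y h)" and lin: "linear (H s y)"
      and B: "0 \<le> B"
    and st: "0 \<le> s" "s < t" "t \<le> T"
  shows "norm (H t (F s t y) (DF s t y h) - H s y h) \<le> shift_const B * (t - s) powr \<beta> * norm h"
proof -
  define h' where "h' = DF s t y h"
  note P0 = order_trans[OF zero_le_one P]
  have d: "norm (h' - h) \<le> C6 * (P * (t - s) powr \<beta>) * norm h"
  proof -
    have "norm (h' - h) \<le> C6 * (t - s) powr \<alpha> * norm h" unfolding h'_def by (rule DF_bounds[OF st])
    also have "\<dots> \<le> C6 * (P * (t - s) powr \<beta>) * norm h"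
      using st \<alpha> \<beta> \<beta>_pos C56_nonneg by (intro mult_right_mono mult_left_mono weaken) auto
    finally show ?thesis .
  qed
  have h': "norm h' \<le> N1 * norm h"
  proof -
    have "norm h' \<le> norm (h' - h) + norm h" using norm_triangle_sub[of h' h] by simp
    also have "norm (h' - h) \<le> C6 * (t - s) powr \<alpha> * norm h" unfolding h'_def by (rule DF_bounds[OF st])
    also have "\<dots> \<le> C6 * (P * (t - s) powr 0) * norm h"
      using st \<alpha> C56_nonneg by (intro mult_right_mono mult_left_mono weaken) auto
    finally show ?thesis using st by (simp add: N1_def algebra_simps)
  qed
  have "norm (H t (F s t y) h' - H s y h') \<le> (B * norm h' * C3 * P + B * norm h') * (t - s) powr \<beta>"
    using B C_nonneg by (intro lip_hoelder_shift[OF H st] F_dev(1)[OF st]) auto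
  also have "\<dots> = (B * C3 * P + B) * (t - s) powr \<beta> * norm h'" by (simp add: algebra_simps)
  also have "\<dots> \<le> (B * C3 * P + B) * (t - s) powr \<beta> * (N1 * norm h)"
    using h' B C_nonneg P0 by (intro mult_left_mono) auto
  finally have 1: "norm (H t (F s t y) h' - H s y h') \<le> (B * C3 * P + B) * (t - s) powr \<beta> * (N1 * norm h)" .
  have "norm (H s y (h' - h)) \<le> B * norm (h' - h)" using st by (intro lip_hoelderD[OF H]) auto
  also have "\<dots> \<le> B * (C6 * (P * (t - s) powr \<beta>) * norm h)" using d B by (rule mult_left_mono)
  finally have 2: "norm (H s y h' - H s y h) \<le> B * (C6 * (P * (t - s) powr \<beta>) * norm h)" by (simp
      add: linear_diff[OF lin])
  have "norm ((H t (F s t y) h' - H s y h') + (H s y h' - H s y h))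
     \<le> (B * C3 * P + B) * (t - s) powr \<beta> * (N1 * norm h) + B * (C6 * (P * (t - s) powr \<beta>) * norm h)"
    by (intro norm_triangle_le[OF add_mono] 1 2)
  then show ?thesis by (simp add: h'_def shift_const_def algebra_simps)
qed

text \<open>Symmetry of the second derivative makes the chain-rule derivative of \<open>D\<sigma>\<close> along
    the solution
  appear in the space derivative of the chain-rule derivative of \<open>\<sigma>\<close>.\<close>
lemma D\<sigma>_remainder:
  assumes st: "0 \<le> s" "s < t" "t \<le> T"
  shows "norm (blinfun_apply (D\<sigma> t (F s t y)) (DF s t y h) - blinfun_apply (D\<sigma> s y) h - contract1
      (w t - w s) (Dc s y h))
    \<le> C7 * (t - s) powr (\<alpha> + \<beta>) * norm h"
proof -
  have s: "0 \<le> s" "s \<le> T" and t: "0 \<le> t" "t \<le> T" using st by auto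
  define y' where "y' = F s t y"
  define h' where "h' = DF s t y h"
  define v where "v = w t - w s"
  define k where "k = (t - s) powr (\<alpha> + \<beta>)"
  define R where "R = D\<sigma> t y' - D\<sigma> s y - contract1 v (\<sigma>1' s y + bmap (D2\<sigma> s y)
      (\<sigma> s y))"
  have sym: "blinfun_apply (blinfun_apply (D2\<sigma> s y) u) v = blinfun_apply (blinfun_apply (D2\<sigma> s y)
      v) u" for u v
    by (rule symmetric_second_derivative_lipschitz[OF c12_boundD(1)[OF \<sigma> s] c12_boundD(1)[OF D\<sigma> s]
      lip_hoelderD(2)[OF c12_boundD(4)[OF D\<sigma>] s] M0])
  have "norm R \<le> C4 * k"
    unfolding R_def v_def k_def C4_def y'_def using remainder_bound[OF D\<sigma> st C_nonneg(2) F_dev[OF st]] by simp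
  then have 1: "norm (blinfun_apply R h) \<le> C4 * k * norm h"
    using norm_blinfun[of R h] mult_right_mono[of "norm R" "C4 * k" "norm h"] by simp
  have 2: "norm (blinfun_apply (D\<sigma> t y' - D\<sigma> s y) (contract1 v (blinfun_apply (D\<sigma> s y)
      h))) \<le> (M * C3 * P + M) * M * M * k * norm h"
  proof -
    have a: "norm (D\<sigma> t y' - D\<sigma> s y) \<le> (M * C3 * P + M) * (t - s) powr \<beta>"
      unfolding y'_def using M0 C_nonneg by (intro lip_hoelder_shift[OF c12_boundD(4)[OF \<sigma>] st]
          F_dev(1)[OF st]) auto
    have "norm (contract1 v (blinfun_apply (D\<sigma> s y) h)) \<le> norm v * norm (blinfun_apply (D\<sigma> s
        y) h)" by (rule norm_contract1_le)
    also have "\<dots> \<le> (M * (t - s) powr \<alpha>) * (M * norm h)"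
      unfolding v_def using M0 st
      by (intro mult_mono w_bound lip_hoelderD(1)[OF lip_hoelder_blinfun[OF c12_boundD(4)[OF \<sigma>]] s]) auto
    finally have b: "norm (contract1 v (blinfun_apply (D\<sigma> s y) h)) \<le> (M * (t - s) powr \<alpha>) *
        (M * norm h)" .
    have "norm (blinfun_apply (D\<sigma> t y' - D\<sigma> s y) (contract1 v (blinfun_apply (D\<sigma> s y) h)))
       \<le> norm (D\<sigma> t y' - D\<sigma> s y) * norm (contract1 v (blinfun_apply (D\<sigma> s y) h))" by
           (rule norm_blinfun)
    also have "\<dots> \<le> ((M * C3 * P + M) * (t - s) powr \<beta>) * ((M * (t - s) powr \<alpha>) * (M * norm h))"
      using a b order_trans[OF norm_ge_zero a] by (intro mult_mono) auto
    finally show ?thesis by (simp add: k_def powr_add mult_ac)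
  qed
  have 3: "norm (blinfun_apply (D\<sigma> t y') (h' - h - contract1 v (blinfun_apply (D\<sigma> s y) h))) \<le>
      M * C6 * k * norm h"
  proof -
    have "norm (blinfun_apply (D\<sigma> t y') (h' - h - contract1 v (blinfun_apply (D\<sigma> s y) h))) \<le>
        M * norm (h' - h - contract1 v (blinfun_apply (D\<sigma> s y) h))"
      by (rule lip_hoelderD(1)[OF lip_hoelder_blinfun[OF c12_boundD(4)[OF \<sigma>]] t])
    also have "\<dots> \<le> M * (C6 * k * norm h)"
      unfolding h'_def v_def k_def by (intro mult_left_mono DF_bounds[OF st] M0)
    finally show ?thesis by (simp add: mult_ac)
  qed
  have swap: "vmap (bmap (D2\<sigma> s y) (\<sigma> s y)) h = bmap (blinfun_apply (D2\<sigma> s y) h) (\<sigma> s y)"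
    by (simp add: vmap_def bmap_def vec_eq_iff sym)
  \<comment> \<open>A product rule: the remainder R of D\<sigma> applied to h, the increment of
    D\<sigma> on the first-order part of h' - h, and D\<sigma> on what is left of h' - h.\<close>
  have "blinfun_apply (D\<sigma> t y') h' - blinfun_apply (D\<sigma> s y) h - contract1 v (Dc s y h)
    = blinfun_apply R h + blinfun_apply (D\<sigma> t y' - D\<sigma> s y) (contract1 v (blinfun_apply (D\<sigma> s y) h))
      + blinfun_apply (D\<sigma> t y') (h' - h - contract1 v (blinfun_apply (D\<sigma> s y) h))"
    by (simp add: R_def Dc_def blinfun.bilinear_simps blinfun_contract1 vmap.add_left contract1.add_right swap
        contract1_bmap
      sym[of h "contract1 v (\<sigma> s y)"])
  also have "norm \<dots> \<le> C4 * k * norm h + (M * C3 * P + M) * M * M * k * norm h + M * C6 * k * norm h"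
    by (intro norm_triangle_le[OF add_mono] 1 2 3)
  finally show ?thesis by (simp add: C7_def y'_def h'_def v_def k_def algebra_simps)
qed

text \<open>Mean value theorem in y. The derivative of the defect is the composition defect of the
  linearised steps DF, so \<open>euler_composition\<close> and \<open>defect_bound\<close> treat it
  like the defect itself.\<close>

lemma F_defect_lip:
  assumes st: "0 \<le> s" "s < r" "r < t" "t \<le> T"
  shows "norm ((F r t (F s r y) - F s t y) - (F r t (F s r z) - F s t z)) \<le> K2 * (t - s) powr (2 * \<alpha>
      + \<beta>) * norm (y - z)"
proof (rule differentiable_bound[where S = UNIV and f' = "\<lambda>y h. DF r t (F s r y) (DF s r y h) - DF s t y h"])
  have sr: "0 \<le> s" "s < r" "r \<le> T" using st by auto
  fix y
  show "((\<lambda>y. F r t (F s r y) - F s t y) has_derivative (\<lambda>h. DF r t (F s r y) (DF s r y h) - DF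
      s t y h)) (at y within UNIV)"
    using st by (intro has_derivative_diff F_deriv has_derivative_compose[OF F_deriv F_deriv]) auto
  show "onorm (\<lambda>h. DF r t (F s r y) (DF s r y h) - DF s t y h) \<le> K2 * (t - s) powr (2 * \<alpha> + \<beta>)"
  proof (rule onorm_bound)
    fix h
    define y' where "y' = F s r y"
    define h' where "h' = DF s r y h"
    have lin: "linear (blinfun_apply (Db s y))" by (rule bounded_linear.linear[OF blinfun.bounded_linear_right])
    have x: "norm (blinfun_apply (D\<sigma> r y') h' - blinfun_apply (D\<sigma> s y) h - contract1 (w r - w s)
        (Dc s y h)) \<le> C7 * (r - s) powr (\<alpha> + \<beta>) * norm h"
      "norm (Dc r y' h' - Dc s y h) \<le> shift_const C5 * (r - s) powr \<beta> * norm h"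
      "norm (blinfun_apply (Db r y') h' - blinfun_apply (Db s y) h) \<le> shift_const M * (r - s) powr \<beta> * norm h"
      unfolding y'_def h'_def
      using D\<sigma>_remainder[OF sr] operator_shift[OF Dc_lip_hoelder Dc_linear C56_nonneg(1) sr, of y h] sr
        operator_shift[OF lip_hoelder_blinfun[OF Db] lin M0 sr, of h] by auto
    have eq: "DF r t y' h' - DF s t y h = contract1 (w t - w r) (blinfun_apply (D\<sigma> r y') h' -
        blinfun_apply (D\<sigma> s y) h - contract1 (w r - w s) (Dc s y h))
       + contract2 (W r t) (Dc r y' h' - Dc s y h) + (t - r) *\<^sub>R (blinfun_apply (Db r y') h' -
           blinfun_apply (Db s y) h)"
      using euler_composition[OF chen[OF st] h'_def[unfolded DF_def],
        where a' = "blinfun_apply (D\<sigma> r y') h'" and c' = "Dc r y' h'" and r' = "t - r" and e' =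
            "blinfun_apply (Db r y') h'"]
      by (simp add: DF_def)
    have "norm (DF r t y' h' - DF s t y h) \<le> (M * C7 + M * shift_const C5 + P * shift_const M) * (t - s)
        powr (2 * \<alpha> + \<beta>) * norm h"
      unfolding eq using M0 C56_nonneg by (intro defect_bound[OF st x]) auto
    then show "norm (DF r t (F s r y) (DF s r y h) - DF s t y h) \<le> K2 * (t - s) powr (2 * \<alpha> +
        \<beta>) * norm h"
      by (simp add: K2_def y'_def h'_def)
  qed (use C56_nonneg in simp)
qed auto

lemma smooth_flow: "smooth_flow T (Kf + K2) (C3 + C6) (2 * \<alpha> + \<beta>) \<alpha> F"
proof unfold_locales
  show "0 < T" "1 < 2 * \<alpha> + \<beta>" "0 < \<alpha>" "\<alpha> \<le> 2 * \<alpha> + \<beta>" "0 \<le> Kf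
      + K2" "0 \<le> C3 + C6"
    using T_pos \<alpha> \<beta> \<beta>_pos C_nonneg C56_nonneg by auto
  have le: "x \<le> Kf * k * n \<Longrightarrow> x \<le> (Kf + K2) * k * n" "x \<le> K2 * k * n
      \<Longrightarrow> x \<le> (Kf + K2) * k * n"
    "x \<le> C3 * k * n \<Longrightarrow> x \<le> (C3 + C6) * k * n" "x \<le> C6 * k * n \<Longrightarrow> x
        \<le> (C3 + C6) * k * n"
    if "0 \<le> k" "0 \<le> n" for x k n
    using that C_nonneg C56_nonneg by (auto simp: distrib_right intro: order_trans add_increasing add_increasing2)
  fix s t y z assume st: "0 \<le> s" "s < t" "t \<le> T"
  show "norm (F s t y - y) \<le> (C3 + C6) * (t - s) powr \<alpha>"
    using le(3)[of "(t - s) powr \<alpha>" 1] F_dev(1)[OF st] by simp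
  show "norm (F s t y - y - (F s t z - z)) \<le> (C3 + C6) * (t - s) powr \<alpha> * norm (y - z)"
    using F_lip[OF st] by (intro le) auto
  show "norm (F s t a - a - (F s t b - b) - (F s t c - c - (F s t d - d)))
     \<le> (C3 + C6) * (t - s) powr \<alpha> * (norm (a - b - (c - d)) + (norm (a - c) + norm (b - d)) * norm
         (c - d))" for a b c d
    using F_lip2[OF st] by (intro le) auto
next
  have le: "x \<le> Kf * k * n \<Longrightarrow> x \<le> (Kf + K2) * k * n" "x \<le> K2 * k * n
      \<Longrightarrow> x \<le> (Kf + K2) * k * n"
    if "0 \<le> k" "0 \<le> n" for x k n
    using that C_nonneg C56_nonneg by (auto simp: distrib_right intro: order_trans add_increasing add_increasing2)
  fix s r t y z assume st: "0 \<le> s" "s < r" "r < t" "t \<le> T"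
  show "norm (F r t (F s r y) - F s t y) \<le> (Kf + K2) * (t - s) powr (2 * \<alpha> + \<beta>)"
    using le(1)[of "(t - s) powr (2 * \<alpha> + \<beta>)" 1] F_defect[OF st] by simp
  show "norm (F r t (F s r y) - F s t y - (F r t (F s r z) - F s t z)) \<le> (Kf + K2) * (t - s) powr (2 *
      \<alpha> + \<beta>) * norm (y - z)"
    using F_defect_lip[OF st] by (intro le) auto
qed

end

section \<open>Pointwise form of the norms\<close>

lemma ennreal_add_leD: "a + b \<le> c \<Longrightarrow> a \<le> c" "a + b \<le> c \<Longrightarrow> b \<le> c"
    for a b c :: ennreal
  by (auto intro: order_trans[rotated])

lemma finite_ennrealE:
  assumes "x < (\<infinity>::ennreal)" obtains B where "0 \<le> B" "x = ennreal B"
  using assms by (cases x) auto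

lemma hoelder2_norm_le_iff:
  assumes "0 \<le> B"
  shows "hoelder2_norm T \<gamma> w \<le> ennreal B \<longleftrightarrow> (\<forall>s t. 0 \<le> s \<and> s < t
      \<and> t \<le> T \<longrightarrow> norm (w s t) \<le> B * (t - s) powr \<gamma>)"
  unfolding hoelder2_norm_def SUP_le_iff using assms
  by (auto simp: time2_def ennreal_le_iff divide_le_eq)

lemma norm0_le_iff:
  assumes "0 \<le> B"
  shows "norm0 T g \<le> ennreal B \<longleftrightarrow> (\<forall>t y. 0 \<le> t \<and> t \<le> T
      \<longrightarrow> norm (g t y) \<le> B)"
  unfolding norm0_def SUP_le_iff using assms by (auto simp: ennreal_le_iff)

lemma norm0D: "norm0 T g \<le> ennreal B \<Longrightarrow> 0 \<le> B \<Longrightarrow> 0 \<le> t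
    \<Longrightarrow> t \<le> T \<Longrightarrow> norm (g t y) \<le> B"
  by (simp add: norm0_le_iff)

lemma hoelder2_normD:
  "hoelder2_norm T \<gamma> w \<le> ennreal B \<Longrightarrow> 0 \<le> B \<Longrightarrow> 0 \<le> s
      \<Longrightarrow> s < t \<Longrightarrow> t \<le> T \<Longrightarrow> norm (w s t) \<le> B * (t - s) powr
      \<gamma>"
  by (simp add: hoelder2_norm_le_iff)

lemma hoelder_normD:
  "hoelder_norm T \<gamma> f \<le> ennreal B \<Longrightarrow> 0 \<le> B \<Longrightarrow> 0 \<le> s
      \<Longrightarrow> s < t \<Longrightarrow> t \<le> T \<Longrightarrow> norm (f t - f s) \<le> B * (t - s)
      powr \<gamma>"
  using hoelder2_normD[of T \<gamma> "incr f"] by (simp add: incr_def)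

lemma sup_norm_le_iff:
  assumes "0 \<le> B"
  shows "sup_norm T f \<le> ennreal B \<longleftrightarrow> (\<forall>t. 0 \<le> t \<and> t \<le> T
      \<longrightarrow> norm (f t) \<le> B)"
  unfolding sup_norm_def SUP_le_iff using assms by (auto simp: ennreal_le_iff)

lemma sup_hoelder_norm_le_iff:
  assumes "0 \<le> B"
  shows "sup_hoelder_norm T \<beta> g \<le> ennreal B \<longleftrightarrow>
    (\<forall>s t y. 0 \<le> s \<and> s < t \<and> t \<le> T \<longrightarrow> norm (g t y - g s y) \<le> B *
        (t - s) powr \<beta>)"
  unfolding sup_hoelder_norm_def SUP_le_iff hoelder2_norm_le_iff[OF assms] by (auto simp: incr_def)

lemma remainder_contract1: "remainder w \<theta> \<theta>' s t = \<theta> t - \<theta> s - contract1 (w t - w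
    s) (\<theta>' s)"
  by (simp add: remainder_def contract1_def incr_def)

section \<open>Space derivatives of functions of time and space\<close>

lemma Dy_works:
  assumes "g t differentiable (at y)"
  shows "(g t has_derivative blinfun_apply (Dy g t y)) (at y)"
proof -
  have "(g t has_derivative frechet_derivative (g t) (at y)) (at y)"
    using assms by (simp add: frechet_derivative_works)
  then show ?thesis
    unfolding Dy_def using has_derivative_bounded_linear bounded_linear_Blinfun_apply by fastforce
qed

lemma Dy_unique:
  assumes "(g t has_derivative blinfun_apply B) (at y)" shows "Dy g t y = B"
  unfolding Dy_def frechet_derivative_at[OF assms, symmetric] by (rule blinfun_apply_inverse)

lemma Dy_diff:
  assumes "g t differentiable (at y)" "h t differentiable (at y)"
  shows "Dy (\<lambda>t y. g t y - h t y) t y = Dy g t y - Dy h t y"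
  by (rule Dy_unique, rule has_derivative_eq_rhs[OF has_derivative_diff[OF Dy_works Dy_works]])
    (use assms in \<open>auto simp: blinfun.diff_left\<close>)

lemma Dy_cong: "g t = h t \<Longrightarrow> Dy g t y = Dy h t y"
  by (simp add: Dy_def)

lemma Dy_Dy_diff:
  assumes "\<And>y. g t differentiable (at y)" "\<And>y. h t differentiable (at y)"
    and "Dy g t differentiable (at y)" "Dy h t differentiable (at y)"
  shows "Dy (Dy (\<lambda>t y. g t y - h t y)) t y = Dy (Dy g) t y - Dy (Dy h) t y"
proof -
  have "Dy (Dy (\<lambda>t y. g t y - h t y)) t y = Dy (\<lambda>t y. Dy g t y - Dy h t y) t y"
    by (rule Dy_cong) (use Dy_diff assms in blast)
  then show ?thesis using Dy_diff[of "Dy g" t y "Dy h"] assms by simp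
qed

lemma Dy_deriv_works:
  assumes "g' t differentiable (at y)"
  shows "((\<lambda>y. g' t y $ j) has_derivative blinfun_apply (Dy_deriv g' t y $ j)) (at y)"
    and "blinfun_apply (Dy_deriv g' t y $ j) h = blinfun_apply (Dy g' t y) h $ j"
proof -
  have 1: "((\<lambda>y. g' t y $ j) has_derivative (\<lambda>h. blinfun_apply (Dy g' t y) h $ j)) (at y)"
    by (rule bounded_linear.has_derivative[OF bounded_linear_vec_nth Dy_works[of g' t y, OF assms]])
  then have "(\<lambda>t y. g' t y $ j) t differentiable (at y)" unfolding differentiable_def by auto
  from Dy_works[of "\<lambda>t y. g' t y $ j", OF this] show 2: "((\<lambda>y. g' t y $ j) has_derivative
      blinfun_apply (Dy_deriv g' t y $ j)) (at y)"
    by (simp add: Dy_deriv_def)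
  show "blinfun_apply (Dy_deriv g' t y $ j) h = blinfun_apply (Dy g' t y) h $ j"
    using has_derivative_unique[OF 1 2] by metis
qed

text \<open>\<open>Dy g'\<close> and \<open>Dy_deriv g'\<close> package one derivative in two ways.
  Each component has at most the full operator norm, and the Euclidean norm of d components is at
  most their sum.\<close>

lemma norm_Dy_deriv_le:
  fixes g' :: "real \<Rightarrow> 'y::euclidean_space \<Rightarrow> 'f::real_normed_vector^'d"
  assumes "g' t differentiable (at y)"
  shows "norm (Dy_deriv g' t y) \<le> real CARD('d) * norm (Dy g' t y)"
proof -
  have "norm (Dy_deriv g' t y $ j) \<le> norm (Dy g' t y)" for j
  proof (rule norm_blinfun_bound)
    fix h
    have "norm (blinfun_apply (Dy g' t y) h $ j) \<le> norm (blinfun_apply (Dy g' t y) h)" by (rule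
        Finite_Cartesian_Product.norm_nth_le)
    also have "\<dots> \<le> norm (Dy g' t y) * norm h" by (rule norm_blinfun)
    finally show "norm (blinfun_apply (Dy_deriv g' t y $ j) h) \<le> norm (Dy g' t y) * norm h"
      unfolding Dy_deriv_works(2)[of g' t y, OF assms] .
  qed simp
  then have "(\<Sum>j\<in>UNIV. norm (Dy_deriv g' t y $ j)) \<le> (\<Sum>j\<in>(UNIV::'d set). norm (Dy g' t y))"
    by (intro sum_mono)
  moreover have "norm (Dy_deriv g' t y) \<le> (\<Sum>j\<in>UNIV. norm (Dy_deriv g' t y $ j))"
    unfolding norm_vec_def by (rule L2_set_le_sum) simp
  ultimately show ?thesis by simp
qed

lemma lipschitz_of_Dy:
  assumes "\<And>y. g t differentiable (at y)" "\<And>y. norm (Dy g t y) \<le> B"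
  shows "norm (g t y - g t z) \<le> B * norm (y - z)"
proof (rule differentiable_bound[where S = UNIV and f' = "\<lambda>x. blinfun_apply (Dy g t x)"])
  show "onorm (blinfun_apply (Dy g t x)) \<le> B" for x
    using assms(2)[of x] by (simp add: norm_blinfun.rep_eq)
qed (use Dy_works assms in auto)

definition c12_data :: "real \<Rightarrow> 'd path \<Rightarrow> real \<Rightarrow> real \<Rightarrow> real
    \<Rightarrow> (real \<Rightarrow> 'y::euclidean_space \<Rightarrow> 'f::real_normed_vector) \<Rightarrow>
    (real \<Rightarrow> 'y \<Rightarrow> 'f^'d) \<Rightarrow> bool" where
  "c12_data T w \<alpha> \<beta> M g g' \<longleftrightarrow>
     (\<forall>t y. 0 \<le> t \<and> t \<le> T \<longrightarrow> norm (g t y) \<le> M \<and> norm (Dy g t y)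
         \<le> M \<and> norm (Dy (Dy g) t y) \<le> M \<and>
        norm (g' t y) \<le> M \<and> norm (Dy g' t y) \<le> M) \<and>
     (\<forall>s t y. 0 \<le> s \<and> s < t \<and> t \<le> T \<longrightarrow> norm (g' t y - g' s y) \<le> M
         * (t - s) powr \<beta> \<and>
        norm (remainder w (\<lambda>t. g t y) (\<lambda>t. g' t y) s t) \<le> M * (t - s) powr (\<alpha> +
            \<beta>) \<and>
        norm (remainder w (\<lambda>t. Dy g t y) (\<lambda>t. Dy_deriv g' t y) s t) \<le> M * (t - s) powr
            (\<alpha> + \<beta>))"

text \<open>\<open>Dy\<close> is total, so the bounds in \<open>c12_data\<close> carry no
  information about differentiability, which is recorded separately.\<close>

definition c12_diff :: "real \<Rightarrow> (real \<Rightarrow> 'y::euclidean_space \<Rightarrow>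
    'f::real_normed_vector) \<Rightarrow> (real \<Rightarrow> 'y \<Rightarrow> 'f^'d) \<Rightarrow> bool" where
  "c12_diff T g g' \<longleftrightarrow> (\<forall>t y. 0 \<le> t \<and> t \<le> T \<longrightarrow> g t
      differentiable (at y) \<and> Dy g t differentiable (at y) \<and> g' t differentiable (at y))"

lemma C12_loc_diff: "C12_loc T w \<alpha> \<beta> g g' \<Longrightarrow> c12_diff T g g'"
  unfolding C12_loc_def C2_loc_def C1_loc_def C1_hoelder_loc_def c12_diff_def by auto

lemma norm12_data:
  assumes "norm12 T w \<alpha> \<beta> g g' \<le> ennreal M" "0 \<le> M"
  shows "c12_data T w \<alpha> \<beta> M g g'"
proof -
  note 1 = ennreal_add_leD[OF assms(1)[unfolded norm12_def norm1_def norm2_def]]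
  note 2 = ennreal_add_leD[OF 1(1)]
  note 3 = ennreal_add_leD[OF 2(1)]
  note 4 = ennreal_add_leD[OF 3(1)]
  note 5 = ennreal_add_leD[OF 2(2)]
  have "controlled_norm T w \<alpha> \<beta> (\<lambda>t. g t y) (\<lambda>t. g' t y) + controlled_norm T w
      \<alpha> \<beta> (\<lambda>t. Dy g t y) (\<lambda>t. Dy_deriv g' t y) \<le> ennreal M" for y
    using 1(2) by (simp add: SUP_le_iff)
  note 6 = ennreal_add_leD[OF this]
  note 7 = ennreal_add_leD[OF 6(1)[unfolded controlled_norm_def]] ennreal_add_leD(2)[OF 6(2)[unfolded
      controlled_norm_def]]
  show ?thesis
    unfolding c12_data_def
    using norm0D[OF 4(1) assms(2)] norm0D[OF 4(2) assms(2)] norm0D[OF 3(2) assms(2)] norm0D[OF 5(1) assms(2)]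
      norm0D[OF 5(2) assms(2)] hoelder_normD[OF 7(1) assms(2)] hoelder2_normD[OF 7(2) assms(2)]
          hoelder2_normD[OF 7(3) assms(2)]
    by simp
qed

text \<open>\<open>norm12\<close> contains no Hoelder norm of \<open>Dy g\<close> itself. It is
  recovered from the remainder of \<open>Dy g\<close> and the path increment times
  \<open>Dy_deriv g'\<close>; the latter is bounded through \<open>Dy g'\<close> at the price of the
  dimension, whence the shape of N.\<close>

lemma c12_bound_data:
  fixes w :: "'d::finite path"
  assumes D: "c12_data T w \<alpha> \<beta> M g g'" and diff: "c12_diff T g g'" and M: "0 \<le> M"
    and w: "\<And>s t. 0 \<le> s \<Longrightarrow> s < t \<Longrightarrow> t \<le> T \<Longrightarrow> norm (w
        t - w s) \<le> M * (t - s) powr \<alpha>"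
    and \<alpha>: "0 \<le> \<alpha>" "\<alpha> \<le> 1" "0 \<le> \<beta>" "\<beta> \<le> \<alpha>"
    and N: "N = M + (1 + T)\<^sup>2 * (M + real CARD('d) * M * M)"
  shows "c12_bound T w \<alpha> \<beta> N g g' (Dy g)"
proof (cases "0 \<le> T")
  case False
  then show ?thesis by (auto simp: c12_bound_def lip_hoelder_def)
next
  case True
  have 0: "0 \<le> (1 + T)\<^sup>2 * (M + real CARD('d) * M * M)" using M by simp
  have MN: "M \<le> N" using N 0 by simp
  have d: "g t differentiable (at y)" "Dy g t differentiable (at y)" "g' t differentiable (at y)" if "0 \<le>
      t" "t \<le> T" for t y
    using diff that by (auto simp: c12_diff_def)
  have b: "norm (g t y) \<le> M" "norm (Dy g t y) \<le> M" "norm (Dy (Dy g) t y) \<le> M" "norm (g' t y) \<le>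
      M" "norm (Dy g' t y) \<le> M"
    if "0 \<le> t" "t \<le> T" for t y
    using D that by (auto simp: c12_data_def)
  have i: "norm (g' t y - g' s y) \<le> M * (t - s) powr \<beta>"
    "norm (g t y - g s y - contract1 (w t - w s) (g' s y)) \<le> M * (t - s) powr (\<alpha> + \<beta>)"
    "norm (Dy g t y - Dy g s y - contract1 (w t - w s) (Dy_deriv g' s y)) \<le> M * (t - s) powr (\<alpha> + \<beta>)"
    if "0 \<le> s" "s < t" "t \<le> T" for s t y
    using D that by (auto simp: c12_data_def remainder_contract1)
  have up: "M * k \<le> N * k" if "0 \<le> k" for k using MN that by (rule mult_right_mono)
  have L: "norm (Dy g t y - Dy g t z) \<le> M * norm (y - z)" "norm (g' t y - g' t z) \<le> M * norm (y - z)"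
      if "0 \<le> t" "t \<le> T" for t y z
    using lipschitz_of_Dy[of "Dy g" t M y z] lipschitz_of_Dy[of g' t M y z] d b that by auto
  have H: "norm (Dy g t y - Dy g s y) \<le> N * (t - s) powr \<beta>" if st: "0 \<le> s" "s < t" "t \<le> T" for s t y
  proof -
    have a: "(t - s) powr \<alpha> \<le> (1 + T)\<^sup>2 * (t - s) powr \<beta>" "(t - s) powr (\<alpha> +
        \<beta>) \<le> (1 + T)\<^sup>2 * (t - s) powr \<beta>"
      using st \<alpha> by (auto intro!: powr_weaken)
    have "norm (Dy_deriv g' s y) \<le> real CARD('d) * norm (Dy g' s y)"
      using st by (intro norm_Dy_deriv_le d) auto
    also have "\<dots> \<le> real CARD('d) * M" using st b(5) by (intro mult_left_mono) auto
    finally have dd: "norm (Dy_deriv g' s y) \<le> real CARD('d) * M" .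
    have "norm (contract1 (w t - w s) (Dy_deriv g' s y)) \<le> norm (w t - w s) * norm (Dy_deriv g' s y)" by
        (rule norm_contract1_le)
    also have "\<dots> \<le> (M * (t - s) powr \<alpha>) * (real CARD('d) * M)"
      using st M w dd by (intro mult_mono) auto
    also have "\<dots> \<le> (M * ((1 + T)\<^sup>2 * (t - s) powr \<beta>)) * (real CARD('d) * M)"
      using a M by (intro mult_right_mono mult_left_mono) auto
    finally have 1: "norm (contract1 (w t - w s) (Dy_deriv g' s y)) \<le> (M * ((1 + T)\<^sup>2 * (t - s) powr
        \<beta>)) * (real CARD('d) * M)" .
    have 2: "norm (Dy g t y - Dy g s y - contract1 (w t - w s) (Dy_deriv g' s y)) \<le> M * ((1 + T)\<^sup>2 *
        (t - s) powr \<beta>)"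
      using i(3)[OF st, of y] mult_left_mono[OF a(2) M] by linarith
    have "norm ((Dy g t y - Dy g s y - contract1 (w t - w s) (Dy_deriv g' s y)) + contract1 (w t - w s)
        (Dy_deriv g' s y)) \<le>
      M * ((1 + T)\<^sup>2 * (t - s) powr \<beta>) + (M * ((1 + T)\<^sup>2 * (t - s) powr \<beta>)) * (real
          CARD('d) * M)"
      by (intro norm_triangle_le[OF add_mono] 1 2)
    also have "\<dots> = ((1 + T)\<^sup>2 * (M + real CARD('d) * M * M)) * (t - s) powr \<beta>" by (simp add:
        algebra_simps)
    also have "\<dots> \<le> N * (t - s) powr \<beta>" using M by (intro mult_right_mono) (auto simp: N)
    finally show ?thesis by simp
  qed
  have DW: "(g t has_derivative blinfun_apply (Dy g t y)) (at y)" if "0 \<le> t" "t \<le> T" for t y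
    by (rule Dy_works[of g t y]) (use d that in auto)
  show ?thesis
    unfolding c12_bound_def lip_hoelder_def
    using H DW order_trans[OF b(1) MN] order_trans[OF b(2) MN] order_trans[OF b(4) MN]
      order_trans[OF L(1) up] order_trans[OF L(2) up] order_trans[OF i(1) up] order_trans[OF i(2) up] by simp
qed

definition c12_close :: "real \<Rightarrow> real \<Rightarrow> real \<Rightarrow> 'd path \<Rightarrow> 'd path
    \<Rightarrow> real \<Rightarrow> (real \<Rightarrow> 'y::euclidean_space \<Rightarrow>
    'f::real_normed_vector) \<Rightarrow>
    (real \<Rightarrow> 'y \<Rightarrow> 'f^'d) \<Rightarrow> (real \<Rightarrow> 'y \<Rightarrow> 'f)
        \<Rightarrow> (real \<Rightarrow> 'y \<Rightarrow> 'f^'d) \<Rightarrow> bool" where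
  "c12_close T \<alpha> \<beta> w v \<epsilon> g g' h h' \<longleftrightarrow>
     (\<forall>t y. 0 \<le> t \<and> t \<le> T \<longrightarrow> norm (g t y - h t y) \<le> \<epsilon> \<and>
         norm (Dy g t y - Dy h t y) \<le> \<epsilon> \<and> norm (Dy (Dy g) t y - Dy (Dy h) t y) \<le> \<epsilon> \<and>
        norm (g' t y - h' t y) \<le> \<epsilon> \<and> norm (Dy g' t y - Dy h' t y) \<le> \<epsilon>) \<and>
     (\<forall>s t y. 0 \<le> s \<and> s < t \<and> t \<le> T \<longrightarrow> norm ((g' t y - h' t y) - (g' s
         y - h' s y)) \<le> \<epsilon> * (t - s) powr \<beta> \<and>
        norm (remainder w (\<lambda>t. g t y) (\<lambda>t. g' t y) s t - remainder v (\<lambda>t. h t y)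
            (\<lambda>t. h' t y) s t) \<le> \<epsilon> * (t - s) powr (\<alpha> + \<beta>) \<and>
        norm (remainder w (\<lambda>t. Dy g t y) (\<lambda>t. Dy_deriv g' t y) s t - remainder v (\<lambda>t.
            Dy h t y) (\<lambda>t. Dy_deriv h' t y) s t) \<le> \<epsilon> * (t - s) powr (\<alpha> + \<beta>))"

text \<open>Part of \<open>dist12\<close> applies \<open>Dy\<close> to differences of functions;
  differentiability of both sides turns these into differences of derivatives.\<close>

lemma dist12_close:
  assumes "dist12 T \<alpha> \<beta> w v g g' h h' \<le> ennreal M" "0 \<le> M" and g: "c12_diff T g g'" and h:
      "c12_diff T h h'"
  shows "c12_close T \<alpha> \<beta> w v M g g' h h'"
proof -
  note 1 = ennreal_add_leD[OF assms(1)[unfolded dist12_def norm1_def norm2_def]]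
  note 2 = ennreal_add_leD[OF 1(1)]
  note 3 = ennreal_add_leD[OF 2(1)]
  note 4 = ennreal_add_leD[OF 3(1)]
  note 5 = ennreal_add_leD[OF 2(2)]
  have "controlled_dist T \<alpha> \<beta> w v (\<lambda>t. g t y) (\<lambda>t. g' t y) (\<lambda>t. h t y)
      (\<lambda>t. h' t y) +
             controlled_dist T \<alpha> \<beta> w v (\<lambda>t. Dy g t y) (\<lambda>t. Dy_deriv g' t y)
               (\<lambda>t. Dy h t y) (\<lambda>t. Dy_deriv h' t y) \<le> ennreal M" for y
    using 1(2) by (simp add: SUP_le_iff)
  note 6 = ennreal_add_leD[OF this]
  note 7 = ennreal_add_leD[OF 6(1)[unfolded controlled_dist_def]] ennreal_add_leD(2)[OF 6(2)[unfolded
      controlled_dist_def]]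
  have D: "Dy (\<lambda>t y. g t y - h t y) t y = Dy g t y - Dy h t y"
    "Dy (\<lambda>t y. g' t y - h' t y) t y = Dy g' t y - Dy h' t y"
    "Dy (Dy (\<lambda>t y. g t y - h t y)) t y = Dy (Dy g) t y - Dy (Dy h) t y" if "0 \<le> t" "t \<le> T" for t y
    using g h that by (auto intro!: Dy_diff Dy_Dy_diff simp: c12_diff_def)
  have A: "norm (g t y - h t y) \<le> M \<and> norm (Dy g t y - Dy h t y) \<le> M \<and> norm (Dy (Dy g) t y -
      Dy (Dy h) t y) \<le> M \<and>
        norm (g' t y - h' t y) \<le> M \<and> norm (Dy g' t y - Dy h' t y) \<le> M" if t: "0 \<le> t \<and> t
            \<le> T" for t y
    using norm0D[OF 4(1) assms(2), of t y] norm0D[OF 4(2) assms(2), of t y] norm0D[OF 3(2) assms(2), of t y]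
      norm0D[OF 5(1) assms(2), of t y] norm0D[OF 5(2) assms(2), of t y] t by (simp add: D)
  show ?thesis
    unfolding c12_close_def
    using A hoelder_normD[OF 7(1) assms(2)] hoelder2_normD[OF 7(2) assms(2)] hoelder2_normD[OF 7(3) assms(2)] by simp
qed

text \<open>This is how approximating coefficients inherit a common bound: for all \<epsilon> \<le>
  1 the constant M + 1 serves.\<close>

lemma c12_close_data:
  assumes g: "c12_data T w \<alpha> \<beta> M g g'" and cl: "c12_close T \<alpha> \<beta> w v \<epsilon> g g' h h'"
  shows "c12_data T v \<alpha> \<beta> (M + \<epsilon>) h h'"
proof -
  have n: "norm b \<le> x + y" if "norm a \<le> x" "norm (a - b) \<le> y" for a b :: "'z::real_normed_vector" and x y
    using norm_triangle_sub[of b a] that by (simp add: norm_minus_commute)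
  have n': "norm b \<le> (x + y) * k" if "norm a \<le> x * k" "norm (a - b) \<le> y * k" for a b ::
      "'z::real_normed_vector" and x y k
    using n[OF that] by (simp add: algebra_simps)
  have e: "(g' t y - g' s y) - (h' t y - h' s y) = (g' t y - h' t y) - (g' s y - h' s y)" for s t y by simp
  show ?thesis
    unfolding c12_data_def
  proof (intro conjI allI impI)
    fix t y assume t: "0 \<le> t \<and> t \<le> T"
    note G = g[unfolded c12_data_def, THEN conjunct1, rule_format, OF t, of y]
    note C = cl[unfolded c12_close_def, THEN conjunct1, rule_format, OF t, of y]
    show "norm (h t y) \<le> M + \<epsilon>" by (rule n[of "g t y"]) (use G C in auto)
    show "norm (Dy h t y) \<le> M + \<epsilon>" by (rule n[of "Dy g t y"]) (use G C in auto)
    show "norm (Dy (Dy h) t y) \<le> M + \<epsilon>" by (rule n[of "Dy (Dy g) t y"]) (use G C in auto)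
    show "norm (h' t y) \<le> M + \<epsilon>" by (rule n[of "g' t y"]) (use G C in auto)
    show "norm (Dy h' t y) \<le> M + \<epsilon>" by (rule n[of "Dy g' t y"]) (use G C in auto)
  next
    fix s t y assume st: "0 \<le> s \<and> s < t \<and> t \<le> T"
    note G = g[unfolded c12_data_def, THEN conjunct2, rule_format, OF st, of y]
    note C = cl[unfolded c12_close_def, THEN conjunct2, rule_format, OF st, of y]
    show "norm (h' t y - h' s y) \<le> (M + \<epsilon>) * (t - s) powr \<beta>"
      by (rule n'[of "g' t y - g' s y"]) (use G C in \<open>auto simp: e\<close>)
    show "norm (remainder v (\<lambda>t. h t y) (\<lambda>t. h' t y) s t) \<le> (M + \<epsilon>) * (t - s) powr
        (\<alpha> + \<beta>)"
      by (rule n'[of "remainder w (\<lambda>t. g t y) (\<lambda>t. g' t y) s t"]) (use G C in auto)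
    show "norm (remainder v (\<lambda>t. Dy h t y) (\<lambda>t. Dy_deriv h' t y) s t) \<le> (M + \<epsilon>) *
        (t - s) powr (\<alpha> + \<beta>)"
      by (rule n'[of "remainder w (\<lambda>t. Dy g t y) (\<lambda>t. Dy_deriv g' t y) s t"]) (use G C in auto)
  qed
qed

section \<open>Davie solutions and rough integrals\<close>

lemma le_ennreal_finite: "x \<le> ennreal B \<Longrightarrow> x < \<infinity>"
  using le_less_trans[of x "ennreal B" \<infinity>] by simp

lemma hoelderI:
  assumes "0 < \<gamma>" "0 \<le> B" "\<And>s t. 0 \<le> s \<Longrightarrow> s < t \<Longrightarrow> t \<le> T
      \<Longrightarrow> norm (f t - f s) \<le> B * (t - s) powr \<gamma>"
  shows "hoelder T \<gamma> f"
  unfolding hoelder_def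
proof
  show "continuous_on {0..T} f"
    by (intro uniformly_continuous_imp_continuous hoelder_imp_uniformly_continuous[OF assms(1) _ assms(2)])
        (use assms(3) in auto)
  have "hoelder_norm T \<gamma> f \<le> ennreal B" using assms by (simp add: hoelder2_norm_le_iff incr_def)
  then show "hoelder_norm T \<gamma> f < \<infinity>" by (rule le_ennreal_finite)
qed

lemma hoelderE:
  assumes "hoelder T \<gamma> f"
  obtains B where "0 \<le> B" "\<And>s t. 0 \<le> s \<Longrightarrow> s < t \<Longrightarrow> t \<le> T
      \<Longrightarrow> norm (f t - f s) \<le> B * (t - s) powr \<gamma>"
proof -
  have "hoelder_norm T \<gamma> f < \<infinity>" using assms by (simp only: hoelder_def)
  then obtain B where "0 \<le> B" "hoelder_norm T \<gamma> f = ennreal B" by (rule finite_ennrealE)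
  then show ?thesis using that[of B] hoelder_normD[of T \<gamma> f B] by simp
qed

lemma remainder_hoelder2I:
  assumes c: "continuous_on {0..T} w" "continuous_on {0..T} \<theta>" "continuous_on {0..T} \<theta>'" and "0 \<le> B"
    and b: "\<And>s t. 0 \<le> s \<Longrightarrow> s < t \<Longrightarrow> t \<le> T \<Longrightarrow> norm
        (\<theta> t - \<theta> s - contract1 (w t - w s) (\<theta>' s)) \<le> B * (t - s) powr \<gamma>"
  shows "hoelder2 T \<gamma> (remainder w \<theta> \<theta>')"
  unfolding hoelder2_def
proof
  have 1: "continuous_on (time2 T) (\<lambda>p. f (fst p))" "continuous_on (time2 T) (\<lambda>p. f (snd p))"
      if "continuous_on {0..T} f" for f :: "real \<Rightarrow> 'z::topological_space"
    by (auto intro!: continuous_on_compose2[OF that] continuous_on_fst continuous_on_snd continuous_on_id simp: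
        time2_def)
  show "continuous_on (time2 T) (\<lambda>(s, t). remainder w \<theta> \<theta>' s t)"
    unfolding remainder_contract1 case_prod_beta
    by (intro continuous_on_diff contract1.continuous_on 1 c)
  have "hoelder2_norm T \<gamma> (remainder w \<theta> \<theta>') \<le> ennreal B" using assms by (simp add:
      hoelder2_norm_le_iff remainder_contract1)
  then show "hoelder2_norm T \<gamma> (remainder w \<theta> \<theta>') < \<infinity>" by (rule le_ennreal_finite)
qed

text \<open>Hoelder continuity of f gives the expansion exponent 1 + \<beta> > 1, so left-point sums
  converge by the same criterion as the rough integral.\<close>

lemma young_drift_expansion:
  fixes f :: "real \<Rightarrow> 'e::euclidean_space"
  assumes f: "\<And>s t. 0 \<le> s \<Longrightarrow> s < t \<Longrightarrow> t \<le> T \<Longrightarrow> norm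
      (f t - f s) \<le> B * (t - s) powr \<beta>" and "0 < \<beta>" "0 \<le> B" "0 \<le> t" "t \<le> T"
  shows "partition_limit (\<lambda>s u. (u - s) *\<^sub>R f s) t (integral {0..t} f)"
proof -
  have cont: "continuous_on {0..T} f" using hoelderI[OF \<open>0 < \<beta>\<close> \<open>0 \<le> B\<close> f]
      by (simp add: hoelder_def)
  have "partition_limit (\<lambda>s u. (u - s) *\<^sub>R f s) t (integral {0..t} f - integral {0..0} f)"
  proof (rule partition_limit_of_expansion)
    fix s u assume su: "0 \<le> s" "s < u" "u \<le> T"
    have int: "f integrable_on {a..b}" if "0 \<le> a" "b \<le> T" for a b
      using that by (intro integrable_continuous_real continuous_on_subset[OF cont]) auto
    have "integral {0..u} f - integral {0..s} f - (u - s) *\<^sub>R f s = integral {s..u} f - (u - s) *\<^sub>R f s"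
      using Henstock_Kurzweil_Integration.integral_combine[of 0 s u f] su int[of 0 u] by (simp add: algebra_simps)
    also have "\<dots> = integral {s..u} (\<lambda>v. f v - f s)"
      using su int[of s u] by (subst integral_diff) auto
    also have "norm \<dots> \<le> (B * (u - s) powr \<beta>) * (u - s)"
    proof (rule integral_bound)
      show "norm (f v - f s) \<le> B * (u - s) powr \<beta>" if "v \<in> {s..u}" for v
      proof (cases "v = s")
        case False
        then have "norm (f v - f s) \<le> B * (v - s) powr \<beta>" using f[of s v] that su by auto
        also have "\<dots> \<le> B * (u - s) powr \<beta>" using that False assms by (intro mult_left_mono
            powr_mono2) auto
        finally show ?thesis .
      qed (use assms in simp)
    qed (use su in \<open>auto intro!: continuous_intros continuous_on_subset[OF cont]\<close>)
    also have "\<dots> = B * (u - s) powr (1 + \<beta>)" using su by (simp add: powr_add)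
    finally show "norm (integral {0..u} f - integral {0..s} f - (u - s) *\<^sub>R f s) \<le> B * (u - s) powr
        (1 + \<beta>)" .
  qed (use assms in auto)
  then show ?thesis by simp
qed

context rough_sde
begin

lemma w_cont: "continuous_on {0..T} w"
  using hoelderI[of \<alpha> M T w] w_bound \<alpha> M0 by (simp add: hoelder_def)

lemma davie_increments:
  assumes Y: "davie_bound T F C (2 * \<alpha> + \<beta>) Y" and C: "0 \<le> C" and st: "0 \<le> s" "s < t" "t \<le> T"
  shows "norm (Y t - Y s) \<le> (C * P + C3) * (t - s) powr \<alpha>"
    and "norm (Y t - Y s - contract1 (w t - w s) (\<sigma> s (Y s))) \<le> (C * P + C3) * (t - s) powr
        (\<alpha> + \<beta>)"
proof -
  have J: "norm (Y t - F s t (Y s)) \<le> C * P * (t - s) powr p" if "p \<le> 2 * \<alpha> + \<beta>" "2 *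
      \<alpha> + \<beta> \<le> p + 2" for p
  proof -
    have "norm (Y t - F s t (Y s)) \<le> C * (t - s) powr (2 * \<alpha> + \<beta>)" using Y st by (auto simp:
        davie_bound_def)
    also have "\<dots> \<le> C * (P * (t - s) powr p)" using st C that by (intro mult_left_mono weaken) auto
    finally show ?thesis by (simp add: mult.assoc)
  qed
  have "norm ((Y t - F s t (Y s)) + (F s t (Y s) - Y s)) \<le> C * P * (t - s) powr \<alpha> + C3 * (t - s)
      powr \<alpha>"
    using \<alpha> \<beta> \<beta>_pos by (intro norm_triangle_le[OF add_mono] F_dev[OF st] J) auto
  then show "norm (Y t - Y s) \<le> (C * P + C3) * (t - s) powr \<alpha>" by (simp add: algebra_simps)
  have "norm ((Y t - F s t (Y s)) + (F s t (Y s) - Y s - contract1 (w t - w s) (\<sigma> s (Y s)))) \<le> C * P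
      * (t - s) powr (\<alpha> + \<beta>) + C3 * (t - s) powr (\<alpha> + \<beta>)"
    using \<alpha> \<beta> \<beta>_pos by (intro norm_triangle_le[OF add_mono] F_dev[OF st] J) auto
  then show "norm (Y t - Y s - contract1 (w t - w s) (\<sigma> s (Y s))) \<le> (C * P + C3) * (t - s) powr
      (\<alpha> + \<beta>)"
    by (simp add: algebra_simps)
qed

lemma davie_composed_hoelder:
  assumes Y: "davie_bound T F C (2 * \<alpha> + \<beta>) Y" and C: "0 \<le> C" and H: "lip_hoelder T \<beta> B
      H" "0 \<le> B"
    and st: "0 \<le> s" "s < t" "t \<le> T"
  shows "norm (H t (Y t) - H s (Y s)) \<le> (B * (C * P + C3) * P + B) * (t - s) powr \<beta>"
  using C C_nonneg P by (intro lip_hoelder_shift[OF H(1) st H(2)] davie_increments(1)[OF Y C st]) auto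

text \<open>Since 2 \<alpha> + \<beta> exceeds \<alpha> + \<beta>, a Davie solution has a remainder
  of the same order as its Euler step; the chain rule then passes this to
  \<open>\<sigma> t (Y t)\<close>.\<close>

lemma davie_controlled:
  assumes Y: "davie_bound T F C (2 * \<alpha> + \<beta>) Y" and C: "0 \<le> C"
  shows "controlled1 T w \<alpha> \<beta> Y (\<lambda>t. \<sigma> t (Y t))"
    and "controlled1 T w \<alpha> \<beta> (\<lambda>t. \<sigma> t (Y t)) (\<lambda>t. c t (Y t))"
proof -
  define B where "B = C * P + C3"
  have B: "0 \<le> B" using C P C_nonneg by (simp add: B_def)
  have P0: "0 \<le> P" using P by simp
  note inc = davie_increments[OF Y C, folded B_def]
  have "hoelder T \<alpha> Y" by (rule hoelderI[OF _ B inc(1)]) (use \<alpha> in auto)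
  then have Yc: "continuous_on {0..T} Y" by (simp add: hoelder_def)
  have hY: "hoelder T \<beta> Y"
  proof (rule hoelderI[OF \<beta>_pos])
    fix s t assume st: "0 \<le> s" "s < t" "t \<le> T"
    have "norm (Y t - Y s) \<le> B * (t - s) powr \<alpha>" by (rule inc[OF st])
    also have "\<dots> \<le> B * (P * (t - s) powr \<beta>)" using st \<alpha> \<beta> \<beta>_pos B by (intro
        mult_left_mono weaken) auto
    finally show "norm (Y t - Y s) \<le> B * P * (t - s) powr \<beta>" by (simp add: mult.assoc)
  qed (use B P0 in auto)
  have comp: "hoelder T \<beta> (\<lambda>t. H t (Y t))" if "lip_hoelder T \<beta> D H" "0 \<le> D" for D and H
      :: "real \<Rightarrow> 'e \<Rightarrow> 'z::real_normed_vector"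
    using that B P0 by (intro hoelderI[OF \<beta>_pos _ davie_composed_hoelder[OF Y C that]]) (auto simp: B_def)
  have h\<sigma>: "hoelder T \<beta> (\<lambda>t. \<sigma> t (Y t))" using M0 P0 by (intro comp[OF
      c12_lip_hoelder[OF \<sigma>]]) auto
  have hc: "hoelder T \<beta> (\<lambda>t. c t (Y t))" using C_nonneg by (intro comp[OF c_lip_hoelder])
  have "hoelder2 T (\<alpha> + \<beta>) (remainder w Y (\<lambda>t. \<sigma> t (Y t)))"
    using h\<sigma> by (intro remainder_hoelder2I[OF w_cont Yc _ B inc(2)]) (auto simp: hoelder_def)
  then show "controlled1 T w \<alpha> \<beta> Y (\<lambda>t. \<sigma> t (Y t))" using hY h\<sigma> by (simp
      add: controlled1_def)
  have "hoelder2 T (\<alpha> + \<beta>) (remainder w (\<lambda>t. \<sigma> t (Y t)) (\<lambda>t. c t (Y t)))"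
    using h\<sigma> hc M0 B P0
    by (intro remainder_hoelder2I[OF w_cont _ _ _ \<sigma>_remainder[OF _ _ _ B inc]]) (auto simp: hoelder_def)
  then show "controlled1 T w \<alpha> \<beta> (\<lambda>t. \<sigma> t (Y t)) (\<lambda>t. c t (Y t))" using
      h\<sigma> hc by (simp add: controlled1_def)
qed

text \<open>The Davie bound makes the full Euler sums converge to Y t - Y 0, and the drift sums
  converge on their own. The rough integral is obtained as the difference, which spares a separate
  construction.\<close>

lemma davie_integrals:
  assumes Y: "davie_bound T F C (2 * \<alpha> + \<beta>) Y" and C: "0 \<le> C" and t: "0 \<le> t" "t \<le> T"
  obtains I J where "partition_limit (\<lambda>s u. contract1 (w u - w s) (\<sigma> s (Y s)) + contract2 (W s
      u) (c s (Y s))) t I"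
    "partition_limit (\<lambda>s u. (u - s) *\<^sub>R b s (Y s)) t J" "Y t = Y 0 + I + J"
proof -
  have total: "partition_limit (\<lambda>s u. contract1 (w u - w s) (\<sigma> s (Y s)) + contract2 (W s u) (c s
      (Y s)) + (u - s) *\<^sub>R b s (Y s)) t (Y t - Y 0)"
  proof (rule partition_limit_of_expansion[OF _ _ C t])
    fix s u assume "0 \<le> s" "s < u" "u \<le> T"
    then have "norm (Y u - F s u (Y s)) \<le> C * (u - s) powr (2 * \<alpha> + \<beta>)" using Y by (auto simp:
        davie_bound_def)
    then show "norm (Y u - Y s - (contract1 (w u - w s) (\<sigma> s (Y s)) + contract2 (W s u) (c s (Y s)) + (u
        - s) *\<^sub>R b s (Y s))) \<le> C * (u - s) powr (2 * \<alpha> + \<beta>)"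
      by (simp add: euler_step_def algebra_simps)
  qed (use \<gamma>_gt1 in simp)
  have drift: "partition_limit (\<lambda>s u. (u - s) *\<^sub>R b s (Y s)) t (integral {0..t} (\<lambda>s. b s (Y s)))"
    using C M0 P C_nonneg by (intro young_drift_expansion[OF davie_composed_hoelder[OF Y C b M0] \<beta>_pos _ t]) auto
  show ?thesis
    by (rule that[OF partition_limit_cong[OF _ partition_limit_diff[OF total drift]] drift]) simp_all
qed

text \<open>The Euler increments \<open>\<Xi>\<close> along Y are almost additive because
  \<open>\<sigma> t (Y t)\<close> is controlled with derivative \<open>c t (Y t)\<close>; the sewing
  estimate then compares them with the increments of Y. The constant depends on Y, which
  \<open>davie_apriori\<close> repairs.\<close>

lemma davie_of_solution:
  assumes Y: "hoelder T \<beta> Y"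
    and ctrl: "controlled1 T w \<alpha> \<beta> (\<lambda>t. \<sigma> t (Y t)) (\<lambda>t. c t (Y t))"
    and lim: "\<And>t. 0 \<le> t \<Longrightarrow> t \<le> T \<Longrightarrow> partition_limit (\<lambda>s u.
        contract1 (w u - w s) (\<sigma> s (Y s)) + contract2 (W s u) (c s (Y s)) + (u - s) *\<^sub>R b s (Y s))
        t (Y t - x)"
  shows "\<exists>C\<ge>0. davie_bound T F C (2 * \<alpha> + \<beta>) Y"
proof -
  obtain BY where BY: "0 \<le> BY" "\<And>s t. 0 \<le> s \<Longrightarrow> s < t \<Longrightarrow> t \<le> T
      \<Longrightarrow> norm (Y t - Y s) \<le> BY * (t - s) powr \<beta>"
    using hoelderE[OF Y] by metis
  obtain Bc where Bc: "0 \<le> Bc" "\<And>s t. 0 \<le> s \<Longrightarrow> s < t \<Longrightarrow> t \<le> T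
      \<Longrightarrow> norm (c t (Y t) - c s (Y s)) \<le> Bc * (t - s) powr \<beta>"
    using hoelderE[of T \<beta> "\<lambda>t. c t (Y t)"] ctrl unfolding controlled1_def by metis
  obtain BR where BR: "0 \<le> BR" "hoelder2_norm T (\<alpha> + \<beta>) (remainder w (\<lambda>t. \<sigma> t
      (Y t)) (\<lambda>t. c t (Y t))) = ennreal BR"
    using ctrl finite_ennrealE unfolding controlled1_def hoelder2_def by metis
  have R: "norm (\<sigma> t (Y t) - \<sigma> s (Y s) - contract1 (w t - w s) (c s (Y s))) \<le> BR * (t - s)
      powr (\<alpha> + \<beta>)" if "0 \<le> s" "s < t" "t \<le> T" for s t
    using hoelder2_normD[OF eq_refl[OF BR(2)] BR(1) that] by (simp add: remainder_contract1)
  have bY: "norm (b t (Y t) - b s (Y s)) \<le> (M * BY + M) * (t - s) powr \<beta>" if st: "0 \<le> s" "s < t"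
      "t \<le> T" for s t
  proof -
    have 1: "norm (b t (Y t) - b t (Y s)) \<le> M * (BY * (t - s) powr \<beta>)"
      using lip_hoelderD(2)[OF b, of t "Y t" "Y s"] mult_left_mono[OF BY(2)[OF st] M0] st by simp
    have 2: "norm (b t (Y s) - b s (Y s)) \<le> M * (t - s) powr \<beta>" by (rule lip_hoelderD(3)[OF b st])
    have "norm ((b t (Y t) - b t (Y s)) + (b t (Y s) - b s (Y s))) \<le> M * (BY * (t - s) powr \<beta>) + M *
        (t - s) powr \<beta>"
      by (intro norm_triangle_le[OF add_mono] 1 2)
    then show ?thesis by (simp add: algebra_simps)
  qed
  define \<Xi> where "\<Xi> s u = contract1 (w u - w s) (\<sigma> s (Y s)) + contract2 (W s u) (c s (Y s)) + (u
      - s) *\<^sub>R b s (Y s)" for s u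
  define K where "K = M * BR + M * Bc + P * (M * BY + M)"
  have K: "0 \<le> K" using M0 BR Bc BY P by (simp add: K_def)
  have \<delta>: "norm (\<Xi> s t - \<Xi> s r - \<Xi> r t) \<le> K * (t - s) powr (2 * \<alpha> + \<beta>)" if
      st: "0 \<le> s" "s < r" "r < t" "t \<le> T" for s r t
  proof -
    have sr: "0 \<le> s" "s < r" "r \<le> T" using st by auto
    have x: "norm (\<sigma> r (Y r) - \<sigma> s (Y s) - contract1 (w r - w s) (c s (Y s))) \<le> BR * (r - s)
        powr (\<alpha> + \<beta>) * 1"
      "norm (c r (Y r) - c s (Y s)) \<le> Bc * (r - s) powr \<beta> * 1"
      "norm (b r (Y r) - b s (Y s)) \<le> (M * BY + M) * (r - s) powr \<beta> * 1"
      using R[OF sr] Bc(2)[OF sr] bY[OF sr] by auto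
    \<comment> \<open>\<open>euler_composition\<close> with initial value y = 0, so that y' is the
      increment \<open>\<Xi> s r\<close> itself.\<close>
    have "\<Xi> s r + \<Xi> r t - \<Xi> s t = contract1 (w t - w r) (\<sigma> r (Y r) - \<sigma> s (Y s) -
        contract1 (w r - w s) (c s (Y s)))
       + contract2 (W r t) (c r (Y r) - c s (Y s)) + (t - r) *\<^sub>R (b r (Y r) - b s (Y s))"
      using euler_composition[OF chen[OF st], where y' = "\<Xi> s r" and y = 0 and a = "\<sigma> s (Y s)" and c
          = "c s (Y s)" and r = "r - s" and e = "b s (Y s)"
        and a' = "\<sigma> r (Y r)" and c' = "c r (Y r)" and r' = "t - r" and e' = "b r (Y r)"]
      by (simp add: \<Xi>_def add.assoc)
    also have "norm \<dots> \<le> (M * BR + M * Bc + P * (M * BY + M)) * (t - s) powr (2 * \<alpha> + \<beta>) * 1"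
      using M0 BR Bc BY by (intro defect_bound[OF st x]) auto
    finally have "norm (\<Xi> s r + \<Xi> r t - \<Xi> s t) \<le> K * (t - s) powr (2 * \<alpha> + \<beta>)" by
        (simp add: K_def)
    moreover have "\<Xi> s t - \<Xi> s r - \<Xi> r t = - (\<Xi> s r + \<Xi> r t - \<Xi> s t)" by simp
    ultimately show ?thesis by (metis norm_minus_cancel)
  qed
  have "norm (Y t - Y s - \<Xi> s t) \<le> K / (1 - 2 / 2 powr (2 * \<alpha> + \<beta>)) * (t - s) powr (2 *
      \<alpha> + \<beta>)" if "0 \<le> s" "s < t" "t \<le> T" for s t
    using expansion_of_partition_limit[where K = "\<lambda>t. Y t - x", OF \<delta> \<gamma>_gt1 lim[folded
        \<Xi>_def] that] by simp
  then have "davie_bound T F (K / (1 - 2 / 2 powr (2 * \<alpha> + \<beta>))) (2 * \<alpha> + \<beta>) Y"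
    by (simp add: davie_bound_def euler_step_def \<Xi>_def algebra_simps)
  moreover have "0 \<le> K / (1 - 2 / 2 powr (2 * \<alpha> + \<beta>))"
    using K two_powr_gt[OF \<gamma>_gt1] by (intro divide_nonneg_nonneg) auto
  ultimately show ?thesis by blast
qed

lemma F_cont:
  assumes "continuous_on (time2 T) (\<lambda>(s, t). W s t)"
  shows "continuous_on (time2 T) (\<lambda>(s, t). F s t y)"
proof -
  have 1: "continuous_on (time2 T) (\<lambda>p. f (fst p))" "continuous_on (time2 T) (\<lambda>p. f (snd p))"
      if "continuous_on {0..T} f" for f :: "real \<Rightarrow> 'z::topological_space"
    by (auto intro!: continuous_on_compose2[OF that] continuous_on_fst continuous_on_snd continuous_on_id simp:
        time2_def)
  have H: "continuous_on {0..T} (\<lambda>t. H t y)" if "lip_hoelder T \<beta> D H" "0 \<le> D" for D and H ::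
      "real \<Rightarrow> 'e \<Rightarrow> 'z::real_normed_vector"
    using hoelderI[OF \<beta>_pos that(2), of T "\<lambda>t. H t y"] lip_hoelderD(3)[OF that(1)] by (simp add:
        hoelder_def)
  have "0 \<le> P * (M + M * M)" using P M0 by simp
  then show ?thesis
    unfolding euler_step_def case_prod_beta
    by (intro continuous_on_add continuous_on_diff contract1.continuous_on contract2.continuous_on
        continuous_on_scaleR continuous_on_const
       1 w_cont H[OF c12_lip_hoelder[OF \<sigma>]] H[OF c_lip_hoelder] H[OF b] continuous_on_id assms[unfolded
           case_prod_beta] C_nonneg M0)
qed

end

section \<open>From partition limits to the integrals of the equation\<close>

lemma has_rough_integral_iff:
  "has_rough_integral w W \<theta> \<theta>' t I \<longleftrightarrow> partition_limit (\<lambda>s u. contract1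
      (w u - w s) (\<theta> s) + contract2 (W s u) (\<theta>' s)) t I"
  by (simp add: has_rough_integral_def contract1_def contract2_def incr_def)

text \<open>The increments of m are multiples of the identity, so only the trace of the integrand is
  summed.\<close>

lemma has_young_integral_identity:
  assumes m: "\<forall>s. 0 \<le> s \<and> s \<le> T \<longrightarrow> m s = s *\<^sub>R mat 1" and t: "t \<le> T"
  shows "has_young_integral m c t J \<longleftrightarrow> partition_limit (\<lambda>s u. (u - s) *\<^sub>R
      (\<Sum>p\<in>UNIV. c s $ p $ p)) t J"
proof -
  have eq: "(\<Sum>p\<in>UNIV. \<Sum>q\<in>UNIV. (incr m s u $ p $ q) *\<^sub>R c s $ p $ q) = (u - s)
      *\<^sub>R (\<Sum>p\<in>UNIV. c s $ p $ p)"
    if "0 \<le> s" "s < u" "u \<le> t" for s u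
  proof -
    have "incr m s u = (u - s) *\<^sub>R mat 1" using m[rule_format, of s] m[rule_format, of u] that t by (simp
        add: incr_def scaleR_diff_left)
    then have "(incr m s u $ p $ q) *\<^sub>R c s $ p $ q = (if q = p then (u - s) *\<^sub>R c s $ p $ p else
        0)" for p q
      by (simp add: mat_def)
    then show ?thesis by (simp add: scaleR_sum_right)
  qed
  show ?thesis
    unfolding has_young_integral_def
    by (rule iffI) (erule partition_limit_cong[rotated], simp add: eq)+
qed

lemma partition_limit_0:
  assumes "partition_limit \<Xi> 0 I" shows "I = 0"
proof (rule ccontr)
  assume "I \<noteq> 0"
  then have "0 < norm I" by simp
  then obtain \<delta> where "0 < \<delta>" and lim: "\<forall>(N::nat) p. p 0 = 0 \<and> p N = 0 \<and>
      (\<forall>k<N. p k < p (Suc k) \<and> p (Suc k) - p k < \<delta>) \<longrightarrow>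
     norm ((\<Sum>k<N. \<Xi> (p k) (p (Suc k))) - I) < norm I"
    using assms[unfolded partition_limit_def, THEN spec, of "norm I"] by (elim impE exE conjE)
  \<comment> \<open>At t = 0 the partition with N = 0 cells is admissible for every \<delta>, and
    its sum is 0.\<close>
  from lim[THEN spec, of 0, THEN spec, of "\<lambda>_. 0"] show False by simp
qed

lemma chain_deriv_eq: "chain_deriv g g' Y (\<lambda>t. \<sigma> t (Y t)) = (\<lambda>t. chain_coeff g' (Dy g)
    \<sigma> t (Y t))"
  by (rule ext) (simp add: chain_deriv_def chain_coeff_def bmap_def vec_eq_iff)

lemma solves_imp_davie:
  fixes \<omega> :: "'d::finite path"
  assumes "rough_sde T \<alpha> \<beta> M \<omega> (lift T \<omega>) \<sigma> \<sigma>' (Dy \<sigma>) b"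
    and br: "\<forall>s. 0 \<le> s \<and> s \<le> T \<longrightarrow> path_bracket T \<omega> s = s *\<^sub>R mat 1"
    and sol: "solves_at T \<omega> \<alpha> \<beta> b \<sigma> \<sigma>' x Y"
  shows "Y 0 = x" "\<exists>C\<ge>0. davie_bound T (euler_step \<omega> (lift T \<omega>) \<sigma> (chain_coeff
      \<sigma>' (Dy \<sigma>) \<sigma>) b) C (2 * \<alpha> + \<beta>) Y"
proof -
  interpret rough_sde T \<alpha> \<beta> M \<omega> "lift T \<omega>" \<sigma> \<sigma>' "Dy \<sigma>" b by fact
  \<comment> \<open>The drift matrix b I_d / d has trace b.\<close>
  have tr: "(\<Sum>p\<in>UNIV. (\<chi> p q. if p = q then (1 / real CARD('d)) *\<^sub>R b s (Y s) else 0) $ p $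
      (p::'d)) = b s (Y s)" for s
    by (simp add: sum_constant_scaleR)
  have ex: "\<exists>I J. partition_limit (\<lambda>s u. contract1 (\<omega> u - \<omega> s) (\<sigma> s (Y s))
      + contract2 (lift T \<omega> s u) (c s (Y s))) t I \<and>
     partition_limit (\<lambda>s u. (u - s) *\<^sub>R b s (Y s)) t J \<and> Y t = x + I + J" if t: "0 \<le> t"
         "t \<le> T" for t
  proof -
    have "\<exists>I J. has_rough_integral \<omega> (lift T \<omega>) (\<lambda>s. \<sigma> s (Y s))
        (\<lambda>s. c s (Y s)) t I \<and>
        has_young_integral (path_bracket T \<omega>) (\<lambda>s. \<chi> p q. if p = q then (1 / real CARD('d))
            *\<^sub>R b s (Y s) else 0) t J \<and>
        Y t = x + I + J"
      using sol t unfolding solves_at_def chain_deriv_eq by simp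
    then show ?thesis unfolding has_rough_integral_iff has_young_integral_identity[of T, OF br t(2)] tr .
  qed
  obtain I J where IJ: "partition_limit (\<lambda>s u. contract1 (\<omega> u - \<omega> s) (\<sigma> s (Y s)) +
      contract2 (lift T \<omega> s u) (c s (Y s))) 0 I"
    "partition_limit (\<lambda>s u. (u - s) *\<^sub>R b s (Y s)) 0 J" "Y 0 = x + I + J"
    using ex[OF order_refl less_imp_le[OF T_pos]] by (elim exE conjE)
  then show "Y 0 = x" using partition_limit_0[OF IJ(1)] partition_limit_0[OF IJ(2)] by simp
  have "partition_limit (\<lambda>s u. contract1 (\<omega> u - \<omega> s) (\<sigma> s (Y s)) + contract2 (lift
      T \<omega> s u) (c s (Y s)) + (u - s) *\<^sub>R b s (Y s)) t (Y t - x)" if t: "0 \<le> t" "t \<le> T" for t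
  proof -
    obtain I J where IJ: "partition_limit (\<lambda>s u. contract1 (\<omega> u - \<omega> s) (\<sigma> s (Y s))
        + contract2 (lift T \<omega> s u) (c s (Y s))) t I"
      "partition_limit (\<lambda>s u. (u - s) *\<^sub>R b s (Y s)) t J" "Y t = x + I + J" using ex[OF t] by blast
    from partition_limit_add[OF IJ(1,2)] IJ(3) show ?thesis by simp
  qed
  then show "\<exists>C\<ge>0. davie_bound T F C (2 * \<alpha> + \<beta>) Y"
    using sol by (intro davie_of_solution) (auto simp: solves_at_def chain_deriv_eq controlled1_def)
qed

lemma davie_imp_solves:
  fixes \<omega> :: "'d::finite path"
  assumes "rough_sde T \<alpha> \<beta> M \<omega> (lift T \<omega>) \<sigma> \<sigma>' (Dy \<sigma>) b"
    and br: "\<forall>s. 0 \<le> s \<and> s \<le> T \<longrightarrow> path_bracket T \<omega> s = s *\<^sub>R mat 1"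
    and Y: "davie_bound T (euler_step \<omega> (lift T \<omega>) \<sigma> (chain_coeff \<sigma>' (Dy \<sigma>)
        \<sigma>) b) C (2 * \<alpha> + \<beta>) Y" "0 \<le> C" "Y 0 = x"
  shows "solves_at T \<omega> \<alpha> \<beta> b \<sigma> \<sigma>' x Y"
proof -
  interpret rough_sde T \<alpha> \<beta> M \<omega> "lift T \<omega>" \<sigma> \<sigma>' "Dy \<sigma>" b by fact
  have tr: "(\<Sum>p\<in>UNIV. (\<chi> p q. if p = q then (1 / real CARD('d)) *\<^sub>R b s (Y s) else 0) $ p $
      (p::'d)) = b s (Y s)" for s
    by (simp add: sum_constant_scaleR)
  have "\<exists>I J. has_rough_integral \<omega> (lift T \<omega>) (\<lambda>s. \<sigma> s (Y s)) (chain_deriv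
      \<sigma> \<sigma>' Y (\<lambda>s. \<sigma> s (Y s))) t I \<and>
        has_young_integral (path_bracket T \<omega>) (\<lambda>s. \<chi> p q. if p = q then (1 / real CARD('d))
            *\<^sub>R b s (Y s) else 0) t J \<and>
        Y t = x + I + J" if "t \<in> {0..T}" for t
  proof -
    from that have t: "0 \<le> t" "t \<le> T" by auto
    obtain I J where IJ: "partition_limit (\<lambda>s u. contract1 (\<omega> u - \<omega> s) (\<sigma> s (Y s))
        + contract2 (lift T \<omega> s u) (c s (Y s))) t I"
      "partition_limit (\<lambda>s u. (u - s) *\<^sub>R b s (Y s)) t J" "Y t = Y 0 + I + J"
      by (rule davie_integrals[OF Y(1,2) t])
    show ?thesis
      unfolding chain_deriv_eq has_rough_integral_iff has_young_integral_identity[of T, OF br t(2)] tr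
      by (intro exI[of _ I] exI[of _ J] conjI IJ(1,2)) (use IJ(3) Y(3) in simp)
  qed
  then show ?thesis
    unfolding solves_at_def chain_deriv_eq using davie_controlled[OF Y(1,2)] by simp
qed

text \<open>\<open>bracket\<close> is built from the second level over [0, t],
  \<open>path_bracket\<close> from \<open>Phi\<close>. They agree because \<open>Phi\<close>
  vanishes at 0, where all truncated increments are empty, and because \<omega> starts at 0.\<close>

lemma bracket_lift:
  assumes "\<omega> 0 = 0" "\<forall>s. 0 \<le> s \<and> s \<le> T \<longrightarrow> path_bracket T \<omega> s
      = s *\<^sub>R mat 1"
  shows "\<forall>t. 0 \<le> t \<and> t \<le> T \<longrightarrow> bracket \<omega> (lift T \<omega>) t = t
      *\<^sub>R mat 1"
proof (intro allI impI)
  fix t assume t: "0 \<le> t \<and> t \<le> T"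
  show "bracket \<omega> (lift T \<omega>) t = t *\<^sub>R mat 1"
  proof (cases "t = 0")
    case False
    have "dyadic_sum T \<omega> 0 n = 0" for n
    proof -
      have "0 \<le> dyadic T n i" for i using t by (simp add: dyadic_def)
      then show ?thesis by (simp add: dyadic_sum_def incr_def outer_def vec_eq_iff)
    qed
    then have "Phi T \<omega> 0 = 0" by (simp add: Phi_def Phi_ereal_def vec_eq_iff Limsup_const flip: zero_ereal_def)
    then have "lift T \<omega> 0 t = Phi T \<omega> t" using assms(1) by (simp add: lift_def outer_def vec_eq_iff)
    then show ?thesis using assms t False by (simp add: bracket_def path_bracket_def incr_def)
  qed (simp add: bracket_def)
qed

lemma solution_controlled2:
  fixes \<omega> :: "'d::finite path" and b :: "real \<Rightarrow> 'e::euclidean_space \<Rightarrow> 'e"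
  assumes sde: "rough_sde T \<alpha> \<beta> M \<omega> (lift T \<omega>) \<sigma> \<sigma>' (Dy \<sigma>) b"
    and br: "\<forall>s. 0 \<le> s \<and> s \<le> T \<longrightarrow> path_bracket T \<omega> s = s *\<^sub>R
        mat 1" and \<omega>0: "\<omega> 0 = 0"
    and sol: "solves_at T \<omega> \<alpha> \<beta> b \<sigma> \<sigma>' x Y"
  shows "controlled2 T \<omega> (lift T \<omega>) \<alpha> \<beta> Y (\<lambda>t. \<sigma> t (Y t))"
proof -
  interpret rough_sde T \<alpha> \<beta> M \<omega> "lift T \<omega>" \<sigma> \<sigma>' "Dy \<sigma>" b by fact
  have Y0: "Y 0 = x" by (rule solves_imp_davie[OF sde br sol])
  obtain C where C: "0 \<le> C" "davie_bound T F C (2 * \<alpha> + \<beta>) Y" using solves_imp_davie(2)[OF sde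
      br sol] by blast
  define d where "d = real CARD('d)"
  have d: "d \<noteq> 0" by (simp add: d_def)
  \<comment> \<open>Against t I_d only the trace counts, so D may be a multiple e of the identity,
    which is symmetric as required; e solves d e + (1/2) tr c = b.\<close>
  define e where "e s = (1 / d) *\<^sub>R (b s (Y s) - (1 / 2) *\<^sub>R (\<Sum>p\<in>UNIV. c s (Y s) $ p $ p))" for s
  define D :: "real \<Rightarrow> 'e^'d^'d" where "D s = (\<chi> p q. if p = q then e s else 0)" for s
  have tr: "(\<Sum>p\<in>UNIV. (D s + (1/2) *\<^sub>R transpose (c s (Y s))) $ p $ p) = b s (Y s)" for s
  proof -
    have "(\<Sum>p\<in>UNIV. (D s + (1/2) *\<^sub>R transpose (c s (Y s))) $ p $ p) = d *\<^sub>R e s + (1/2)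
        *\<^sub>R (\<Sum>p\<in>UNIV. c s (Y s) $ p $ p)"
      by (simp add: D_def transpose_def sum.distrib scaleR_sum_right sum_constant_scaleR d_def)
    then show ?thesis using d by (simp add: e_def)
  qed
  have Dsym: "transpose (D t) = D t" for t by (simp add: D_def transpose_def vec_eq_iff)
  define Bb where "Bb = M * (C * P + C3) * P + M"
  define Bc where "Bc = C2 * (C * P + C3) * P + C2"
  have B0: "0 \<le> Bb" "0 \<le> Bc" using C C_nonneg M0 P by (auto simp: Bb_def Bc_def)
  have "hoelder T \<beta> D"
  proof (rule hoelderI[OF \<beta>_pos])
    fix s t assume st: "0 \<le> s" "s < t" "t \<le> T"
    define k where "k = (t - s) powr \<beta>"
    have 1: "norm (b t (Y t) - b s (Y s)) \<le> Bb * k"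
      unfolding Bb_def k_def by (rule davie_composed_hoelder[OF C(2,1) b M0 st])
    have 2: "norm (c t (Y t) - c s (Y s)) \<le> Bc * k"
      unfolding Bc_def k_def by (rule davie_composed_hoelder[OF C(2,1) c_lip_hoelder C_nonneg(1) st])
    have "norm (\<Sum>p\<in>UNIV. (c t (Y t) - c s (Y s)) $ p $ p) \<le> (\<Sum>p\<in>(UNIV::'d set). Bc * k)"
    proof (rule sum_norm_le)
      fix p
      have "norm ((c t (Y t) - c s (Y s)) $ p $ p) \<le> norm ((c t (Y t) - c s (Y s)) $ p)" by (rule
          Finite_Cartesian_Product.norm_nth_le)
      also have "\<dots> \<le> norm (c t (Y t) - c s (Y s))" by (rule Finite_Cartesian_Product.norm_nth_le)
      finally show "norm ((c t (Y t) - c s (Y s)) $ p $ p) \<le> Bc * k" using 2 by simp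
    qed
    then have 3: "norm (\<Sum>p\<in>UNIV. (c t (Y t) - c s (Y s)) $ p $ p) \<le> d * (Bc * k)" by (simp add: d_def)
    have "e t - e s = (1 / d) *\<^sub>R ((b t (Y t) - b s (Y s)) - (1 / 2) *\<^sub>R (\<Sum>p\<in>UNIV. (c t (Y
        t) - c s (Y s)) $ p $ p))"
      by (simp add: e_def sum_subtractf algebra_simps)
    also have "norm \<dots> \<le> (1 / d) * (Bb * k + (1 / 2) * (d * (Bc * k)))"
      using 1 3 by (auto simp: d_def intro!: mult_left_mono norm_triangle_le_diff add_mono divide_right_mono)
    finally have 4: "norm (e t - e s) \<le> (1 / d) * (Bb * k + (1 / 2) * (d * (Bc * k)))" .
    have "norm (D t - D s) \<le> (\<Sum>p\<in>UNIV. norm ((D t - D s) $ p))" unfolding norm_vec_def by (rule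
        L2_set_le_sum) simp
    also have "\<dots> \<le> (\<Sum>p\<in>(UNIV::'d set). norm (e t - e s))"
    proof (rule sum_mono)
      fix p
      have "norm ((D t - D s) $ p) \<le> (\<Sum>q\<in>UNIV. norm ((D t - D s) $ p $ q))" unfolding norm_vec_def
          by (rule L2_set_le_sum) simp
      also have "\<dots> = (\<Sum>q\<in>UNIV. if p = q then norm (e t - e s) else 0)" by (intro sum.cong) (auto
          simp: D_def)
      finally show "norm ((D t - D s) $ p) \<le> norm (e t - e s)" by simp
    qed
    also have "\<dots> = d * norm (e t - e s)" by (simp add: d_def)
    also have "\<dots> \<le> d * ((1 / d) * (Bb * k + (1 / 2) * (d * (Bc * k))))" using 4 by (intro
        mult_left_mono) (auto simp: d_def)
    also have "\<dots> = (Bb + d * Bc / 2) * k" using d by (simp add: algebra_simps)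
    finally show "norm (D t - D s) \<le> (Bb + d * Bc / 2) * (t - s) powr \<beta>" by (simp add: k_def)
  qed (use B0 in \<open>simp add: d_def\<close>)
  moreover have "\<exists>I J. has_rough_integral \<omega> (lift T \<omega>) (\<lambda>t. \<sigma> t (Y t))
      (\<lambda>t. c t (Y t)) t I \<and>
        has_young_integral (bracket \<omega> (lift T \<omega>)) (\<lambda>s. D s + (1/2) *\<^sub>R transpose (c
            s (Y s))) t J \<and>
        incr Y 0 t = I + J" if "t \<in> {0..T}" for t
  proof -
    from that have t: "0 \<le> t" "t \<le> T" by auto
    obtain I J where IJ: "partition_limit (\<lambda>s u. contract1 (\<omega> u - \<omega> s) (\<sigma> s (Y s))
        + contract2 (lift T \<omega> s u) (c s (Y s))) t I"
      "partition_limit (\<lambda>s u. (u - s) *\<^sub>R b s (Y s)) t J" "Y t = Y 0 + I + J"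
      by (rule davie_integrals[OF C(2,1) t])
    then have "incr Y 0 t = I + J" by (simp add: incr_def)
    then show ?thesis
      unfolding has_rough_integral_iff has_young_integral_identity[of T, OF bracket_lift[OF \<omega>0 br] t(2)] tr
      by (intro exI[of _ I] exI[of _ J] conjI IJ(1,2))
  qed
  ultimately have "controlled2_with T \<omega> (lift T \<omega>) \<alpha> \<beta> Y (\<lambda>t. \<sigma> t (Y
      t)) (\<lambda>t. c t (Y t)) D"
    unfolding controlled2_with_def using davie_controlled[OF C(2,1)] Dsym by auto
  then show ?thesis unfolding controlled2_def by blast
qed

section \<open>Constants extracted from the hypotheses\<close>

lemma OmegaD:
  assumes "\<omega> \<in> Omega T" "\<alpha> \<in> {1/3<..<1/2}"
  shows "rough_path T \<alpha> \<omega> (lift T \<omega>)" "\<forall>s. 0 \<le> s \<and> s \<le> T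
      \<longrightarrow> path_bracket T \<omega> s = s *\<^sub>R mat 1" "\<omega> 0 = 0"
  using assms by (auto simp: Omega_def A_set_def Omega0_def)

definition path_data :: "real \<Rightarrow> real \<Rightarrow> real \<Rightarrow> 'd path \<Rightarrow> (real
    \<Rightarrow> real \<Rightarrow> real^'d^'d) \<Rightarrow> bool" where
  "path_data T \<alpha> M w W \<longleftrightarrow> (\<forall>s t. 0 \<le> s \<and> s < t \<and> t \<le> T
      \<longrightarrow>
     norm (w t - w s) \<le> M * (t - s) powr \<alpha> \<and> norm (W s t) \<le> M * (t - s) powr (2 * \<alpha>))"

lemma rough_path_data:
  assumes "rough_path T \<alpha> \<omega> W" obtains M where "0 \<le> M" "path_data T \<alpha> M \<omega> W"
proof -
  have fin: "hoelder_norm T \<alpha> \<omega> + hoelder2_norm T (2 * \<alpha>) W < \<infinity>"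
    using assms by (simp add: rough_path_def hoelder_def hoelder2_def)
  then obtain M where M: "0 \<le> M" "hoelder_norm T \<alpha> \<omega> + hoelder2_norm T (2 * \<alpha>) W = ennreal M"
    by (rule finite_ennrealE)
  note 1 = ennreal_add_leD[OF eq_refl[OF M(2)]]
  show ?thesis
    using that[OF M(1)] hoelder_normD[OF 1(1) M(1)] hoelder2_normD[OF 1(2) M(1)] by (simp add: path_data_def)
qed

lemma driverI:
  fixes \<omega> :: "'d::finite path"
  assumes "0 < T" "\<alpha> \<in> {1/3<..<1/2}" "\<beta> \<in> {1 - 2 * \<alpha><..\<alpha>}" "1 \<le> N"
      "rough_path T \<alpha> \<omega> W" "path_data T \<alpha> M \<omega> W" "M \<le> N"
  shows "driver T \<alpha> \<beta> N \<omega> W"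
proof
  have up: "M * k \<le> N * k" if "0 \<le> k" for k using assms(7) that by (rule mult_right_mono)
  fix s t :: real assume "0 \<le> s" "s < t" "t \<le> T"
  then have a: "norm (\<omega> t - \<omega> s) \<le> M * (t - s) powr \<alpha>" "norm (W s t) \<le> M * (t - s)
      powr (2 * \<alpha>)"
    using assms(6) by (auto simp: path_data_def)
  show "norm (\<omega> t - \<omega> s) \<le> N * (t - s) powr \<alpha>" by (rule order_trans[OF a(1) up]) simp
  show "norm (W s t) \<le> N * (t - s) powr (2 * \<alpha>)" by (rule order_trans[OF a(2) up]) simp
next
  fix s r t :: real assume "0 \<le> s" "s < r" "r < t" "t \<le> T"
  then have "W s t - W s r - W r t = outer (incr \<omega> s r) (incr \<omega> r t)"
    using assms(5) unfolding rough_path_def by blast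
  then show "W s t = W s r + W r t + outer (\<omega> r - \<omega> s) (\<omega> t - \<omega> r)" by (simp add:
      incr_def algebra_simps)
qed (use assms in auto)

lemma drift_lip_hoelder:
  assumes "\<And>t y. 0 \<le> t \<Longrightarrow> t \<le> T \<Longrightarrow> b t differentiable (at y) \<and>
      norm (b t y) \<le> M \<and> norm (Dy b t y) \<le> M"
    and "\<And>s t y. 0 \<le> s \<Longrightarrow> s < t \<Longrightarrow> t \<le> T \<Longrightarrow> norm (b t
        y - b s y) \<le> M * (t - s) powr \<beta>"
  shows "lip_hoelder T \<beta> M b"
  unfolding lip_hoelder_def using assms by (auto intro!: lipschitz_of_Dy[where g = b])

lemma C2_hoelder_data:
  assumes "C2_hoelder T \<beta> b"
  obtains M where "0 \<le> M" "\<And>N. M \<le> N \<Longrightarrow> lip_hoelder T \<beta> N b" "\<And>N. M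
      \<le> N \<Longrightarrow> lip_hoelder T \<beta> N (Dy b)"
    "\<And>t y. 0 \<le> t \<Longrightarrow> t \<le> T \<Longrightarrow> b t differentiable (at y)"
    "\<And>t y. 0 \<le> t \<Longrightarrow> t \<le> T \<Longrightarrow> norm (Dy b t y) \<le> M"
proof -
  have diff: "b t differentiable (at y)" "Dy b t differentiable (at y)" if "0 \<le> t" "t \<le> T" for t y
    using assms that by (auto simp: C2_hoelder_def C2_hoelder_loc_def C2_loc_def C1_loc_def)
  have "norm2_hoelder T \<beta> b < \<infinity>" using assms by (simp add: C2_hoelder_def)
  then obtain M where M: "0 \<le> M" "norm2_hoelder T \<beta> b = ennreal M" by (rule finite_ennrealE)
  note 1 = ennreal_add_leD[OF eq_refl[OF M(2)[unfolded norm2_hoelder_def norm2_def]]]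
  note 2 = ennreal_add_leD[OF 1(1)] ennreal_add_leD[OF 1(2)]
  note 3 = ennreal_add_leD[OF 2(1)] ennreal_add_leD[OF 2(3)]
  note b = norm0D[OF 3(1) M(1)] norm0D[OF 3(2) M(1)] norm0D[OF 2(2) M(1)]
  note h = 3(3,4)[unfolded sup_hoelder_norm_le_iff[OF M(1)]]
  have l1: "lip_hoelder T \<beta> M b" by (rule drift_lip_hoelder) (use b h diff in auto)
  have l2: "lip_hoelder T \<beta> M (Dy b)" by (rule drift_lip_hoelder) (use b h diff in auto)
  show ?thesis
    by (rule that[OF M(1) lip_hoelder_mono[OF l1] lip_hoelder_mono[OF l2] diff(1) b(2)])
qed

lemma exists_smooth_sde:
  fixes \<omega> :: "'d::finite path"
  assumes T: "0 < T" and \<omega>: "\<omega> \<in> Omega T" and \<alpha>: "\<alpha> \<in> {1/3<..<1/2}" and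
      \<beta>: "\<beta> \<in> {1 - 2 * \<alpha><..\<alpha>}"
    and b: "C2_hoelder T \<beta> b" and \<sigma>: "C23 T \<omega> (lift T \<omega>) \<alpha> \<beta> \<sigma> \<sigma>'"
  obtains M where "smooth_sde T \<alpha> \<beta> M \<omega> (lift T \<omega>) \<sigma> \<sigma>' (Dy \<sigma>)
      b (Dy_deriv \<sigma>') (Dy (Dy \<sigma>)) (Dy b)"
proof -
  obtain M1 where M1: "0 \<le> M1" "path_data T \<alpha> M1 \<omega> (lift T \<omega>)" using
      rough_path_data[OF OmegaD(1)[OF \<omega> \<alpha>]] by blast
  obtain M2 where M2: "0 \<le> M2" "\<And>N. M2 \<le> N \<Longrightarrow> lip_hoelder T \<beta> N b" "\<And>N.
      M2 \<le> N \<Longrightarrow> lip_hoelder T \<beta> N (Dy b)"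
    "\<And>t y. 0 \<le> t \<Longrightarrow> t \<le> T \<Longrightarrow> b t differentiable (at y)"
    by (rule C2_hoelder_data[OF b]) (rule that, assumption+)
  obtain g'' where fin: "norm12 T \<omega> \<alpha> \<beta> \<sigma> \<sigma>' + norm12 T \<omega> \<alpha>
      \<beta> \<sigma>' g'' + norm12 T \<omega> \<alpha> \<beta> (Dy \<sigma>) (Dy_deriv \<sigma>') < \<infinity>"
    using \<sigma> unfolding C23_def by blast
  then obtain M3 where M3: "0 \<le> M3" "norm12 T \<omega> \<alpha> \<beta> \<sigma> \<sigma>' + norm12 T
      \<omega> \<alpha> \<beta> \<sigma>' g'' + norm12 T \<omega> \<alpha> \<beta> (Dy \<sigma>) (Dy_deriv
      \<sigma>') = ennreal M3"
    by (rule finite_ennrealE)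
  define M where "M = max 1 (max M1 (max M2 M3))"
  have M: "1 \<le> M" "M1 \<le> M" "M2 \<le> M" "M3 \<le> M" "0 \<le> M" by (auto simp: M_def)
  \<comment> \<open>M collects the bounds in the hypotheses; \<open>c12_bound_data\<close> turns M
    into N, and all other bounds are enlarged to N.\<close>
  define N where "N = M + (1 + T)\<^sup>2 * (M + real CARD('d) * M * M)"
  have MN: "M \<le> N" using M by (simp add: N_def)
  have "ennreal M3 \<le> ennreal M" using M by (simp add: ennreal_leI)
  then have le: "norm12 T \<omega> \<alpha> \<beta> \<sigma> \<sigma>' + norm12 T \<omega> \<alpha> \<beta>
      \<sigma>' g'' + norm12 T \<omega> \<alpha> \<beta> (Dy \<sigma>) (Dy_deriv \<sigma>') \<le> ennreal M"
      using M3 by simp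
  have wM: "norm (\<omega> t - \<omega> s) \<le> M * (t - s) powr \<alpha>" if "0 \<le> s" "s < t" "t \<le> T" for s t
  proof -
    have "norm (\<omega> t - \<omega> s) \<le> M1 * (t - s) powr \<alpha>" using M1 that by (auto simp: path_data_def)
    also have "\<dots> \<le> M * (t - s) powr \<alpha>" using M by (intro mult_right_mono) auto
    finally show ?thesis .
  qed
  have diff: "c12_diff T \<sigma> \<sigma>'" "c12_diff T (Dy \<sigma>) (Dy_deriv \<sigma>')"
    using \<sigma> by (auto simp: C23_def intro: C12_loc_diff)
  have 1: "c12_bound T \<omega> \<alpha> \<beta> N \<sigma> \<sigma>' (Dy \<sigma>)"
    by (rule c12_bound_data[OF norm12_data[OF ennreal_add_leD(1)[OF ennreal_add_leD(1)[OF le]] M(5)] diff(1)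
        M(5) wM _ _ _ _ N_def])
      (use \<alpha> \<beta> in auto)
  have 2: "c12_bound T \<omega> \<alpha> \<beta> N (Dy \<sigma>) (Dy_deriv \<sigma>') (Dy (Dy \<sigma>))"
    by (rule c12_bound_data[OF norm12_data[OF ennreal_add_leD(2)[OF le] M(5)] diff(2) M(5) wM _ _ _ _ N_def])
      (use \<alpha> \<beta> in auto)
  have 3: "driver T \<alpha> \<beta> N \<omega> (lift T \<omega>)"
    using M MN by (intro driverI[OF T \<alpha> \<beta> _ OmegaD(1)[OF \<omega> \<alpha>] M1(2)]) auto
  have 4: "rough_sde T \<alpha> \<beta> N \<omega> (lift T \<omega>) \<sigma> \<sigma>' (Dy \<sigma>) b"
    using 1 3 M2(2) M MN by (intro rough_sde.intro rough_sde_axioms.intro) auto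
  have "smooth_sde T \<alpha> \<beta> N \<omega> (lift T \<omega>) \<sigma> \<sigma>' (Dy \<sigma>) b (Dy_deriv
      \<sigma>') (Dy (Dy \<sigma>)) (Dy b)"
  proof (intro smooth_sde.intro smooth_sde_axioms.intro 4 2)
    show "lip_hoelder T \<beta> N (Dy b)" using M2(3) M MN by auto
    fix t y j assume t: "0 \<le> t" "t \<le> T"
    show "(b t has_derivative blinfun_apply (Dy b t y)) (at y)" by (rule Dy_works[of b]) (use M2(4) t in auto)
    show "((\<lambda>y. \<sigma>' t y $ j) has_derivative blinfun_apply (Dy_deriv \<sigma>' t y $ j)) (at y)"
      by (rule Dy_deriv_works[of \<sigma>']) (use diff t in \<open>auto simp: c12_diff_def\<close>)
  qed
  then show ?thesis by (rule that)
qed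

section \<open>Stability of the equation\<close>

text \<open>Both equations are taken with the same N, so their flows share all constants and
  \<epsilon> is the only small parameter. Time increments of \<sigma> and \<tau> are compared
  through remainders, since the two are controlled by different paths.\<close>

locale sde_close = A: rough_sde T \<alpha> \<beta> N w W \<sigma> \<sigma>' D\<sigma> b + B: rough_sde T
    \<alpha> \<beta> N v V \<tau> \<tau>' D\<tau> a
  for T \<alpha> \<beta> N :: real and w :: "'d::finite path" and W and \<sigma> :: "real \<Rightarrow>
      'e::euclidean_space \<Rightarrow> 'e^'d" and \<sigma>' D\<sigma> b
    and v :: "'d path" and V and \<tau> :: "real \<Rightarrow> 'e \<Rightarrow> 'e^'d" and \<tau>' D\<tau> a +
  fixes \<epsilon> :: real
  assumes \<epsilon>: "0 \<le> \<epsilon>"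
    and w_close: "\<And>s t. 0 \<le> s \<Longrightarrow> s < t \<Longrightarrow> t \<le> T \<Longrightarrow>
        norm ((w t - w s) - (v t - v s)) \<le> \<epsilon> * (t - s) powr \<alpha>"
    and W_close: "\<And>s t. 0 \<le> s \<Longrightarrow> s < t \<Longrightarrow> t \<le> T \<Longrightarrow>
        norm (W s t - V s t) \<le> \<epsilon> * (t - s) powr (2 * \<alpha>)"
    and \<sigma>_close: "\<And>t y. 0 \<le> t \<Longrightarrow> t \<le> T \<Longrightarrow> norm (\<sigma> t y
        - \<tau> t y) \<le> \<epsilon>"
    and D\<sigma>_close: "\<And>t y. 0 \<le> t \<Longrightarrow> t \<le> T \<Longrightarrow> norm (D\<sigma> t
        y - D\<tau> t y) \<le> \<epsilon>"
    and \<sigma>'_close: "\<And>t y. 0 \<le> t \<Longrightarrow> t \<le> T \<Longrightarrow> norm (\<sigma>' t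
        y - \<tau>' t y) \<le> \<epsilon>"
    and b_close: "\<And>t y. 0 \<le> t \<Longrightarrow> t \<le> T \<Longrightarrow> norm (b t y - a t y) \<le>
        \<epsilon>"
    and R_close: "\<And>s t y. 0 \<le> s \<Longrightarrow> s < t \<Longrightarrow> t \<le> T \<Longrightarrow>
      norm ((\<sigma> t y - \<sigma> s y - contract1 (w t - w s) (\<sigma>' s y)) - (\<tau> t y - \<tau> s y -
          contract1 (v t - v s) (\<tau>' s y))) \<le> \<epsilon> * (t - s) powr (\<alpha> + \<beta>)"
begin

abbreviation P :: real where "P \<equiv> A.P"
abbreviation C2 :: real where "C2 \<equiv> A.C2"
abbreviation C3 :: real where "C3 \<equiv> A.C3"

lemma N0: "0 \<le> N" "1 \<le> N" using A.M by auto
lemma P0: "0 \<le> P" using A.P by simp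

lemma bilinear_close:
  assumes f: "bounded_bilinear f" and nf: "\<And>a b. norm (f a b) \<le> norm a * norm b"
    and le: "norm (x - x') \<le> p" "norm y \<le> q" "norm x' \<le> r" "norm (y - y') \<le> s"
  shows "norm (f x y - f x' y') \<le> p * q + r * s"
proof -
  interpret bounded_bilinear f by (rule f)
  have "f x y - f x' y' = f (x - x') y + f x' (y - y')" by (simp add: diff_left diff_right)
  moreover have "norm (f (x - x') y) \<le> p * q"
    using order_trans[OF nf mult_mono[OF le(1,2)]] order_trans[OF norm_ge_zero le(1)] by simp
  moreover have "norm (f x' (y - y')) \<le> r * s"
    using order_trans[OF nf mult_mono[OF le(3,4)]] order_trans[OF norm_ge_zero le(3)] by simp
  ultimately show ?thesis by (simp add: norm_triangle_le add_mono)
qed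

lemma shifted_close:
  assumes "\<And>y z. norm (H y - H z) \<le> B * norm (y - z)" "\<And>y. norm (H y - G y) \<le> D * \<epsilon>"
      "norm (y - z) \<le> \<epsilon>" "0 \<le> B"
  shows "norm (H y - G z) \<le> (B + D) * \<epsilon>"
proof -
  have "norm (H y - H z) \<le> B * \<epsilon>" using assms(1)[of y z] mult_left_mono[OF assms(3,4)] by linarith
  then have "norm ((H y - H z) + (H z - G z)) \<le> B * \<epsilon> + D * \<epsilon>"
    by (intro norm_triangle_le[OF add_mono] assms(2))
  then show ?thesis by (simp add: algebra_simps)
qed

lemma coeff_close:
  assumes t: "0 \<le> t" "t \<le> T" and yz: "norm (y - z) \<le> \<epsilon>"
  shows "norm (\<sigma> t y - \<tau> t z) \<le> (N + 1) * \<epsilon>" "norm (b t y - a t z) \<le> (N + 1) * \<epsilon>"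
    "norm (A.c t y - B.c t z) \<le> (C2 + (1 + 2 * N)) * \<epsilon>"
proof -
  show "norm (\<sigma> t y - \<tau> t z) \<le> (N + 1) * \<epsilon>"
    using t \<sigma>_close N0 by (intro shifted_close[OF A.\<sigma>_lip _ yz]) auto
  show "norm (b t y - a t z) \<le> (N + 1) * \<epsilon>"
    using t b_close N0 by (intro shifted_close[OF lip_hoelderD(2)[OF A.b] _ yz]) auto
  have "norm (A.c t y - B.c t y) \<le> (1 + 2 * N) * \<epsilon>" for y
  proof -
    have "norm (bmap (D\<sigma> t y) (\<sigma> t y) - bmap (D\<tau> t y) (\<tau> t y)) \<le> \<epsilon> * N + N
        * \<epsilon>"
      by (intro bilinear_close[OF bmap.bounded_bilinear_axioms norm_bmap_le] D\<sigma>_close \<sigma>_close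
        c12_boundD(2)[OF A.\<sigma>] lip_hoelderD(1)[OF c12_boundD(4)[OF B.\<sigma>]] t)
    then have "norm ((\<sigma>' t y - \<tau>' t y) + (bmap (D\<sigma> t y) (\<sigma> t y) - bmap (D\<tau> t y)
        (\<tau> t y))) \<le> \<epsilon> + (\<epsilon> * N + N * \<epsilon>)"
      by (intro norm_triangle_le[OF add_mono] \<sigma>'_close t)
    then show ?thesis by (simp add: chain_coeff_def algebra_simps)
  qed
  then show "norm (A.c t y - B.c t z) \<le> (C2 + (1 + 2 * N)) * \<epsilon>"
    using t A.C_nonneg by (intro shifted_close[OF lip_hoelderD(2)[OF A.c_lip_hoelder] _ yz]) auto
qed

text \<open>D0, D1 and D2 are the factors of \<epsilon> in the distance of the first-order terms, of
  the second-order terms with drift, and of the full Euler steps.\<close>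

definition D0 :: real where "D0 = N + N * (N + 1)"
definition D1 :: real where "D1 = P * (C2 + N * (C2 + (1 + 2 * N))) + P * (N + 1)"
definition D2 :: real where "D2 = 1 + D0 * P + D1 * P"

lemma D_nonneg: "0 \<le> D0" "0 \<le> D1" "0 \<le> D2"
  using N0 P0 A.C_nonneg by (simp_all add: D0_def D1_def D2_def)

lemma first_order_close:
  assumes st: "0 \<le> s" "s < t" "t \<le> T" and yz: "norm (y - z) \<le> \<epsilon>"
  shows "norm (contract1 (w t - w s) (\<sigma> s y) - contract1 (v t - v s) (\<tau> s z)) \<le> D0 * \<epsilon>
      * (t - s) powr \<alpha>"
proof -
  have s: "0 \<le> s" "s \<le> T" using st by auto
  have "norm (contract1 (w t - w s) (\<sigma> s y) - contract1 (v t - v s) (\<tau> s z)) \<le>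
    (\<epsilon> * (t - s) powr \<alpha>) * N + (N * (t - s) powr \<alpha>) * ((N + 1) * \<epsilon>)"
    by (intro bilinear_close[OF contract1.bounded_bilinear_axioms norm_contract1_le] w_close B.w_bound coeff_close(1)
       c12_boundD(2)[OF A.\<sigma>] st s yz)
  then show ?thesis by (simp add: D0_def algebra_simps)
qed

lemma second_order_close:
  assumes st: "0 \<le> s" "s < t" "t \<le> T" and yz: "norm (y - z) \<le> \<epsilon>"
  shows "norm ((contract2 (W s t) (A.c s y) + (t - s) *\<^sub>R b s y) - (contract2 (V s t) (B.c s z) + (t - s)
      *\<^sub>R a s z)) \<le> D1 * \<epsilon> * (t - s) powr (\<alpha> + \<beta>)"
proof -
  have s: "0 \<le> s" "s \<le> T" using st by auto
  have h: "0 < t - s" "t - s \<le> T" using st by auto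
  define k where "k = (t - s) powr (\<alpha> + \<beta>)"
  have "norm (contract2 (W s t) (A.c s y) - contract2 (V s t) (B.c s z)) \<le>
    (\<epsilon> * (t - s) powr (2 * \<alpha>)) * C2 + (N * (t - s) powr (2 * \<alpha>)) * ((C2 + (1 + 2 * N)) *
        \<epsilon>)"
    by (intro bilinear_close[OF contract2.bounded_bilinear_axioms norm_contract2_le] W_close B.W_bound coeff_close(3)
       lip_hoelderD(1)[OF A.c_lip_hoelder] st s yz)
  also have "\<dots> = (t - s) powr (2 * \<alpha>) * ((C2 + N * (C2 + (1 + 2 * N))) * \<epsilon>)" by (simp
      add: algebra_simps)
  also have "\<dots> \<le> (P * k) * ((C2 + N * (C2 + (1 + 2 * N))) * \<epsilon>)"
    unfolding k_def using h N0 \<epsilon> A.C_nonneg A.\<alpha> A.\<beta> A.\<beta>_pos by (intro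
        mult_right_mono A.weaken) auto
  finally have 1: "norm (contract2 (W s t) (A.c s y) - contract2 (V s t) (B.c s z)) \<le> (P * k) * ((C2 + N *
      (C2 + (1 + 2 * N))) * \<epsilon>)" .
  have "norm ((t - s) *\<^sub>R (b s y - a s z)) = (t - s) powr 1 * norm (b s y - a s z)" using st by simp
  also have "\<dots> \<le> (P * k) * ((N + 1) * \<epsilon>)"
    unfolding k_def using h P0 A.\<alpha> A.\<beta> A.\<beta>_pos by (intro mult_mono A.weaken coeff_close(2) s yz) auto
  finally have 2: "norm ((t - s) *\<^sub>R (b s y - a s z)) \<le> (P * k) * ((N + 1) * \<epsilon>)" .
  have "norm ((contract2 (W s t) (A.c s y) - contract2 (V s t) (B.c s z)) + (t - s) *\<^sub>R (b s y - a s z)) \<le>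
    (P * k) * ((C2 + N * (C2 + (1 + 2 * N))) * \<epsilon>) + (P * k) * ((N + 1) * \<epsilon>)"
    by (intro norm_triangle_le[OF add_mono] 1 2)
  then show ?thesis by (simp add: D1_def k_def algebra_simps)
qed

lemma flow_close:
  assumes st: "0 \<le> s" "s < t" "t \<le> T" and yz: "norm (y - z) \<le> \<epsilon>"
  shows "norm (A.F s t y - B.F s t z) \<le> D2 * \<epsilon>"
proof -
  have h: "0 < t - s" "t - s \<le> T" using st by auto
  have pw: "(t - s) powr p \<le> P" if "0 \<le> p" "p \<le> 2" for p
    using A.weaken[of "t - s" 0 p] h that by simp
  have "norm (contract1 (w t - w s) (\<sigma> s y) - contract1 (v t - v s) (\<tau> s z)) \<le> D0 * \<epsilon>
      * (t - s) powr \<alpha>"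
    by (rule first_order_close[OF assms])
  also have "\<dots> \<le> D0 * \<epsilon> * P" using D_nonneg \<epsilon> A.\<alpha> by (intro mult_left_mono pw) auto
  finally have 1: "norm (contract1 (w t - w s) (\<sigma> s y) - contract1 (v t - v s) (\<tau> s z)) \<le> D0 *
      \<epsilon> * P" .
  have "norm ((contract2 (W s t) (A.c s y) + (t - s) *\<^sub>R b s y) - (contract2 (V s t) (B.c s z) + (t - s)
      *\<^sub>R a s z)) \<le> D1 * \<epsilon> * (t - s) powr (\<alpha> + \<beta>)"
    by (rule second_order_close[OF assms])
  also have "\<dots> \<le> D1 * \<epsilon> * P" using D_nonneg \<epsilon> A.\<alpha> A.\<beta> A.\<beta>_pos by
      (intro mult_left_mono pw) auto
  finally have 2: "norm ((contract2 (W s t) (A.c s y) + (t - s) *\<^sub>R b s y) - (contract2 (V s t) (B.c s z)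
      + (t - s) *\<^sub>R a s z)) \<le> D1 * \<epsilon> * P" .
  have "norm ((y - z) + (contract1 (w t - w s) (\<sigma> s y) - contract1 (v t - v s) (\<tau> s z)) +
    ((contract2 (W s t) (A.c s y) + (t - s) *\<^sub>R b s y) - (contract2 (V s t) (B.c s z) + (t - s) *\<^sub>R
        a s z))) \<le> \<epsilon> + D0 * \<epsilon> * P + D1 * \<epsilon> * P"
    by (intro norm_triangle_le[OF add_mono] yz 1 2)
  then show ?thesis by (simp add: euler_step_def D2_def algebra_simps)
qed

text \<open>The bound on the difference of remainders. Its first term comes from intervals of length
  at most \<delta>, where each Davie error is small by itself; the division by a power of \<delta>
  comes from longer ones, where uniform closeness is used.\<close>

definition err :: "real \<Rightarrow> real \<Rightarrow> real" where "err C \<delta> = 2 * C * \<delta> powr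
    \<alpha> + ((1 + D2) / \<delta> powr (\<alpha> + \<beta>) + D1) * \<epsilon>"
definition BZ :: "real \<Rightarrow> real" where "BZ C = C * P + C3"
definition err' :: "real \<Rightarrow> real \<Rightarrow> real" where
  "err' C \<delta> = (BZ C * P + 2 * N * P + P) * \<epsilon> + N * (D0 * \<epsilon> + err C \<delta> * P + 2 *
      \<epsilon> * BZ C) * P + N * \<epsilon>"
text \<open>The sum of \<open>err\<close> and \<open>err'\<close> is rearranged as A2 err + A1
  \<epsilon>. Neither A1 nor A2 involves \<delta>, which can therefore be chosen before
  \<epsilon>.\<close>

definition A1 :: "real \<Rightarrow> real" where "A1 C = BZ C * P + 2 * N * P + P + N * (D0 + 2 * BZ C) * P + N"
definition A2 :: "real" where "A2 = 1 + N * P * P"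

lemma A_nonneg:
  assumes "0 \<le> C" shows "0 \<le> A1 C" "0 \<le> A2"
  using assms N0 P0 D_nonneg A.C_nonneg by (simp_all add: A1_def A2_def BZ_def)

section \<open>Comparison of two Davie solutions\<close>

context
  fixes Y Z :: "real \<Rightarrow> 'e" and C \<delta> :: real
  assumes Y: "davie_bound T A.F C (2 * \<alpha> + \<beta>) Y" and Z: "davie_bound T B.F C (2 * \<alpha> +
      \<beta>) Z" and C: "0 \<le> C" and \<delta>: "0 < \<delta>"
    and YZ: "\<And>t. 0 \<le> t \<Longrightarrow> t \<le> T \<Longrightarrow> norm (Y t - Z t) \<le> \<epsilon>"
begin


lemma err_nonneg: "0 \<le> err C \<delta>"
  using C D_nonneg \<epsilon> by (simp add: err_def)

text \<open>Interpolation: the Davie errors are small uniformly, and of order \<open>2\<alpha> + \<beta> >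
    \<alpha> + \<beta>\<close>.\<close>
lemma davie_error_close:
  assumes st: "0 \<le> s" "s < t" "t \<le> T"
  shows "norm ((Y t - A.F s t (Y s)) - (Z t - B.F s t (Z s))) \<le> (2 * C * \<delta> powr \<alpha> + (1 + D2)
      / \<delta> powr (\<alpha> + \<beta>) * \<epsilon>) * (t - s) powr (\<alpha> + \<beta>)"
    (is "norm ?J \<le> (?p + ?q) * ?k")
proof (cases "t - s \<le> \<delta>")
  case True
  \<comment> \<open>On short intervals the two errors are bounded separately; their spare power
    \<alpha> of the length is at most \<delta>^\<alpha>.\<close>
  have "norm ?J \<le> C * (t - s) powr (2 * \<alpha> + \<beta>) + C * (t - s) powr (2 * \<alpha> + \<beta>)"
    using Y Z st by (intro norm_triangle_le_diff[OF add_mono]) (auto simp: davie_bound_def)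
  also have "\<dots> = 2 * C * (t - s) powr \<alpha> * ?k"
    using powr_add[of "t - s" \<alpha> "\<alpha> + \<beta>"] by simp
  also have "\<dots> \<le> ?p * ?k"
    using True st C A.\<alpha> by (intro mult_right_mono mult_left_mono powr_mono2) auto
  also have "\<dots> \<le> (?p + ?q) * ?k"
    using D_nonneg \<epsilon> by (intro mult_right_mono) auto
  finally show ?thesis .
next
  case False
  \<comment> \<open>On long intervals closeness of the solutions and of the flows gives a multiple
    of \<epsilon>, and the length is bounded below by \<delta>.\<close>
  have "norm ?J = norm ((Y t - Z t) - (A.F s t (Y s) - B.F s t (Z s)))" by (simp add: algebra_simps)
  also have "\<dots> \<le> \<epsilon> + D2 * \<epsilon>"
    using st by (intro norm_triangle_le_diff add_mono YZ flow_close) auto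
  also have "\<dots> = (1 + D2) * \<epsilon> / \<delta> powr (\<alpha> + \<beta>) * \<delta> powr (\<alpha> + \<beta>)"
    using \<delta> by (simp add: field_simps)
  also have "\<dots> \<le> (1 + D2) * \<epsilon> / \<delta> powr (\<alpha> + \<beta>) * ?k"
    using False \<delta> D_nonneg \<epsilon> A.\<alpha> A.\<beta>_pos by (intro mult_left_mono powr_mono2) auto
  also have "\<dots> \<le> (?p + ?q) * ?k"
    using C by (intro mult_right_mono) auto
  finally show ?thesis .
qed

lemma remainder_close:
  assumes st: "0 \<le> s" "s < t" "t \<le> T"
  shows "norm ((Y t - Y s - contract1 (w t - w s) (\<sigma> s (Y s))) - (Z t - Z s - contract1 (v t - v s)
      (\<tau> s (Z s)))) \<le> err C \<delta> * (t - s) powr (\<alpha> + \<beta>)"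
proof -
  have s: "0 \<le> s" "s \<le> T" using st by auto
  have "norm (((Y t - A.F s t (Y s)) - (Z t - B.F s t (Z s))) +
     ((contract2 (W s t) (A.c s (Y s)) + (t - s) *\<^sub>R b s (Y s)) - (contract2 (V s t) (B.c s (Z s)) + (t -
         s) *\<^sub>R a s (Z s))))
    \<le> (2 * C * \<delta> powr \<alpha> + (1 + D2) / \<delta> powr (\<alpha> + \<beta>) * \<epsilon>) * (t -
        s) powr (\<alpha> + \<beta>) + D1 * \<epsilon> * (t - s) powr (\<alpha> + \<beta>)"
    by (intro norm_triangle_le[OF add_mono] davie_error_close second_order_close st YZ s)
  then show ?thesis by (simp add: euler_step_def err_def algebra_simps)
qed

lemma increment_close:
  assumes st: "0 \<le> s" "s < t" "t \<le> T"
  shows "norm ((Y t - Y s) - (Z t - Z s)) \<le> (D0 * \<epsilon> + err C \<delta> * P) * (t - s) powr \<alpha>"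
proof -
  have s: "0 \<le> s" "s \<le> T" using st by auto
  have "norm ((Y t - Y s - contract1 (w t - w s) (\<sigma> s (Y s))) - (Z t - Z s - contract1 (v t - v s)
      (\<tau> s (Z s)))) \<le> err C \<delta> * (t - s) powr (\<alpha> + \<beta>)"
    by (rule remainder_close[OF st])
  also have "\<dots> \<le> err C \<delta> * (P * (t - s) powr \<alpha>)"
    using st err_nonneg A.\<alpha> A.\<beta> A.\<beta>_pos by (intro mult_left_mono A.weaken) auto
  finally have 1: "norm ((Y t - Y s - contract1 (w t - w s) (\<sigma> s (Y s))) - (Z t - Z s - contract1 (v t -
      v s) (\<tau> s (Z s)))) \<le> err C \<delta> * (P * (t - s) powr \<alpha>)" .
  have "norm ((contract1 (w t - w s) (\<sigma> s (Y s)) - contract1 (v t - v s) (\<tau> s (Z s))) +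
    ((Y t - Y s - contract1 (w t - w s) (\<sigma> s (Y s))) - (Z t - Z s - contract1 (v t - v s) (\<tau> s (Z
        s))))) \<le> D0 * \<epsilon> * (t - s) powr \<alpha> + err C \<delta> * (P * (t - s) powr \<alpha>)"
    by (intro norm_triangle_le[OF add_mono] 1 first_order_close st YZ s)
  then show ?thesis by (simp add: algebra_simps)
qed



text \<open>Four differences: \<sigma> - \<tau> along the movement of Z, \<sigma> - \<tau> in time
  at the point Z s, a second difference of \<sigma> in space, and a mixed difference of \<sigma> in
  time and space. They are controlled in turn by closeness of the space derivatives, of the
  remainders and path derivatives, of the increments of Y and Z, and of Y and Z at time s.\<close>

lemma derivative_close:
  assumes st: "0 \<le> s" "s < t" "t \<le> T"
  shows "norm ((\<sigma> t (Y t) - \<tau> t (Z t)) - (\<sigma> s (Y s) - \<tau> s (Z s))) \<le> err' C \<delta>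
      * (t - s) powr \<beta>"
proof -
  have s: "0 \<le> s" "s \<le> T" and t: "0 \<le> t" "t \<le> T" using st by auto
  define k where "k = (t - s) powr \<beta>"
  have k0: "0 \<le> k" by (simp add: k_def)
  have pk: "(t - s) powr p \<le> P * k" if "\<beta> \<le> p" "p \<le> \<beta> + 2" for p
    unfolding k_def using st that by (intro A.weaken) auto
  have BZ0: "0 \<le> BZ C" using C P0 A.C_nonneg by (simp add: BZ_def)
  have Zinc: "norm (Z t - Z s) \<le> BZ C * (t - s) powr \<alpha>"
    unfolding BZ_def by (rule B.davie_increments(1)[OF Z C st])
  have d\<sigma>: "(\<sigma> r has_derivative blinfun_apply (D\<sigma> r y)) (at y)" and d\<tau>: "(\<tau> r
      has_derivative blinfun_apply (D\<tau> r y)) (at y)"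
    if "0 \<le> r" "r \<le> T" for r y
    using c12_boundD(1)[OF A.\<sigma> that] c12_boundD(1)[OF B.\<sigma> that] by auto
  have lipD: "norm (f y - f z) \<le> D * norm (y - z)"
    if "\<And>y. (f has_derivative blinfun_apply (Df y)) (at y)" "\<And>y. norm (Df y) \<le> D" for f :: "'e
        \<Rightarrow> 'e^'d" and Df D y z
    by (rule differentiable_bound[where S = UNIV and f' = "\<lambda>x. blinfun_apply (Df x)"])
      (use that in \<open>auto simp: norm_blinfun.rep_eq[symmetric]\<close>)
  have 1: "norm ((\<sigma> t (Z t) - \<tau> t (Z t)) - (\<sigma> t (Z s) - \<tau> t (Z s))) \<le> BZ C * P *
      \<epsilon> * k"
  proof -
    have "norm ((\<sigma> t (Z t) - \<tau> t (Z t)) - (\<sigma> t (Z s) - \<tau> t (Z s))) \<le> \<epsilon> *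
        norm (Z t - Z s)"
    proof (rule lipD[where f = "\<lambda>y. \<sigma> t y - \<tau> t y" and Df = "\<lambda>y. D\<sigma> t y -
        D\<tau> t y"])
      show "((\<lambda>y. \<sigma> t y - \<tau> t y) has_derivative blinfun_apply (D\<sigma> t y - D\<tau> t
          y)) (at y)" for y
        by (rule has_derivative_eq_rhs[OF has_derivative_diff[OF d\<sigma>[OF t] d\<tau>[OF t]]]) (simp add:
            fun_eq_iff blinfun.diff_left)
    qed (rule D\<sigma>_close[OF t])
    also have "\<dots> \<le> \<epsilon> * (BZ C * (P * k))"
      using Zinc pk[of \<alpha>] A.\<beta> A.\<alpha> A.\<beta>_pos BZ0 \<epsilon> by (intro mult_left_mono)
          (auto intro: order_trans mult_left_mono)
    finally show ?thesis by (simp add: mult_ac)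
  qed
  have 2: "norm ((\<sigma> t (Z s) - \<tau> t (Z s)) - (\<sigma> s (Z s) - \<tau> s (Z s))) \<le> (2 * N * P +
      P) * \<epsilon> * k"
  proof -
    define y where "y = Z s"
    have "norm (contract1 (w t - w s) (\<sigma>' s y) - contract1 (v t - v s) (\<tau>' s y)) \<le> (\<epsilon>
        * (t - s) powr \<alpha>) * N + (N * (t - s) powr \<alpha>) * \<epsilon>"
      by (intro bilinear_close[OF contract1.bounded_bilinear_axioms norm_contract1_le] w_close B.w_bound \<sigma>'_close
         lip_hoelderD(1)[OF c12_boundD(3)[OF A.\<sigma>]] st s)
    also have "\<dots> = 2 * N * \<epsilon> * (t - s) powr \<alpha>" by simp
    also have "\<dots> \<le> 2 * N * \<epsilon> * (P * k)" using A.\<beta> A.\<alpha> A.\<beta>_pos N0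
        \<epsilon> by (intro mult_left_mono pk) auto
    finally have a: "norm (contract1 (w t - w s) (\<sigma>' s y) - contract1 (v t - v s) (\<tau>' s y)) \<le> 2
        * N * \<epsilon> * (P * k)" .
    have "norm ((\<sigma> t y - \<sigma> s y - contract1 (w t - w s) (\<sigma>' s y)) - (\<tau> t y - \<tau> s
        y - contract1 (v t - v s) (\<tau>' s y))) \<le> \<epsilon> * (t - s) powr (\<alpha> + \<beta>)"
      by (rule R_close[OF st])
    also have "\<dots> \<le> \<epsilon> * (P * k)" using A.\<alpha> \<epsilon> by (intro mult_left_mono pk) auto
    finally have b: "norm ((\<sigma> t y - \<sigma> s y - contract1 (w t - w s) (\<sigma>' s y)) - (\<tau> t y
        - \<tau> s y - contract1 (v t - v s) (\<tau>' s y))) \<le> \<epsilon> * (P * k)" .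
    have "norm ((contract1 (w t - w s) (\<sigma>' s y) - contract1 (v t - v s) (\<tau>' s y)) +
       ((\<sigma> t y - \<sigma> s y - contract1 (w t - w s) (\<sigma>' s y)) - (\<tau> t y - \<tau> s y -
           contract1 (v t - v s) (\<tau>' s y)))) \<le> 2 * N * \<epsilon> * (P * k) + \<epsilon> * (P * k)"
      by (intro norm_triangle_le[OF add_mono] a b)
    then show ?thesis by (simp add: y_def algebra_simps)
  qed
  have 3: "norm (\<sigma> t (Y t) - \<sigma> t (Y s) - (\<sigma> t (Z t) - \<sigma> t (Z s))) \<le> N * (D0 *
      \<epsilon> + err C \<delta> * P + 2 * \<epsilon> * BZ C) * P * k"
  proof -
    have "norm (\<sigma> t (Y t) - \<sigma> t (Y s) - (\<sigma> t (Z t) - \<sigma> t (Z s))) \<le>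
      N * (norm ((Y t - Y s) - (Z t - Z s)) + (norm (Y t - Z t) + norm (Y s - Z s)) * norm (Z t - Z s))"
    proof (rule second_difference_bound[where f' = "\<lambda>x. blinfun_apply (D\<sigma> t x)"])
      note L = c12_boundD(4)[OF A.\<sigma>]
      show "norm (blinfun_apply (D\<sigma> t x) h) \<le> N * norm h" for x h
        by (rule lip_hoelderD(1)[OF lip_hoelder_blinfun[OF L] t])
      show "norm (blinfun_apply (D\<sigma> t x) h - blinfun_apply (D\<sigma> t y) h) \<le> N * norm (x - y) *
          norm h" for x y h
        using lip_hoelderD(2)[OF lip_hoelder_blinfun[OF L] t, of x h y] by (simp add: mult_ac)
    qed (use d\<sigma>[OF t] N0 in auto)
    also have "\<dots> \<le> N * ((D0 * \<epsilon> + err C \<delta> * P) * (t - s) powr \<alpha> + (\<epsilon>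
        + \<epsilon>) * (BZ C * (t - s) powr \<alpha>))"
      using increment_close[OF st] YZ[OF t] YZ[OF s] Zinc N0 \<epsilon> by (intro mult_left_mono add_mono
          mult_mono) auto
    also have "\<dots> = N * (D0 * \<epsilon> + err C \<delta> * P + 2 * \<epsilon> * BZ C) * (t - s) powr
        \<alpha>" by (simp add: algebra_simps)
    also have "\<dots> \<le> N * (D0 * \<epsilon> + err C \<delta> * P + 2 * \<epsilon> * BZ C) * (P * k)"
      using A.\<beta> A.\<alpha> A.\<beta>_pos N0 \<epsilon> D_nonneg err_nonneg P0 BZ0 by (intro
          mult_left_mono pk) auto
    finally show ?thesis by (simp add: mult_ac)
  qed
  have 4: "norm ((\<sigma> t (Y s) - \<sigma> s (Y s)) - (\<sigma> t (Z s) - \<sigma> s (Z s))) \<le> N *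
      \<epsilon> * k"
  proof -
    have "norm ((\<sigma> t (Y s) - \<sigma> s (Y s)) - (\<sigma> t (Z s) - \<sigma> s (Z s))) \<le> (N * k) *
        norm (Y s - Z s)"
    proof (rule lipD[where f = "\<lambda>y. \<sigma> t y - \<sigma> s y" and Df = "\<lambda>y. D\<sigma> t y -
        D\<sigma> s y"])
      show "((\<lambda>y. \<sigma> t y - \<sigma> s y) has_derivative blinfun_apply (D\<sigma> t y - D\<sigma>
          s y)) (at y)" for y
        by (rule has_derivative_eq_rhs[OF has_derivative_diff[OF d\<sigma>[OF t] d\<sigma>[OF s]]]) (simp add:
            fun_eq_iff blinfun.diff_left)
    qed (unfold k_def, rule lip_hoelderD(3)[OF c12_boundD(4)[OF A.\<sigma>] st])
    also have "\<dots> \<le> (N * k) * \<epsilon>" using YZ[OF s] N0 k0 by (intro mult_left_mono) auto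
    finally show ?thesis by (simp add: mult_ac)
  qed
  have "(\<sigma> t (Y t) - \<tau> t (Z t)) - (\<sigma> s (Y s) - \<tau> s (Z s)) =
      ((\<sigma> t (Z t) - \<tau> t (Z t)) - (\<sigma> t (Z s) - \<tau> t (Z s))) + ((\<sigma> t (Z s) - \<tau>
          t (Z s)) - (\<sigma> s (Z s) - \<tau> s (Z s)))
    + (\<sigma> t (Y t) - \<sigma> t (Y s) - (\<sigma> t (Z t) - \<sigma> t (Z s))) + ((\<sigma> t (Y s) -
        \<sigma> s (Y s)) - (\<sigma> t (Z s) - \<sigma> s (Z s)))"
    by simp
  also have "norm \<dots> \<le> BZ C * P * \<epsilon> * k + (2 * N * P + P) * \<epsilon> * k + N * (D0 *
      \<epsilon> + err C \<delta> * P + 2 * \<epsilon> * BZ C) * P * k + N * \<epsilon> * k"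
    by (intro norm_triangle_le[OF add_mono] 1 2 3 4)
  finally show ?thesis by (simp add: err'_def k_def algebra_simps)
qed


lemma controlled_dist_close:
  "controlled_dist T \<alpha> \<beta> w v Y (\<lambda>t. \<sigma> t (Y t)) Z (\<lambda>t. \<tau> t (Z t))
    \<le> ennreal (A2 * 2 * C * \<delta> powr \<alpha> + (A2 * (1 + D2) / \<delta> powr (\<alpha> + \<beta>) +
        (A2 * D1 + A1 C)) * \<epsilon>)"
proof -
  have BZ0: "0 \<le> BZ C" using C P0 A.C_nonneg by (simp add: BZ_def)
  have err0: "0 \<le> err' C \<delta>"
    unfolding err'_def using BZ0 P0 N0 \<epsilon> D_nonneg err_nonneg by simp
  have "hoelder_norm T \<beta> (\<lambda>t. \<sigma> t (Y t) - \<tau> t (Z t)) \<le> ennreal (err' C \<delta>)"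
    using derivative_close by (simp add: hoelder2_norm_le_iff[OF err0] incr_def)
  moreover have "hoelder2_norm T (\<alpha> + \<beta>) (\<lambda>s t. remainder w Y (\<lambda>t. \<sigma> t (Y
      t)) s t - remainder v Z (\<lambda>t. \<tau> t (Z t)) s t) \<le> ennreal (err C \<delta>)"
    using remainder_close by (simp add: hoelder2_norm_le_iff[OF err_nonneg] remainder_contract1)
  ultimately have "controlled_dist T \<alpha> \<beta> w v Y (\<lambda>t. \<sigma> t (Y t)) Z (\<lambda>t.
      \<tau> t (Z t)) \<le> ennreal (err' C \<delta>) + ennreal (err C \<delta>)"
    unfolding controlled_dist_def by (rule add_mono)
  also have "\<dots> = ennreal (err' C \<delta> + err C \<delta>)" using err0 err_nonneg by (simp add: ennreal_plus)
  also have "err' C \<delta> + err C \<delta> = A2 * err C \<delta> + A1 C * \<epsilon>"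
    by (simp add: err'_def A1_def A2_def algebra_simps)
  also have "\<dots> = A2 * 2 * C * \<delta> powr \<alpha> + (A2 * (1 + D2) / \<delta> powr (\<alpha> +
      \<beta>) + (A2 * D1 + A1 C)) * \<epsilon>"
    by (simp add: err_def algebra_simps add_divide_distrib)
  finally show ?thesis .
qed

end

end

section \<open>Continuity in the path\<close>

lemma tendsto_0_ennrealI:
  fixes f :: "nat \<Rightarrow> ennreal"
  assumes "\<And>e. 0 < e \<Longrightarrow> eventually (\<lambda>n. f n \<le> ennreal e) sequentially"
  shows "f \<longlonglongrightarrow> 0"
proof (rule order_tendstoI)
  fix a :: ennreal assume "0 < a"
  then obtain q where q: "0 < q" "q < a" using dense by blast
  then obtain e where e: "q = ennreal e" "0 \<le> e" by (cases q) auto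
  then have "0 < e" using q by (simp add: ennreal_less_zero_iff)
  from assms[OF this] show "\<forall>\<^sub>F n in sequentially. f n < a"
    by eventually_elim (use q e in auto)
qed simp

lemma c12_data_mono:
  assumes "c12_data T w \<alpha> \<beta> M g g'" "M \<le> N" shows "c12_data T w \<alpha> \<beta> N g g'"
proof -
  have 1: "x \<le> N" if "x \<le> M" for x using that assms(2) by simp
  have 2: "x \<le> N * k" if "x \<le> M * k" "0 \<le> k" for x k using that mult_right_mono[OF assms(2) that(2)] by simp
  show ?thesis using assms(1) unfolding c12_data_def by (auto intro: 1 2)
qed

text \<open>First \<delta> makes the term without \<epsilon> small, then \<epsilon> beats the factor
  that grows as \<delta> shrinks.\<close>

lemma choose_scales:
  fixes \<alpha> e p q r :: real
  assumes "0 < \<alpha>" "0 < e" "0 \<le> p" "0 \<le> q" "0 \<le> r"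
  obtains \<delta> \<epsilon> where "0 < \<delta>" "0 < \<epsilon>" "\<epsilon> \<le> 1" "\<epsilon> \<le> e"
      "p * \<delta> powr \<alpha> + (q / \<delta> powr \<kappa> + r) * \<epsilon> \<le> e"
proof -
  obtain \<delta> where \<delta>: "0 < \<delta>" "p * \<delta> powr \<alpha> < e / 2" using small_scale[of
      \<alpha> p "e/2"] assms by auto
  define s where "s = q / \<delta> powr \<kappa> + r"
  have s: "0 \<le> s" using assms by (simp add: s_def)
  define \<epsilon> where "\<epsilon> = min (min 1 e) (e / (2 * (s + 1)))"
  have \<epsilon>: "0 < \<epsilon>" "\<epsilon> \<le> 1" "\<epsilon> \<le> e" "\<epsilon> \<le> e / (2 * (s +
      1))" using assms s by (auto simp: \<epsilon>_def)
  have "s * \<epsilon> \<le> s * (e / (2 * (s + 1)))" using \<epsilon> s by (intro mult_left_mono)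
  also have "\<dots> \<le> e / 2" using s assms by (simp add: field_simps)
  finally have "p * \<delta> powr \<alpha> + (q / \<delta> powr \<kappa> + r) * \<epsilon> \<le> e" using
      \<delta>(2) unfolding s_def by linarith
  then show ?thesis by (rule that[OF \<delta>(1) \<epsilon>(1-3)])
qed

section \<open>Convergence along a sequence of paths\<close>

context
  fixes T \<alpha> \<beta> :: real and \<omega> :: "'d::finite path" and \<omega>n :: "nat \<Rightarrow> 'd path"
    and b :: "real \<Rightarrow> 'e::euclidean_space \<Rightarrow> 'e" and bn :: "nat \<Rightarrow> real
        \<Rightarrow> 'e \<Rightarrow> 'e"
    and \<sigma> \<sigma>' and \<sigma>n :: "nat \<Rightarrow> real \<Rightarrow> 'e \<Rightarrow> 'e^'d" and \<sigma>'n
  assumes T: "0 < T" and \<alpha>: "\<alpha> \<in> {1/3<..<1/2}" and \<beta>: "\<beta> \<in> {1 - 2 *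
      \<alpha><..\<alpha>}"
    and \<omega>: "\<omega> \<in> Omega T" "\<And>n. \<omega>n n \<in> Omega T" and path_lim: "(\<lambda>n.
        path_dist T \<alpha> (\<omega>n n) \<omega>) \<longlonglongrightarrow> 0"
    and b: "C2_hoelder T \<beta> b" and bn: "\<And>n t y. 0 \<le> t \<Longrightarrow> t \<le> T
        \<Longrightarrow> bn n t differentiable (at y)"
    and \<sigma>: "C23 T \<omega> (lift T \<omega>) \<alpha> \<beta> \<sigma> \<sigma>'"
    and \<sigma>n: "\<forall>\<^sub>F n in sequentially. C12 T (\<omega>n n) \<alpha> \<beta> (\<sigma>n n)
        (\<sigma>'n n)"
    and coeff_lim: "(\<lambda>n. norm1_hoelder T \<beta> (\<lambda>t y. bn n t y - b t y) + dist12 T \<alpha>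
        \<beta> \<omega> (\<omega>n n) \<sigma> \<sigma>' (\<sigma>n n) (\<sigma>'n n)) \<longlonglongrightarrow> 0"
begin

text \<open>N comes before \<epsilon>: closeness \<epsilon> \<le> 1 raises each bound of the limit
  equation by at most 1, so a single N serves all such \<epsilon> and all large n.\<close>

lemma eventually_sde_close:
  obtains N where "\<And>\<epsilon>. 0 < \<epsilon> \<Longrightarrow> \<epsilon> \<le> 1 \<Longrightarrow>
      \<forall>\<^sub>F n in sequentially.
    sde_close T \<alpha> \<beta> N \<omega> (lift T \<omega>) \<sigma> \<sigma>' (Dy \<sigma>) b (\<omega>n n)
        (lift T (\<omega>n n)) (\<sigma>n n) (\<sigma>'n n) (Dy (\<sigma>n n)) (bn n) \<epsilon>"
proof -
  obtain M1 where M1: "0 \<le> M1" "path_data T \<alpha> M1 \<omega> (lift T \<omega>)" using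
      rough_path_data[OF OmegaD(1)[OF \<omega>(1) \<alpha>]] by blast
  obtain M2 where M2: "0 \<le> M2" "\<And>N. M2 \<le> N \<Longrightarrow> lip_hoelder T \<beta> N b"
    "\<And>t y. 0 \<le> t \<Longrightarrow> t \<le> T \<Longrightarrow> b t differentiable (at y)"
    "\<And>t y. 0 \<le> t \<Longrightarrow> t \<le> T \<Longrightarrow> norm (Dy b t y) \<le> M2"
    by (rule C2_hoelder_data[OF b]) (rule that, assumption+)
  obtain g'' where fin: "norm12 T \<omega> \<alpha> \<beta> \<sigma> \<sigma>' + norm12 T \<omega> \<alpha>
      \<beta> \<sigma>' g'' + norm12 T \<omega> \<alpha> \<beta> (Dy \<sigma>) (Dy_deriv \<sigma>') < \<infinity>"
    using \<sigma> unfolding C23_def by blast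
  then obtain M3 where M3: "0 \<le> M3" "norm12 T \<omega> \<alpha> \<beta> \<sigma> \<sigma>' + norm12 T
      \<omega> \<alpha> \<beta> \<sigma>' g'' + norm12 T \<omega> \<alpha> \<beta> (Dy \<sigma>) (Dy_deriv
      \<sigma>') = ennreal M3"
    by (rule finite_ennrealE)
  have D3: "c12_data T \<omega> \<alpha> \<beta> M3 \<sigma> \<sigma>'"
    using norm12_data[OF ennreal_add_leD(1)[OF ennreal_add_leD(1)[OF eq_refl[OF M3(2)]]] M3(1)] .
  \<comment> \<open>The extra 1 is the room for the perturbation.\<close>
  define M where "M = max 1 (max M1 (max M2 M3)) + 1"
  have M: "1 \<le> M" "M1 + 1 \<le> M" "M2 + 1 \<le> M" "M3 + 1 \<le> M" "0 \<le> M" by (auto simp: M_def)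
  define N where "N = M + (1 + T)\<^sup>2 * (M + real CARD('d) * M * M)"
  have MN: "M \<le> N" using M by (simp add: N_def)
  have \<alpha>\<beta>: "0 \<le> \<alpha>" "\<alpha> \<le> 1" "0 \<le> \<beta>" "\<beta> \<le> \<alpha>" using
      \<alpha> \<beta> by auto
  have path_mono: "norm (w t - w s) \<le> M * (t - s) powr \<alpha>" if "path_data T \<alpha> M' w W" "M' \<le>
      M" "0 \<le> s" "s < t" "t \<le> T" for w W M' s t
  proof -
    have "norm (w t - w s) \<le> M' * (t - s) powr \<alpha>" using that by (auto simp: path_data_def)
    also have "\<dots> \<le> M * (t - s) powr \<alpha>" using that by (intro mult_right_mono) auto
    finally show ?thesis .
  qed
  have diff: "c12_diff T \<sigma> \<sigma>'" using \<sigma> by (auto simp: C23_def intro: C12_loc_diff)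
  have "c12_bound T \<omega> \<alpha> \<beta> N \<sigma> \<sigma>' (Dy \<sigma>)"
    by (rule c12_bound_data[OF c12_data_mono[OF D3] diff M(5) path_mono[OF M1(2)] \<alpha>\<beta> N_def]) (use
        M in auto)
  moreover have "driver T \<alpha> \<beta> N \<omega> (lift T \<omega>)"
    using M MN by (intro driverI[OF T \<alpha> \<beta> _ OmegaD(1)[OF \<omega>(1) \<alpha>] M1(2)]) auto
  ultimately have A: "rough_sde T \<alpha> \<beta> N \<omega> (lift T \<omega>) \<sigma> \<sigma>' (Dy \<sigma>) b"
    using M2(2) M MN by (intro rough_sde.intro rough_sde_axioms.intro) auto
  show ?thesis
  proof (rule that)
    fix \<epsilon> :: real assume \<epsilon>: "0 < \<epsilon>" "\<epsilon> \<le> 1"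
    then have e0: "0 < ennreal \<epsilon>" "0 \<le> \<epsilon>" by (auto simp: ennreal_less_zero_iff)
    from order_tendstoD(2)[OF path_lim e0(1)] order_tendstoD(2)[OF coeff_lim e0(1)] \<sigma>n
    show "\<forall>\<^sub>F n in sequentially.
      sde_close T \<alpha> \<beta> N \<omega> (lift T \<omega>) \<sigma> \<sigma>' (Dy \<sigma>) b (\<omega>n
          n) (lift T (\<omega>n n)) (\<sigma>n n) (\<sigma>'n n) (Dy (\<sigma>n n)) (bn n) \<epsilon>"
    proof eventually_elim
      case (elim n)
      define v where "v = \<omega>n n"
      note path = ennreal_add_leD[OF less_imp_le[OF elim(1)[unfolded path_dist_def, folded v_def]]]
      note w1 = hoelder_normD[OF path(1) e0(2)] and W1 = hoelder2_normD[OF path(2) e0(2)]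
      note co = ennreal_add_leD[OF less_imp_le[OF elim(2), folded v_def]]
      have diffn: "c12_diff T (\<sigma>n n) (\<sigma>'n n)" using elim(3) by (auto simp: C12_def intro: C12_loc_diff)
      note cl = dist12_close[OF co(2) e0(2) diff diffn]
      have wc: "norm ((\<omega> t - \<omega> s) - (v t - v s)) \<le> \<epsilon> * (t - s) powr \<alpha>" if "0
          \<le> s" "s < t" "t \<le> T" for s t
        using w1[OF that] norm_minus_commute[of "\<omega> t - \<omega> s" "v t - v s"] by (simp add: algebra_simps)
      have Wc: "norm (lift T \<omega> s t - lift T v s t) \<le> \<epsilon> * (t - s) powr (2 * \<alpha>)" if "0
          \<le> s" "s < t" "t \<le> T" for s t
        using W1[OF that] by (simp add: norm_minus_commute)
      have grow: "norm x' \<le> (m + 1) * k" if "norm x \<le> m * k" "norm (x - x') \<le> \<epsilon> * k" "0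
          \<le> k" for x x' :: "'z::real_normed_vector" and m k
        using norm_triangle_sub[of x' x] that mult_right_mono[OF \<epsilon>(2) that(3)] by (simp add:
            norm_minus_commute algebra_simps)
      have pv: "path_data T \<alpha> (M1 + 1) v (lift T v)"
        unfolding path_data_def
      proof (intro allI impI conjI)
        fix s t assume st: "0 \<le> s \<and> s < t \<and> t \<le> T"
        show "norm (v t - v s) \<le> (M1 + 1) * (t - s) powr \<alpha>"
          by (rule grow[of "\<omega> t - \<omega> s"]) (use M1(2) wc st in \<open>auto simp: path_data_def\<close>)
        show "norm (lift T v s t) \<le> (M1 + 1) * (t - s) powr (2 * \<alpha>)"
          by (rule grow[of "lift T \<omega> s t"]) (use M1(2) Wc st in \<open>auto simp: path_data_def\<close>)
      qed
      have "c12_data T v \<alpha> \<beta> M (\<sigma>n n) (\<sigma>'n n)"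
        by (rule c12_data_mono[OF c12_close_data[OF D3 cl]]) (use M \<epsilon> in auto)
      then have 1: "c12_bound T v \<alpha> \<beta> N (\<sigma>n n) (\<sigma>'n n) (Dy (\<sigma>n n))"
        by (rule c12_bound_data[OF _ diffn M(5) path_mono[OF pv M(2)] \<alpha>\<beta> N_def])
      have 2: "driver T \<alpha> \<beta> N v (lift T v)"
        using M MN by (intro driverI[OF T \<alpha> \<beta> _ OmegaD(1)[OF \<omega>(2)[of n] \<alpha>, folded
            v_def] pv]) auto
      note nb = ennreal_add_leD[OF co(1)[unfolded norm1_hoelder_def norm1_def]]
      note nb1 = ennreal_add_leD[OF nb(1)]
      have b0: "norm (bn n t y - b t y) \<le> \<epsilon>" if "0 \<le> t" "t \<le> T" for t y by (rule norm0D[OF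
          nb1(1) e0(2) that])
      have b1: "norm (Dy (bn n) t y - Dy b t y) \<le> \<epsilon>" if "0 \<le> t" "t \<le> T" for t y
        using norm0D[OF nb1(2) e0(2) that, of y] Dy_diff[of "bn n" t y b] bn M2(3) that by simp
      have b2: "norm ((bn n t y - b t y) - (bn n s y - b s y)) \<le> \<epsilon> * (t - s) powr \<beta>" if "0
          \<le> s" "s < t" "t \<le> T" for s t y
        using ennreal_add_leD(1)[OF nb(2)] that unfolding sup_hoelder_norm_le_iff[OF e0(2)] by blast
      have "lip_hoelder T \<beta> (M2 + 1) (bn n)"
      proof (rule drift_lip_hoelder)
        fix t y assume t: "0 \<le> t" "t \<le> T"
        have "norm (b t y) \<le> M2" using lip_hoelderD(1)[OF M2(2)[OF order_refl] t] .
        then show "bn n t differentiable (at y) \<and> norm (bn n t y) \<le> M2 + 1 \<and> norm (Dy (bn n) t y)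
            \<le> M2 + 1"
          using grow[of "b t y" M2 1 "bn n t y"] grow[of "Dy b t y" M2 1 "Dy (bn n) t y"] b0[OF t, of y] b1[OF
              t, of y] M2(4)[OF t, of y] bn[OF t]
          by (simp add: norm_minus_commute)
      next
        fix s t y assume st: "0 \<le> s" "s < t" "t \<le> T"
        have "norm ((b t y - b s y) - (bn n t y - bn n s y)) \<le> \<epsilon> * (t - s) powr \<beta>"
          using b2[OF st, of y] norm_minus_commute[of "b t y - b s y" "bn n t y - bn n s y"] by (simp add:
              algebra_simps)
        then show "norm (bn n t y - bn n s y) \<le> (M2 + 1) * (t - s) powr \<beta>"
          by (rule grow[OF lip_hoelderD(3)[OF M2(2)[OF order_refl] st]]) simp
      qed
      then have "lip_hoelder T \<beta> N (bn n)" by (rule lip_hoelder_mono) (use M MN in auto)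
      with 1 2 have B: "rough_sde T \<alpha> \<beta> N v (lift T v) (\<sigma>n n) (\<sigma>'n n) (Dy (\<sigma>n
          n)) (bn n)"
        by (intro rough_sde.intro rough_sde_axioms.intro)
      show ?case
        unfolding v_def[symmetric]
      proof (intro sde_close.intro sde_close_axioms.intro A B e0(2) wc Wc)
        fix t y assume t: "0 \<le> t" "t \<le> T"
        note C = cl[unfolded c12_close_def, THEN conjunct1, rule_format, OF conjI[OF t], of y]
        show "norm (\<sigma> t y - \<sigma>n n t y) \<le> \<epsilon>" "norm (Dy \<sigma> t y - Dy (\<sigma>n n)
            t y) \<le> \<epsilon>" "norm (\<sigma>' t y - \<sigma>'n n t y) \<le> \<epsilon>"
          using C by auto
        show "norm (b t y - bn n t y) \<le> \<epsilon>" using b0[OF t] by (simp add: norm_minus_commute)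
      next
        fix s t y assume st: "0 \<le> s" "s < t" "t \<le> T"
        note C = cl[unfolded c12_close_def, THEN conjunct2, rule_format, OF conjI[OF st(1) conjI[OF st(2,3)]], of y]
        show "norm (\<sigma> t y - \<sigma> s y - contract1 (\<omega> t - \<omega> s) (\<sigma>' s y) -
            (\<sigma>n n t y - \<sigma>n n s y - contract1 (v t - v s) (\<sigma>'n n s y))) \<le> \<epsilon> *
            (t - s) powr (\<alpha> + \<beta>)"
          using C by (simp add: remainder_contract1 v_def)
      qed
    qed
  qed
qed

text \<open>The given Davie bounds may have any exponents above 1 and constants varying with n. They
  only serve as input for \<open>davie_apriori\<close>, which yields one constant with exponent 2
  \<alpha> + \<beta> for the limit and all large n.\<close>

lemma solution_continuous:
  assumes Y: "davie_bound T (euler_step \<omega> (lift T \<omega>) \<sigma> (chain_coeff \<sigma>' (Dy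
      \<sigma>) \<sigma>) b) C0 \<gamma>0 Y" "1 < \<gamma>0" "Y 0 = x"
    and Yn: "\<And>n. davie_bound T (euler_step (\<omega>n n) (lift T (\<omega>n n)) (\<sigma>n n) (chain_coeff
        (\<sigma>'n n) (Dy (\<sigma>n n)) (\<sigma>n n)) (bn n)) (Cn n) (\<gamma>n n) (Yn n)"
      "\<And>n. 1 < \<gamma>n n" "\<And>n. Yn n 0 = x"
  shows "(\<lambda>n. controlled_dist T \<alpha> \<beta> \<omega> (\<omega>n n) Y (\<lambda>t. \<sigma> t (Y
      t)) (Yn n) (\<lambda>t. \<sigma>n n t (Yn n t))) \<longlonglongrightarrow> 0"
    and "(\<lambda>n. sup_norm T (\<lambda>t. Y t - Yn n t)) \<longlonglongrightarrow> 0"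
proof -
  obtain N where close: "\<And>\<epsilon>. 0 < \<epsilon> \<Longrightarrow> \<epsilon> \<le> 1
      \<Longrightarrow> \<forall>\<^sub>F n in sequentially.
    sde_close T \<alpha> \<beta> N \<omega> (lift T \<omega>) \<sigma> \<sigma>' (Dy \<sigma>) b (\<omega>n n)
        (lift T (\<omega>n n)) (\<sigma>n n) (\<sigma>'n n) (Dy (\<sigma>n n)) (bn n) \<epsilon>"
    by (rule eventually_sde_close) (rule that)
  define F where "F = euler_step \<omega> (lift T \<omega>) \<sigma> (chain_coeff \<sigma>' (Dy \<sigma>) \<sigma>) b"
  define Fn where "Fn n = euler_step (\<omega>n n) (lift T (\<omega>n n)) (\<sigma>n n) (chain_coeff
      (\<sigma>'n n) (Dy (\<sigma>n n)) (\<sigma>n n)) (bn n)" for n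
  note Y = Y[folded F_def] and Yn = Yn[folded Fn_def]
  define \<gamma> where "\<gamma> = 2 * \<alpha> + \<beta>"
  have \<gamma>: "1 < \<gamma>" using \<beta> by (simp add: \<gamma>_def)
  obtain n0 where n0: "\<And>n. n0 \<le> n \<Longrightarrow>
    sde_close T \<alpha> \<beta> N \<omega> (lift T \<omega>) \<sigma> \<sigma>' (Dy \<sigma>) b (\<omega>n n)
        (lift T (\<omega>n n)) (\<sigma>n n) (\<sigma>'n n) (Dy (\<sigma>n n)) (bn n) 1"
    using close[of 1] unfolding eventually_sequentially by auto
  \<comment> \<open>This fixes names for the constants. Apart from the argument C they depend on T
    and N only, so they are the same for every later instance of the locale.\<close>
  interpret base: sde_close T \<alpha> \<beta> N \<omega> "lift T \<omega>" \<sigma> \<sigma>' "Dy \<sigma>" b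
      "\<omega>n n0" "lift T (\<omega>n n0)" "\<sigma>n n0" "\<sigma>'n n0" "Dy (\<sigma>n n0)" "bn n0" 1
    by (rule n0) simp
  define K where "K = base.A.Kf"
  define L where "L = base.A.C3"
  have flow: "almost_flow T K L \<gamma> \<alpha> F"
    unfolding K_def L_def \<gamma>_def F_def by (rule base.A.almost_flow_axioms)
  have flown: "almost_flow T K L \<gamma> \<alpha> (Fn n)" if "n0 \<le> n" for n
  proof -
    interpret c: sde_close T \<alpha> \<beta> N \<omega> "lift T \<omega>" \<sigma> \<sigma>' "Dy \<sigma>" b
        "\<omega>n n" "lift T (\<omega>n n)" "\<sigma>n n" "\<sigma>'n n" "Dy (\<sigma>n n)" "bn n" 1
      by (rule n0[OF that])
    show ?thesis unfolding K_def L_def \<gamma>_def Fn_def by (rule c.B.almost_flow_axioms)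
  qed
  have 0: "0 \<le> K" "0 \<le> L" "0 < \<alpha>" using base.A.C_nonneg \<alpha> by (auto simp: K_def L_def)
  obtain C where C: "0 \<le> C" and ap: "\<forall>(F :: real \<Rightarrow> real \<Rightarrow> 'e \<Rightarrow>
      'e) Y C' \<gamma>'. almost_flow T K L \<gamma> \<alpha> F \<longrightarrow>
      davie_bound T F C' \<gamma>' Y \<longrightarrow> 1 < \<gamma>' \<longrightarrow> davie_bound T F C \<gamma> Y"
    using davie_apriori[OF T 0(1,2) \<gamma> 0(3)] by (elim exE conjE)
  have YC: "davie_bound T F C \<gamma> Y" using ap flow Y by blast
  have YnC: "davie_bound T (Fn n) C \<gamma> (Yn n)" if "n0 \<le> n" for n using ap flown[OF that] Yn by blast
  \<comment> \<open>Smoothness concerns the limit equation alone, and its constants need no relation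
    to N.\<close>
  obtain M where "smooth_sde T \<alpha> \<beta> M \<omega> (lift T \<omega>) \<sigma> \<sigma>' (Dy \<sigma>) b
      (Dy_deriv \<sigma>') (Dy (Dy \<sigma>)) (Dy b)"
    using exists_smooth_sde[OF T \<omega>(1) \<alpha> \<beta> b \<sigma>] by blast
  then interpret S: smooth_sde T \<alpha> \<beta> M \<omega> "lift T \<omega>" \<sigma> \<sigma>' "Dy \<sigma>"
      b "Dy_deriv \<sigma>'" "Dy (Dy \<sigma>)" "Dy b" .
  have smooth: "smooth_flow T (S.Kf + S.K2) (S.C3 + S.C6) \<gamma> \<alpha> F"
    unfolding \<gamma>_def F_def by (rule S.smooth_flow)
  have lim: "(\<lambda>n. Fn (n + n0) s t y) \<longlonglongrightarrow> F s t y" if st: "0 \<le> s" "s < t" "t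
      \<le> T" for s t y
  proof -
    have "(\<lambda>n. Fn n s t y) \<longlonglongrightarrow> F s t y"
    proof (rule metric_LIMSEQ_I, unfold eventually_sequentially[symmetric])
      fix e :: real assume e: "0 < e"
      define \<epsilon> where "\<epsilon> = min 1 (e / (2 * (base.D2 + 1)))"
      have D: "0 \<le> base.D2" by (rule base.D_nonneg)
      have \<epsilon>: "0 < \<epsilon>" "\<epsilon> \<le> 1" "\<epsilon> \<le> e / (2 * (base.D2 + 1))" using e
          D by (auto simp: \<epsilon>_def)
      have "base.D2 * \<epsilon> \<le> base.D2 * (e / (2 * (base.D2 + 1)))" using \<epsilon> D by (intro mult_left_mono)
      also have "\<dots> < e" using D e by (simp add: field_simps add_pos_nonneg)
      finally have small: "base.D2 * \<epsilon> < e" .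
      show "\<forall>\<^sub>F n in sequentially. dist (Fn n s t y) (F s t y) < e"
        using close[OF \<epsilon>(1,2)]
      proof eventually_elim
        case (elim n)
        then interpret c: sde_close T \<alpha> \<beta> N \<omega> "lift T \<omega>" \<sigma> \<sigma>' "Dy
            \<sigma>" b "\<omega>n n" "lift T (\<omega>n n)" "\<sigma>n n" "\<sigma>'n n" "Dy (\<sigma>n n)"
            "bn n" \<epsilon> .
        have "norm (F s t y - Fn n s t y) \<le> base.D2 * \<epsilon>"
          unfolding F_def Fn_def using \<epsilon> by (intro c.flow_close[OF st]) auto
        then show ?case using small by (simp add: dist_norm norm_minus_commute)
      qed
    qed
    then show ?thesis by (rule LIMSEQ_ignore_initial_segment)
  qed
  \<comment> \<open>Common constants are known only from n0 on, so the index is shifted; the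
    convergence statement is then shifted back.\<close>
  have "uniform_limit {0..T} (\<lambda>n. Yn (n + n0)) Y sequentially"
    by (rule smooth_flow.davie_stability[OF smooth flown lim YnC Yn(3) YC Y(3) C]) simp_all
  then have unif: "\<forall>\<^sub>F n in sequentially. \<forall>t\<in>{0..T}. dist (Yn n t) (Y t) < e" if "0 < e" for e
    using that eventually_sequentially_seg[of "\<lambda>n. \<forall>t\<in>{0..T}. dist (Yn n t) (Y t) < e" n0]
        unfolding uniform_limit_iff by auto
  show "(\<lambda>n. sup_norm T (\<lambda>t. Y t - Yn n t)) \<longlonglongrightarrow> 0"
  proof (rule tendsto_0_ennrealI)
    fix e :: real assume e: "0 < e"
    show "\<forall>\<^sub>F n in sequentially. sup_norm T (\<lambda>t. Y t - Yn n t) \<le> ennreal e"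
      using unif[OF e]
    proof eventually_elim
      case (elim n)
      then show ?case unfolding sup_norm_le_iff[OF less_imp_le[OF e]]
        by (auto simp: dist_norm norm_minus_commute less_imp_le)
    qed
  qed
  show "(\<lambda>n. controlled_dist T \<alpha> \<beta> \<omega> (\<omega>n n) Y (\<lambda>t. \<sigma> t (Y t))
      (Yn n) (\<lambda>t. \<sigma>n n t (Yn n t))) \<longlonglongrightarrow> 0"
  proof (rule tendsto_0_ennrealI)
    fix e :: real assume e: "0 < e"
    have A: "0 \<le> base.A1 C" "0 \<le> base.A2" using base.A_nonneg[OF C] by auto
    \<comment> \<open>Both scales are fixed before n; afterwards n is taken so large that
      coefficients and solutions are \<epsilon>-close.\<close>
    obtain \<delta> \<epsilon> where \<delta>: "0 < \<delta>" and \<epsilon>: "0 < \<epsilon>" "\<epsilon>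
        \<le> 1" "\<epsilon> \<le> e"
      and le: "base.A2 * 2 * C * \<delta> powr \<alpha> + (base.A2 * (1 + base.D2) / \<delta> powr (\<alpha> +
          \<beta>) + (base.A2 * base.D1 + base.A1 C)) * \<epsilon> \<le> e"
      using choose_scales[of \<alpha> e "base.A2 * 2 * C" "base.A2 * (1 + base.D2)" "base.A2 * base.D1 +
          base.A1 C" "\<alpha> + \<beta>"]
        0(3) e A C base.D_nonneg by auto
    show "\<forall>\<^sub>F n in sequentially. controlled_dist T \<alpha> \<beta> \<omega> (\<omega>n n) Y
        (\<lambda>t. \<sigma> t (Y t)) (Yn n) (\<lambda>t. \<sigma>n n t (Yn n t)) \<le> ennreal e"
      using close[OF \<epsilon>(1,2)] unif[OF \<epsilon>(1)] eventually_ge_at_top[of n0]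
    proof eventually_elim
      case (elim n)
      interpret c: sde_close T \<alpha> \<beta> N \<omega> "lift T \<omega>" \<sigma> \<sigma>' "Dy \<sigma>" b
          "\<omega>n n" "lift T (\<omega>n n)" "\<sigma>n n" "\<sigma>'n n" "Dy (\<sigma>n n)" "bn n" \<epsilon>
        by (rule elim(1))
      have "norm (Y t - Yn n t) \<le> \<epsilon>" if "0 \<le> t" "t \<le> T" for t
        using elim(2) that by (auto simp: dist_norm norm_minus_commute less_imp_le)
      then show ?case
        by (intro order_trans[OF c.controlled_dist_close[OF YC[unfolded F_def \<gamma>_def]
          YnC[OF elim(3), unfolded Fn_def \<gamma>_def] C \<delta>] ennreal_leI[OF le]])
    qed
  qed
qed

end

theorem theorem5p5:
  fixes T :: real
    and \<alpha> \<beta> :: "(real \<Rightarrow> real^'d) \<Rightarrow> real"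
    and b :: "real \<Rightarrow> 'e::euclidean_space \<Rightarrow> (real \<Rightarrow> real^'d) \<Rightarrow> 'e"
    and \<sigma> :: "real \<Rightarrow> 'e \<Rightarrow> (real \<Rightarrow> real^'d) \<Rightarrow> 'e^'d"
    and \<sigma>' :: "real \<Rightarrow> 'e \<Rightarrow> (real \<Rightarrow> real^'d) \<Rightarrow> 'e^'d^'d"
    and x :: 'e
  assumes "0 < T"
    and "progressively_measurable T b"
    and "progressively_measurable T \<sigma>"
    and "\<And>\<omega>. \<omega> \<in> Omega T \<Longrightarrow> \<alpha> \<omega> \<in> {1/3<..<1/2} \<and> \<beta> \<omega> \<in> {1 - 2 * \<alpha> \<omega><..\<alpha> \<omega>}"
    and "\<And>\<omega>. \<omega> \<in> Omega T \<Longrightarrow> C2_hoelder T (\<beta> \<omega>) (\<lambda>t y. b t y \<omega>)"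
    and "\<And>\<omega>. \<omega> \<in> Omega T \<Longrightarrow>
           C23 T \<omega> (lift T \<omega>) (\<alpha> \<omega>) (\<beta> \<omega>) (\<lambda>t y. \<sigma> t y \<omega>) (\<lambda>t y. \<sigma>' t y \<omega>)"
  shows "\<exists>X. is_solution T \<alpha> \<beta> b \<sigma> \<sigma>' x X \<and>
     (\<forall>Y. is_solution T \<alpha> \<beta> b \<sigma> \<sigma>' x Y \<longrightarrow> (\<forall>\<omega>\<in>Omega T. \<forall>t\<in>{0..T}. Y \<omega> t = X \<omega> t)) \<and>
     (\<forall>\<omega>\<in>Omega T. controlled2 T \<omega> (lift T \<omega>) (\<alpha> \<omega>) (\<beta> \<omega>) (X \<omega>) (\<lambda>t. \<sigma> t (X \<omega> t) \<omega>)) \<and>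
     (continuous_coefficients T \<alpha> \<beta> b \<sigma> \<sigma>' \<longrightarrow>
       (\<forall>\<omega>\<in>Omega T. \<forall>\<omega>n::nat \<Rightarrow> real \<Rightarrow> real^'d.
          (\<forall>n. \<omega>n n \<in> Omega T) \<and> (\<lambda>n. path_dist T (\<alpha> \<omega>) (\<omega>n n) \<omega>) \<longlonglongrightarrow> 0 \<longrightarrow>
          (\<lambda>n. controlled_dist T (\<alpha> \<omega>) (\<beta> \<omega>) \<omega> (\<omega>n n)
             (X \<omega>) (\<lambda>t. \<sigma> t (X \<omega> t) \<omega>)
             (X (\<omega>n n)) (\<lambda>t. \<sigma> t (X (\<omega>n n) t) (\<omega>n n))) \<longlonglongrightarrow> 0 \<and>
          (\<lambda>n. sup_norm T (\<lambda>t. X \<omega> t - X (\<omega>n n) t)) \<longlonglongrightarrow> 0))"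
proof -
  have ab: "\<alpha> \<omega> \<in> {1/3<..<1/2}" "\<beta> \<omega> \<in> {1 - 2 * \<alpha> \<omega><..\<alpha>
      \<omega>}" if "\<omega> \<in> Omega T" for \<omega>
    using assms(4)[OF that] by auto
  note br = OmegaD(2)[OF _ ab(1)]
  define F where "F \<omega> = euler_step \<omega> (lift T \<omega>) (\<lambda>t y. \<sigma> t y \<omega>)
     (chain_coeff (\<lambda>t y. \<sigma>' t y \<omega>) (Dy (\<lambda>t y. \<sigma> t y \<omega>)) (\<lambda>t
         y. \<sigma> t y \<omega>)) (\<lambda>t y. b t y \<omega>)" for \<omega>
  define sol where "sol \<omega> Y \<longleftrightarrow> solves_at T \<omega> (\<alpha> \<omega>) (\<beta>
      \<omega>) (\<lambda>t y. b t y \<omega>) (\<lambda>t y. \<sigma> t y \<omega>) (\<lambda>t y. \<sigma>' t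
      y \<omega>) x Y" for \<omega> Y
  define smooth where "smooth \<omega> M \<longleftrightarrow> smooth_sde T (\<alpha> \<omega>) (\<beta>
      \<omega>) M \<omega> (lift T \<omega>) (\<lambda>t y. \<sigma> t y \<omega>) (\<lambda>t y. \<sigma>' t y
      \<omega>) (Dy (\<lambda>t y. \<sigma> t y \<omega>))
      (\<lambda>t y. b t y \<omega>) (Dy_deriv (\<lambda>t y. \<sigma>' t y \<omega>)) (Dy (Dy (\<lambda>t y.
          \<sigma> t y \<omega>))) (Dy (\<lambda>t y. b t y \<omega>))" for \<omega> M
  have smooth_ex: "\<exists>M. smooth \<omega> M" if "\<omega> \<in> Omega T" for \<omega>
    unfolding smooth_def using exists_smooth_sde[OF assms(1) that ab[OF that] assms(5)[OF that] assms(6)[OF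
        that]] by blast
  have rough: "rough_sde T (\<alpha> \<omega>) (\<beta> \<omega>) M \<omega> (lift T \<omega>) (\<lambda>t y.
      \<sigma> t y \<omega>) (\<lambda>t y. \<sigma>' t y \<omega>) (Dy (\<lambda>t y. \<sigma> t y \<omega>))
      (\<lambda>t y. b t y \<omega>)"
    if "smooth \<omega> M" for \<omega> M
    using that unfolding smooth_def by (rule smooth_sde.axioms)
  have davie: "Y 0 = x \<and> (\<exists>C\<ge>0. davie_bound T (F \<omega>) C (2 * \<alpha> \<omega> + \<beta>
      \<omega>) Y)" if \<omega>: "\<omega> \<in> Omega T" and Y: "sol \<omega> Y" for \<omega> Y
  proof -
    obtain M where M: "smooth \<omega> M" using smooth_ex[OF \<omega>] by blast
    show ?thesis using solves_imp_davie[OF rough[OF M] br[OF \<omega> \<omega>] Y[unfolded sol_def]] unfolding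
        F_def by blast
  qed
  have ex: "\<exists>Y. sol \<omega> Y" if \<omega>: "\<omega> \<in> Omega T" for \<omega>
  proof -
    obtain M where M: "smooth \<omega> M" using smooth_ex[OF \<omega>] by blast
    interpret S: smooth_sde T "\<alpha> \<omega>" "\<beta> \<omega>" M \<omega> "lift T \<omega>" "\<lambda>t
        y. \<sigma> t y \<omega>" "\<lambda>t y. \<sigma>' t y \<omega>" "Dy (\<lambda>t y. \<sigma> t y \<omega>)"
      "\<lambda>t y. b t y \<omega>" "Dy_deriv (\<lambda>t y. \<sigma>' t y \<omega>)" "Dy (Dy (\<lambda>t y.
          \<sigma> t y \<omega>))" "Dy (\<lambda>t y. b t y \<omega>)"
      using M unfolding smooth_def .
    have "continuous_on (time2 T) (\<lambda>(s, t). lift T \<omega> s t)"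
      using OmegaD(1)[OF \<omega> ab(1)[OF \<omega>]] by (simp add: rough_path_def hoelder2_def)
    from S.exists_davie[OF S.F_cont[OF this], of x]
    obtain Y C where "0 \<le> C" "Y 0 = x" "davie_bound T S.F C (2 * \<alpha> \<omega> + \<beta> \<omega>) Y" by blast
    then have "sol \<omega> Y"
      unfolding sol_def by (intro davie_imp_solves[OF S.rough_sde_axioms br[OF \<omega> \<omega>]])
    then show ?thesis by blast
  qed
  \<comment> \<open>\<open>is_solution\<close> is a condition on each path separately, so a choice
    for each \<omega> suffices.\<close>
  define X where "X \<omega> = (SOME Y. sol \<omega> Y)" for \<omega>
  have X: "sol \<omega> (X \<omega>)" if "\<omega> \<in> Omega T" for \<omega>
    unfolding X_def using ex[OF that] by (rule someI_ex)
  have unique: "Y t = Z t" if \<omega>: "\<omega> \<in> Omega T" and Y: "sol \<omega> Y" and Z: "sol \<omega>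
      Z" and t: "t \<in> {0..T}" for \<omega> Y Z t
  proof -
    obtain M where M: "smooth \<omega> M" using smooth_ex[OF \<omega>] by blast
    from smooth_sde.smooth_flow[OF M[unfolded smooth_def]]
    obtain K L where fl: "smooth_flow T K L (2 * \<alpha> \<omega> + \<beta> \<omega>) (\<alpha> \<omega>) (F
        \<omega>)" unfolding F_def by blast
    obtain C C' where "davie_bound T (F \<omega>) C (2 * \<alpha> \<omega> + \<beta> \<omega>) Y" "davie_bound
        T (F \<omega>) C' (2 * \<alpha> \<omega> + \<beta> \<omega>) Z"
      "Y 0 = x" "Z 0 = x" using davie[OF \<omega> Y] davie[OF \<omega> Z] by blast
    then show ?thesis using smooth_flow.davie_unique[OF fl, of C Y C' Z t] t by auto
  qed
  have c2: "controlled2 T \<omega> (lift T \<omega>) (\<alpha> \<omega>) (\<beta> \<omega>) (X \<omega>)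
      (\<lambda>t. \<sigma> t (X \<omega> t) \<omega>)" if \<omega>: "\<omega> \<in> Omega T" for \<omega>
  proof -
    obtain M where M: "smooth \<omega> M" using smooth_ex[OF \<omega>] by blast
    show ?thesis
      using solution_controlled2[OF rough[OF M] br[OF \<omega> \<omega>] OmegaD(3)[OF \<omega> ab(1)[OF
          \<omega>]] X[OF \<omega>, unfolded sol_def]] .
  qed
  have cont: "(\<lambda>n. controlled_dist T (\<alpha> \<omega>) (\<beta> \<omega>) \<omega> (\<omega>n n)
             (X \<omega>) (\<lambda>t. \<sigma> t (X \<omega> t) \<omega>)
             (X (\<omega>n n)) (\<lambda>t. \<sigma> t (X (\<omega>n n) t) (\<omega>n n)))
                 \<longlonglongrightarrow> 0 \<and>
          (\<lambda>n. sup_norm T (\<lambda>t. X \<omega> t - X (\<omega>n n) t)) \<longlonglongrightarrow> 0"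
    if coeff: "continuous_coefficients T \<alpha> \<beta> b \<sigma> \<sigma>'" and \<omega>: "\<omega> \<in>
        Omega T" and \<omega>n: "\<And>n. \<omega>n n \<in> Omega T"
      and lim: "(\<lambda>n. path_dist T (\<alpha> \<omega>) (\<omega>n n) \<omega>) \<longlonglongrightarrow>
          0" for \<omega> \<omega>n
  proof -
    have co: "\<forall>\<^sub>F n in sequentially. C12 T (\<omega>n n) (\<alpha> \<omega>) (\<beta> \<omega>)
        (\<lambda>t y. \<sigma> t y (\<omega>n n)) (\<lambda>t y. \<sigma>' t y (\<omega>n n))"
      "(\<lambda>n. norm1_hoelder T (\<beta> \<omega>) (\<lambda>t y. b t y (\<omega>n n) - b t y \<omega>) +
          dist12 T (\<alpha> \<omega>) (\<beta> \<omega>) \<omega> (\<omega>n n)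
            (\<lambda>t y. \<sigma> t y \<omega>) (\<lambda>t y. \<sigma>' t y \<omega>)
            (\<lambda>t y. \<sigma> t y (\<omega>n n)) (\<lambda>t y. \<sigma>' t y (\<omega>n n)))
                \<longlonglongrightarrow> 0"
      using coeff \<omega> \<omega>n lim unfolding continuous_coefficients_def by blast+
    have bn: "(\<lambda>y. b t y (\<omega>n n)) differentiable (at y)" if "0 \<le> t" "t \<le> T" for n t y
      using assms(5)[OF \<omega>n[of n]] that by (auto simp: C2_hoelder_def C2_hoelder_loc_def C2_loc_def C1_loc_def)
    \<comment> \<open>The solution at an approximating path comes with the exponents of that path
      and an uncontrolled constant, while the comparison takes place with the exponents of \<omega>;
      \<open>solution_continuous\<close> is stated so as to accept this.\<close>
    have "\<forall>n. \<exists>C. davie_bound T (F (\<omega>n n)) C (2 * \<alpha> (\<omega>n n) + \<beta>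
        (\<omega>n n)) (X (\<omega>n n))"
      using davie[OF \<omega>n X[OF \<omega>n]] by blast
    then obtain Cn where Cn: "\<And>n. davie_bound T (F (\<omega>n n)) (Cn n) (2 * \<alpha> (\<omega>n n) +
        \<beta> (\<omega>n n)) (X (\<omega>n n))" by metis
    have X0: "X (\<omega>n n) 0 = x" for n using davie[OF \<omega>n X[OF \<omega>n]] by blast
    obtain C where C: "davie_bound T (F \<omega>) C (2 * \<alpha> \<omega> + \<beta> \<omega>) (X \<omega>)" "X
        \<omega> 0 = x" using davie[OF \<omega> X[OF \<omega>]] by blast
    have \<gamma>: "1 < 2 * \<alpha> \<omega> + \<beta> \<omega>" if "\<omega> \<in> Omega T" for \<omega>
        using ab[OF that] by auto
    note main = solution_continuous[OF assms(1) ab[OF \<omega>] \<omega> \<omega>n lim assms(5)[OF \<omega>] bn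
        assms(6)[OF \<omega>] co
      C(1)[unfolded F_def] \<gamma>[OF \<omega>] C(2) Cn[unfolded F_def] \<gamma>[OF \<omega>n] X0]
    show ?thesis using main by blast
  qed
  show ?thesis
  proof (intro exI[of _ X] conjI allI impI ballI)
    show "is_solution T \<alpha> \<beta> b \<sigma> \<sigma>' x X"
      using X by (simp add: is_solution_def sol_def)
    show "Y \<omega> t = X \<omega> t" if "is_solution T \<alpha> \<beta> b \<sigma> \<sigma>' x Y" "\<omega>
        \<in> Omega T" "t \<in> {0..T}" for Y \<omega> t
      using that X by (intro unique[of \<omega>]) (auto simp: is_solution_def sol_def)
  qed (use c2 cont in blast)+
qed

end
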